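(* Let $\mathbb B$, the spin FH-algebra $\mathcal K$, its submodules $\mathcal K^{(m)}$ and $\mathcal H^{(m)}$, and the elements $e_r^*\in\mathcal K$ be as defined in the context; let $\mathbb B[\frac12]$ be obtained from $\mathbb B$ by inverting $2$, and put $\mathcal K[\frac12]=\mathbb B[\frac12]\otimes_{\mathbb B}\mathcal K$ and $\mathcal K[\frac12]^{(m)}=\mathbb B[\frac12]\otimes_{\mathbb B}\mathcal K^{(m)}$. (1) Let $m=2r$ be an even positive integer. Then the $\mathbb B[\frac12]$-module $\mathcal K[\frac12]^{(m)}$ is spanned by $e_r^*$ and $\mathcal H^{(m)}$. (2) As a $\mathbb B[\frac12]$-algebra, $\mathcal K[\frac12]$ is generated by the elements $e_r^*$ for $r\ge1$.
   Context: Partitions: $|\lambda|$ is the sum of the parts of $\lambda$, $\ell(\lambda)$ the number of parts. $\mathcal{EP}$ is the set of partitions all of whose parts are even (including $\emptyset$), and $\mathcal{EP}(m)$ those with $|\lambda|=m$. Double cover: $\widetilde S_n$ is the group generated by $t_1,\dots,t_{n-1},z$ with relations: $z$ central, $z^2=1$, $t_i^2=z$, $t_it_{i+1}t_i=t_{i+1}t_it_{i+1}$, $t_jt_i=zt_it_j$ for $|i-j|>1$. There are natural embeddings $\widetilde S_n\subset\widetilde S_{n+1}$. Cycles: in $\widetilde S_{n+1}$ put $x_i=t_it_{i+1}\cdots t_{n-1}t_nt_{n-1}\cdots t_{i+1}t_i$ for $1\le i\le n$ (so $x_n=t_n$). For distinct $i_1,\dots,i_m\in\{1,\dots,n\}$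 with $m\ge2$ put $[i_1,\dots,i_m]=x_{i_1}x_{i_m}x_{i_{m-1}}\cdots x_{i_2}x_{i_1}$. This element lies in $\widetilde S_n$, does not depend on $n$, and maps to the cycle $(i_1,\dots,i_m)$ under $\widetilde S_n\to S_n$, $t_i\mapsto(i,i+1)$, $z\mapsto 1$ (permutations multiplied right to left). Classes: for $\lambda=(\lambda_1,\dots,\lambda_\ell)\in\mathcal{EP}$, $D_\lambda(n)$ is the set of all products of disjoint cycles $[i_1,\dots,i_{\lambda_1+1}][j_1,\dots,j_{\lambda_2+1}]\cdots[k_1,\dots,k_{\lambda_\ell+1}]$ in $\widetilde S_n$; it is empty if $|\lambda|+\ell(\lambda)>n$, and a conjugacy class of $\widetilde S_n$ otherwise. Spin group algebra: $\mathbb ZS_n^-=\mathbb Z\widetilde S_n/\langle z+1\rangle$, a superalgebra with every $t_i$ odd; $\mathcal Z_n$ is its even center (the set of even central elements). $d_\lambda(n)\in\mathbb ZS_n^-$ is the image of the class sum of $D_\lambda(n)$. The $d_\lambda(n)$ with $\lambda\in\mathcal{EP}$, $|\lambda|+\ell(\lambda)\le n$, form a basis of $\mathcal Z_n$. Write $d_\lambda(n)d_\mu(n)=\sum_{\nu\in\mathcal{EP}}a_{\lambda\mu}^\nu(n)d_\nu(n)$ with $a_{\lambda\mu}^\nu(n)\in\mathbb Z$ defined for $n\ge|\nu|+\ell(\nu)$. It is known that there is a unique polynomial $f_{\lambda\mu}^\nu(x)$ with $a_{\lambda\mu}^\nu(n)=f_{\lambda\mu}^\nu(n)$ for all $n\ge|\nu|+\ell(\nu)$,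 that $f_{\lambda\mu}^\nu=0$ unless $|\nu|\le|\lambda|+|\mu|$, and that $f_{\lambda\mu}^\nu$ is an integer constant if $|\nu|=|\lambda|+|\mu|$. The algebra $\mathcal K$: $\mathbb B$ is the ring of all polynomials (in one variable $x$, with rational coefficients) taking integer values at all integers. $\mathcal K$ is the (associative, commutative) $\mathbb B$-algebra with $\mathbb B$-basis $\{d_\lambda:\lambda\in\mathcal{EP}\}$ and multiplication $d_\lambda d_\mu=\sum_{\nu\in\mathcal{EP},\,|\nu|\le|\lambda|+|\mu|}f_{\lambda\mu}^\nu(x)d_\nu$. For $m\ge 0$ even, $\mathcal K^{(m)}$ is the $\mathbb B$-span of all $d_\lambda$ with $|\lambda|=m$. Put $(d_\lambda d_\mu)^*=\sum_{|\nu|=|\lambda|+|\mu|}f_{\lambda\mu}^\nu d_\nu$. For $m>0$ even, $\mathcal H^{(m)}$ is the $\mathbb B$-submodule of $\mathcal K^{(m)}$ spanned by all $(d_\lambda d_\mu)^*$ with $\lambda,\mu\in\mathcal{EP}$, $|\lambda|+|\mu|=m$, $|\lambda|>0$, $|\mu|>0$. The elements $e_r^*$: let $M_k=\sum_{i=1}^{k-1}[i,k]\in\mathbb ZS_n^-$ for $1\le k\le n$ (odd Jucys–Murphy elements). The element $e_{r;n}=\sum_{1\le i_1<\cdots<i_r\le n}M_{i_1}^2\cdots M_{i_r}^2$ lies in $\mathcal Z_n$. For $\lambda\in\mathcal{EP}(2r)$ let $A_\lambda\in\mathbb Z$ be the coefficient of $d_\lambda(n)$ in the expansion of $e_{r;n}$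 in the class sum basis, for any $n\ge|\lambda|+\ell(\lambda)$ (it does not depend on $n$). Then $e_r^*=\sum_{\lambda\in\mathcal{EP}(2r)}A_\lambda d_\lambda\in\mathcal K^{(2r)}$. *)

theory Defs
  imports
    "HOL-Algebra.QuotRing"
    "HOL-Algebra.Subrings"
    "HOL-Algebra.Module"
    "HOL-Library.Multiset"
    "HOL-Library.Poly_Mapping"
    "HOL-Computational_Algebra.Polynomial"
begin

definition EP :: "nat multiset set" where
  "EP = {\<alpha>. \<forall>p \<in># \<alpha>. p > 0 \<and> even p}"

definition EP_of :: "nat \<Rightarrow> nat multiset set" where
  "EP_of m = {\<alpha> \<in> EP. sum_mset \<alpha> = m}"

definition parts_list :: "nat multiset \<Rightarrow> nat list" where
  "parts_list \<alpha> = rev (sorted_list_of_multiset \<alpha>)"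

text \<open>
  A letter is a generator together with an exponent: \<open>(x, True)\<close> stands for \<open>x\<close> and
  \<open>(x, False)\<close> for its inverse. A relation \<open>u = v\<close> is a pair of words. Elements of the
  presented group are classes of words in the generators.
\<close>

inductive word_eq :: "'g set \<Rightarrow> (('g \<times> bool) list \<times> ('g \<times> bool) list) set \<Rightarrow>
    ('g \<times> bool) list \<Rightarrow> ('g \<times> bool) list \<Rightarrow> bool"
  for S R where
  refl: "fst ` set u \<subseteq> S \<Longrightarrow> word_eq S R u u"
| sym: "word_eq S R u v \<Longrightarrow> word_eq S R v u"
| trans: "word_eq S R u v \<Longrightarrow> word_eq S R v w \<Longrightarrow> word_eq S R u w"
| append: "word_eq S R u u' \<Longrightarrow> word_eq S R v v' \<Longrightarrow> word_eq S R (u @ v) (u' @ v')"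
| cancel: "x \<in> S \<Longrightarrow> word_eq S R [(x, b), (x, \<not> b)] []"
| relation: "(u, v) \<in> R \<Longrightarrow> fst ` set u \<subseteq> S \<Longrightarrow> fst ` set v \<subseteq> S \<Longrightarrow> word_eq S R u v"

definition presented_group :: "'g set \<Rightarrow> (('g \<times> bool) list \<times> ('g \<times> bool) list) set \<Rightarrow>
    ('g \<times> bool) list set monoid" where
  "presented_group S R =
    \<lparr>carrier = {u. fst ` set u \<subseteq> S} // {(u, v). word_eq S R u v},
     monoid.mult = (\<lambda>A B. \<Union>a\<in>A. \<Union>b\<in>B. {w. word_eq S R (a @ b) w}),
     one = {w. word_eq S R [] w}\<rparr>"

datatype spin_gen = T nat | Z

type_synonym spin_word = "(spin_gen \<times> bool) list"
type_synonym spin_elt = "spin_word set"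

definition tw :: "nat \<Rightarrow> spin_word" where "tw i = [(T i, True)]"

definition zw :: spin_word where "zw = [(Z, True)]"

definition spin_gens :: "nat \<Rightarrow> spin_gen set" where
  "spin_gens n = insert Z (T ` {1..<n})"

definition spin_rels :: "nat \<Rightarrow> (spin_word \<times> spin_word) set" where
  "spin_rels n =
     {(zw @ tw i, tw i @ zw) | i. i \<in> {1..<n}} \<union>
     {(zw @ zw, [])} \<union>
     {(tw i @ tw i, zw) | i. i \<in> {1..<n}} \<union>
     {(tw i @ tw (i+1) @ tw i, tw (i+1) @ tw i @ tw (i+1)) | i. i \<in> {1..<n} \<and> i + 1 \<in> {1..<n}} \<union>
     {(tw j @ tw i, zw @ tw i @ tw j) | i j. i \<in> {1..<n} \<and> j \<in> {1..<n} \<and> \<bar>int i - int j\<bar> > 1}"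

definition spin_group :: "nat \<Rightarrow> spin_elt monoid" where
  "spin_group n = presented_group (spin_gens n) (spin_rels n)"

definition word_class :: "nat \<Rightarrow> spin_word \<Rightarrow> spin_elt" where
  "word_class n u = {w. word_eq (spin_gens n) (spin_rels n) u w}"

definition spin_t :: "nat \<Rightarrow> nat \<Rightarrow> spin_elt" where
  "spin_t n i = word_class n (tw i)"

definition spin_z :: "nat \<Rightarrow> spin_elt" where
  "spin_z n = word_class n zw"

text \<open>
  The natural embedding of \<open>spin_group n\<close> into \<open>spin_group (n + 1)\<close>: a class of words is sent to
  the class of the same words modulo the larger set of relations.
\<close>
definition spin_emb :: "nat \<Rightarrow> spin_elt \<Rightarrow> spin_elt" where
  "spin_emb n g = (\<Union>w\<in>g. word_class (n + 1) w)"

definition list_prod :: "('a, 'b) monoid_scheme \<Rightarrow> 'a list \<Rightarrow> 'a" where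
  "list_prod G xs = foldr (\<lambda>x y. x \<otimes>\<^bsub>G\<^esub> y) xs \<one>\<^bsub>G\<^esub>"

text \<open>\<open>spin_x n i\<close> is \<open>t\<^sub>i t\<^sub>i\<^sub>+\<^sub>1 \<dots> t\<^sub>n\<^sub>-\<^sub>1 t\<^sub>n t\<^sub>n\<^sub>-\<^sub>1 \<dots> t\<^sub>i\<^sub>+\<^sub>1 t\<^sub>i\<close>, an element of \<open>spin_group (n + 1)\<close>.\<close>
definition spin_x :: "nat \<Rightarrow> nat \<Rightarrow> spin_elt" where
  "spin_x n i = list_prod (spin_group (n + 1)) (map (spin_t (n + 1)) ([i..<n+1] @ rev [i..<n]))"

text \<open>
  The cycle \<open>[i\<^sub>1, \<dots>, i\<^sub>m]\<close>, defined as a product in \<open>spin_group (n + 1)\<close> but lying in the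
  image of \<open>spin_group n\<close>; \<open>spin_cycle\<close> is the corresponding element of \<open>spin_group n\<close>.
  Meaningful for lists of at least two distinct elements of \<open>{1..n}\<close>.
\<close>
definition spin_cycle_up :: "nat \<Rightarrow> nat list \<Rightarrow> spin_elt" where
  "spin_cycle_up n c =
     list_prod (spin_group (n + 1)) (map (spin_x n) (hd c # rev (tl c) @ [hd c]))"

definition spin_cycle :: "nat \<Rightarrow> nat list \<Rightarrow> spin_elt" where
  "spin_cycle n c = the_inv_into (carrier (spin_group n)) (spin_emb n) (spin_cycle_up n c)"

definition D_class :: "nat multiset \<Rightarrow> nat \<Rightarrow> spin_elt set" where
  "D_class \<alpha> n = {list_prod (spin_group n) (map (spin_cycle n) cs) | cs.
      map length cs = map Suc (parts_list \<alpha>) \<and> distinct (concat cs) \<and> set (concat cs) \<subseteq> {1..n}}"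

definition int_group_ring :: "('a, 'b) monoid_scheme \<Rightarrow> ('a \<Rightarrow>\<^sub>0 int) ring" where
  "int_group_ring G =
    \<lparr>carrier = {f. Poly_Mapping.keys f \<subseteq> carrier G},
     monoid.mult = (\<lambda>f g. \<Sum>a\<in>Poly_Mapping.keys f. \<Sum>b\<in>Poly_Mapping.keys g.
        Poly_Mapping.single (a \<otimes>\<^bsub>G\<^esub> b) (Poly_Mapping.lookup f a * Poly_Mapping.lookup g b)),
     one = frag_of \<one>\<^bsub>G\<^esub>,
     zero = 0,
     add = (+)\<rparr>"

definition spin_ideal :: "nat \<Rightarrow> (spin_elt \<Rightarrow>\<^sub>0 int) set" where
  "spin_ideal n = genideal (int_group_ring (spin_group n))
      {frag_of (spin_z n) + frag_of \<one>\<^bsub>spin_group n\<^esub>}"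

definition spin_algebra :: "nat \<Rightarrow> (spin_elt \<Rightarrow>\<^sub>0 int) set ring" where
  "spin_algebra n = int_group_ring (spin_group n) Quot spin_ideal n"

definition to_spin_algebra :: "nat \<Rightarrow> (spin_elt \<Rightarrow>\<^sub>0 int) \<Rightarrow> (spin_elt \<Rightarrow>\<^sub>0 int) set" where
  "to_spin_algebra n f = spin_ideal n +>\<^bsub>int_group_ring (spin_group n)\<^esub> f"

definition d_sum :: "nat multiset \<Rightarrow> nat \<Rightarrow> (spin_elt \<Rightarrow>\<^sub>0 int) set" where
  "d_sum \<alpha> n = to_spin_algebra n (\<Sum>g\<in>D_class \<alpha> n. frag_of g)"

definition EP_upto :: "nat \<Rightarrow> nat multiset set" where
  "EP_upto n = {\<nu> \<in> EP. sum_mset \<nu> + size \<nu> \<le> n}"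

text \<open>
  The \<open>d_sum \<nu> n\<close> with \<open>\<nu> \<in> EP_upto n\<close> form a basis of the even center; \<open>class_coeffs n v\<close> are
  the coordinates of an even central \<open>v\<close> in it, extended by \<open>0\<close> (and arbitrary for other \<open>v\<close>).
\<close>
definition class_coeffs :: "nat \<Rightarrow> (spin_elt \<Rightarrow>\<^sub>0 int) set \<Rightarrow> nat multiset \<Rightarrow> int" where
  "class_coeffs n v = (THE a. (\<forall>\<nu>. \<nu> \<notin> EP_upto n \<longrightarrow> a \<nu> = 0) \<and>
      v = (\<Oplus>\<^bsub>spin_algebra n\<^esub>\<nu>\<in>EP_upto n. [a \<nu>] \<cdot>\<^bsub>spin_algebra n\<^esub> d_sum \<nu> n))"

definition struct_coeff :: "nat multiset \<Rightarrow> nat multiset \<Rightarrow> nat multiset \<Rightarrow> nat \<Rightarrow> int" where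
  "struct_coeff \<alpha> \<beta> \<nu> n = class_coeffs n (d_sum \<alpha> n \<otimes>\<^bsub>spin_algebra n\<^esub> d_sum \<beta> n) \<nu>"

definition struct_poly :: "nat multiset \<Rightarrow> nat multiset \<Rightarrow> nat multiset \<Rightarrow> rat poly" where
  "struct_poly \<alpha> \<beta> \<nu> = (THE p. \<forall>n \<ge> sum_mset \<nu> + size \<nu>.
      poly p (of_nat n) = of_int (struct_coeff \<alpha> \<beta> \<nu> n))"

definition JM :: "nat \<Rightarrow> nat \<Rightarrow> (spin_elt \<Rightarrow>\<^sub>0 int) set" where
  "JM n k = to_spin_algebra n (\<Sum>i\<in>{1..<k}. frag_of (spin_cycle n [i, k]))"

definition e_sym :: "nat \<Rightarrow> nat \<Rightarrow> (spin_elt \<Rightarrow>\<^sub>0 int) set" where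
  "e_sym r n = (\<Oplus>\<^bsub>spin_algebra n\<^esub>I\<in>{I. I \<subseteq> {1..n} \<and> card I = r}.
      list_prod (spin_algebra n) (map (\<lambda>k. JM n k \<otimes>\<^bsub>spin_algebra n\<^esub> JM n k) (sorted_list_of_set I)))"

definition A_coeff :: "nat \<Rightarrow> nat multiset \<Rightarrow> int" where
  "A_coeff r \<alpha> = (THE c. \<forall>n \<ge> sum_mset \<alpha> + size \<alpha>. class_coeffs n (e_sym r n) \<alpha> = c)"

text \<open>
  Both coefficient rings are realised inside the rational polynomials; \<open>int_valued_half\<close> is the
  localisation of \<open>int_valued\<close> at the powers of \<open>2\<close>.
\<close>

definition int_valued :: "rat poly set" where
  "int_valued = {p. \<forall>k::int. poly p (of_int k) \<in> \<int>}"

definition int_valued_half :: "rat poly set" where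
  "int_valued_half = {Polynomial.smult (1 / 2 ^ k) p | k p. p \<in> int_valued}"

definition poly_ring_on :: "rat poly set \<Rightarrow> rat poly ring" where
  "poly_ring_on B = \<lparr>carrier = B, monoid.mult = (*), one = 1, zero = 0, add = (+)\<rparr>"

type_synonym fh_elt = "nat multiset \<Rightarrow>\<^sub>0 rat poly"

abbreviation d_basis :: "nat multiset \<Rightarrow> fh_elt" where
  "d_basis \<alpha> \<equiv> Poly_Mapping.single \<alpha> 1"

definition fh_scale :: "rat poly \<Rightarrow> fh_elt \<Rightarrow> fh_elt" where
  "fh_scale c v = Poly_Mapping.map (\<lambda>a. c * a) v"

definition d_mult :: "nat multiset \<Rightarrow> nat multiset \<Rightarrow> fh_elt" where
  "d_mult \<alpha> \<beta> = (\<Sum>\<nu> | \<nu> \<in> EP \<and> sum_mset \<nu> \<le> sum_mset \<alpha> + sum_mset \<beta>.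
      fh_scale (struct_poly \<alpha> \<beta> \<nu>) (d_basis \<nu>))"

definition d_mult_top :: "nat multiset \<Rightarrow> nat multiset \<Rightarrow> fh_elt" where
  "d_mult_top \<alpha> \<beta> = (\<Sum>\<nu> | \<nu> \<in> EP \<and> sum_mset \<nu> = sum_mset \<alpha> + sum_mset \<beta>.
      fh_scale (struct_poly \<alpha> \<beta> \<nu>) (d_basis \<nu>))"

text \<open>
  \<open>fh_algebra B\<close> is the free \<open>B\<close>-module on the \<open>d_basis \<alpha>\<close> with \<open>\<alpha> \<in> EP\<close> (\<open>v\<close> stands for
  the sum of the \<open>lookup v \<alpha>\<close> times \<open>d_basis \<alpha>\<close>), with the product determined by the structure
  polynomials. Thus \<open>fh_algebra int_valued\<close> is the spin FH-algebra. Since it is free over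
  \<open>int_valued\<close>, its base change to \<open>int_valued_half\<close> is \<open>fh_algebra int_valued_half\<close> (same
  basis, same structure constants).
\<close>
definition fh_algebra :: "rat poly set \<Rightarrow> (rat poly, fh_elt) module" where
  "fh_algebra B =
    \<lparr>carrier = {v. Poly_Mapping.keys v \<subseteq> EP \<and> (\<forall>\<alpha>. Poly_Mapping.lookup v \<alpha> \<in> B)},
     monoid.mult = (\<lambda>v w. \<Sum>\<alpha>\<in>Poly_Mapping.keys v. \<Sum>\<beta>\<in>Poly_Mapping.keys w.
        fh_scale (Poly_Mapping.lookup v \<alpha> * Poly_Mapping.lookup w \<beta>) (d_mult \<alpha> \<beta>)),
     one = d_basis {#},
     zero = 0,
     add = (+),
     module.smult = fh_scale\<rparr>"

definition fh_span :: "rat poly set \<Rightarrow> fh_elt set \<Rightarrow> fh_elt set" where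
  "fh_span B S = (\<lambda>N. submodule N (poly_ring_on B) (fh_algebra B)) hull S"

definition fh_alg_gen :: "rat poly set \<Rightarrow> fh_elt set \<Rightarrow> fh_elt set" where
  "fh_alg_gen B S =
    (\<lambda>N. subring N (fh_algebra B) \<and> submodule N (poly_ring_on B) (fh_algebra B)) hull S"

definition K_deg :: "rat poly set \<Rightarrow> nat \<Rightarrow> fh_elt set" where
  "K_deg B m = fh_span B (d_basis ` EP_of m)"

definition H_deg :: "nat \<Rightarrow> fh_elt set" where
  "H_deg m = fh_span int_valued {d_mult_top \<alpha> \<beta> | \<alpha> \<beta>. \<alpha> \<in> EP \<and> \<beta> \<in> EP \<and>
      sum_mset \<alpha> + sum_mset \<beta> = m \<and> sum_mset \<alpha> > 0 \<and> sum_mset \<beta> > 0}"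

definition e_star :: "nat \<Rightarrow> fh_elt" where
  "e_star r = (\<Sum>\<alpha>\<in>EP_of (2 * r). fh_scale (of_int (A_coeff r \<alpha>)) (d_basis \<alpha>))"

end

theory Submission
  imports Defs "HOL-Combinatorics.Combinatorics"
begin

text \<open>
  The map \<open>t\<^sub>i \<mapsto> (\<gamma>\<^sub>i\<^sub>+\<^sub>1 - \<gamma>\<^sub>i) / \<surd>2\<close> into a Clifford algebra is faithful on the double cover, so every
  computation takes place in a concrete group of signed lifts of permutations, and a class sum is
  detected by one coefficient at a representative.

  For symmetric \<open>u\<close> in the squared Jucys--Murphy elements \<open>M\<^sub>k\<^sup>2\<close>, removing multiples of
  \<open>e\<^sub>1, e\<^sub>2, \<dots>\<close> in turn writes \<open>u\<close>, homogeneous of degree \<open>r\<close>, as an integer multiple of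
  \<open>e\<^sub>r\<close> plus products of symmetric elements of lower degree. The top-degree part of the monomial
  symmetric element of type \<open>\<nu>\<close> is \<open>\<plusminus>d\<^sub>\<nu>\<close> plus terms \<open>d\<^sub>\<kappa>\<close> with fewer parts: in \<open>\<Prod> M\<^sub>k\<^bsup>2a\<^sub>k\<^esup>\<close> a
  word with pairwise distinct leaves that avoid the centres multiplies to disjoint cycles with maxima
  \<open>k\<close> and lengths \<open>2a\<^sub>k + 1\<close>, and any other word moves too few points. Unitriangularity then
  expresses each \<open>d\<^sub>\<nu>\<close> through \<open>e\<^sub>r\<^sup>*\<close> and top-degree products with integer coefficients, and
  generation follows by induction on the degree.
\<close>

section \<open>A Clifford model of the double cover\<close>

text \<open>The obstacle is the sign: most arguments determine an element of the double cover only
  through its permutation, that is, up to \<open>zz\<close>. The development is arranged so that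
  this suffices. Words are reduced up to the central element, and the two lifts are told apart
  afterwards in the model; supports are tracked through permutations; and a diagonal coefficient
  known only up to sign is still a unit of the integers.

  The model contains all points at once, so one representative \<open>rep \<nu>\<close> serves every
  n, and dependence on n becomes a count of points outside its support. This count produces the
  binomial polynomials. The filtration by degree and the constancy of the top coefficients both rest
  on one fact about transposition words: if the product has c orbits on {1..N}, the word has at
  least N - c letters, and in a word of exactly this length no letter touches a fixed point of the
  product.

  The index 4 * r at which degree 2 * r is read off bounds the support of every class in that
  degree, since a partition has at most as many parts as its sum.\<close>

type_synonym op = "(nat set \<Rightarrow> real) \<Rightarrow> nat set \<Rightarrow> real"

definition flip :: "nat \<Rightarrow> nat set \<Rightarrow> nat set" where
  "flip i S = (if i \<in> S then S - {i} else insert i S)"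

text \<open>Fock space model: S stands for a monomial in the generators, toggling i multiplies by
  one generator, and the power of -1 counts the generators it has to pass. The extra sign for i in S
  makes each generator square to -1. Infinite S cause no trouble because only the finitely many j <
  i are counted.\<close>

definition cl_sign :: "nat \<Rightarrow> nat set \<Rightarrow> real" where
  "cl_sign i S = (if i \<in> S then - 1 else 1) * (- 1) ^ card {j \<in> S. j < i}"

definition cl :: "nat \<Rightarrow> op" where
  "cl i f = (\<lambda>S. cl_sign i S * f (flip i S))"

lemma flip_flip [simp]: "flip i (flip i S) = S"
  by (auto simp: flip_def)

lemma flip_commute: "flip i (flip j S) = flip j (flip i S)"
  by (auto simp: flip_def)

lemma mem_flip: "j \<in> flip i S \<longleftrightarrow> (j \<in> S) \<noteq> (i = j)"
  by (auto simp: flip_def)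

lemma card_less_flip:
  "(- 1 :: real) ^ card {k \<in> flip j S. k < i} =
     (if j < i then - 1 else 1) * (- 1) ^ card {k \<in> S. k < i}"
proof -
  let ?A = "{k \<in> S. k < i}"
  have fin: "finite ?A" by simp
  show ?thesis
  proof (cases "j < i")
    case False
    then have "{k \<in> flip j S. k < i} = ?A" by (auto simp: mem_flip)
    then show ?thesis using False by simp
  next
    case True
    show ?thesis
    proof (cases "j \<in> S")
      case False
      then have "{k \<in> flip j S. k < i} = insert j ?A" using True by (auto simp: mem_flip)
      then show ?thesis using True False fin by simp
    next
      case jS: True
      then have e: "?A = insert j {k \<in> flip j S. k < i}" using True by (auto simp: mem_flip)
      have f: "finite {k \<in> flip j S. k < i}" by simp
      have "card ?A = Suc (card {k \<in> flip j S. k < i})"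
        by (subst e, subst card_insert_disjoint[OF f]) (auto simp: mem_flip jS)
      then show ?thesis using True by simp
    qed
  qed
qed

lemma cl_sign_flip:
  "cl_sign i (flip j S) = (if j < i \<or> i = j then - 1 else 1) * cl_sign i S"
  unfolding cl_sign_def card_less_flip by (auto simp: mem_flip)

lemma cl_sign_sq: "cl_sign i S * cl_sign i S = 1"
proof -
  have "(- 1 :: real) ^ n * (- 1) ^ n = 1" for n :: nat
    by (simp flip: power_mult_distrib)
  then show ?thesis by (simp add: cl_sign_def)
qed

lemma cl_cl [simp]: "cl i (cl i f) = (\<lambda>S. - f S)"
  by (rule ext) (simp add: cl_def cl_sign_flip mult.assoc[symmetric] cl_sign_sq)

lemma cl_anticommute: "i \<noteq> j \<Longrightarrow> cl i (cl j f) = (\<lambda>S. - cl j (cl i f) S)"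
  by (rule ext) (auto simp: cl_def cl_sign_flip flip_commute)

lemma cl_minus [simp]: "cl i (\<lambda>S. - f S) = (\<lambda>S. - cl i f S)"
  by (rule ext) (simp add: cl_def)

definition refl_op :: "nat \<Rightarrow> nat \<Rightarrow> op" where
  "refl_op i j f = (\<lambda>S. (cl j f S - cl i f S) / sqrt 2)"

lemma cl_refl_op':
  "cl k (\<lambda>S. (cl j f S - cl i f S) / sqrt 2) = (\<lambda>S. (cl k (cl j f) S - cl k (cl i f) S) / sqrt 2)"
  by (rule ext) (simp add: cl_def algebra_simps)

lemma cl_refl_op:
  "cl k (refl_op i j f) = (\<lambda>S. (cl k (cl j f) S - cl k (cl i f) S) / sqrt 2)"
  by (rule ext) (simp add: cl_def refl_op_def algebra_simps)

lemma refl_op_minus [simp]: "refl_op i j (\<lambda>S. - f S) = (\<lambda>S. - refl_op i j f S)"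
  by (rule ext) (simp add: refl_op_def diff_divide_distrib)

lemma refl_op_swap: "refl_op j i f = (\<lambda>S. - refl_op i j f S)"
  by (rule ext) (simp add: refl_op_def diff_divide_distrib)

lemma cl_anticommute_app: "i \<noteq> j \<Longrightarrow> cl i (cl j f) S = - cl j (cl i f) S"
  using cl_anticommute[of i j f] by simp

text \<open>For a unit vector u the map v -> - u v / u is the reflection along u, and reflection
  along e_j - e_i exchanges two coordinates. A generator with another index simply anticommutes with
  u.\<close>

lemma refl_op_cl:
  assumes "i \<noteq> j"
  shows "refl_op i j (cl k f) = (\<lambda>S. - cl (transpose i j k) (refl_op i j f) S)"
proof (rule ext)
  fix S
  consider "k = i" | "k = j" | "k \<noteq> i" "k \<noteq> j" by blast
  then show "refl_op i j (cl k f) S = - cl (transpose i j k) (refl_op i j f) S"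
  proof cases
    case 1
    then show ?thesis using assms cl_anticommute_app[of j i f S]
      by (simp add: cl_refl_op' refl_op_def field_simps)
  next
    case 2
    then show ?thesis using assms cl_anticommute_app[of j i f S]
      by (simp add: cl_refl_op' refl_op_def field_simps)
  next
    case 3
    then show ?thesis using cl_anticommute_app[of k i f S] cl_anticommute_app[of k j f S]
      by (simp add: cl_refl_op' refl_op_def field_simps)
  qed
qed

lemma refl_op_sq: "i \<noteq> j \<Longrightarrow> refl_op i j (refl_op i j f) = (\<lambda>S. - f S)"
proof (rule ext)
  fix S assume "i \<noteq> j"
  then have a: "cl j (cl i f) S = - cl i (cl j f) S" by (simp add: cl_anticommute_app[of j i])
  show "refl_op i j (refl_op i j f) S = - f S"
    by (subst refl_op_def) (simp add: cl_refl_op a diff_divide_distrib add_divide_distrib)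
qed

lemma refl_op_refl_op:
  assumes "i \<noteq> j"
  shows "refl_op i j (refl_op k l f) =
    (\<lambda>S. - refl_op (transpose i j k) (transpose i j l) (refl_op i j f) S)"
proof (rule ext)
  fix S
  have lin: "refl_op i j (\<lambda>S. (g S - h S) / sqrt 2) S = (refl_op i j g S - refl_op i j h S) / sqrt 2" for g h
    by (simp add: refl_op_def cl_def field_simps)
  show "refl_op i j (refl_op k l f) S =
      - refl_op (transpose i j k) (transpose i j l) (refl_op i j f) S"
    by (subst (2) refl_op_def, subst lin)
       (simp add: refl_op_cl[OF assms] refl_op_def[of "transpose i j k"] diff_divide_distrib)
qed

text \<open>The permutation is carried next to the operator, so that projecting to permutations
  means taking the first component and nothing has to be recovered from the operator. The points
  include 0, which lies outside every {1..n}.\<close>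

inductive_set spin_pairs :: "((nat \<Rightarrow> nat) \<times> op) set" where
  spin_pairs_id: "(id, id) \<in> spin_pairs"
| spin_pairs_mult: "(p, A) \<in> spin_pairs \<Longrightarrow> i \<noteq> j \<Longrightarrow>
    (transpose i j \<circ> p, refl_op i j \<circ> A) \<in> spin_pairs"

text \<open>The group is written additively, so that the monoid ring \<open>sp \<Rightarrow>\<^sub>0 int\<close> of the library is
  its group ring.\<close>
typedef sp = spin_pairs
  using spin_pairs_id by blast

setup_lifting type_definition_sp

lemma spin_pairs_comp:
  assumes "(p, A) \<in> spin_pairs" "(q, B) \<in> spin_pairs"
  shows "(p \<circ> q, A \<circ> B) \<in> spin_pairs"
  using assms(1)
proof (induction p A rule: spin_pairs.induct)
  case spin_pairs_id
  then show ?case using assms(2) by simp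
next
  case (spin_pairs_mult p A i j)
  then show ?case using spin_pairs.spin_pairs_mult[of "p \<circ> q" "A \<circ> B" i j]
    by (metis comp_assoc)
qed

lemma spin_pairs_gen: "i \<noteq> j \<Longrightarrow> (transpose i j, refl_op i j) \<in> spin_pairs"
  using spin_pairs_mult[OF spin_pairs_id, of i j] by simp

lemma spin_pairs_minus: "(id, \<lambda>f S. - f S) \<in> spin_pairs"
proof -
  have "(transpose 0 1 \<circ> transpose 0 1, refl_op 0 1 \<circ> refl_op 0 1) \<in> spin_pairs"
    by (intro spin_pairs_comp spin_pairs_gen) auto
  moreover have "refl_op 0 1 \<circ> refl_op 0 1 = (\<lambda>f S. - f S)"
    by (rule ext) (simp add: refl_op_sq)
  moreover have "transpose 0 1 \<circ> transpose 0 (1 :: nat) = id" by (simp add: fun_eq_iff)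
  ultimately show ?thesis by metis
qed

text \<open>A reflection squares to -1, so its inverse is its negative, and -1 belongs to the set as
  the square of a reflection.\<close>

lemma spin_pairs_inverse:
  "(p, A) \<in> spin_pairs \<Longrightarrow> \<exists>q B. (q, B) \<in> spin_pairs \<and> q \<circ> p = id \<and> B \<circ> A = id"
proof (induction p A rule: spin_pairs.induct)
  case spin_pairs_id
  have "(id, id) \<in> spin_pairs \<and> id \<circ> id = id \<and> id \<circ> id = id"
    using spin_pairs.spin_pairs_id by (simp only: id_comp simp_thms)
  then show ?case by blast
next
  case (spin_pairs_mult p A i j)
  then obtain q B where qB: "(q, B) \<in> spin_pairs" "q \<circ> p = id" "B \<circ> A = id" by blast
  have 1: "(q \<circ> (id \<circ> transpose i j), B \<circ> ((\<lambda>f S. - f S) \<circ> refl_op i j)) \<in> spin_pairs"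
    by (intro spin_pairs_comp spin_pairs_gen spin_pairs_minus spin_pairs_mult qB)
  have 2: "q \<circ> (id \<circ> transpose i j) \<circ> (transpose i j \<circ> p) = id"
    using qB(2) by (simp add: fun_eq_iff)
  have 3: "B \<circ> ((\<lambda>f S. - f S) \<circ> refl_op i j) \<circ> (refl_op i j \<circ> A) = id"
    using qB(3) by (simp add: fun_eq_iff refl_op_sq[OF spin_pairs_mult.hyps(2)])
  show ?case using 1 2 3 by blast
qed

instantiation sp :: group_add
begin

lift_definition zero_sp :: sp is "(id, id)" by (rule spin_pairs_id)

lift_definition plus_sp :: "sp \<Rightarrow> sp \<Rightarrow> sp" is "\<lambda>(p, A) (q, B). (p \<circ> q, A \<circ> B)"
  by (auto intro: spin_pairs_comp)

definition uminus_sp :: "sp \<Rightarrow> sp" where "uminus_sp a = (SOME b. b + a = 0)"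

definition minus_sp :: "sp \<Rightarrow> sp \<Rightarrow> sp" where "minus_sp a b = a + - b"

instance
proof
  fix a b c :: sp
  show "a + b + c = a + (b + c)" by transfer (auto simp: o_assoc)
  show "0 + a = a" by transfer auto
  show "a + 0 = a" by transfer auto
  have "\<exists>b. b + a = 0"
  proof -
    obtain p A where pA: "Rep_sp a = (p, A)" by (cases "Rep_sp a")
    then have "(p, A) \<in> spin_pairs" using Rep_sp[of a] by (simp only:)
    then obtain q B where qB: "(q, B) \<in> spin_pairs" "q \<circ> p = id" "B \<circ> A = id"
      using spin_pairs_inverse[of p A] by blast
    have "Rep_sp (Abs_sp (q, B) + a) = Rep_sp 0"
      by (simp only: plus_sp.rep_eq zero_sp.rep_eq Abs_sp_inverse[OF qB(1)] pA case_prod_conv qB(2,3))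
    then show ?thesis by (auto simp only: Rep_sp_inject)
  qed
  then show "- a + a = 0" unfolding uminus_sp_def by (rule someI_ex)
  show "a + - b = a - b" by (simp add: minus_sp_def)
qed

end

lift_definition act :: "sp \<Rightarrow> nat \<Rightarrow> nat" is fst .
lift_definition oper :: "sp \<Rightarrow> op" is snd .
lift_definition zz :: sp is "(id, \<lambda>f S. - f S)" by (rule spin_pairs_minus)
lift_definition tt :: "nat \<Rightarrow> nat \<Rightarrow> sp" is
  "\<lambda>i j. if i = j then (id, id) else (transpose i j, refl_op i j)"
  by (auto intro: spin_pairs_gen spin_pairs_id)

lemma sp_eqI: "act a = act b \<Longrightarrow> oper a = oper b \<Longrightarrow> a = b"
  by transfer (simp add: prod_eq_iff)

lemma act_0 [simp]: "act 0 = id" by transfer simp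
lemma act_add [simp]: "act (a + b) = act a \<circ> act b" by transfer auto
lemma act_zz [simp]: "act zz = id" by transfer simp
lemma act_tt [simp]: "act (tt i j) = transpose i j" by transfer auto
lemma oper_0 [simp]: "oper 0 = id" by transfer simp
lemma oper_add [simp]: "oper (a + b) = oper a \<circ> oper b" by transfer auto
lemma oper_zz [simp]: "oper zz f = (\<lambda>S. - f S)" by transfer simp
lemma oper_tt: "oper (tt i j) = (if i = j then id else refl_op i j)" by transfer auto

lemma tt_same [simp]: "tt i i = 0" by transfer simp

lemma sp_induct [case_names zero tt]:
  assumes "P 0" and "\<And>i j a. i \<noteq> j \<Longrightarrow> P a \<Longrightarrow> P (tt i j + a)"
  shows "P a"
proof -
  have "P (Abs_sp (p, A))" if "(p, A) \<in> spin_pairs" for p A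
    using that
  proof (induction p A rule: spin_pairs.induct)
    case spin_pairs_id
    show ?case using assms(1) by (simp only: zero_sp_def)
  next
    case (spin_pairs_mult p A i j)
    note Abs_sp_inverse[OF spin_pairs_mult(1)]
      Abs_sp_inverse[OF spin_pairs.spin_pairs_mult[OF spin_pairs_mult(1,2)]]
    then have "Rep_sp (Abs_sp (transpose i j \<circ> p, refl_op i j \<circ> A)) = Rep_sp (tt i j + Abs_sp (p, A))"
      using spin_pairs_mult(2) by (simp add: plus_sp.rep_eq tt.rep_eq)
    then have "Abs_sp (transpose i j \<circ> p, refl_op i j \<circ> A) = tt i j + Abs_sp (p, A)"
      by (simp only: Rep_sp_inject)
    then show ?case using assms(2)[OF spin_pairs_mult(2,3)] by (simp only:)
  qed
  then show ?thesis using Abs_sp_cases[of a] by (metis surj_pair)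
qed

lemma oper_minus: "oper a (\<lambda>S. - f S) = (\<lambda>S. - oper a f S)"
  by (induction a rule: sp_induct) (simp_all add: oper_tt)

lemma zz_commute: "zz + a = a + zz"
proof (rule sp_eqI)
  show "oper (zz + a) = oper (a + zz)" by (rule ext) (simp add: oper_minus)
qed simp

lemma zz_zz [simp]: "zz + zz = 0"
proof (rule sp_eqI)
  show "oper (zz + zz) = oper 0" by (rule ext) simp
qed simp

lemma zz_zz_add [simp]: "zz + (zz + a) = a"
  by (simp only: add.assoc[symmetric] zz_zz add_0_left)

lemma zz_left_commute: "a + (zz + b) = zz + (a + b)"
  using arg_cong[OF zz_commute, of "\<lambda>x. x + b" a] by (simp only: add.assoc)

lemma tt_zz [simp]: "tt i j + zz = zz + tt i j" "tt i j + (zz + a) = zz + (tt i j + a)"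
  by (rule zz_commute[symmetric], rule zz_left_commute)

lemma zz_neq_0 [simp]: "zz \<noteq> 0"
proof
  assume "zz = 0"
  then have "oper zz (\<lambda>_. 1) {} = oper 0 (\<lambda>_. 1) {}" by simp
  then show False by simp
qed

lemma uminus_zz [simp]: "- zz = zz"
  by (rule minus_unique) simp

lemma zz_add_neq [simp]: "zz + a \<noteq> a"
  by (metis add.right_neutral add_right_cancel add.left_neutral zz_neq_0)

lemma tt_swap: "i \<noteq> j \<Longrightarrow> tt j i = zz + tt i j"
  by (rule sp_eqI) (auto simp: fun_eq_iff transpose_commute oper_tt refl_op_swap[of j i])

lemma tt_tt: "i \<noteq> j \<Longrightarrow> tt i j + tt i j = zz"
  by (rule sp_eqI) (auto simp: fun_eq_iff oper_tt refl_op_sq)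

lemma uminus_tt: "i \<noteq> j \<Longrightarrow> - tt i j = zz + tt i j"
  by (rule minus_unique) (simp add: tt_tt)

lemma permutation_act: "permutation (act a)"
proof (induction a rule: sp_induct)
  case zero
  show ?case unfolding act_0 by (rule permutation_id)
next
  case (tt i j a)
  then show ?case unfolding act_add act_tt by (intro permutation_compose permutation_swap_id)
qed

lemma bij_act: "bij (act a)"
  using permutation_act permutation_bijective by blast

lemma act_eq_iff [simp]: "act a x = act a y \<longleftrightarrow> x = y"
  using bij_is_inj[OF bij_act[of a]] by (auto dest: injD)

definition odd_sp :: "sp \<Rightarrow> bool" where "odd_sp a \<longleftrightarrow> \<not> evenperm (act a)"

lemma odd_sp_0 [simp]: "\<not> odd_sp 0" by (simp add: odd_sp_def evenperm_id[unfolded id_def] id_def)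
lemma odd_sp_zz [simp]: "\<not> odd_sp zz" by (simp add: odd_sp_def evenperm_id[unfolded id_def] id_def)
lemma odd_sp_add [simp]: "odd_sp (a + b) \<longleftrightarrow> odd_sp a \<noteq> odd_sp b"
  by (simp add: odd_sp_def evenperm_comp permutation_act)
lemma odd_sp_tt [simp]: "odd_sp (tt i j) \<longleftrightarrow> i \<noteq> j"
  by (simp add: odd_sp_def evenperm_swap)
lemma odd_sp_uminus [simp]: "odd_sp (- a) \<longleftrightarrow> odd_sp a"
  by (metis left_minus odd_sp_0 odd_sp_add)

definition zs :: "bool \<Rightarrow> sp" where "zs b = (if b then zz else 0)"

lemma zs_simps [simp]: "zs False = 0" "zs True = zz" by (simp_all add: zs_def)
lemma act_zs [simp]: "act (zs b) = id" by (simp add: zs_def)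
lemma odd_sp_zs [simp]: "\<not> odd_sp (zs b)" by (simp add: zs_def)
lemma zs_left_commute: "a + (zs b + c) = zs b + (a + c)"
  using zz_left_commute by (cases b) simp_all
lemma zs_commute: "a + zs b = zs b + a" using zz_commute[of a] by (cases b) simp_all
lemma tt_zs [simp]: "tt i j + zs b = zs b + tt i j" "tt i j + (zs b + a) = zs b + (tt i j + a)"
  by (rule zs_commute, rule zs_left_commute)
lemma zs_zs_add: "zs a + (zs b + c) = zs (a \<noteq> b) + c" by (auto simp: zs_def)

lemma inj_apply_transpose: "inj f \<Longrightarrow> f (transpose a b x) = transpose (f a) (f b) (f x)"
  by (cases "x = a"; cases "x = b") (auto dest: injD simp: transpose_def)

text \<open>Conjugation by an odd element is, up to sign, a relabelling: the reflection formula
  \<open>u v u\<^sup>-\<^sup>1 = - r\<^sub>u(v)\<close> in a Clifford algebra.\<close>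
lemma add_tt:
  assumes "i \<noteq> j"
  shows "a + tt i j = zs (odd_sp a) + tt (act a i) (act a j) + a"
proof (induction a rule: sp_induct)
  case zero
  then show ?case by simp
next
  case (tt k l a)
  have 1: "tt k l + tt i' j' = zz + tt (transpose k l i') (transpose k l j') + tt k l" if "i' \<noteq> j'" for i' j'
  proof (rule sp_eqI)
    have inj: "inj (transpose k l)" by (rule inj_transpose)
    show "act (tt k l + tt i' j') = act (zz + tt (transpose k l i') (transpose k l j') + tt k l)"
      unfolding act_add act_tt act_zz by (rule ext, unfold o_apply id_apply, rule inj_apply_transpose[OF inj])
    have "transpose k l i' \<noteq> transpose k l j'" using that inj_eq[OF inj] by blast
    then show "oper (tt k l + tt i' j') = oper (zz + tt (transpose k l i') (transpose k l j') + tt k l)"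
      using that tt(1) refl_op_refl_op[OF tt(1), of i' j'] by (intro ext) (simp only: oper_add oper_tt oper_zz o_apply if_False)
  qed
  have "tt k l + a + tt i j = zs (odd_sp a) + (tt k l + tt (act a i) (act a j)) + a"
    using tt(2) by (simp only: add.assoc zs_left_commute)
  also have "\<dots> = zs (odd_sp (tt k l + a)) + tt (act (tt k l + a) i) (act (tt k l + a) j) + (tt k l + a)"
    using 1[of "act a i" "act a j"] assms tt(1) by (cases "odd_sp a") (simp_all add: add.assoc)
  finally show ?case .
qed

section \<open>Words in the presented group and their normal form up to the central element\<close>

lemma word_eqD:
  assumes "word_eq S R u v"
  shows "fst ` set u \<subseteq> S" "fst ` set v \<subseteq> S"
  using assms by (induction rule: word_eq.induct) auto

abbreviation spin_eq :: "nat \<Rightarrow> spin_word \<Rightarrow> spin_word \<Rightarrow> bool" where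
  "spin_eq n \<equiv> word_eq (spin_gens n) (spin_rels n)"

definition spin_valid :: "nat \<Rightarrow> spin_word \<Rightarrow> bool" where
  "spin_valid n u \<longleftrightarrow> fst ` set u \<subseteq> spin_gens n"

lemma spin_valid_append [simp]: "spin_valid n (u @ v) \<longleftrightarrow> spin_valid n u \<and> spin_valid n v"
  by (auto simp: spin_valid_def)
lemma spin_valid_Nil [simp]: "spin_valid n []" by (simp add: spin_valid_def)
lemma spin_valid_zw [simp]: "spin_valid n zw" by (simp add: spin_valid_def zw_def spin_gens_def)
lemma spin_valid_tw [simp]: "spin_valid n (tw i) \<longleftrightarrow> i \<in> {1..<n}"
  by (auto simp: spin_valid_def tw_def spin_gens_def)
lemma spin_valid_Cons: "spin_valid n (x # u) \<longleftrightarrow> spin_valid n [x] \<and> spin_valid n u"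
  by (auto simp: spin_valid_def)

lemma spin_eq_valid: "spin_eq n u v \<Longrightarrow> spin_valid n u \<and> spin_valid n v"
  using word_eqD[of "spin_gens n" "spin_rels n" u v] unfolding spin_valid_def by blast

lemma spin_eq_refl: "spin_valid n u \<Longrightarrow> spin_eq n u u"
  by (simp add: spin_valid_def word_eq.refl)

lemma spin_eq_rel: "(u, v) \<in> spin_rels n \<Longrightarrow> spin_valid n u \<Longrightarrow> spin_valid n v \<Longrightarrow> spin_eq n u v"
  by (simp add: spin_valid_def word_eq.relation)

lemma spin_eq_mono:
  assumes "spin_eq n u v" "n \<le> m"
  shows "spin_eq m u v"
proof -
  have g: "spin_gens n \<subseteq> spin_gens m" using assms(2) by (auto simp: spin_gens_def)
  have r: "spin_rels n \<subseteq> spin_rels m" 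
  proof -
    have "{1..<n} \<subseteq> {1..<m}" using assms(2) by auto
    then show ?thesis unfolding spin_rels_def by (intro Un_mono) blast+
  qed
  show ?thesis using assms(1)
  proof (induction rule: word_eq.induct)
    case (refl u)
    then show ?case using g by (intro word_eq.refl) blast
  next
    case (sym u v)
    show ?case by (rule word_eq.sym[OF sym.IH])
  next
    case (trans u v w)
    show ?case by (rule word_eq.trans[OF trans.IH])
  next
    case (append u u' v v')
    show ?case by (rule word_eq.append[OF append.IH])
  next
    case (cancel x b)
    then show ?case using g by (intro word_eq.cancel) blast
  next
    case (relation u v)
    then show ?case using g r by (intro word_eq.relation) blast+
  qed
qed

lemma spin_eq_append: "spin_eq n u u' \<Longrightarrow> spin_eq n v v' \<Longrightarrow> spin_eq n (u @ v) (u' @ v')"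
  by (rule word_eq.append)

lemma spin_eq_ctx:
  assumes "spin_eq n u v" "spin_valid n a" "spin_valid n b"
  shows "spin_eq n (a @ u @ b) (a @ v @ b)"
  by (intro spin_eq_append spin_eq_refl assms)

lemma spin_eq_zw_zw: "spin_eq n (zw @ zw) []"
  by (intro spin_eq_rel) (auto simp: spin_rels_def)

lemma spin_eq_zw_inverse: "spin_eq n [(Z, False)] zw"
proof -
  have v: "spin_valid n [(Z, False)]" by (simp add: spin_valid_def spin_gens_def)
  have "spin_eq n ([(Z, False)] @ [] @ []) ([(Z, False)] @ (zw @ zw) @ [])"
    by (intro spin_eq_ctx word_eq.sym[OF spin_eq_zw_zw] v spin_valid_Nil)
  moreover have "spin_eq n ([] @ [(Z, False), (Z, \<not> False)] @ zw) ([] @ [] @ zw)"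
    by (intro spin_eq_ctx word_eq.cancel) (auto simp: spin_gens_def)
  ultimately show ?thesis by (auto simp: zw_def intro: word_eq.trans)
qed

lemma spin_eq_tw_inverse:
  assumes "i \<in> {1..<n}"
  shows "spin_eq n [(T i, False)] (zw @ tw i)"
proof -
  have v: "spin_valid n [(T i, False)]" using assms by (simp add: spin_valid_def spin_gens_def)
  have t: "spin_eq n (tw i @ tw i) zw" using assms by (intro spin_eq_rel) (auto simp: spin_rels_def)
  have 1: "spin_eq n ([(T i, False)] @ [] @ []) ([(T i, False)] @ (zw @ zw) @ [])"
    by (intro spin_eq_ctx word_eq.sym[OF spin_eq_zw_zw] v spin_valid_Nil)
  have 2: "spin_eq n ([(T i, False)] @ zw @ zw) ([(T i, False)] @ (tw i @ tw i) @ zw)"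
    using v by (intro spin_eq_ctx word_eq.sym[OF t]) auto
  have 3: "spin_eq n ([] @ [(T i, False), (T i, \<not> False)] @ (tw i @ zw)) ([] @ [] @ (tw i @ zw))"
    using assms by (intro spin_eq_ctx word_eq.cancel) (auto simp: spin_gens_def)
  have 4: "spin_eq n (tw i @ zw) (zw @ tw i)"
    using assms by (intro word_eq.sym[OF spin_eq_rel]) (auto simp: spin_rels_def)
  have "spin_eq n ([(T i, False)] @ zw @ zw) (tw i @ zw)"
    using word_eq.trans[OF 2] 3 by (simp add: tw_def)
  moreover have "spin_eq n [(T i, False)] ([(T i, False)] @ zw @ zw)" using 1 by simp
  ultimately show ?thesis using 4 word_eq.trans by blast
qed

lemma spin_eq_zw_commute:
  assumes "spin_valid n u"
  shows "spin_eq n (u @ zw) (zw @ u)"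
  using assms
proof (induction u)
  case Nil
  then show ?case by (simp add: spin_eq_refl)
next
  case (Cons x u)
  obtain g b where x: "x = (g, b)" by (cases x)
  have v: "spin_valid n [x]" "spin_valid n u" using Cons.prems spin_valid_Cons by blast+
  have letter: "spin_eq n ([x] @ zw) (zw @ [x])"
  proof (cases g)
    case Z
    show ?thesis
    proof (cases b)
      case True
      then show ?thesis using Z x spin_eq_refl[of n "zw @ zw"] by (simp add: zw_def spin_valid_def spin_gens_def)
    next
      case False
      then have e: "spin_eq n [x] zw" using spin_eq_zw_inverse Z x by simp
      have "spin_eq n ([x] @ zw) (zw @ zw)" "spin_eq n (zw @ zw) (zw @ [x])"
        using spin_eq_append[OF e spin_eq_refl[of n zw]] spin_eq_append[OF spin_eq_refl[of n zw] word_eq.sym[OF e]]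
        by simp_all
      then show ?thesis using word_eq.trans by blast
    qed
  next
    case (T i)
    then have i: "i \<in> {1..<n}" using v x by (auto simp: spin_valid_def spin_gens_def)
    have t: "spin_eq n (tw i @ zw) (zw @ tw i)"
      using i by (intro word_eq.sym[OF spin_eq_rel]) (auto simp: spin_rels_def)
    show ?thesis
    proof (cases b)
      case True
      then show ?thesis using t T x by (simp add: tw_def)
    next
      case False
      then have e: "spin_eq n [x] (zw @ tw i)" using spin_eq_tw_inverse[OF i] T x by simp
      have "spin_eq n ([x] @ zw) ((zw @ tw i) @ zw)"
        by (intro spin_eq_append spin_eq_refl e) simp
      moreover have "spin_eq n (zw @ (tw i @ zw)) (zw @ (zw @ tw i))"
        by (intro spin_eq_append spin_eq_refl t) simp
      moreover have "spin_eq n (zw @ (zw @ tw i)) (zw @ [x])"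
        by (intro spin_eq_append spin_eq_refl word_eq.sym[OF e]) simp
      ultimately show ?thesis by (metis append.assoc word_eq.trans)
    qed
  qed
  have "spin_eq n ([x] @ (u @ zw)) ([x] @ (zw @ u))"
    by (rule spin_eq_append[OF spin_eq_refl[OF v(1)] Cons.IH[OF v(2)]])
  moreover have "spin_eq n (([x] @ zw) @ u) ((zw @ [x]) @ u)"
    by (intro spin_eq_append letter spin_eq_refl v)
  ultimately show ?case by (auto intro: word_eq.trans)
qed

text \<open>Equality up to the central element. Tracking the exact power of z through the normal
  form is avoided: the sign is settled later by evaluation in the model, where \<open>zz\<close>
  differs from 0.\<close>

definition spin_sim :: "nat \<Rightarrow> spin_word \<Rightarrow> spin_word \<Rightarrow> bool" where
  "spin_sim n u v \<longleftrightarrow> spin_eq n u v \<or> spin_eq n u (zw @ v)"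

lemma spin_simI: "spin_eq n u v \<Longrightarrow> spin_sim n u v"
  by (simp add: spin_sim_def)

lemma spin_sim_refl: "spin_valid n u \<Longrightarrow> spin_sim n u u"
  by (simp add: spin_simI spin_eq_refl)

lemma spin_sim_valid: "spin_sim n u v \<Longrightarrow> spin_valid n u \<and> spin_valid n v"
  using spin_eq_valid by (fastforce simp: spin_sim_def)

lemma spin_eq_zw_cancel: "spin_valid n u \<Longrightarrow> spin_eq n (zw @ zw @ u) u"
  using spin_eq_append[OF spin_eq_zw_zw spin_eq_refl, of n u] by simp

lemma spin_sim_trans:
  assumes "spin_sim n u v" "spin_sim n v w"
  shows "spin_sim n u w"
proof -
  have v: "spin_valid n w" using spin_sim_valid assms by blast
  have a: "spin_eq n (zw @ x) (zw @ y)" if "spin_eq n x y" for x y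
    using that by (intro spin_eq_append spin_eq_refl) auto
  have "spin_eq n u w" if "spin_eq n u (zw @ v)" "spin_eq n v (zw @ w)"
    using word_eq.trans[OF that(1) word_eq.trans[OF a[OF that(2)] spin_eq_zw_cancel[OF v]]] .
  then show ?thesis using assms a unfolding spin_sim_def by (meson word_eq.trans)
qed

lemma spin_sim_append:
  assumes "spin_sim n u u'" "spin_sim n v v'"
  shows "spin_sim n (u @ v) (u' @ v')"
proof -
  have v: "spin_valid n u'" "spin_valid n v'" using spin_sim_valid assms by blast+
  have z: "spin_eq n (u' @ zw @ v') (zw @ u' @ v')"
    using spin_eq_append[OF spin_eq_zw_commute[OF v(1)] spin_eq_refl[OF v(2)]] by simp
  have zz: "spin_eq n (zw @ u' @ zw @ v') (u' @ v')"
    using word_eq.trans[OF spin_eq_append[OF spin_eq_refl[of n zw] z] spin_eq_zw_cancel] v by simp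
  consider "spin_eq n u u'" "spin_eq n v v'" | "spin_eq n u u'" "spin_eq n v (zw @ v')"
    | "spin_eq n u (zw @ u')" "spin_eq n v v'" | "spin_eq n u (zw @ u')" "spin_eq n v (zw @ v')"
    using assms unfolding spin_sim_def by blast
  then show ?thesis
  proof cases
    case 1
    then show ?thesis by (intro spin_simI spin_eq_append)
  next
    case 2
    then show ?thesis using word_eq.trans[OF spin_eq_append[OF 2] z] by (simp add: spin_sim_def)
  next
    case 3
    then show ?thesis using spin_eq_append[OF 3] by (simp add: spin_sim_def)
  next
    case 4
    then show ?thesis using word_eq.trans[OF spin_eq_append[OF 4]] zz by (simp add: spin_sim_def)
  qed
qed

lemma spin_sim_ctx:
  assumes "spin_sim n u v" "spin_valid n a" "spin_valid n b"
  shows "spin_sim n (a @ u @ b) (a @ v @ b)"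
  by (intro spin_sim_append spin_sim_refl assms)

lemma spin_sim_mono: "spin_sim n u v \<Longrightarrow> n \<le> m \<Longrightarrow> spin_sim m u v"
  unfolding spin_sim_def using spin_eq_mono by blast

lemma spin_valid_mono: "spin_valid n u \<Longrightarrow> n \<le> m \<Longrightarrow> spin_valid m u"
  unfolding spin_valid_def spin_gens_def by (erule subset_trans) auto

lemma spin_sim_zw: "spin_sim n zw []"
  by (simp add: spin_sim_def spin_eq_refl)

lemma spin_sim_tw_tw: "i \<in> {1..<n} \<Longrightarrow> spin_sim n (tw i @ tw i) []"
  unfolding spin_sim_def
  by (rule disjI2, rule spin_eq_rel) (auto simp: spin_rels_def)

lemma spin_sim_commute:
  assumes "i \<in> {1..<n}" "j \<in> {1..<n}" "i + 1 < j \<or> j + 1 < i"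
  shows "spin_sim n (tw j @ tw i) (tw i @ tw j)"
  unfolding spin_sim_def
proof (rule disjI2, rule spin_eq_rel)
  have "\<bar>int i - int j\<bar> > 1" using assms(3) by linarith
  then show "(tw j @ tw i, zw @ tw i @ tw j) \<in> spin_rels n"
    unfolding spin_rels_def using assms(1,2) by blast
qed (use assms in auto)

lemma spin_sim_braid:
  assumes "i \<in> {1..<n}" "i + 1 \<in> {1..<n}"
  shows "spin_sim n (tw (i+1) @ tw i @ tw (i+1)) (tw i @ tw (i+1) @ tw i)"
  by (intro spin_simI word_eq.sym[OF spin_eq_rel]) (use assms in \<open>auto simp: spin_rels_def\<close>)

definition tws :: "nat list \<Rightarrow> spin_word" where
  "tws l = concat (map tw l)"

lemma tws_simps [simp]: "tws [] = []" "tws (i # l) = tw i @ tws l" "tws (l @ l') = tws l @ tws l'"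
  by (simp_all add: tws_def)

lemma spin_valid_tws [simp]: "spin_valid n (tws l) \<longleftrightarrow> set l \<subseteq> {1..<n}"
  by (induction l) auto

lemma spin_sim_tws_commute:
  assumes "i \<in> {1..<n}" "set l \<subseteq> {1..<n}" "\<And>j. j \<in> set l \<Longrightarrow> i + 1 < j \<or> j + 1 < i"
  shows "spin_sim n (tws l @ tw i) (tw i @ tws l)"
  using assms(2,3)
proof (induction l)
  case Nil
  then show ?case using assms(1) by (simp add: spin_sim_refl)
next
  case (Cons j l)
  have "spin_sim n (tw j @ (tws l @ tw i)) (tw j @ (tw i @ tws l))"
    by (rule spin_sim_append[OF spin_sim_refl Cons.IH]) (use Cons.prems in auto)
  moreover have "spin_sim n ((tw j @ tw i) @ tws l) ((tw i @ tw j) @ tws l)"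
    using Cons.prems assms(1) by (intro spin_sim_append spin_sim_refl spin_sim_commute) auto
  ultimately show ?case by (auto intro: spin_sim_trans)
qed

text \<open>Coset representatives \<open>t\<^sub>n t\<^sub>n\<^sub>-\<^sub>1 \<dots> t\<^sub>k\<close> for \<open>spin_group n\<close> in \<open>spin_group (n + 1)\<close>.\<close>
definition desc :: "nat \<Rightarrow> nat \<Rightarrow> spin_word" where
  "desc n k = tws (rev [k..<n + 1])"

lemma desc_rec: "k \<le> n \<Longrightarrow> desc n k = desc n (k + 1) @ tw k"
  using upt_conv_Cons[of k "n + 1"] by (simp add: desc_def del: upt_Suc)

text \<open>Right multiplication by t_i lengthens the representative if i = k - 1 and shortens it if
  i = k. Otherwise a generator of the smaller group comes out on the left: t_i itself if i < k - 1,
  and t_(i-1) if i > k.\<close>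

lemma desc_tw:
  assumes "1 \<le> k" "k \<le> n + 1" "1 \<le> i" "i \<le> n"
  shows "\<exists>u k'. spin_valid n u \<and> 1 \<le> k' \<and> k' \<le> n + 1 \<and> spin_sim (n + 1) (desc n k @ tw i) (u @ desc n k')"
proof -
  consider "i + 1 = k" | "i = k" | "i + 1 < k" | "k < i" by linarith
  then show ?thesis
  proof cases
    case 1
    have "desc n k @ tw i = desc n i"
      using 1 assms desc_rec[of i n] by simp
    then have "spin_sim (n + 1) (desc n k @ tw i) ([] @ desc n i)"
      using assms by (auto intro!: spin_sim_refl simp: desc_def)
    then show ?thesis using assms by (intro exI[of _ "[]"] exI[of _ i]) simp
  next
    case 2
    have d: "desc n k = desc n (k + 1) @ tw k"
      using 2 assms by (intro desc_rec) simp
    have "spin_sim (n + 1) (desc n (k + 1) @ (tw k @ tw k)) (desc n (k + 1) @ [])"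
      using 2 assms by (intro spin_sim_append spin_sim_refl spin_sim_tw_tw) (auto simp: desc_def)
    then have "spin_sim (n + 1) (desc n k @ tw i) ([] @ desc n (k + 1))"
      using 2 by (simp add: d)
    moreover have "k + 1 \<le> n + 1" using 2 assms by simp
    ultimately show ?thesis by (intro exI[of _ "[]"] exI[of _ "k + 1"]) simp
  next
    case 3
    have "spin_sim (n + 1) (desc n k @ tw i) (tw i @ desc n k)"
      unfolding desc_def using 3 assms by (intro spin_sim_tws_commute) auto
    moreover have "spin_valid n (tw i)" using 3 assms by simp
    ultimately show ?thesis using assms by (intro exI[of _ "tw i"] exI[of _ k]) simp
  next
    case 4
    \<comment> \<open>With j = i - 1 the representative is cut as A t_i t_j B. The new t_i commutes
      past B, a braid move turns t_i t_j t_i into t_j t_i t_j, and the leading t_j commutes past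
      A.\<close>
    define A where "A = tws (rev [i + 1..<n + 1])"
    define B where "B = tws (rev [k..<i - 1])"
    obtain j where j: "i = Suc j" using 4 by (cases i) auto
    have "[k..<n + 1] = [k..<i - 1] @ [j, i] @ [i + 1..<n + 1]"
    proof -
      have "[k..<n + 1] = [k..<j] @ [j..<n + 1]"
        using 4 j assms upt_add_eq_append[of k j "n + 1 - j"] by (simp del: upt_Suc)
      also have "[j..<n + 1] = [j, i] @ [i + 1..<n + 1]"
        using 4 j assms upt_conv_Cons[of j "n + 1"] upt_conv_Cons[of i "n + 1"] by (simp del: upt_Suc)
      finally show ?thesis by (simp add: j del: upt_Suc)
    qed
    then have d: "desc n k = A @ tw i @ tw j @ B"
      by (simp add: desc_def A_def B_def del: upt_Suc)
    have vA: "spin_valid (n + 1) A" and vB: "spin_valid (n + 1) B"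
      using 4 assms by (auto simp: A_def B_def)
    have vt: "spin_valid (n + 1) (tw i)" "spin_valid (n + 1) (tw j)" using 4 assms j by auto
    have 1: "spin_sim (n + 1) ((A @ tw i @ tw j) @ (B @ tw i)) ((A @ tw i @ tw j) @ (tw i @ B))"
      unfolding B_def using 4 assms vA vt by (intro spin_sim_append spin_sim_refl spin_sim_tws_commute) auto
    have "spin_sim (n + 1) (tw i @ tw j @ tw i) (tw j @ tw i @ tw j)"
      using spin_sim_braid[of j "n + 1"] 4 assms j by simp
    then have 2: "spin_sim (n + 1) (A @ (tw i @ tw j @ tw i) @ B) (A @ (tw j @ tw i @ tw j) @ B)"
      by (intro spin_sim_ctx vA vB)
    have 3: "spin_sim (n + 1) ((A @ tw j) @ (tw i @ tw j @ B)) ((tw j @ A) @ (tw i @ tw j @ B))"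
      unfolding A_def using 4 assms vB vt j by (intro spin_sim_append spin_sim_refl spin_sim_tws_commute) auto
    have "spin_sim (n + 1) (desc n k @ tw i) (tw j @ desc n k)"
      using spin_sim_trans[OF _ spin_sim_trans[OF _ 3]] 1 2 d by simp
    moreover have "spin_valid n (tw j)" using 4 assms j by simp
    ultimately show ?thesis using assms by (intro exI[of _ "tw j"] exI[of _ k]) simp
  qed
qed

lemma spin_normal_form:
  assumes "spin_valid (n + 1) u"
  shows "\<exists>u0 k. spin_valid n u0 \<and> 1 \<le> k \<and> k \<le> n + 1 \<and> spin_sim (n + 1) u (u0 @ desc n k)"
  using assms
proof (induction u rule: rev_induct)
  case Nil
  have "spin_sim (n + 1) [] ([] @ desc n (n + 1))" by (simp add: desc_def spin_sim_refl)
  then show ?case by (intro exI[of _ "[]"] exI[of _ "n + 1"]) simp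
next
  case (snoc x u)
  then obtain u0 k where u0: "spin_valid n u0" "1 \<le> k" "k \<le> n + 1" "spin_sim (n + 1) u (u0 @ desc n k)"
    by auto
  have vx: "spin_valid (n + 1) [x]" using snoc.prems by simp
  have s: "spin_sim (n + 1) (u @ [x]) ((u0 @ desc n k) @ [x])"
    by (intro spin_sim_append u0 spin_sim_refl vx)
  obtain g b where x: "x = (g, b)" by (cases x)
  show ?case
  proof (cases g)
    case Z
    then have "spin_sim (n + 1) [x] []"
      using spin_sim_zw[of "n + 1"] spin_sim_trans[OF spin_simI[OF spin_eq_zw_inverse] spin_sim_zw, of "n + 1"] x
      by (cases b) (auto simp: zw_def)
    then have "spin_sim (n + 1) ((u0 @ desc n k) @ [x]) ((u0 @ desc n k) @ [])"
      using u0 spin_sim_valid by (intro spin_sim_append spin_sim_refl) blast+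
    then have "spin_sim (n + 1) (u @ [x]) (u0 @ desc n k)" using spin_sim_trans[OF s] by simp
    then show ?thesis using u0 by (intro exI[of _ u0] exI[of _ k]) simp
  next
    case (T i)
    then have i: "1 \<le> i" "i \<le> n" using vx x by (auto simp: spin_valid_def spin_gens_def)
    have x': "spin_sim (n + 1) [x] (tw i)"
    proof (cases b)
      case True
      then show ?thesis using vx x T by (simp add: tw_def spin_sim_refl)
    next
      case False
      then show ?thesis using spin_eq_tw_inverse[of i "n + 1"] i x T by (simp add: spin_sim_def)
    qed
    obtain v k' where v: "spin_valid n v" "1 \<le> k'" "k' \<le> n + 1"
        "spin_sim (n + 1) (desc n k @ tw i) (v @ desc n k')"
      using desc_tw[OF u0(2,3) i] by blast
    have vu: "spin_valid (n + 1) u0" "spin_valid (n + 1) (u0 @ desc n k)"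
      using u0(4) spin_sim_valid by fastforce+
    have 1: "spin_sim (n + 1) ((u0 @ desc n k) @ [x]) ((u0 @ desc n k) @ tw i)"
      by (intro spin_sim_append spin_sim_refl vu x')
    have "spin_sim (n + 1) (u0 @ (desc n k @ tw i)) (u0 @ (v @ desc n k'))"
      by (intro spin_sim_append spin_sim_refl vu v)
    then have "spin_sim (n + 1) (u @ [x]) ((u0 @ v) @ desc n k')"
      using spin_sim_trans[OF spin_sim_trans[OF s 1]] by simp
    then show ?thesis using u0 v by (intro exI[of _ "u0 @ v"] exI[of _ k']) simp
  qed
qed

section \<open>Evaluation of words in the model: kernel and image\<close>

fun sp_gen :: "spin_gen \<Rightarrow> sp" where
  "sp_gen (T i) = tt (i + 1) i"
| "sp_gen Z = zz"

definition ev :: "spin_word \<Rightarrow> sp" where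
  "ev u = sum_list (map (\<lambda>(g, b). if b then sp_gen g else - sp_gen g) u)"

lemma ev_simps [simp]: "ev [] = 0" "ev (u @ v) = ev u + ev v"
  "ev ((g, b) # u) = (if b then sp_gen g else - sp_gen g) + ev u"
  by (simp_all add: ev_def)

lemma ev_tw [simp]: "ev (tw i) = tt (i + 1) i" by (simp add: tw_def)
lemma ev_zw [simp]: "ev zw = zz" by (simp add: zw_def)

lemma tt_braid:
  assumes "i \<noteq> j" "i \<noteq> k" "j \<noteq> k"
  shows "tt k j + tt j i + tt k j = tt k i" "tt j i + tt k j + tt j i = tt k i"
proof -
  have "tt k j + tt j i + tt k j = zz + tt k i + (tt k j + tt k j)"
    using add_tt[of j i "tt k j"] assms by (simp add: add.assoc)
  then show "tt k j + tt j i + tt k j = tt k i" using assms by (simp add: tt_tt add.assoc)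
  have "tt j i + tt k j + tt j i = zz + tt k i + (tt j i + tt j i)"
    using add_tt[of k j "tt j i"] assms by (simp add: add.assoc)
  then show "tt j i + tt k j + tt j i = tt k i" using assms by (simp add: tt_tt add.assoc)
qed

lemma ev_spin_eq:
  assumes "spin_eq n u v"
  shows "ev u = ev v"
  using assms
proof (induction rule: word_eq.induct)
  case (relation u v)
  have c: "tt (j + 1) j + tt (i + 1) i = zz + (tt (i + 1) i + tt (j + 1) j)" if "\<bar>int i - int j\<bar> > 1" for i j
    using that add_tt[of "i + 1" i "tt (j + 1) j"] by (simp add: add.assoc)
  from relation(1) show ?case unfolding spin_rels_def
  proof (elim UnE)
    assume "(u, v) \<in> {(tw i @ tw (i + 1) @ tw i, tw (i + 1) @ tw i @ tw (i + 1)) |i. i \<in> {1..<n} \<and> i + 1 \<in> {1..<n}}"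
    then obtain i where "u = tw i @ tw (i + 1) @ tw i" "v = tw (i + 1) @ tw i @ tw (i + 1)" by blast
    then show ?thesis using tt_braid[of i "i + 1" "i + 2"] by (simp add: add.assoc)
  next
    assume "(u, v) \<in> {(tw j @ tw i, zw @ tw i @ tw j) |i j. i \<in> {1..<n} \<and> j \<in> {1..<n} \<and> 1 < \<bar>int i - int j\<bar>}"
    then obtain i j where "u = tw j @ tw i" "v = zw @ tw i @ tw j" "1 < \<bar>int i - int j\<bar>" by blast
    then show ?thesis using c[of i j] by simp
  qed (auto simp: tt_tt)
qed simp_all

lemma act_ev_spin_sim: "spin_sim n u v \<Longrightarrow> act (ev u) = act (ev v)"
  unfolding spin_sim_def using ev_spin_eq by fastforce

lemma act_ev_outside:
  assumes "spin_valid n u" "x \<notin> {1..n}"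
  shows "act (ev u) x = x"
  using assms(1)
proof (induction u)
  case (Cons y u)
  then have "spin_valid n [y]" "spin_valid n u" using spin_valid_Cons by blast+
  moreover obtain g b where "y = (g, b)" by (cases y)
  moreover have "act (- tt (i + 1) i) = transpose (i + 1) i" for i
    by (simp add: uminus_tt fun_eq_iff)
  ultimately show ?case using Cons.IH assms(2)
    by (cases g) (auto simp: spin_valid_def spin_gens_def transpose_def)
qed simp

lemma act_ev_desc: "k \<le> n + 1 \<Longrightarrow> act (ev (desc n k)) k = n + 1"
proof (induction "n + 1 - k" arbitrary: k)
  case 0
  then show ?case by (simp add: desc_def)
next
  case (Suc d)
  then have "desc n k = desc n (k + 1) @ tw k" by (intro desc_rec) simp
  moreover have "act (ev (desc n (k + 1))) (k + 1) = n + 1" using Suc(1)[of "k + 1"] Suc(2,3) by simp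
  ultimately show ?case by simp
qed

text \<open>The coset index k is the point sent to n + 1, because \<open>desc n k\<close> sends k
  there and words of the smaller group fix n + 1. If the permutation fixes n + 1, the representative
  is therefore empty.\<close>

lemma spin_normal_form_fix:
  assumes "spin_valid (n + 1) u" "act (ev u) (n + 1) = n + 1"
  shows "\<exists>u0. spin_valid n u0 \<and> spin_sim (n + 1) u u0"
proof -
  obtain u0 k where u0: "spin_valid n u0" "1 \<le> k" "k \<le> n + 1" "spin_sim (n + 1) u (u0 @ desc n k)"
    using spin_normal_form[OF assms(1)] by blast
  have "act (ev u) k = act (ev u0) (act (ev (desc n k)) k)"
    using act_ev_spin_sim[OF u0(4)] by simp
  also have "\<dots> = n + 1" using act_ev_desc[OF u0(3)] act_ev_outside[OF u0(1)] by simp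
  finally have "k = n + 1" using assms(2) by (metis act_eq_iff)
  then show ?thesis using u0 by (auto simp: desc_def)
qed

text \<open>The identity fixes n + 1, so the word descends to the smaller group; at n = 0 only
  letters z are left. This is the bound 2 n! on the order of the presented group.\<close>

lemma spin_kernel:
  assumes "spin_valid n u" "act (ev u) = id"
  shows "spin_sim n u []"
  using assms
proof (induction n arbitrary: u)
  case 0
  have "spin_sim 0 u []" if "spin_valid 0 u" for u
    using that
  proof (induction u)
    case (Cons x u)
    have v: "spin_valid 0 [x]" "spin_valid 0 u" using Cons.prems spin_valid_Cons by blast+
    obtain g b where x: "x = (g, b)" by (cases x)
    have "g = Z" using v(1) x by (auto simp: spin_valid_def spin_gens_def)
    then have "spin_sim 0 [x] []"
      using spin_sim_zw[of 0] spin_sim_trans[OF spin_simI[OF spin_eq_zw_inverse] spin_sim_zw, of 0] x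
      by (cases b) (auto simp: zw_def)
    then show ?case using spin_sim_append[OF _ Cons.IH[OF v(2)], of "[x]" "[]"] by simp
  qed (simp add: spin_sim_refl)
  then show ?case using 0 by blast
next
  case (Suc n)
  then obtain u0 where u0: "spin_valid n u0" "spin_sim (n + 1) u u0"
    using spin_normal_form_fix[of n u] by auto
  have "act (ev u0) = id" using HOL.trans[OF HOL.sym[OF act_ev_spin_sim[OF u0(2)]] Suc.prems(2)] .
  then have "spin_sim (n + 1) u0 []" using Suc.IH[OF u0(1)] spin_sim_mono by simp
  then show ?case using spin_sim_trans[OF u0(2)] by simp
qed

text \<open>Generators are removed from the top, one point at a time; the sign that
  \<open>spin_sim\<close> forgets is put back by prefixing \<open>zw\<close>.\<close>

lemma ev_surj_aux:
  assumes "spin_valid N u" "\<And>x. n < x \<Longrightarrow> act (ev u) x = x"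
  shows "\<exists>v. spin_valid n v \<and> ev v = ev u"
  using assms
proof (induction N arbitrary: u)
  case 0
  then show ?case using spin_valid_mono by blast
next
  case (Suc N)
  show ?case
  proof (cases "Suc N \<le> n")
    case True
    then show ?thesis using Suc.prems(1) spin_valid_mono by blast
  next
    case False
    then obtain u0 where u0: "spin_valid N u0" "spin_sim (N + 1) u u0"
      using spin_normal_form_fix[of N u] Suc.prems by auto
    obtain u1 where u1: "spin_valid N u1" "ev u1 = ev u"
    proof (cases "spin_eq (N + 1) u u0")
      case True
      then show ?thesis using that[OF u0(1)] ev_spin_eq by simp
    next
      case False
      then have "spin_eq (N + 1) u (zw @ u0)" using u0(2) by (simp add: spin_sim_def)
      then show ?thesis using that[of "zw @ u0"] ev_spin_eq u0(1) by fastforce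
    qed
    then show ?thesis using Suc.IH[OF u1(1)] Suc.prems(2) by auto
  qed
qed

definition Gn :: "nat \<Rightarrow> sp set" where
  "Gn n = {a. \<forall>x. x \<notin> {1..n} \<longrightarrow> act a x = x}"

lemma tt_eq_ev:
  assumes "1 \<le> i" "1 \<le> j" "i \<noteq> j"
  shows "\<exists>N u. spin_valid N u \<and> ev u = tt i j"
proof -
  have 1: "\<exists>N u. spin_valid N u \<and> ev u = tt (i + Suc d) i" if "1 \<le> i" for i d
  proof (induction d)
    case 0
    have "spin_valid (i + 2) (tw i)" using that by simp
    then show ?case by (intro exI[of _ "i + 2"] exI[of _ "tw i"]) simp
  next
    case (Suc d)
    then obtain N u where u: "spin_valid N u" "ev u = tt (i + Suc d) i" by blast
    let ?j = "i + Suc d"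
    have "spin_valid (N + ?j + 2) (tw ?j @ u @ tw ?j)" using spin_valid_mono[OF u(1)] by simp
    moreover have "ev (tw ?j @ u @ tw ?j) = tt (i + Suc (Suc d)) i"
      using u(2) tt_braid(1)[of i ?j "?j + 1"] by (simp add: add.assoc)
    ultimately show ?case by blast
  qed
  show ?thesis
  proof (cases "i < j")
    case False
    then have "j + Suc (i - j - 1) = i" using assms(3) by simp
    then show ?thesis using 1[OF assms(2), of "i - j - 1"] by metis
  next
    case True
    then have "i + Suc (j - i - 1) = j" by simp
    then obtain N u where "spin_valid N u" "ev u = tt j i" using 1[OF assms(1), of "j - i - 1"] by metis
    then have "spin_valid N (zw @ u)" "ev (zw @ u) = tt i j" using tt_swap[of j i] assms(3) by auto
    then show ?thesis by blast
  qed
qed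

text \<open>An element of the model may be written with the point 0, which no generator moves.
  Conjugation by \<open>tt 0 M\<close>, with M beyond all points in use, renames 0 to M and leaves
  transpositions of positive points, which are words.\<close>

lemma tt0_conj_ev: "\<exists>M0. \<forall>M\<ge>M0. \<exists>N u. spin_valid N u \<and> tt 0 M + a = ev u + tt 0 M"
proof (induction a rule: sp_induct)
  case zero
  then show ?case using spin_valid_Nil by (metis add.left_neutral add.right_neutral ev_simps(1))
next
  case (tt i j a)
  then obtain M0 where M0: "\<And>M. M \<ge> M0 \<Longrightarrow> \<exists>N u. spin_valid N u \<and> tt 0 M + a = ev u + tt 0 M" by blast
  show ?case
  proof (rule exI[of _ "M0 + i + j + 1"], intro allI impI)
    fix M assume M: "M \<ge> M0 + i + j + 1"
    then obtain N u where u: "spin_valid N u" "tt 0 M + a = ev u + tt 0 M" using M0[of M] by auto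
    let ?i = "transpose 0 M i" and ?j = "transpose 0 M j"
    have "?i \<noteq> ?j" "1 \<le> ?i" "1 \<le> ?j" using tt(1) M by (auto simp: transpose_def)
    then obtain N' w where w: "spin_valid N' w" "ev w = tt ?i ?j" using tt_eq_ev by blast
    have "tt 0 M + (tt i j + a) = zz + (tt ?i ?j + (tt 0 M + a))"
      using add_tt[OF tt(1), of "tt 0 M"] M by (simp flip: add.assoc)
    also have "\<dots> = ev (zw @ w @ u) + tt 0 M" using u w by (simp add: add.assoc)
    finally have "tt 0 M + (tt i j + a) = ev (zw @ w @ u) + tt 0 M" .
    moreover have "spin_valid (max N N') (zw @ w @ u)"
      using spin_valid_mono u(1) w(1) by simp
    ultimately show "\<exists>N u. spin_valid N u \<and> tt 0 M + (tt i j + a) = ev u + tt 0 M" by blast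
  qed
qed

text \<open>This undoes the renaming: disjoint transpositions anticommute, so only the parity of the
  word leaves a trace.\<close>

lemma tt0_ev_commute:
  assumes "spin_valid n v" "n < M"
  shows "tt 0 M + ev v = zs (odd_sp (ev v)) + ev v + tt 0 M"
  using assms(1)
proof (induction v)
  case (Cons x v)
  have vx: "spin_valid n [x]" "spin_valid n v" using Cons.prems spin_valid_Cons by blast+
  obtain g b where x: "x = (g, b)" by (cases x)
  show ?case
  proof (cases g)
    case Z
    then show ?thesis using Cons.IH[OF vx(2)] x by (simp add: add.assoc zs_left_commute)
  next
    case (T i)
    then have i: "1 \<le> i" "i < n" using vx x by (auto simp: spin_valid_def spin_gens_def)
    have t: "tt 0 M + (tt (i + 1) i + ev v) = zz + (tt (i + 1) i + (tt 0 M + ev v))"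
      using add_tt[of "i + 1" i "tt 0 M"] i assms(2) by (simp flip: add.assoc)
    show ?thesis using Cons.IH[OF vx(2)] x T t
      by (cases b; cases "odd_sp (ev v)") (simp_all add: add.assoc uminus_tt)
  qed
qed simp

text \<open>Rename 0 by conjugation with \<open>tt 0 M\<close>, drop the generators that the
  permutation does not require, and rename back. Since M > n, renaming back costs only a sign, which
  \<open>zw\<close> absorbs.\<close>

lemma ev_surj:
  assumes "a \<in> Gn n"
  shows "\<exists>v. spin_valid n v \<and> ev v = a"
proof -
  obtain M0 where M0: "\<And>M. M \<ge> M0 \<Longrightarrow> \<exists>N u. spin_valid N u \<and> tt 0 M + a = ev u + tt 0 M"
    using tt0_conj_ev by blast
  have "M0 \<le> M0 + n + 1" by simp
  from M0[OF this] obtain N u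
    where u: "spin_valid N u" "tt 0 (M0 + n + 1) + a = ev u + tt 0 (M0 + n + 1)"
    by blast
  define M where "M = M0 + n + 1"
  have a: "act a x = x" if "x \<notin> {1..n}" for x using that assms by (simp add: Gn_def)
  have "act (ev u) x = x" if "n < x" for x
  proof -
    have "act (tt 0 M + a) (transpose 0 M x) = act (ev u + tt 0 M) (transpose 0 M x)"
      using u(2) M_def by simp
    moreover have "transpose 0 M x \<notin> {1..n}" using that by (auto simp: M_def transpose_def)
    ultimately show ?thesis using a by simp
  qed
  then obtain v where v: "spin_valid n v" "ev v = ev u" using ev_surj_aux[OF u(1)] by blast
  have "tt 0 M + a = ev v + tt 0 M" using u(2) v(2) by (simp add: M_def)
  also have "\<dots> = zs (odd_sp (ev v)) + (zs (odd_sp (ev v)) + ev v + tt 0 M)"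
    by (simp add: add.assoc zs_zs_add)
  also have "\<dots> = zs (odd_sp (ev v)) + (tt 0 M + ev v)"
    using tt0_ev_commute[OF v(1), of M] by (simp add: M_def)
  also have "\<dots> = tt 0 M + (zs (odd_sp (ev v)) + ev v)" by simp
  finally have "a = zs (odd_sp (ev v)) + ev v" by (simp only: add_left_cancel)
  then have "a = ev (if odd_sp (ev v) then zw @ v else v)" by (simp add: zs_def)
  moreover have "spin_valid n (if odd_sp (ev v) then zw @ v else v)" using v by simp
  ultimately show ?thesis by metis
qed

text \<open>The case n = 0 of surjectivity does the work: an element over the identity lies in
  \<open>Gn 0\<close> and hence comes from a word in z alone.\<close>

lemma act_eq_id: "act a = id \<Longrightarrow> a = 0 \<or> a = zz"
proof -
  assume a: "act a = id"
  then obtain v where v: "spin_valid 0 v" "ev v = a" using ev_surj[of a 0] by (auto simp: Gn_def)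
  then have "spin_sim 0 v []" using spin_kernel a by simp
  then show ?thesis using v(2) ev_spin_eq[of 0] by (fastforce simp: spin_sim_def)
qed

lemma act_eq: "act a = act b \<Longrightarrow> a = b \<or> a = zz + b"
proof -
  assume e: "act a = act b"
  have "act (a + - b) = act (b + - b)" by (simp only: act_add e)
  also have "b + - b = 0" by simp
  finally have "act (a - b) = id" unfolding act_0 by (simp only: add_uminus_conv_diff)
  then have "a - b = 0 \<or> a - b = zz" by (rule act_eq_id)
  then show ?thesis by (auto simp: algebra_simps)
qed

lifting_forget sp.lifting

section \<open>The spin group algebra\<close>

definition zeta :: "sp \<Rightarrow>\<^sub>0 int" where
  "zeta = 1 - Poly_Mapping.single zz 1"

lemma single_one_induct [case_names zero add diff]:
  fixes f :: "'a \<Rightarrow>\<^sub>0 int"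
  assumes "P 0" and "\<And>f a. P f \<Longrightarrow> P (f + Poly_Mapping.single a 1)"
    and "\<And>f a. P f \<Longrightarrow> P (f - Poly_Mapping.single a 1)"
  shows "P f"
proof -
  have "P (f + Poly_Mapping.single a k)" if "P f" for f a and k :: int
  proof (induction k rule: int_induct[where k = 0])
    case base
    then show ?case using that by simp
  next
    case (step1 i)
    then show ?case using assms(2)[of "f + Poly_Mapping.single a i" a]
      by (simp add: single_add add.assoc)
  next
    case (step2 i)
    then show ?case using assms(3)[of "f + Poly_Mapping.single a i" a]
      by (simp add: single_diff add_diff_eq)
  qed
  note single = this
  show ?thesis
  proof (induction f rule: update_induct)
    case const
    then show ?case by (rule assms(1))
  next
    case (update f a b)
    have "Poly_Mapping.update a b f = f + Poly_Mapping.single a b"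
      by (rule poly_mapping_eqI) (use update in \<open>auto simp: lookup_update lookup_add lookup_single in_keys_iff when_def\<close>)
    then show ?case using single[OF update(3)] by simp
  qed
qed

lemma single_zz_commute: "Poly_Mapping.single zz 1 * f = f * Poly_Mapping.single zz (1 :: int)"
  by (induction f rule: single_one_induct) (simp_all add: algebra_simps mult_single zz_commute)

lemma zeta_commute: "zeta * f = f * zeta"
  by (simp add: zeta_def algebra_simps single_zz_commute)

text \<open>\<open>f\<close> and \<open>g\<close> agree modulo the ideal generated by \<open>zz + 1\<close> iff \<open>(1 - zz) f = (1 - zz) g\<close>,
  the annihilator of \<open>1 - zz\<close> being that ideal.\<close>
quotient_type salg = "sp \<Rightarrow>\<^sub>0 int" / "\<lambda>f g. zeta * f = zeta * g"
  by (auto intro!: equivpI reflpI sympI transpI)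

instantiation salg :: ring_1
begin

lift_definition zero_salg :: salg is 0 .
lift_definition one_salg :: salg is 1 .
lift_definition plus_salg :: "salg \<Rightarrow> salg \<Rightarrow> salg" is "(+)" by (simp add: distrib_left)
lift_definition minus_salg :: "salg \<Rightarrow> salg \<Rightarrow> salg" is "(-)" by (simp add: right_diff_distrib)
lift_definition uminus_salg :: "salg \<Rightarrow> salg" is uminus by simp
lift_definition times_salg :: "salg \<Rightarrow> salg \<Rightarrow> salg" is "(*)"
proof -
  fix f f' g g' :: "sp \<Rightarrow>\<^sub>0 int"
  assume f: "zeta * f = zeta * f'" and g: "zeta * g = zeta * g'"
  have "zeta * (f * g) = f' * (zeta * g)" using f by (metis mult.assoc zeta_commute)
  also have "\<dots> = zeta * (f' * g')" using g by (metis mult.assoc zeta_commute)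
  finally show "zeta * (f * g) = zeta * (f' * g')" .
qed

instance
proof
  have "Poly_Mapping.lookup (zeta * 0) 0 \<noteq> Poly_Mapping.lookup (zeta * 1) 0"
    by (simp add: zeta_def lookup_minus lookup_single lookup_one)
  then have "zeta * 0 \<noteq> zeta * 1" by (rule contrapos_nn) (simp only:)
  then show "(0 :: salg) \<noteq> 1" by transfer
  fix a b c :: salg
  show "a + b + c = a + (b + c)" by transfer (simp add: add.assoc)
  show "a + b = b + a" by transfer (simp add: add.commute)
  show "0 + a = a" by transfer simp
  show "- a + a = 0" by transfer simp
  show "a - b = a + - b" by transfer simp
  show "a * b * c = a * (b * c)" by transfer (simp add: mult.assoc)
  show "1 * a = a" by transfer simp
  show "a * 1 = a" by transfer simp
  show "(a + b) * c = a * c + b * c" by transfer (simp add: distrib_right)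
  show "a * (b + c) = a * b + a * c" by transfer (simp add: distrib_left)
qed

end

lift_definition el :: "sp \<Rightarrow> salg" is "\<lambda>a. Poly_Mapping.single a 1" .

text \<open>This is the coefficient at a minus the coefficient at \<open>zz + a\<close>. It is well
  defined because the quotient compares elements after multiplication by \<open>zeta\<close>, and it
  is odd under passing from a to \<open>zz + a\<close>.\<close>

lift_definition co :: "sp \<Rightarrow> salg \<Rightarrow> int" is "\<lambda>a f. Poly_Mapping.lookup (zeta * f) a"
  by simp

lemma salg_eqI: "(\<And>a. co a x = co a y) \<Longrightarrow> x = y"
  by transfer (simp add: poly_mapping_eqI)

lemma el_0 [simp]: "el 0 = 1" by transfer simp
lemma el_add: "el (a + b) = el a * el b" by transfer (simp add: mult_single)
lemma el_zz_add [simp]: "el (zz + a) = - el a"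
proof transfer
  fix a
  have "zeta * Poly_Mapping.single (zz + a) 1 + zeta * Poly_Mapping.single a 1 = (0 :: sp \<Rightarrow>\<^sub>0 int)"
    by (simp add: zeta_def algebra_simps mult_single)
  then show "zeta * Poly_Mapping.single (zz + a) 1 = zeta * - Poly_Mapping.single a 1"
    by (simp add: eq_neg_iff_add_eq_0)
qed
lemma el_zz [simp]: "el zz = - 1" using el_zz_add[of 0] by simp

lemma co_0 [simp]: "co a 0 = 0" by transfer simp
lemma co_add [simp]: "co a (x + y) = co a x + co a y" by transfer (simp add: distrib_left lookup_add)
lemma co_minus [simp]: "co a (- x) = - co a x" by transfer simp
lemma co_diff [simp]: "co a (x - y) = co a x - co a y" by transfer (simp add: right_diff_distrib lookup_minus)

lemma neq_zz_add [simp]: "a \<noteq> zz + a"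
  using zz_add_neq[of a] by metis

lemma co_el: "co a (el b) = (if b = a then 1 else if zz + b = a then - 1 else 0)"
proof transfer
  fix a b
  have "zeta * Poly_Mapping.single b 1 = Poly_Mapping.single b 1 - Poly_Mapping.single (zz + b) (1 :: int)"
    by (simp add: zeta_def left_diff_distrib mult_single)
  then show "Poly_Mapping.lookup (zeta * Poly_Mapping.single b 1) a =
      (if b = a then 1 else if zz + b = a then - 1 else 0)"
    by (simp add: lookup_minus lookup_single when_def)
qed

lemma co_sum: "co a (sum f A) = (\<Sum>x\<in>A. co a (f x))"
  by (induction A rule: infinite_finite_induct) simp_all

lemma of_int_commute: "of_int k * x = x * (of_int k :: 'a :: ring_1)"
  by (rule mult_of_int_commute)

lemma co_of_int [simp]: "co a (of_int k * x) = k * co a x"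
  by (induction k rule: int_induct[where k = 0]) (simp_all add: algebra_simps)

text \<open>Addition steps suffice, since subtracting \<open>el a\<close> is the same as adding
  \<open>el (zz + a)\<close>.\<close>

lemma salg_induct [case_names zero add]:
  assumes "P 0" and "\<And>x a. P x \<Longrightarrow> P (x + el a)"
  shows "P x"
proof -
  have "P (abs_salg f)" for f
  proof (induction f rule: single_one_induct)
    case zero
    then show ?case using assms(1) by (simp add: zero_salg_def)
  next
    case (add f a)
    then show ?case using assms(2)[of "abs_salg f" a] by (simp add: plus_salg.abs_eq el.abs_eq)
  next
    case (diff f a)
    have "abs_salg f + el (zz + a) = abs_salg f - el a" by simp
    then show ?case using assms(2)[OF diff, of "zz + a"] by (simp add: minus_salg.abs_eq el.abs_eq)
  qed
  then show ?thesis by (metis Quotient_abs_rep Quotient_salg)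
qed

lemma co_zz_add: "co (zz + a) x = - co a x"
  by (induction x rule: salg_induct) (auto simp: co_el)

lemma co_add_el: "co a (el b * x) = co (- b + a) x"
proof (induction x rule: salg_induct)
  case (add x c)
  have 1: "b + d = a \<longleftrightarrow> d = - b + a" for d
    by (metis add_minus_cancel minus_add_cancel)
  have "b + (zz + c) = zz + (b + c)" by (rule zz_left_commute)
  then have "b + c = a \<longleftrightarrow> c = - b + a" "zz + (b + c) = a \<longleftrightarrow> zz + c = - b + a"
    using 1[of c] 1[of "zz + c"] by simp_all
  then show ?case using add by (simp add: distrib_left co_el flip: el_add)
qed simp

lemma co_el_add: "co a (x * el b) = co (a - b) x"
proof (induction x rule: salg_induct)
  case (add x c)
  have 1: "d + b = a \<longleftrightarrow> d = a - b" for d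
    by (rule eq_diff_eq[symmetric])
  have "c + b = a \<longleftrightarrow> c = a - b" "zz + (c + b) = a \<longleftrightarrow> zz + c = a - b"
    using 1[of c] 1[of "zz + c"] by (simp_all only: add.assoc)
  then show ?case using add by (simp add: distrib_right co_el flip: el_add)
qed simp

lemma co_conj: "co (b + a - b) (el b * x * el (- b)) = co a x"
  by (simp add: co_el_add co_add_el add.assoc[symmetric])

definition supp_salg :: "salg \<Rightarrow> sp set" where
  "supp_salg x = {a. co a x \<noteq> 0}"

lemma supp_salg_add: "supp_salg (x + y) \<subseteq> supp_salg x \<union> supp_salg y"
  by (auto simp: supp_salg_def)

lemma supp_salg_0 [simp]: "supp_salg 0 = {}" by (simp add: supp_salg_def)
lemma supp_salg_minus [simp]: "supp_salg (- x) = supp_salg x" by (simp add: supp_salg_def)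
lemma supp_salg_of_int: "supp_salg (of_int k * x) \<subseteq> supp_salg x" by (auto simp: supp_salg_def)

lemma supp_salg_el: "supp_salg (el a) = {a, zz + a}"
  by (auto simp: supp_salg_def co_el)

lemma supp_salg_sum: "supp_salg (sum f A) \<subseteq> (\<Union>x\<in>A. supp_salg (f x))"
proof
  fix a assume "a \<in> supp_salg (sum f A)"
  then have "(\<Sum>x\<in>A. co a (f x)) \<noteq> 0" by (simp add: supp_salg_def co_sum)
  then obtain x where "x \<in> A" "co a (f x) \<noteq> 0" by (meson sum.neutral)
  then show "a \<in> (\<Union>x\<in>A. supp_salg (f x))" by (auto simp: supp_salg_def)
qed

lemma finite_supp_salg: "finite (supp_salg x)"
  by (induction x rule: salg_induct)
     (auto intro: finite_subset[OF supp_salg_add] simp: supp_salg_el)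

lemma zz_add_eq_iff: "zz + a = b \<longleftrightarrow> a = zz + b"
  using zz_zz_add[of a] zz_zz_add[of b] by metis

text \<open>The sum counts every basis vector twice, once for each of its two signs.\<close>
lemma double_eq_sum_co: "2 * x = (\<Sum>a\<in>supp_salg x. of_int (co a x) * el a)"
proof (rule salg_eqI)
  fix b
  have fin: "finite (supp_salg x)" by (rule finite_supp_salg)
  have "co b (\<Sum>a\<in>supp_salg x. of_int (co a x) * el a)
      = (\<Sum>a\<in>supp_salg x. (if a = b then co a x else 0) + (if a = zz + b then - co a x else 0))"
    unfolding co_sum
  proof (rule sum.cong)
    fix a
    show "co b (of_int (co a x) * el a) = (if a = b then co a x else 0) + (if a = zz + b then - co a x else 0)"
      by (cases "a = b"; cases "a = zz + b") (simp_all add: co_el zz_add_eq_iff)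
  qed (rule HOL.refl)
  also have "\<dots> = co b x + co b x"
  proof -
    have "(\<Sum>a\<in>supp_salg x. if a = b then co a x else 0) = co b x"
      unfolding sum.delta[OF fin] by (simp add: supp_salg_def)
    moreover have "(\<Sum>a\<in>supp_salg x. if a = zz + b then - co a x else 0) = co b x"
      unfolding sum.delta[OF fin] by (simp add: supp_salg_def co_zz_add)
    ultimately show ?thesis unfolding sum.distrib by (rule arg_cong2)
  qed
  also have "\<dots> = co b (2 * x)" by (simp only: mult_2 co_add)
  finally show "co b (2 * x) = co b (\<Sum>a\<in>supp_salg x. of_int (co a x) * el a)" by (rule HOL.sym)
qed

lemma supp_salg_el_mult: "supp_salg (el b * y) = (+) b ` supp_salg y"
  by (auto simp: supp_salg_def co_add_el image_iff) (metis add_minus_cancel)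

lemma supp_salg_double: "supp_salg (2 * x) = supp_salg x"
  by (simp only: supp_salg_def mult_2 co_add) simp

text \<open>The expansion in basis elements is available for 2 x only, which does no harm: the
  coefficients are integers, so doubling preserves supports.\<close>

lemma supp_salg_mult: "supp_salg (x * y) \<subseteq> {a + b | a b. a \<in> supp_salg x \<and> b \<in> supp_salg y}"
proof -
  have "2 * (x * y) = (\<Sum>a\<in>supp_salg x. of_int (co a x) * (el a * y))"
    by (simp only: mult.assoc[symmetric] double_eq_sum_co sum_distrib_right)
  then have "supp_salg (x * y) \<subseteq> (\<Union>a\<in>supp_salg x. supp_salg (of_int (co a x) * (el a * y)))"
    using supp_salg_sum supp_salg_double[of "x * y"] by metis
  also have "\<dots> \<subseteq> (\<Union>a\<in>supp_salg x. supp_salg (el a * y))"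
    using supp_salg_of_int by fast
  finally show ?thesis unfolding supp_salg_el_mult by blast
qed

lemma supp_salg_1: "supp_salg 1 = {0, zz}"
  using supp_salg_el[of 0] by simp

section \<open>The presented group as a subgroup of the model\<close>

lemma mem_spin_carrier:
  "X \<in> carrier (spin_group n) \<longleftrightarrow> (\<exists>u. spin_valid n u \<and> X = word_class n u)"
  by (auto simp: spin_group_def presented_group_def quotient_def spin_valid_def word_class_def)

lemma word_class_in_carrier: "spin_valid n u \<Longrightarrow> word_class n u \<in> carrier (spin_group n)"
  using mem_spin_carrier by blast

lemma word_class_eq: "spin_eq n u v \<Longrightarrow> word_class n u = word_class n v"
  unfolding word_class_def by (blast intro: word_eq.sym word_eq.trans)

lemma spin_mult_class:
  assumes "spin_valid n u" "spin_valid n v"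
  shows "word_class n u \<otimes>\<^bsub>spin_group n\<^esub> word_class n v = word_class n (u @ v)"
proof -
  have "word_class n (a @ b) = word_class n (u @ v)" if "a \<in> word_class n u" "b \<in> word_class n v" for a b
    using that by (intro word_class_eq word_eq.sym[OF spin_eq_append]) (auto simp: word_class_def)
  moreover have "u \<in> word_class n u" "v \<in> word_class n v"
    using assms spin_eq_refl by (auto simp: word_class_def)
  ultimately have "(\<Union>a\<in>word_class n u. \<Union>b\<in>word_class n v. word_class n (a @ b)) = word_class n (u @ v)"
    by blast
  then show ?thesis by (simp add: spin_group_def presented_group_def word_class_def)
qed

lemma spin_one_class: "\<one>\<^bsub>spin_group n\<^esub> = word_class n []"
  by (simp add: spin_group_def presented_group_def word_class_def)

definition iota :: "nat \<Rightarrow> spin_elt \<Rightarrow> sp" where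
  "iota n X = ev (SOME u. u \<in> X)"

lemma iota_class [simp]: "spin_valid n u \<Longrightarrow> iota n (word_class n u) = ev u"
proof -
  assume "spin_valid n u"
  then have "u \<in> word_class n u" using spin_eq_refl by (simp add: word_class_def)
  then have "(SOME w. w \<in> word_class n u) \<in> word_class n u" by (rule someI)
  then show ?thesis using ev_spin_eq by (simp add: iota_def word_class_def)
qed

lemma spin_inverse_word: "spin_valid n v \<Longrightarrow> \<exists>v'. spin_valid n v' \<and> spin_eq n (v' @ v) []"
proof (induction v)
  case Nil
  then show ?case using spin_eq_refl[of n "[]"] by (intro exI[of _ "[]"]) simp
next
  case (Cons x v)
  have v: "spin_valid n [x]" "spin_valid n v" using Cons.prems spin_valid_Cons by blast+
  obtain g b where x: "x = (g, b)" by (cases x)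
  obtain v' where v': "spin_valid n v'" "spin_eq n (v' @ v) []" using Cons.IH v by blast
  have "spin_eq n [(g, \<not> b), (g, \<not> \<not> b)] []"
    using v(1) x by (intro word_eq.cancel) (simp add: spin_valid_def)
  then have "spin_eq n (v' @ [(g, \<not> b), x] @ v) (v' @ [] @ v)"
    using x by (intro spin_eq_ctx v v') simp
  then have "spin_eq n ((v' @ [(g, \<not> b)]) @ x # v) []" using v'(2) word_eq.trans by fastforce
  moreover have "spin_valid n (v' @ [(g, \<not> b)])" using v'(1) v(1) x by (simp add: spin_valid_def)
  ultimately show ?case by blast
qed

text \<open>Applied to u times the inverse of v, the kernel lemma gives equality up to z. The case u
  = z v is excluded because \<open>zz + a\<close> never equals a.\<close>

lemma spin_eq_iff_ev:
  assumes "spin_valid n u" "spin_valid n v"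
  shows "spin_eq n u v \<longleftrightarrow> ev u = ev v"
proof
  assume e: "ev u = ev v"
  obtain v' where v': "spin_valid n v'" "spin_eq n (v' @ v) []" using spin_inverse_word assms by blast
  have "ev v' + ev v = 0" using ev_spin_eq[OF v'(2)] by simp
  then have "ev (u @ v') = 0" using e by (simp add: eq_neg_iff_add_eq_0[symmetric])
  then have "spin_sim n (u @ v') []" using assms v' by (intro spin_kernel) auto
  then have "spin_sim n ((u @ v') @ v) ([] @ v)" by (intro spin_sim_append spin_sim_refl assms)
  moreover have "spin_eq n (u @ (v' @ v)) (u @ [])" by (intro spin_eq_append spin_eq_refl assms v')
  ultimately have "spin_sim n u v"
    using spin_sim_trans[OF spin_simI[OF word_eq.sym]] by fastforce
  moreover have "\<not> spin_eq n u (zw @ v)" using ev_spin_eq[of n u "zw @ v"] e zz_add_neq[of "ev v"] by auto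
  ultimately show "spin_eq n u v" by (simp add: spin_sim_def)
qed (rule ev_spin_eq)

lemma iota_inj: "inj_on (iota n) (carrier (spin_group n))"
proof (rule inj_onI)
  fix X Y assume X: "X \<in> carrier (spin_group n)" and Y: "Y \<in> carrier (spin_group n)" and e: "iota n X = iota n Y"
  obtain u where u: "spin_valid n u" "X = word_class n u" using X mem_spin_carrier by blast
  obtain v where v: "spin_valid n v" "Y = word_class n v" using Y mem_spin_carrier by blast
  have "spin_eq n u v" using spin_eq_iff_ev[OF u(1) v(1)] e u v by simp
  then show "X = Y" using word_class_eq u v by simp
qed

lemma iota_image: "iota n ` carrier (spin_group n) = Gn n"
proof (intro equalityI subsetI)
  fix a assume "a \<in> iota n ` carrier (spin_group n)"
  then obtain u where u: "spin_valid n u" "a = ev u" using mem_spin_carrier by auto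
  then show "a \<in> Gn n" using act_ev_outside by (auto simp: Gn_def)
next
  fix a assume "a \<in> Gn n"
  then obtain u where "spin_valid n u" "ev u = a" using ev_surj by blast
  then show "a \<in> iota n ` carrier (spin_group n)"
    using word_class_in_carrier iota_class by (metis image_eqI)
qed

lemma spin_mult_closed:
  "X \<in> carrier (spin_group n) \<Longrightarrow> Y \<in> carrier (spin_group n) \<Longrightarrow>
    X \<otimes>\<^bsub>spin_group n\<^esub> Y \<in> carrier (spin_group n)"
  using spin_mult_class word_class_in_carrier unfolding mem_spin_carrier by (metis spin_valid_append)

lemma iota_mult:
  "X \<in> carrier (spin_group n) \<Longrightarrow> Y \<in> carrier (spin_group n) \<Longrightarrow>
    iota n (X \<otimes>\<^bsub>spin_group n\<^esub> Y) = iota n X + iota n Y"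
  unfolding mem_spin_carrier using spin_mult_class by fastforce

lemma spin_one_closed: "\<one>\<^bsub>spin_group n\<^esub> \<in> carrier (spin_group n)"
  using spin_one_class word_class_in_carrier by simp

lemma iota_one [simp]: "iota n \<one>\<^bsub>spin_group n\<^esub> = 0"
  by (simp add: spin_one_class)

lemma list_prod_simps [simp]: "list_prod G [] = \<one>\<^bsub>G\<^esub>"
  "list_prod G (x # xs) = x \<otimes>\<^bsub>G\<^esub> list_prod G xs"
  by (simp_all add: list_prod_def)

lemma iota_list_prod:
  "set xs \<subseteq> carrier (spin_group n) \<Longrightarrow>
    list_prod (spin_group n) xs \<in> carrier (spin_group n) \<and>
    iota n (list_prod (spin_group n) xs) = sum_list (map (iota n) xs)"
  by (induction xs) (auto simp: spin_one_closed spin_mult_closed iota_mult)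

lemma spin_t_closed: "i \<in> {1..<n} \<Longrightarrow> spin_t n i \<in> carrier (spin_group n)"
  unfolding spin_t_def by (rule word_class_in_carrier) simp

lemma iota_spin_t: "i \<in> {1..<n} \<Longrightarrow> iota n (spin_t n i) = tt (i + 1) i"
  by (simp add: spin_t_def)

lemma spin_z_closed: "spin_z n \<in> carrier (spin_group n)"
  unfolding spin_z_def by (rule word_class_in_carrier) simp

lemma iota_spin_z: "iota n (spin_z n) = zz"
  by (simp add: spin_z_def)

lemma spin_emb_class:
  assumes "spin_valid n u"
  shows "spin_emb n (word_class n u) = word_class (n + 1) u"
proof -
  have "word_class (n + 1) w = word_class (n + 1) u" if "w \<in> word_class n u" for w
    using that spin_eq_mono[of n u w "n + 1"] word_class_eq by (simp add: word_class_def)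
  moreover have "u \<in> word_class n u" using assms spin_eq_refl by (simp add: word_class_def)
  ultimately show ?thesis unfolding spin_emb_def by blast
qed

lemma spin_emb:
  assumes "X \<in> carrier (spin_group n)"
  shows "spin_emb n X \<in> carrier (spin_group (n + 1))" "iota (n + 1) (spin_emb n X) = iota n X"
proof -
  obtain u where u: "spin_valid n u" "X = word_class n u" using assms mem_spin_carrier by blast
  then have v: "spin_valid (n + 1) u" using spin_valid_mono by simp
  show "spin_emb n X \<in> carrier (spin_group (n + 1))"
    using word_class_in_carrier[OF v] u spin_emb_class by simp
  show "iota (n + 1) (spin_emb n X) = iota n X"
    using iota_class[OF v] u spin_emb_class by simp
qed

lemma spin_emb_inj: "inj_on (spin_emb n) (carrier (spin_group n))"
  by (rule inj_onI) (metis spin_emb(2) iota_inj inj_onD)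

text \<open>This makes \<open>spin_cycle\<close> meaningful: an element of the larger group comes
  from the smaller one as soon as its permutation moves only points of {1..n}.\<close>

lemma the_inv_spin_emb:
  assumes "Y \<in> carrier (spin_group (n + 1))" "iota (n + 1) Y \<in> Gn n"
  shows "the_inv_into (carrier (spin_group n)) (spin_emb n) Y \<in> carrier (spin_group n)"
    "iota n (the_inv_into (carrier (spin_group n)) (spin_emb n) Y) = iota (n + 1) Y"
proof -
  obtain X where X: "X \<in> carrier (spin_group n)" "iota n X = iota (n + 1) Y"
    using assms(2) iota_image by (metis imageE)
  have "iota (n + 1) (spin_emb n X) = iota (n + 1) Y" using spin_emb(2)[OF X(1)] X(2) by simp
  then have "spin_emb n X = Y"
    using inj_onD[OF iota_inj _ spin_emb(1)[OF X(1)] assms(1)] by blast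
  then have "the_inv_into (carrier (spin_group n)) (spin_emb n) Y = X"
    using the_inv_into_f_f[OF spin_emb_inj X(1)] by simp
  then show "the_inv_into (carrier (spin_group n)) (spin_emb n) Y \<in> carrier (spin_group n)"
    "iota n (the_inv_into (carrier (spin_group n)) (spin_emb n) Y) = iota (n + 1) Y"
    using X by auto
qed

text \<open>Peeling off the outer pair t_i and applying the braid relation to what the inner part
  evaluates to shows x_i to be a lift of the transposition of i and n + 1, with no sign left
  over.\<close>

lemma spin_x:
  assumes "1 \<le> i" "i \<le> n"
  shows "spin_x n i \<in> carrier (spin_group (n + 1))" "iota (n + 1) (spin_x n i) = tt (n + 1) i"
proof -
  let ?xs = "[i..<n + 1] @ rev [i..<n]"
  have s: "set (map (spin_t (n + 1)) ?xs) \<subseteq> carrier (spin_group (n + 1))"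
    using assms spin_t_closed[of _ "n + 1"] by auto
  show "spin_x n i \<in> carrier (spin_group (n + 1))"
    using iota_list_prod[OF s] by (simp add: spin_x_def)
  have "iota (n + 1) (spin_x n i) = sum_list (map (iota (n + 1)) (map (spin_t (n + 1)) ?xs))"
    using iota_list_prod[OF s] by (simp only: spin_x_def)
  also have "map (iota (n + 1)) (map (spin_t (n + 1)) ?xs) = map (\<lambda>j. tt (j + 1) j) ?xs"
    using assms iota_spin_t[of _ "n + 1"] by auto
  also have "sum_list \<dots> = tt (n + 1) i"
    using assms(2)
  proof (induction "n - i" arbitrary: i)
    case 0
    then show ?case by simp
  next
    case (Suc d)
    have e: "[i..<n + 1] @ rev [i..<n] = i # ([i + 1..<n + 1] @ rev [i + 1..<n]) @ [i]"
      using Suc(2) upt_conv_Cons[of i "n + 1"] upt_conv_Cons[of i n] by (simp del: upt_Suc)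
    have "sum_list (map (\<lambda>j. tt (j + 1) j) ([i + 1..<n + 1] @ rev [i + 1..<n])) = tt (n + 1) (i + 1)"
      by (rule Suc(1)) (use Suc(2) in simp_all)
    moreover have "sum_list (map (\<lambda>j. tt (j + 1) j) (i # M @ [i]))
        = tt (i + 1) i + sum_list (map (\<lambda>j. tt (j + 1) j) M) + tt (i + 1) i" for M
      by (simp add: add.assoc)
    moreover have "tt (i + 1) i + tt (n + 1) (i + 1) + tt (i + 1) i = tt (n + 1) i"
      using Suc(2) by (intro tt_braid(2)) simp_all
    ultimately show ?case unfolding e by (simp only:)
  qed
  finally show "iota (n + 1) (spin_x n i) = tt (n + 1) i" .
qed

text \<open>\<open>gcy c\<close> is the cycle \<open>c\<close> up to sign; \<open>cyc c\<close> equals the element \<open>[i\<^sub>1, \<dots>, i\<^sub>m]\<close> of the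
  paper when \<open>m\<close> is odd.\<close>
definition gcy :: "nat list \<Rightarrow> sp" where
  "gcy c = sum_list (map (tt (hd c)) (rev (tl c)))"

definition cyc :: "nat list \<Rightarrow> sp" where
  "cyc c = zz + gcy c"

text \<open>Moving the left factor \<open>tt N k\<close> through the star changes its centre from N
  to k at the price of one sign per leaf. The square of \<open>tt N k\<close> that remains
  contributes one more, hence the factor for an even number of leaves.\<close>

lemma tt_star_conj:
  assumes "N \<noteq> k" "N \<notin> set l" "k \<notin> set l"
  shows "tt N k + sum_list (map (tt N) l) + tt N k = zs (even (length l)) + sum_list (map (tt k) l)"
  using assms(2,3)
proof (induction l)
  case Nil
  then show ?case using assms(1) by (simp add: tt_tt)
next
  case (Cons i l)
  have "tt N k + tt N i = zz + (tt k i + tt N k)"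
    using add_tt[of N i "tt N k"] assms(1) Cons.prems by (simp add: add.assoc)
  then have "tt N k + (tt N i + (sum_list (map (tt N) l) + tt N k))
      = zz + (tt k i + (tt N k + sum_list (map (tt N) l) + tt N k))"
    by (metis add.assoc)
  then show ?case using Cons assms(1) by (cases "even (length l)") (simp_all add: add.assoc)
qed

lemma spin_cycle_up:
  assumes "distinct c" "set c \<subseteq> {1..n}" "length c \<ge> 2"
  shows "spin_cycle_up n c \<in> carrier (spin_group (n + 1))"
    "iota (n + 1) (spin_cycle_up n c) = zs (odd (length c)) + gcy c"
proof -
  obtain k l where c: "c = k # l" using assms(3) by (cases c) auto
  let ?xs = "k # rev l @ [k]"
  have s: "set (map (spin_x n) ?xs) \<subseteq> carrier (spin_group (n + 1))"
    using spin_x(1)[of _ n] assms(2) c by auto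
  show "spin_cycle_up n c \<in> carrier (spin_group (n + 1))"
    using iota_list_prod[OF s] c by (simp add: spin_cycle_up_def)
  have "iota (n + 1) (spin_cycle_up n c) = sum_list (map (iota (n + 1)) (map (spin_x n) ?xs))"
    using iota_list_prod[OF s] c by (simp add: spin_cycle_up_def)
  also have "map (iota (n + 1)) (map (spin_x n) ?xs) = map (tt (n + 1)) ?xs"
    using spin_x(2)[of _ n] assms(2) c by auto
  also have "sum_list \<dots> = tt (n + 1) k + sum_list (map (tt (n + 1)) (rev l)) + tt (n + 1) k"
    by (simp add: add.assoc)
  also have "tt (n + 1) k + sum_list (map (tt (n + 1)) (rev l)) + tt (n + 1) k
      = zs (even (length l)) + sum_list (map (tt k) (rev l))"
  proof -
    have "n + 1 \<notin> set l" using assms(2) c by auto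
    then show ?thesis
      using tt_star_conj[of "n + 1" k "rev l"] assms(1,2) c by auto
  qed
  also have "\<dots> = zs (odd (length c)) + gcy c" by (simp add: c gcy_def)
  finally show "iota (n + 1) (spin_cycle_up n c) = zs (odd (length c)) + gcy c" .
qed

lemma act_gcy_outside: "x \<notin> set c \<Longrightarrow> act (gcy c) x = x"
proof -
  assume x: "x \<notin> set c"
  have "act (sum_list (map (tt k) l)) x = x" if "x \<noteq> k" "x \<notin> set l" for k l
    using that by (induction l) auto
  then show ?thesis using x by (cases c) (auto simp: gcy_def)
qed

lemma gcy_Gn: "set c \<subseteq> {1..n} \<Longrightarrow> gcy c \<in> Gn n"
  using act_gcy_outside by (fastforce simp: Gn_def)

lemma zs_add_Gn: "zs b + a \<in> Gn n \<longleftrightarrow> a \<in> Gn n"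
  by (simp add: Gn_def)

lemma spin_cycle:
  assumes "distinct c" "set c \<subseteq> {1..n}" "length c \<ge> 2"
  shows "spin_cycle n c \<in> carrier (spin_group n)"
    "iota n (spin_cycle n c) = zs (odd (length c)) + gcy c"
  unfolding spin_cycle_def
  using the_inv_spin_emb[OF spin_cycle_up(1)[OF assms]] spin_cycle_up(2)[OF assms] gcy_Gn[OF assms(2)]
  by (simp_all add: zs_add_Gn)

section \<open>Cycles and conjugacy classes\<close>

lemma add_star:
  assumes "k \<notin> set l"
  shows "a + sum_list (map (tt k) l) =
    zs (odd_sp a \<and> odd (length l)) + sum_list (map (tt (act a k)) (map (act a) l)) + a"
  using assms
proof (induction l)
  case (Cons i l)
  have 1: "a + tt k i = zs (odd_sp a) + tt (act a k) (act a i) + a"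
    using Cons.prems by (intro add_tt) auto
  let ?S = "sum_list (map (tt (act a k)) (map (act a) l))"
  have "a + sum_list (map (tt k) (i # l)) = a + tt k i + sum_list (map (tt k) l)"
    by (simp add: add.assoc)
  also have "\<dots> = zs (odd_sp a) + tt (act a k) (act a i) + (a + sum_list (map (tt k) l))"
    unfolding 1 by (simp only: add.assoc)
  also have "\<dots> = zs (odd_sp a) + tt (act a k) (act a i) + (zs (odd_sp a \<and> odd (length l)) + ?S + a)"
    using Cons by simp
  also have "\<dots> = zs (odd_sp a) + (zs (odd_sp a \<and> odd (length l)) + (tt (act a k) (act a i) + (?S + a)))"
    by (simp only: add.assoc tt_zs)
  also have "\<dots> = zs (odd_sp a \<noteq> (odd_sp a \<and> odd (length l))) + (tt (act a k) (act a i) + (?S + a))"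
    by (simp only: zs_zs_add)
  also have "(odd_sp a \<noteq> (odd_sp a \<and> odd (length l))) = (odd_sp a \<and> odd (length (i # l)))"
    by auto
  finally show ?case by (simp add: add.assoc)
qed simp

lemma add_gcy:
  assumes "distinct c" "c \<noteq> []"
  shows "a + gcy c = zs (odd_sp a \<and> even (length c)) + gcy (map (act a) c) + a"
proof -
  obtain k l where c: "c = k # l" using assms(2) by (cases c) auto
  then show ?thesis using add_star[of k "rev l" a] assms(1) by (simp add: gcy_def rev_map)
qed

lemma odd_sp_star: "k \<notin> set l \<Longrightarrow> odd_sp (sum_list (map (tt k) l)) \<longleftrightarrow> odd (length l)"
  by (induction l) auto

lemma odd_sp_gcy: "distinct c \<Longrightarrow> c \<noteq> [] \<Longrightarrow> odd_sp (gcy c) \<longleftrightarrow> even (length c)"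
  by (cases c) (simp_all add: gcy_def odd_sp_star)

text \<open>A cycle of odd length is a product of an even number of transpositions, so the signs of
  \<open>add_tt\<close> cancel even when a is odd. This is why partitions with even parts give
  conjugation without signs.\<close>

lemma add_cyc:
  assumes "distinct c" "odd (length c)"
  shows "a + cyc c = cyc (map (act a) c) + a"
proof -
  have "c \<noteq> []" using assms(2) by auto
  then have "a + gcy c = gcy (map (act a) c) + a" using add_gcy[of c a] assms by simp
  moreover have "a + (zz + gcy c) = zz + (a + gcy c)" by (rule zz_left_commute)
  ultimately show ?thesis by (simp only: cyc_def add.assoc)
qed

text \<open>The list recursion of \<open>cycle_of_list\<close> splits off the transposition of the
  first two entries on the left, whereas the star splits it off on the right. Conjugating by this
  transposition passes from one form to the other.\<close>

lemma act_gcy: "distinct c \<Longrightarrow> act (gcy c) = cycle_of_list c"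
proof (induction "length c" arbitrary: c)
  case 0
  then show ?case by (simp add: gcy_def)
next
  case (Suc m)
  then obtain k l where c: "c = k # l" by (cases c) auto
  show ?case
  proof (cases l)
    case Nil
    then show ?thesis using c by (simp add: gcy_def)
  next
    case (Cons i l')
    let ?t = "transpose k i"
    have d: "distinct (i # l')" "k \<notin> set l'" "i \<notin> set l'" "k \<noteq> i" "distinct (k # l')"
      using Suc.prems c Cons by auto
    have IH: "act (gcy (k # l')) = cycle_of_list (k # l')"
      using Suc(1)[of "k # l'"] Suc(2) c Cons d by simp
    have "map ?t l' = l'"
      by (rule map_idI) (use d in \<open>auto simp: transpose_def\<close>)
    then have m: "map ?t (i # l') = k # l'" by simp
    have "?t \<circ> cycle_of_list (i # l') \<circ> Hilbert_Choice.inv ?t = cycle_of_list (k # l')"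
      using conjugation_of_cycle[OF d(1), of ?t] unfolding m by (simp only: bij_transpose)
    then have e: "?t \<circ> cycle_of_list (i # l') \<circ> ?t = cycle_of_list (k # l')"
      by (simp only: inv_transpose_eq)
    have g: "gcy c = gcy (k # l') + tt k i"
      by (simp add: c Cons gcy_def)
    show ?thesis
    proof
      fix x
      have "act (gcy c) x = cycle_of_list (k # l') (?t x)" unfolding g act_add IH act_tt by (rule o_apply)
      also have "\<dots> = ?t (cycle_of_list (i # l') (?t (?t x)))" unfolding e[symmetric] by (simp only: o_apply)
      also have "\<dots> = cycle_of_list c x" by (simp add: c Cons)
      finally show "act (gcy c) x = cycle_of_list c x" .
    qed
  qed
qed

definition gsum :: "nat list list \<Rightarrow> sp" where "gsum cs = sum_list (map gcy cs)"
definition csum :: "nat list list \<Rightarrow> sp" where "csum cs = sum_list (map cyc cs)"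

lemma gsum_simps [simp]: "gsum [] = 0" "gsum (c # cs) = gcy c + gsum cs" "gsum (cs @ ds) = gsum cs + gsum ds"
  by (simp_all add: gsum_def)
lemma csum_simps [simp]: "csum [] = 0" "csum (c # cs) = cyc c + csum cs" "csum (cs @ ds) = csum cs + csum ds"
  by (simp_all add: csum_def)

lemma act_cyc [simp]: "act (cyc c) = act (gcy c)" by (simp add: cyc_def)

lemma act_csum: "act (csum cs) = act (gsum cs)"
  by (induction cs) simp_all

lemma add_csum:
  assumes "distinct (concat cs)" "\<And>c. c \<in> set cs \<Longrightarrow> odd (length c)"
  shows "a + csum cs = csum (map (map (act a)) cs) + a"
  using assms
proof (induction cs)
  case (Cons c cs)
  have "a + cyc c = cyc (map (act a) c) + a" using Cons.prems by (intro add_cyc) auto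
  then have "a + csum (c # cs) = cyc (map (act a) c) + (a + csum cs)"
    by (simp only: csum_simps add.assoc[symmetric])
  also have "a + csum cs = csum (map (map (act a)) cs) + a" using Cons by simp
  finally show ?case by (simp only: csum_simps list.map add.assoc)
qed simp

text \<open>Elements with disjoint supports supercommute: a sign appears exactly when both are
  odd.\<close>

lemma add_gsum_fixed:
  assumes "distinct (concat cs)" "\<And>c. c \<in> set cs \<Longrightarrow> c \<noteq> []" "\<And>x. x \<in> set (concat cs) \<Longrightarrow> act a x = x"
  shows "a + gsum cs = zs (odd_sp a \<and> odd_sp (gsum cs)) + gsum cs + a"
  using assms
proof (induction cs)
  case (Cons c cs)
  have m: "map (act a) c = c" using Cons.prems(3) by (auto intro: map_idI)
  have 1: "a + gcy c = zs (odd_sp a \<and> odd_sp (gcy c)) + gcy c + a"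
    using add_gcy[of c a] odd_sp_gcy[of c] Cons.prems m by simp
  have 2: "a + gsum cs = zs (odd_sp a \<and> odd_sp (gsum cs)) + gsum cs + a"
    using Cons by simp
  have "a + gsum (c # cs) = zs (odd_sp a \<and> odd_sp (gcy c)) + gcy c + (a + gsum cs)"
    using 1 by (simp only: gsum_simps add.assoc[symmetric])
  also have "\<dots> = zs (odd_sp a \<and> odd_sp (gcy c)) + (zs (odd_sp a \<and> odd_sp (gsum cs)) + (gcy c + gsum cs + a))"
    unfolding 2 by (simp only: add.assoc zs_left_commute[of "gcy c"])
  also have "\<dots> = zs ((odd_sp a \<and> odd_sp (gcy c)) \<noteq> (odd_sp a \<and> odd_sp (gsum cs))) + (gcy c + gsum cs + a)"
    by (simp only: zs_zs_add)
  also have "((odd_sp a \<and> odd_sp (gcy c)) \<noteq> (odd_sp a \<and> odd_sp (gsum cs))) = (odd_sp a \<and> odd_sp (gsum (c # cs)))"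
    by auto
  finally show ?case by (simp only: gsum_simps add.assoc)
qed simp

lemma act_gsum_outside: "x \<notin> set (concat cs) \<Longrightarrow> act (gsum cs) x = x"
  by (induction cs) (auto simp: act_gcy_outside)

lemma cycle_of_list_in: "x \<in> set c \<Longrightarrow> cycle_of_list c x \<in> set c"
  using cycle_permutes[of c] by (simp add: permutes_in_image)

lemma act_gsum:
  assumes "distinct (concat cs)" "c \<in> set cs" "x \<in> set c"
  shows "act (gsum cs) x = cycle_of_list c x"
  using assms
proof (induction cs)
  case (Cons d cs)
  show ?case
  proof (cases "c = d")
    case True
    then have "x \<notin> set (concat cs)" using Cons.prems by auto
    then show ?thesis using True Cons.prems act_gcy[of d] by (simp add: act_gsum_outside)
  next
    case False
    then have c: "c \<in> set cs" using Cons.prems by auto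
    then have "cycle_of_list c x \<in> set (concat cs)" using cycle_of_list_in Cons.prems(3) by fastforce
    then have "cycle_of_list c x \<notin> set d" using Cons.prems by auto
    then show ?thesis using Cons.IH[OF _ c Cons.prems(3)] Cons.prems by (simp add: act_gcy_outside)
  qed
qed simp

lemma act_gsum_funpow:
  assumes "distinct (concat cs)" "c \<in> set cs" "x \<in> set c"
  shows "(act (gsum cs) ^^ n) x = (cycle_of_list c ^^ n) x \<and> (cycle_of_list c ^^ n) x \<in> set c"
proof (induction n)
  case (Suc n)
  then show ?case
    using act_gsum[OF assms(1,2)] cycle_of_list_in[of "(cycle_of_list c ^^ n) x" c] by simp
qed (use assms in simp)

lemma distinct_cyc: "distinct (concat cs) \<Longrightarrow> c \<in> set cs \<Longrightarrow> distinct c"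
  by (metis distinct_concat_iff)

lemma cycle_of_list_nth:
  assumes "distinct c" "i < length c"
  shows "(cycle_of_list c ^^ n) (c ! i) = c ! ((i + n) mod length c)"
proof -
  have "map (cycle_of_list c ^^ n) c ! i = rotate n c ! i" using cyclic_rotation[OF assms(1)] by simp
  then show ?thesis using assms(2) by (simp add: nth_rotate add.commute)
qed

lemma range_cycle:
  fixes c :: "nat list"
  assumes "distinct c" "x \<in> set c"
  shows "range (\<lambda>n. (cycle_of_list c ^^ n) x) = set c"
proof -
  obtain i where i: "i < length c" "x = c ! i" using assms(2) by (metis in_set_conv_nth)
  have "c ! j \<in> range (\<lambda>n. (cycle_of_list c ^^ n) x)" if "j < length c" for j
  proof -
    have "(i + (length c - i + j)) mod length c = j" using that i by simp
    then have "(cycle_of_list c ^^ (length c - i + j)) x = c ! j"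
      using cycle_of_list_nth[OF assms(1) i(1)] i(2) by simp
    then show ?thesis by (metis rangeI)
  qed
  then have "set c \<subseteq> range (\<lambda>n. (cycle_of_list c ^^ n) x)" by (auto simp: in_set_conv_nth)
  moreover have "(cycle_of_list c ^^ n) x \<in> set c" for n
    using act_gsum_funpow[of "[c]" c x n] assms by simp
  ultimately show ?thesis by blast
qed

lemma cycle_of_list_moves:
  assumes "distinct c" "x \<in> set c" "2 \<le> length c"
  shows "cycle_of_list c x \<noteq> x"
proof -
  obtain i where i: "i < length c" "x = c ! i" using assms(2) by (metis in_set_conv_nth)
  have "(i + 1) mod length c \<noteq> i" "(i + 1) mod length c < length c" using i assms(3)
    by (auto simp: mod_if)
  then show ?thesis
    using cycle_of_list_nth[OF assms(1) i(1), of 1] i assms(1) by (simp add: nth_eq_iff_index_eq)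
qed

definition orbs :: "(nat \<Rightarrow> nat) \<Rightarrow> nat set set" where
  "orbs p = (\<lambda>x. range (\<lambda>n. (p ^^ n) x)) ` {x. p x \<noteq> x}"

text \<open>The reduced cycle type: a cycle of length p + 1 contributes the part p, and fixed points
  contribute nothing, so the type does not depend on n.\<close>

definition ctype :: "(nat \<Rightarrow> nat) \<Rightarrow> nat multiset" where
  "ctype p = image_mset (\<lambda>X. card X - 1) (mset_set (orbs p))"

definition cyc_sys :: "nat list list \<Rightarrow> bool" where
  "cyc_sys cs \<longleftrightarrow> distinct (concat cs) \<and> (\<forall>c\<in>set cs. 2 \<le> length c)"

lemma moved_gsum:
  assumes "cyc_sys cs"
  shows "{x. act (gsum cs) x \<noteq> x} = set (concat cs)"
  using act_gsum_outside act_gsum[of cs] cycle_of_list_moves distinct_cyc assms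
  by (fastforce simp: cyc_sys_def)

lemma orbs_gsum:
  assumes "cyc_sys cs"
  shows "orbs (act (gsum cs)) = set ` set cs"
proof -
  have d: "distinct (concat cs)" using assms by (simp add: cyc_sys_def)
  have r: "range (\<lambda>n. (act (gsum cs) ^^ n) x) = set c" if "c \<in> set cs" "x \<in> set c" for x c
    using act_gsum_funpow[OF d that] range_cycle[OF distinct_cyc[OF d that(1)] that(2)] by auto
  have ne: "\<exists>x. x \<in> set c" if "c \<in> set cs" for c
    using assms that by (cases c) (auto simp: cyc_sys_def)
  show ?thesis unfolding orbs_def moved_gsum[OF assms]
  proof (intro equalityI subsetI)
    fix X assume "X \<in> (\<lambda>x. range (\<lambda>n. (act (gsum cs) ^^ n) x)) ` set (concat cs)"
    then show "X \<in> set ` set cs" using r by auto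
  next
    fix X assume "X \<in> set ` set cs"
    then obtain c where c: "c \<in> set cs" "X = set c" by blast
    then obtain x where "x \<in> set c" using ne by blast
    then show "X \<in> (\<lambda>x. range (\<lambda>n. (act (gsum cs) ^^ n) x)) ` set (concat cs)"
      using r c by (intro image_eqI[of _ _ x]) auto
  qed
qed

lemma ctype_gsum:
  assumes "cyc_sys cs"
  shows "ctype (act (gsum cs)) = mset (map (\<lambda>c. length c - 1) cs)"
proof -
  have d: "distinct (concat cs)" and l: "\<And>c. c \<in> set cs \<Longrightarrow> 2 \<le> length c"
    using assms by (auto simp: cyc_sys_def)
  have ne: "[] \<notin> set cs" using l by fastforce
  have dcs: "distinct cs" using d ne by (metis distinct_concat_iff removeAll_id)
  have inj: "inj_on set (set cs)"
  proof (rule inj_onI)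
    fix c c' assume c: "c \<in> set cs" "c' \<in> set cs" "set c = set c'"
    then have "set c \<inter> set c' \<noteq> {}" using ne by auto
    then show "c = c'" using d c by (metis distinct_concat_iff)
  qed
  have "ctype (act (gsum cs)) = image_mset (\<lambda>X. card X - 1) (image_mset set (mset_set (set cs)))"
    unfolding ctype_def orbs_gsum[OF assms] by (simp add: image_mset_mset_set[OF inj])
  also have "\<dots> = image_mset (\<lambda>c. length c - 1) (mset cs)"
    using dcs distinct_cyc[OF d]
    by (auto simp: mset_set_set multiset.map_comp distinct_card intro!: image_mset_cong)
  finally show ?thesis by simp
qed

lemma mset_parts_list [simp]: "mset (parts_list \<alpha>) = \<alpha>"
  by (simp add: parts_list_def)

lemma set_parts_list [simp]: "set (parts_list \<alpha>) = set_mset \<alpha>"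
  by (simp add: parts_list_def)

lemma length_parts_list [simp]: "length (parts_list \<alpha>) = size \<alpha>"
  by (metis mset_parts_list size_mset)

lemma sum_list_parts_list [simp]: "sum_list (parts_list \<alpha>) = sum_mset \<alpha>"
  by (metis mset_parts_list sum_mset_sum_list)

definition cyc_of_type :: "nat multiset \<Rightarrow> nat list list \<Rightarrow> bool" where
  "cyc_of_type \<alpha> cs \<longleftrightarrow> map length cs = map Suc (parts_list \<alpha>) \<and> distinct (concat cs)"

lemma cyc_of_type:
  assumes "\<alpha> \<in> EP" "cyc_of_type \<alpha> cs"
  shows "cyc_sys cs" "\<And>c. c \<in> set cs \<Longrightarrow> odd (length c)"
    "mset (map (\<lambda>c. length c - 1) cs) = \<alpha>" "length (concat cs) = sum_mset \<alpha> + size \<alpha>"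
    "ctype (act (csum cs)) = \<alpha>" "{x. act (csum cs) x \<noteq> x} = set (concat cs)"
proof -
  have l: "\<exists>p\<in>#\<alpha>. length c = Suc p" if "c \<in> set cs" for c
  proof -
    have "length c \<in> set (map length cs)" using that by simp
    then show ?thesis using assms(2) unfolding cyc_of_type_def by auto
  qed
  show o: "odd (length c)" if "c \<in> set cs" for c
    using l[OF that] assms(1) by (auto simp: EP_def)
  have "2 \<le> length c" if "c \<in> set cs" for c
    using l[OF that] assms(1) by (fastforce simp: EP_def)
  then show s: "cyc_sys cs" using assms(2) by (simp add: cyc_sys_def cyc_of_type_def)
  have "map (\<lambda>c. length c - 1) cs = map (\<lambda>k. k - 1) (map length cs)" by simp
  also have "\<dots> = parts_list \<alpha>" using assms(2) by (simp add: cyc_of_type_def comp_def)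
  finally have m: "map (\<lambda>c. length c - 1) cs = parts_list \<alpha>" .
  show t: "mset (map (\<lambda>c. length c - 1) cs) = \<alpha>" unfolding m by simp
  show "length (concat cs) = sum_mset \<alpha> + size \<alpha>"
    using assms(2) by (simp add: length_concat cyc_of_type_def sum_list_Suc)
  show "ctype (act (csum cs)) = \<alpha>" using ctype_gsum[OF s] t by (simp only: act_csum)
  show "{x. act (csum cs) x \<noteq> x} = set (concat cs)" using moved_gsum[OF s] by (simp only: act_csum)
qed

text \<open>The union over all n of the classes \<open>Dn \<alpha> n\<close>. The point 0 is
  excluded because the model moves it although no {1..n} contains it.\<close>

definition DD :: "nat multiset \<Rightarrow> sp set" where
  "DD \<alpha> = {csum cs | cs. cyc_of_type \<alpha> cs \<and> 0 \<notin> set (concat cs)}"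

definition Dn :: "nat multiset \<Rightarrow> nat \<Rightarrow> sp set" where
  "Dn \<alpha> n = DD \<alpha> \<inter> Gn n"

lemma Dn_eq:
  assumes "\<alpha> \<in> EP"
  shows "Dn \<alpha> n = {csum cs | cs. cyc_of_type \<alpha> cs \<and> set (concat cs) \<subseteq> {1..n}}"
proof -
  have "csum cs \<in> Gn n \<and> 0 \<notin> set (concat cs) \<longleftrightarrow> set (concat cs) \<subseteq> {1..n}" if "cyc_of_type \<alpha> cs" for cs
  proof -
    have f: "act (csum cs) x = x \<longleftrightarrow> x \<notin> set (concat cs)" for x
      using cyc_of_type(6)[OF assms that] by blast
    have "0 \<notin> {1..n}" by simp
    then show ?thesis unfolding Gn_def mem_Collect_eq f by blast
  qed
  then show ?thesis unfolding Dn_def DD_def by blast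
qed

lemma DD_ctype: "\<alpha> \<in> EP \<Longrightarrow> g \<in> DD \<alpha> \<Longrightarrow> ctype (act g) = \<alpha>"
  using cyc_of_type(5) by (auto simp: DD_def)

lemma DD_card_moved: "\<alpha> \<in> EP \<Longrightarrow> g \<in> DD \<alpha> \<Longrightarrow> card {x. act g x \<noteq> x} = sum_mset \<alpha> + size \<alpha>"
proof -
  assume a: "\<alpha> \<in> EP" and "g \<in> DD \<alpha>"
  then obtain cs where cs: "cyc_of_type \<alpha> cs" "g = csum cs" by (auto simp: DD_def)
  have "distinct (concat cs)" using cs(1) by (simp add: cyc_of_type_def)
  then show ?thesis
    unfolding cs(2) cyc_of_type(6)[OF a cs(1)] cyc_of_type(4)[OF a cs(1), symmetric]
    by (rule distinct_card)
qed

lemma even_csum: "distinct (concat cs) \<Longrightarrow> (\<And>c. c \<in> set cs \<Longrightarrow> odd (length c)) \<Longrightarrow> \<not> odd_sp (csum cs)"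
proof (induction cs)
  case (Cons c cs)
  have "c \<noteq> []" using Cons.prems(2)[of c] by auto
  then show ?case using Cons odd_sp_gcy[of c] by (simp add: cyc_def)
qed simp

lemma even_DD: "\<alpha> \<in> EP \<Longrightarrow> g \<in> DD \<alpha> \<Longrightarrow> \<not> odd_sp g"
  using cyc_of_type(2) even_csum by (fastforce simp: DD_def cyc_of_type_def)

lemma finite_Gn: "finite (Gn n)"
proof -
  have "act a permutes {1..n}" if "a \<in> Gn n" for a
    using that bij_act[of a] by (simp add: Gn_def permutes_def bij_iff)
  then have "act ` Gn n \<subseteq> {p. p permutes {1..n}}" by blast
  then have fin: "finite (act ` Gn n)" using finite_permutations finite_subset by blast
  define s where "s p = (SOME a. act a = p)" for p
  have "Gn n \<subseteq> s ` act ` Gn n \<union> (+) zz ` s ` act ` Gn n"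
  proof
    fix a assume a: "a \<in> Gn n"
    have "act (s (act a)) = act a" unfolding s_def by (rule someI) (rule HOL.refl)
    then have "a = s (act a) \<or> a = zz + s (act a)" by (intro act_eq) simp
    then show "a \<in> s ` act ` Gn n \<union> (+) zz ` s ` act ` Gn n" using a by blast
  qed
  then show ?thesis using fin finite_subset by blast
qed

lemma finite_Dn: "finite (Dn \<alpha> n)"
  using finite_Gn by (simp add: Dn_def)

lemma ex_act:
  assumes "p permutes S" "finite S"
  shows "\<exists>a. act a = p"
  using assms
proof (induction rule: permutes_induct)
  case id
  show ?case using act_0 by blast
next
  case (swap a b p)
  then show ?case using act_add act_tt by metis
qed

lemma ex_permutes_map:
  assumes "finite A" "distinct L" "distinct L'" "length L = length L'" "set L \<subseteq> A" "set L' \<subseteq> A"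
  shows "\<exists>p. p permutes A \<and> map p L = L'"
  using assms(2-)
proof (induction L arbitrary: L')
  case Nil
  then show ?case using permutes_id by fastforce
next
  case (Cons x l)
  then obtain y l' where L': "L' = y # l'" by (cases L') auto
  obtain p where p: "p permutes A" "map p l = l'" using Cons L' by auto
  define q where "q = transpose (p x) y \<circ> p"
  have "p x \<in> A" "y \<in> A" using Cons.prems p(1) L' by (auto simp: permutes_in_image)
  then have q: "q permutes A" unfolding q_def by (intro permutes_compose p permutes_swap_id)
  have "set l' = p ` set l" using p(2) by (metis list.set_map)
  then have "p x \<notin> set l'"
    using Cons.prems(1) inj_image_mem_iff[OF permutes_inj[OF p(1)]] by simp
  moreover have "y \<notin> set l'" using Cons.prems L' by simp
  ultimately have "map (transpose (p x) y) l' = l'"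
    by (intro map_idI) (auto simp: transpose_def)
  then have "map q l = l'" unfolding q_def map_map[symmetric] p(2) .
  moreover have "q x = y" by (simp add: q_def)
  ultimately show ?case using q L' by (intro exI[of _ q]) simp
qed

text \<open>A permutation of {1..n} matches the entries of the two families of cycles in order. Any
  lift of it conjugates one product into the other exactly, because cycles of odd length relabel
  without a sign.\<close>

lemma DD_transitive:
  assumes "\<alpha> \<in> EP" "g \<in> Dn \<alpha> n" "g' \<in> Dn \<alpha> n"
  shows "\<exists>a\<in>Gn n. a + g = g' + a"
proof -
  obtain cs where cs: "cyc_of_type \<alpha> cs" "set (concat cs) \<subseteq> {1..n}" "g = csum cs"
    using assms(2) Dn_eq[OF assms(1)] by auto
  obtain ds where ds: "cyc_of_type \<alpha> ds" "set (concat ds) \<subseteq> {1..n}" "g' = csum ds"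
    using assms(3) Dn_eq[OF assms(1)] by auto
  have l: "map length cs = map length ds" using cs(1) ds(1) by (simp add: cyc_of_type_def)
  obtain p where p: "p permutes {1..n}" "map p (concat cs) = concat ds"
    using ex_permutes_map[of "{1..n}" "concat cs" "concat ds"] cs ds l
    by (auto simp: cyc_of_type_def length_concat)
  obtain a where a: "act a = p" using ex_act[OF p(1)] by auto
  have "map (map p) cs = ds"
  proof (rule concat_injective)
    show "concat (map (map p) cs) = concat ds" using p(2) by (simp add: map_concat)
    show len: "length (map (map p) cs) = length ds" using l by (metis length_map)
    have "length (map p (cs ! i)) = length (ds ! i)" if "i < length cs" for i
      using that l len by (metis length_map nth_map)
    then show "\<forall>(x, y)\<in>set (zip (map (map p) cs) ds). length x = length y"
      by (auto simp: set_zip)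
  qed
  then have "a + g = g' + a"
    using add_csum[of cs a] cyc_of_type(2)[OF assms(1) cs(1)] cs ds a by (simp add: cyc_of_type_def)
  moreover have "a \<in> Gn n" using a p(1) by (simp add: Gn_def permutes_def)
  ultimately show ?thesis by blast
qed

definition npow :: "nat \<Rightarrow> sp \<Rightarrow> sp" where "npow N g = sum_list (replicate N g)"

lemma act_npow: "act (npow N g) = act g ^^ N"
  by (induction N) (simp_all add: npow_def)

lemma conj_npow: "a + g = g' + a \<Longrightarrow> a + npow N g = npow N g' + a"
proof (induction N)
  case (Suc N)
  have "a + npow (Suc N) g = g' + (a + npow N g)"
    using Suc.prems by (simp add: npow_def add.assoc[symmetric])
  then show ?case using Suc by (simp add: npow_def add.assoc)
qed (simp add: npow_def)

lemma npow_zz: "npow N (zz + g) = zs (odd N) + npow N g"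
proof (induction N)
  case (Suc N)
  have "npow (Suc N) (zz + g) = zz + (g + (zs (odd N) + npow N g))"
    using Suc by (simp add: npow_def add.assoc)
  also have "\<dots> = zz + (zs (odd N) + npow (Suc N) g)"
    by (simp add: npow_def zs_left_commute[of g])
  finally show ?case by (cases "odd N") simp_all
qed (simp add: npow_def)

text \<open>Two elements of \<open>Dn \<alpha> n\<close> are conjugate, while \<open>g\<close> and \<open>zz + g\<close> are not conjugate when \<open>g\<close> lies
  over a permutation of odd order \<open>N\<close>: compare \<open>N\<close>-th powers.\<close>
lemma zz_add_notin_Dn:
  assumes "\<alpha> \<in> EP" "g \<in> Dn \<alpha> n"
  shows "zz + g \<notin> Dn \<alpha> n"
proof
  assume "zz + g \<in> Dn \<alpha> n"
  then obtain a where a: "a + g = zz + g + a" using DD_transitive assms by blast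
  obtain cs where cs: "cyc_of_type \<alpha> cs" "g = csum cs"
    using assms Dn_eq by auto
  \<comment> \<open>The product of the cycle lengths is odd and a multiple of each of them, so the
    permutation of g has trivial N-th power.\<close>
  define N where "N = prod_list (map length cs)"
  have oN: "odd N" using cyc_of_type(2)[OF assms(1) cs(1)] unfolding N_def
    by (induction cs) auto
  have d: "distinct (concat cs)" using cs(1) by (simp add: cyc_of_type_def)
  have "(act g ^^ N) x = x" for x
  proof (cases "x \<in> set (concat cs)")
    case True
    then obtain c where c: "c \<in> set cs" "x \<in> set c" by auto
    then obtain i where i: "i < length c" "x = c ! i" by (metis in_set_conv_nth)
    have "length c dvd N" unfolding N_def using c(1) by (induction cs) auto
    then have "(cycle_of_list c ^^ N) x = x"
      using cycle_of_list_nth[OF distinct_cyc[OF d c(1)] i(1), of N] i by auto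
    then show ?thesis using act_gsum_funpow[OF d c, of N] cs(2) by (simp add: act_csum)
  next
    case False
    then have "act g x = x" using act_gsum_outside cs(2) by (simp add: act_csum)
    then show ?thesis by (induction N) (simp_all del: funpow.simps add: funpow_Suc_right)
  qed
  then have "act (npow N g) = id" by (intro ext) (simp add: act_npow)
  then have "npow N g = 0 \<or> npow N g = zz" by (rule act_eq_id)
  \<comment> \<open>Raising the conjugacy to an odd power keeps the factor \<open>zz\<close>,
    whereas the N-th power of g is central.\<close>
  moreover have "a + npow N g = zz + npow N g + a"
    using conj_npow[OF a, of N] npow_zz[of N g] oN by (simp add: add.assoc)
  ultimately show False using zz_commute[of a] by (elim disjE) simp_all
qed

lemma cycle_decomp_cyc_sys:
  assumes "cycle_decomp I p"
  shows "\<exists>cs. cyc_sys cs \<and> act (gsum cs) = p \<and> set (concat cs) \<subseteq> I"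
  using assms
proof (induction rule: cycle_decomp.induct)
  case empty
  show ?case by (rule exI[of _ "[]"]) (simp add: cyc_sys_def)
next
  case (comp I p c)
  then obtain cs where cs: "cyc_sys cs" "act (gsum cs) = p" "set (concat cs) \<subseteq> I" by blast
  show ?case
  proof (cases "2 \<le> length c")
    case True
    have "set c \<inter> set (concat cs) = {}" using comp(3) cs(3) by blast
    then have "cyc_sys (c # cs)" using True cs(1) comp(2) by (simp add: cyc_sys_def)
    moreover have "act (gsum (c # cs)) = cycle_of_list c \<circ> p"
      using act_gcy[OF comp(2)] cs(2) by (simp only: gsum_simps act_add)
    moreover have "set (concat (c # cs)) \<subseteq> set c \<union> I" using cs(3) by auto
    ultimately show ?thesis by blast
  next
    case False
    then have "cycle_of_list c = id" by (cases c rule: cycle_of_list.cases) auto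
    then have "act (gsum cs) = cycle_of_list c \<circ> p" using cs(2) by (simp only: id_comp)
    then show ?thesis using cs by blast
  qed
qed

lemma ex_cyc_sys: "\<exists>cs. cyc_sys cs \<and> act (gsum cs) = act g"
proof -
  obtain S where "finite S" "act g permutes S"
    using permutation_act[of g] by (auto simp: permutation_permutes)
  then show ?thesis using cycle_decomp_cyc_sys[OF cycle_decomposition] by blast
qed

lemma act_gsum_cong:
  assumes "cyc_sys cs" "cyc_sys ds" "set cs = set ds"
  shows "act (gsum cs) = act (gsum ds)"
proof
  fix x
  have d: "distinct (concat cs)" "distinct (concat ds)" using assms by (auto simp: cyc_sys_def)
  show "act (gsum cs) x = act (gsum ds) x"
  proof (cases "x \<in> set (concat cs)")
    case True
    then obtain c where c: "c \<in> set cs" "x \<in> set c" by auto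
    then show ?thesis using act_gsum[OF d(1) c] act_gsum[OF d(2) _ c(2)] assms(3) by simp
  next
    case False
    then have "x \<notin> set (concat ds)" using assms(3) by simp
    then show ?thesis using False act_gsum_outside by metis
  qed
qed

lemma cyc_sys_mset:
  assumes "cyc_sys cs" "mset ds = mset cs"
  shows "cyc_sys ds"
proof -
  have s: "set ds = set cs" using assms(2) by (metis set_mset_mset)
  have ne: "[] \<notin> set cs" using assms(1) by (fastforce simp: cyc_sys_def)
  have "distinct cs" using assms(1) ne by (metis cyc_sys_def distinct_concat_iff removeAll_id)
  then have "distinct ds" using assms(2) mset_eq_imp_distinct_iff by blast
  then have "distinct (concat ds)"
    using assms(1) s ne by (simp add: cyc_sys_def distinct_concat_iff)
  then show ?thesis using assms(1) s by (simp add: cyc_sys_def)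
qed

lemma odd_cycles_in_Dn:
  assumes "g \<in> Gn n" "cyc_sys cs" "act (gsum cs) = act g" "\<And>c. c \<in> set cs \<Longrightarrow> odd (length c)"
  shows "\<exists>\<alpha>\<in>EP_upto n. g \<in> Dn \<alpha> n \<or> zz + g \<in> Dn \<alpha> n"
proof -
  define \<alpha> where "\<alpha> = mset (map (\<lambda>c. length c - 1) cs)"
  \<comment> \<open>The cycles are arranged by decreasing length, the order in which
    \<open>parts_list\<close> enumerates the parts.\<close>
  define ds where "ds = rev (sort_key length cs)"
  have ds: "cyc_sys ds" "set ds = set cs"
    using cyc_sys_mset[OF assms(2), of ds] by (auto simp: ds_def)
  have EP: "\<alpha> \<in> EP" using assms(2,4) by (fastforce simp: EP_def \<alpha>_def cyc_sys_def)
  have "sorted_list_of_multiset \<alpha> = map (\<lambda>c. length c - 1) (sort_key length cs)"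
    unfolding \<alpha>_def sorted_list_of_multiset_mset
  proof (rule properties_for_sort)
    have "sorted (map length (sort_key length cs))" by (rule sorted_sort_key)
    then show "sorted (map (\<lambda>c. length c - 1) (sort_key length cs))"
      by (simp add: sorted_iff_nth_mono diff_le_mono)
  qed simp
  then have pl: "parts_list \<alpha> = map (\<lambda>c. length c - 1) ds"
    by (simp add: parts_list_def ds_def rev_map)
  have "map Suc (parts_list \<alpha>) = map length ds"
    unfolding pl using ds(1) by (auto simp: cyc_sys_def)
  then have ct: "cyc_of_type \<alpha> ds" using ds(1) by (simp add: cyc_of_type_def cyc_sys_def)
  have a: "act (csum ds) = act g"
    using act_gsum_cong[OF ds(1) assms(2) ds(2)] assms(3) by (simp only: act_csum)
  have sub: "set (concat ds) \<subseteq> {1..n}"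
    using cyc_of_type(6)[OF EP ct] assms(1) unfolding a Gn_def by blast
  have "sum_mset \<alpha> + size \<alpha> = card (set (concat ds))"
    using cyc_of_type(4)[OF EP ct] ds(1) by (metis cyc_sys_def distinct_card)
  also have "\<dots> \<le> n" using card_mono[OF _ sub] by simp
  finally have "\<alpha> \<in> EP_upto n" using EP by (simp add: EP_upto_def)
  moreover have "csum ds \<in> Dn \<alpha> n" using Dn_eq[OF EP] ct sub by blast
  moreover have "csum ds = g \<or> csum ds = zz + g" by (rule act_eq[OF a])
  ultimately show ?thesis by metis
qed

text \<open>The conjugating element is the even-length cycle itself. It is odd, it commutes with its
  own factor, and it supercommutes with the remaining cycles. Their product is odd because g is
  even, so exactly one sign appears.\<close>

lemma even_cycle_conj:
  assumes "cyc_sys cs" "act (gsum cs) = act g" "\<not> odd_sp g" "c \<in> set cs" "even (length c)"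
  shows "gcy c + g = zz + g + gcy c"
proof -
  obtain xs ys where cs: "cs = xs @ c # ys" using assms(4) by (meson split_list)
  have d: "distinct (concat cs)" using assms(1) by (simp add: cyc_sys_def)
  have ne: "e \<noteq> []" if "e \<in> set cs" for e using assms(1) that by (fastforce simp: cyc_sys_def)
  let ?a = "gcy c"
  have oa: "odd_sp ?a" using odd_sp_gcy[of c] d ne[OF assms(4)] assms(5) cs by auto
  have fx: "act ?a x = x" if "x \<in> set (concat xs) \<union> set (concat ys)" for x
    using that d cs by (intro act_gcy_outside) auto
  have 1: "?a + gsum xs = zs (odd_sp (gsum xs)) + gsum xs + ?a"
    using add_gsum_fixed[of xs ?a] d ne fx oa cs by simp
  have 2: "?a + gsum ys = zs (odd_sp (gsum ys)) + gsum ys + ?a"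
    using add_gsum_fixed[of ys ?a] d ne fx oa cs by simp
  have g: "g = gsum cs \<or> g = zz + gsum cs" using assms(2) act_eq by metis
  then have "\<not> odd_sp (gsum cs)" using assms(3) by auto
  then have par: "(odd_sp (gsum xs) \<noteq> odd_sp (gsum ys)) = True" using cs oa by auto
  have "?a + gsum cs = (?a + gsum xs) + (?a + gsum ys)" by (simp add: cs add.assoc)
  also have "\<dots> = zs (odd_sp (gsum xs)) + (gsum xs + (?a + (zs (odd_sp (gsum ys)) + (gsum ys + ?a))))"
    unfolding 1 2 by (simp only: add.assoc)
  also have "\<dots> = zs (odd_sp (gsum xs)) + (zs (odd_sp (gsum ys)) + (gsum xs + (?a + (gsum ys + ?a))))"
    by (simp only: zs_left_commute[of ?a] zs_left_commute[of "gsum xs"])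
  also have "\<dots> = zz + gsum cs + ?a"
    unfolding zs_zs_add par by (simp add: cs add.assoc)
  finally have e: "?a + gsum cs = zz + gsum cs + ?a" .
  from g show ?thesis
  proof
    assume "g = zz + gsum cs"
    then show ?thesis using e zz_left_commute[of ?a "gsum cs"] by (simp add: add.assoc)
  qed (use e in simp)
qed

section \<open>The even centre and its expansion in class sums\<close>

definition dn :: "nat multiset \<Rightarrow> nat \<Rightarrow> salg" where
  "dn \<alpha> n = (\<Sum>g\<in>Dn \<alpha> n. el g)"

lemma co_dn: "co h (dn \<alpha> n) = of_bool (h \<in> Dn \<alpha> n) - of_bool (zz + h \<in> Dn \<alpha> n)"
proof -
  have "co h (dn \<alpha> n) = (\<Sum>g\<in>Dn \<alpha> n. (if g = h then 1 else 0) - (if g = zz + h then 1 else 0))"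
    unfolding dn_def co_sum
  proof (rule sum.cong)
    fix g
    show "co h (el g) = (if g = h then 1 else 0) - (if g = zz + h then 1 else 0)"
      by (cases "g = h"; cases "g = zz + h") (simp_all add: co_el zz_add_eq_iff)
  qed (rule HOL.refl)
  then show ?thesis unfolding sum_subtractf sum.delta[OF finite_Dn] by simp
qed

definition even_center :: "nat \<Rightarrow> salg set" where
  "even_center n = {x. supp_salg x \<subseteq> Gn n \<and> (\<forall>g\<in>supp_salg x. \<not> odd_sp g) \<and>
     (\<forall>a\<in>Gn n. el a * x = x * el a)}"

lemma even_centerI:
  assumes "\<And>g. g \<in> supp_salg x \<Longrightarrow> g \<in> Gn n \<and> \<not> odd_sp g" "\<And>a. a \<in> Gn n \<Longrightarrow> el a * x = x * el a"
  shows "x \<in> even_center n"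
  using assms unfolding even_center_def by blast

lemma even_center_supp: "x \<in> even_center n \<Longrightarrow> g \<in> supp_salg x \<Longrightarrow> g \<in> Gn n \<and> \<not> odd_sp g"
  unfolding even_center_def by blast

lemma even_center_commute: "x \<in> even_center n \<Longrightarrow> a \<in> Gn n \<Longrightarrow> el a * x = x * el a"
  unfolding even_center_def by blast

lemma Gn_add: "a \<in> Gn n \<Longrightarrow> b \<in> Gn n \<Longrightarrow> a + b \<in> Gn n"
  by (simp add: Gn_def)

lemma Gn_0 [simp]: "0 \<in> Gn n" by (simp add: Gn_def)
lemma Gn_zz [simp]: "zz \<in> Gn n" by (simp add: Gn_def)
lemma Gn_zz_add [simp]: "zz + a \<in> Gn n \<longleftrightarrow> a \<in> Gn n" by (simp add: Gn_def)

lemma even_center_0: "0 \<in> even_center n" by (simp add: even_center_def)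
lemma even_center_1: "1 \<in> even_center n" by (rule even_centerI) (auto simp: supp_salg_1)

lemma even_center_add:
  assumes "x \<in> even_center n" "y \<in> even_center n"
  shows "x + y \<in> even_center n"
proof (rule even_centerI)
  show "g \<in> Gn n \<and> \<not> odd_sp g" if "g \<in> supp_salg (x + y)" for g
    using that supp_salg_add[of x y] even_center_supp assms by blast
  show "el a * (x + y) = (x + y) * el a" if "a \<in> Gn n" for a
    by (simp only: distrib_left distrib_right even_center_commute[OF assms(1) that] even_center_commute[OF assms(2) that])
qed

lemma even_center_of_int:
  assumes "x \<in> even_center n"
  shows "of_int k * x \<in> even_center n"
proof (rule even_centerI)
  show "g \<in> Gn n \<and> \<not> odd_sp g" if "g \<in> supp_salg (of_int k * x)" for g
    using that supp_salg_of_int[of k x] even_center_supp[OF assms] by blast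
  show "el a * (of_int k * x) = of_int k * x * el a" if "a \<in> Gn n" for a
    using even_center_commute[OF assms that] by (metis mult.assoc of_int_commute)
qed

lemma even_center_mult:
  assumes "x \<in> even_center n" "y \<in> even_center n"
  shows "x * y \<in> even_center n"
proof (rule even_centerI)
  fix g assume g: "g \<in> supp_salg (x * y)"
  obtain a b where "g = a + b" "a \<in> supp_salg x" "b \<in> supp_salg y"
    using g supp_salg_mult[of x y] by blast
  then show "g \<in> Gn n \<and> \<not> odd_sp g"
    using even_center_supp[OF assms(1), of a] even_center_supp[OF assms(2), of b] Gn_add by simp
next
  fix a assume a: "a \<in> Gn n"
  show "el a * (x * y) = x * y * el a"
    by (metis mult.assoc even_center_commute[OF assms(1) a] even_center_commute[OF assms(2) a])
qed

lemma even_center_sum: "(\<And>i. i \<in> A \<Longrightarrow> f i \<in> even_center n) \<Longrightarrow> sum f A \<in> even_center n"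
  by (induction A rule: infinite_finite_induct) (auto simp: even_center_0 even_center_add)

lemma even_center_conj:
  assumes "x \<in> even_center n" "a \<in> Gn n" "a + g = g' + a"
  shows "co g' x = co g x"
proof -
  have "el a * x * el (- a) = x * (el a * el (- a))"
    by (simp only: even_center_commute[OF assms(1,2)] mult.assoc)
  also have "\<dots> = x" by (simp flip: el_add)
  finally have "el a * x * el (- a) = x" .
  moreover have "a + g - a = g'" using assms(3) by (simp add: algebra_simps)
  ultimately show ?thesis using co_conj[of a g x] by simp
qed

text \<open>A cycle of even length in g would make g conjugate to \<open>zz + g\<close>. A central
  element has equal coefficients there, but \<open>co\<close> changes sign under \<open>zz\<close>,
  so the coefficient would vanish.\<close>

lemma even_center_co:
  assumes "x \<in> even_center n" "co g x \<noteq> 0"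
  shows "\<exists>\<alpha>\<in>EP_upto n. g \<in> Dn \<alpha> n \<or> zz + g \<in> Dn \<alpha> n"
proof -
  have g: "g \<in> Gn n" "\<not> odd_sp g"
    using even_center_supp[OF assms(1), of g] assms(2) by (simp_all add: supp_salg_def)
  obtain cs where cs: "cyc_sys cs" "act (gsum cs) = act g" using ex_cyc_sys by blast
  have "odd (length c)" if c: "c \<in> set cs" for c
  proof (rule ccontr)
    assume "\<not> odd (length c)"
    then have e: "gcy c + g = zz + g + gcy c" using even_cycle_conj[OF cs g(2) c] by simp
    have "set c \<subseteq> {x. act g x \<noteq> x}" using moved_gsum[OF cs(1)] c unfolding cs(2) by auto
    then have "set c \<subseteq> {1..n}" using g(1) by (auto simp: Gn_def)
    then have "co (zz + g) x = co g x" by (intro even_center_conj[OF assms(1) gcy_Gn e])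
    then show False using assms(2) by (simp add: co_zz_add)
  qed
  then show ?thesis by (intro odd_cycles_in_Dn[OF g(1) cs])
qed

lemma Dn_conj_closed:
  assumes "\<alpha> \<in> EP" "a \<in> Gn n" "g \<in> Dn \<alpha> n"
  shows "a + g - a \<in> Dn \<alpha> n"
proof -
  obtain cs where cs: "cyc_of_type \<alpha> cs" "set (concat cs) \<subseteq> {1..n}" "g = csum cs"
    using assms(3) Dn_eq[OF assms(1)] by auto
  let ?ds = "map (map (act a)) cs"
  have "a + g = csum ?ds + a"
    using add_csum[of cs a] cyc_of_type(2)[OF assms(1) cs(1)] cs by (simp add: cyc_of_type_def)
  then have e: "a + g - a = csum ?ds" by (simp add: algebra_simps)
  have "distinct (map (act a) (concat cs))"
    using cs(1) by (simp add: cyc_of_type_def distinct_map inj_on_def)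
  then have ct: "cyc_of_type \<alpha> ?ds"
    using cs(1) by (simp add: cyc_of_type_def comp_def map_concat[symmetric])
  have "act a x \<in> {1..n}" if "x \<in> {1..n}" for x
    using that assms(2) act_eq_iff[of a] unfolding Gn_def by (metis (mono_tags, lifting) mem_Collect_eq)
  then have "set (concat ?ds) \<subseteq> {1..n}" using cs(2) by auto
  then show ?thesis unfolding e using Dn_eq[OF assms(1)] ct by blast
qed

lemma dn_even_center:
  assumes "\<alpha> \<in> EP"
  shows "dn \<alpha> n \<in> even_center n"
proof -
  have supp: "g \<in> Dn \<alpha> n \<or> zz + g \<in> Dn \<alpha> n" if "g \<in> supp_salg (dn \<alpha> n)" for g
    using that by (auto simp: supp_salg_def co_dn split: if_splits)
  have "g \<in> Gn n \<and> \<not> odd_sp g" if "g \<in> supp_salg (dn \<alpha> n)" for g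
    using supp[OF that] even_DD[OF assms, of g] even_DD[OF assms, of "zz + g"] by (auto simp: Dn_def)
  moreover have "el a * dn \<alpha> n = dn \<alpha> n * el a" if a: "a \<in> Gn n" for a
  proof -
    let ?c = "\<lambda>g. a + g - a"
    have inj: "inj_on ?c (Dn \<alpha> n)"
      by (rule inj_onI) (simp only: diff_conv_add_uminus add_right_cancel add_left_cancel)
    have "?c ` Dn \<alpha> n = Dn \<alpha> n"
      using endo_inj_surj[OF finite_Dn _ inj] Dn_conj_closed[OF assms a] by blast
    then have "dn \<alpha> n * el a = (\<Sum>g\<in>?c ` Dn \<alpha> n. el (g + a))"
      by (simp add: dn_def sum_distrib_right el_add)
    also have "\<dots> = (\<Sum>g\<in>Dn \<alpha> n. el (a + g))" unfolding sum.reindex[OF inj] by simp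
    finally show ?thesis by (simp add: dn_def sum_distrib_left el_add)
  qed
  ultimately show ?thesis by (intro even_centerI)
qed

fun blocks :: "nat \<Rightarrow> nat list \<Rightarrow> nat list list" where
  "blocks k [] = []"
| "blocks k (p # ps) = [k + 1..<k + p + 2] # blocks (k + p + 1) ps"

lemma blocks: "map length (blocks k ps) = map Suc ps" "set (concat (blocks k ps)) = {k<..k + sum_list ps + length ps}"
  "distinct (concat (blocks k ps))"
  by (induction ps arbitrary: k) (auto simp del: upt_Suc)

text \<open>The cycles occupy consecutive intervals, so exactly an initial segment of the positive
  integers is moved. The same element represents the class for every n at which the class is not
  empty, and coefficients for different n can be compared at it.\<close>

definition rep :: "nat multiset \<Rightarrow> sp" where
  "rep \<nu> = csum (blocks 0 (parts_list \<nu>))"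

lemma rep:
  assumes "\<nu> \<in> EP"
  shows "rep \<nu> \<in> DD \<nu>" "{x. act (rep \<nu>) x \<noteq> x} = {1..sum_mset \<nu> + size \<nu>}"
proof -
  have ct: "cyc_of_type \<nu> (blocks 0 (parts_list \<nu>))"
    by (simp add: cyc_of_type_def blocks)
  have s: "set (concat (blocks 0 (parts_list \<nu>))) = {1..sum_mset \<nu> + size \<nu>}"
    unfolding blocks(2) by auto
  show "rep \<nu> \<in> DD \<nu>" unfolding rep_def DD_def using ct s by fastforce
  show "{x. act (rep \<nu>) x \<noteq> x} = {1..sum_mset \<nu> + size \<nu>}"
    using cyc_of_type(6)[OF assms ct] s by (simp add: rep_def)
qed

lemma rep_Dn: "\<nu> \<in> EP \<Longrightarrow> sum_mset \<nu> + size \<nu> \<le> n \<Longrightarrow> rep \<nu> \<in> Dn \<nu> n"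
proof -
  assume a: "\<nu> \<in> EP" "sum_mset \<nu> + size \<nu> \<le> n"
  have "act (rep \<nu>) x = x" if "x \<notin> {1..n}" for x
  proof -
    have "x \<notin> {1..sum_mset \<nu> + size \<nu>}" using that a(2) by auto
    then show ?thesis unfolding rep(2)[OF a(1), symmetric] by simp
  qed
  then show ?thesis using rep(1)[OF a(1)] by (simp add: Dn_def Gn_def)
qed

lemma finite_EP_upto: "finite (EP_upto n)"
proof (rule finite_subset)
  show "finite (mset ` {xs. set xs \<subseteq> {..n} \<and> length xs \<le> n})"
    by (intro finite_imageI finite_lists_length_le) simp
  show "EP_upto n \<subseteq> mset ` {xs. set xs \<subseteq> {..n} \<and> length xs \<le> n}"
  proof
    fix \<nu> assume \<nu>: "\<nu> \<in> EP_upto n"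
    have "p \<le> n" if "p \<in># \<nu>" for p
      using member_le_sum_list[of p "parts_list \<nu>"] that \<nu> by (simp add: EP_upto_def)
    then have "parts_list \<nu> \<in> {xs. set xs \<subseteq> {..n} \<and> length xs \<le> n}" using \<nu> by (auto simp: EP_upto_def)
    then show "\<nu> \<in> mset ` {xs. set xs \<subseteq> {..n} \<and> length xs \<le> n}"
      by (intro image_eqI[of _ _ "parts_list \<nu>"]) simp_all
  qed
qed

lemma co_dn_disjoint:
  assumes "\<alpha> \<in> EP" "\<beta> \<in> EP" "\<alpha> \<noteq> \<beta>" "h \<in> Dn \<beta> n \<or> zz + h \<in> Dn \<beta> n"
  shows "co h (dn \<alpha> n) = 0"
proof -
  have "ctype (act h) = \<beta>" using assms(4) DD_ctype[OF assms(2), of h] DD_ctype[OF assms(2), of "zz + h"] by (auto simp: Dn_def)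
  then have "h \<notin> Dn \<alpha> n" "zz + h \<notin> Dn \<alpha> n" using assms(3) DD_ctype[OF assms(1), of h] DD_ctype[OF assms(1), of "zz + h"] by (auto simp: Dn_def)
  then show ?thesis by (simp add: co_dn)
qed

lemma co_combination:
  assumes "\<beta> \<in> EP_upto n" "h \<in> Dn \<beta> n"
  shows "co h (\<Sum>\<alpha>\<in>EP_upto n. of_int (c \<alpha>) * dn \<alpha> n) = c \<beta>"
proof -
  have EP: "\<alpha> \<in> EP" if "\<alpha> \<in> EP_upto n" for \<alpha> using that by (simp add: EP_upto_def)
  have "co h (\<Sum>\<alpha>\<in>EP_upto n. of_int (c \<alpha>) * dn \<alpha> n) = (\<Sum>\<alpha>\<in>EP_upto n. if \<alpha> = \<beta> then c \<alpha> else 0)"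
    unfolding co_sum
  proof (rule sum.cong)
    fix \<alpha> assume \<alpha>: "\<alpha> \<in> EP_upto n"
    show "co h (of_int (c \<alpha>) * dn \<alpha> n) = (if \<alpha> = \<beta> then c \<alpha> else 0)"
    proof (cases "\<alpha> = \<beta>")
      case True
      then show ?thesis using assms zz_add_notin_Dn[OF EP[OF \<alpha>]] by (simp add: co_dn)
    next
      case False
      then show ?thesis using co_dn_disjoint[OF EP[OF \<alpha>] EP[OF assms(1)]] assms(2) by simp
    qed
  qed (rule HOL.refl)
  then show ?thesis using assms(1) by (simp add: sum.delta[OF finite_EP_upto])
qed

lemma EP_upto_rep: "\<nu> \<in> EP_upto n \<Longrightarrow> rep \<nu> \<in> Dn \<nu> n"
  by (simp add: EP_upto_def rep_Dn)

lemma even_center_co_eq: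
  assumes "x \<in> even_center n" "\<alpha> \<in> EP" "g \<in> Dn \<alpha> n" "h \<in> Dn \<alpha> n"
  shows "co g x = co h x"
proof -
  obtain a where "a \<in> Gn n" "a + h = g + a" using DD_transitive[OF assms(2,4,3)] by blast
  then show ?thesis by (rule even_center_conj[OF assms(1)])
qed

text \<open>Both sides agree at the chosen representatives, hence by conjugation on whole classes
  and by oddness of \<open>co\<close> on their translates by \<open>zz\<close>. Everywhere else both
  vanish by \<open>even_center_co\<close>.\<close>

lemma even_center_expand:
  assumes "x \<in> even_center n"
  shows "x = (\<Sum>\<alpha>\<in>EP_upto n. of_int (co (rep \<alpha>) x) * dn \<alpha> n)" (is "x = ?S")
proof (rule salg_eqI)
  fix h
  have EP: "\<alpha> \<in> EP" if "\<alpha> \<in> EP_upto n" for \<alpha> using that by (simp add: EP_upto_def)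
  have S: "?S \<in> even_center n"
    using EP by (intro even_center_sum even_center_of_int dn_even_center)
  have main: "co h x = co h ?S" if "\<alpha> \<in> EP_upto n" "h \<in> Dn \<alpha> n" for h \<alpha>
    using co_combination[OF that] even_center_co_eq[OF assms EP[OF that(1)] that(2) EP_upto_rep[OF that(1)]]
    by simp
  show "co h x = co h ?S"
  proof (cases "\<exists>\<alpha>\<in>EP_upto n. h \<in> Dn \<alpha> n \<or> zz + h \<in> Dn \<alpha> n")
    case True
    then obtain \<alpha> where \<alpha>: "\<alpha> \<in> EP_upto n" "h \<in> Dn \<alpha> n \<or> zz + h \<in> Dn \<alpha> n" by blast
    then have "co h x = co h ?S \<or> co (zz + h) x = co (zz + h) ?S" using main by blast
    then show ?thesis by (simp only: co_zz_add neg_equal_iff_equal disj_absorb)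
  next
    case False
    then have "co h x = 0" "co h ?S = 0" using even_center_co assms S by blast+
    then show ?thesis by simp
  qed
qed

section \<open>The quotient of the integral group ring inside the model\<close>

definition push :: "('a \<Rightarrow> 'b) \<Rightarrow> ('a \<Rightarrow>\<^sub>0 int) \<Rightarrow> ('b \<Rightarrow>\<^sub>0 int)" where
  "push u f = (\<Sum>a\<in>Poly_Mapping.keys f. Poly_Mapping.single (u a) (Poly_Mapping.lookup f a))"

lemma push_superset:
  assumes "finite A" "Poly_Mapping.keys f \<subseteq> A"
  shows "push u f = (\<Sum>a\<in>A. Poly_Mapping.single (u a) (Poly_Mapping.lookup f a))"
  unfolding push_def using assms
  by (intro sum.mono_neutral_left) (auto simp: in_keys_iff)

lemma push_0 [simp]: "push u 0 = 0" by (simp add: push_def)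

lemma push_add: "push u (f + g) = push u f + push u g"
proof -
  let ?A = "Poly_Mapping.keys f \<union> Poly_Mapping.keys g"
  have k: "Poly_Mapping.keys (f + g) \<subseteq> ?A" by (rule keys_add)
  have "push u (f + g) = (\<Sum>a\<in>?A. Poly_Mapping.single (u a) (Poly_Mapping.lookup (f + g) a))"
    by (rule push_superset[OF _ k]) simp
  also have "\<dots> = (\<Sum>a\<in>?A. Poly_Mapping.single (u a) (Poly_Mapping.lookup f a))
      + (\<Sum>a\<in>?A. Poly_Mapping.single (u a) (Poly_Mapping.lookup g a))"
    by (simp add: lookup_add single_add sum.distrib)
  also have "\<dots> = push u f + push u g"
    by (intro arg_cong2[where f = "(+)"] push_superset[symmetric]) auto
  finally show ?thesis .
qed

lemma push_single: "push u (Poly_Mapping.single a k) = Poly_Mapping.single (u a) k"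
  by (simp add: push_def)

lemma push_uminus: "push u (- f) = - push u f"
  using push_add[of u f "- f"] by (simp add: eq_neg_iff_add_eq_0 add.commute)

lemma push_diff: "push u (f - g) = push u f - push u g"
  using push_add[of u f "- g"] by (simp add: push_uminus)

lemma push_sum: "push u (sum f A) = (\<Sum>x\<in>A. push u (f x))"
  by (induction A rule: infinite_finite_induct) (simp_all add: push_add)

lemma lookup_push:
  assumes "inj_on u A" "Poly_Mapping.keys f \<subseteq> A" "a \<in> A"
  shows "Poly_Mapping.lookup (push u f) (u a) = Poly_Mapping.lookup f a"
proof -
  have "Poly_Mapping.lookup (push u f) (u a)
      = (\<Sum>b\<in>Poly_Mapping.keys f. if b = a then Poly_Mapping.lookup f b else 0)"
    unfolding push_def lookup_sum
  proof (rule sum.cong)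
    fix b assume "b \<in> Poly_Mapping.keys f"
    then have "u b = u a \<longleftrightarrow> b = a" using assms by (auto dest: inj_onD)
    then show "Poly_Mapping.lookup (Poly_Mapping.single (u b) (Poly_Mapping.lookup f b)) (u a)
        = (if b = a then Poly_Mapping.lookup f b else 0)"
      by (simp add: lookup_single when_def)
  qed (rule HOL.refl)
  then show ?thesis by (simp add: sum.delta in_keys_iff)
qed

lemma push_inj:
  assumes "inj_on u A" "Poly_Mapping.keys f \<subseteq> A" "Poly_Mapping.keys g \<subseteq> A" "push u f = push u g"
  shows "f = g"
proof (rule poly_mapping_eqI)
  fix a
  show "Poly_Mapping.lookup f a = Poly_Mapping.lookup g a"
  proof (cases "a \<in> A")
    case True
    then show ?thesis using lookup_push[OF assms(1,2)] lookup_push[OF assms(1,3)] assms(4) by metis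
  next
    case False
    then show ?thesis using assms(2,3) by (metis in_keys_iff subsetD)
  qed
qed

abbreviation sgr :: "nat \<Rightarrow> (spin_elt \<Rightarrow>\<^sub>0 int) ring" where
  "sgr n \<equiv> int_group_ring (spin_group n)"

lemma sgr_carrier: "f \<in> carrier (sgr n) \<longleftrightarrow> Poly_Mapping.keys f \<subseteq> carrier (spin_group n)"
  by (simp add: int_group_ring_def)

lemma sgr_simps: "f \<oplus>\<^bsub>sgr n\<^esub> g = f + g" "\<zero>\<^bsub>sgr n\<^esub> = 0" "\<one>\<^bsub>sgr n\<^esub> = Poly_Mapping.single \<one>\<^bsub>spin_group n\<^esub> 1"
  by (simp_all add: int_group_ring_def)

lemma keys_sum_subset:
  assumes "\<And>i. i \<in> I \<Longrightarrow> Poly_Mapping.keys (f i) \<subseteq> A"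
  shows "Poly_Mapping.keys (sum f I) \<subseteq> A"
  using assms
proof (induction I rule: infinite_finite_induct)
  case (insert i I)
  then show ?case using keys_add[of "f i" "sum f I"] by auto
qed simp_all

lemma sgr_mult_closed:
  assumes "f \<in> carrier (sgr n)" "g \<in> carrier (sgr n)"
  shows "f \<otimes>\<^bsub>sgr n\<^esub> g \<in> carrier (sgr n)"
proof -
  have 1: "Poly_Mapping.keys (Poly_Mapping.single (a \<otimes>\<^bsub>spin_group n\<^esub> b) k) \<subseteq> carrier (spin_group n)"
    if "a \<in> Poly_Mapping.keys f" "b \<in> Poly_Mapping.keys g" for a b and k :: int
  proof -
    have "a \<in> carrier (spin_group n)" "b \<in> carrier (spin_group n)"
      using that assms unfolding sgr_carrier by blast+
    then show ?thesis by (simp add: spin_mult_closed)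
  qed
  have 2: "f \<otimes>\<^bsub>sgr n\<^esub> g = (\<Sum>a\<in>Poly_Mapping.keys f. \<Sum>b\<in>Poly_Mapping.keys g.
      Poly_Mapping.single (a \<otimes>\<^bsub>spin_group n\<^esub> b) (Poly_Mapping.lookup f a * Poly_Mapping.lookup g b))"
    by (simp add: int_group_ring_def)
  show ?thesis unfolding sgr_carrier 2 by (intro keys_sum_subset 1)
qed

lemma push_mult:
  assumes "f \<in> carrier (sgr n)" "g \<in> carrier (sgr n)"
  shows "push (iota n) (f \<otimes>\<^bsub>sgr n\<^esub> g) = push (iota n) f * push (iota n) g"
proof -
  have "push (iota n) (f \<otimes>\<^bsub>sgr n\<^esub> g) = (\<Sum>a\<in>Poly_Mapping.keys f. \<Sum>b\<in>Poly_Mapping.keys g.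
      Poly_Mapping.single (iota n (a \<otimes>\<^bsub>spin_group n\<^esub> b)) (Poly_Mapping.lookup f a * Poly_Mapping.lookup g b))"
    by (simp add: int_group_ring_def push_sum push_single)
  also have "\<dots> = (\<Sum>a\<in>Poly_Mapping.keys f. \<Sum>b\<in>Poly_Mapping.keys g.
      Poly_Mapping.single (iota n a) (Poly_Mapping.lookup f a) * Poly_Mapping.single (iota n b) (Poly_Mapping.lookup g b))"
    using assms unfolding sgr_carrier
    by (intro sum.cong HOL.refl) (auto simp: mult_single iota_mult subset_eq)
  finally show ?thesis unfolding push_def sum_product .
qed

lemma push_one: "push (iota n) \<one>\<^bsub>sgr n\<^esub> = 1"
  by (simp add: sgr_simps push_single)

lemma sgr_eqI:
  assumes "f \<in> carrier (sgr n)" "g \<in> carrier (sgr n)" "push (iota n) f = push (iota n) g"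
  shows "f = g"
  using push_inj[OF iota_inj] assms unfolding sgr_carrier by blast

lemma sgr_one_closed: "\<one>\<^bsub>sgr n\<^esub> \<in> carrier (sgr n)"
  by (simp add: sgr_carrier sgr_simps spin_one_closed)

lemma sgr_add_closed: "f \<in> carrier (sgr n) \<Longrightarrow> g \<in> carrier (sgr n) \<Longrightarrow> f + g \<in> carrier (sgr n)"
  unfolding sgr_carrier using keys_add[of f g] by blast

lemma sgr_uminus_closed: "f \<in> carrier (sgr n) \<Longrightarrow> - f \<in> carrier (sgr n)"
  unfolding sgr_carrier by simp

lemma sgr_diff_closed: "f \<in> carrier (sgr n) \<Longrightarrow> g \<in> carrier (sgr n) \<Longrightarrow> f - g \<in> carrier (sgr n)"
  using sgr_add_closed[of f n "- g"] sgr_uminus_closed by simp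

lemma sgr_0_closed: "0 \<in> carrier (sgr n)" by (simp add: sgr_carrier)

lemma ring_sgr: "ring (sgr n)"
proof (rule ringI)
  show "abelian_group (sgr n)"
  proof (rule abelian_groupI)
    fix x assume "x \<in> carrier (sgr n)"
    then show "\<exists>y\<in>carrier (sgr n). y \<oplus>\<^bsub>sgr n\<^esub> x = \<zero>\<^bsub>sgr n\<^esub>"
      using sgr_uminus_closed by (intro bexI[of _ "- x"]) (simp_all add: sgr_simps)
  qed (auto simp: sgr_simps sgr_add_closed sgr_0_closed add.assoc add.commute)
  show "Group.monoid (sgr n)"
  proof (rule monoidI)
    fix x y z assume x: "x \<in> carrier (sgr n)" and y: "y \<in> carrier (sgr n)" and z: "z \<in> carrier (sgr n)"
    show "x \<otimes>\<^bsub>sgr n\<^esub> y \<otimes>\<^bsub>sgr n\<^esub> z = x \<otimes>\<^bsub>sgr n\<^esub> (y \<otimes>\<^bsub>sgr n\<^esub> z)"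
      using x y z by (intro sgr_eqI[of _ n]) (auto simp: sgr_mult_closed push_mult mult.assoc)
  next
    fix x assume x: "x \<in> carrier (sgr n)"
    show "\<one>\<^bsub>sgr n\<^esub> \<otimes>\<^bsub>sgr n\<^esub> x = x" "x \<otimes>\<^bsub>sgr n\<^esub> \<one>\<^bsub>sgr n\<^esub> = x"
      using x by (auto intro!: sgr_eqI[of _ n] simp: sgr_mult_closed push_mult sgr_one_closed push_one)
  qed (auto simp: sgr_mult_closed sgr_one_closed)
  fix x y z assume x: "x \<in> carrier (sgr n)" and y: "y \<in> carrier (sgr n)" and z: "z \<in> carrier (sgr n)"
  show "(x \<oplus>\<^bsub>sgr n\<^esub> y) \<otimes>\<^bsub>sgr n\<^esub> z = x \<otimes>\<^bsub>sgr n\<^esub> z \<oplus>\<^bsub>sgr n\<^esub> y \<otimes>\<^bsub>sgr n\<^esub> z"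
    "z \<otimes>\<^bsub>sgr n\<^esub> (x \<oplus>\<^bsub>sgr n\<^esub> y) = z \<otimes>\<^bsub>sgr n\<^esub> x \<oplus>\<^bsub>sgr n\<^esub> z \<otimes>\<^bsub>sgr n\<^esub> y"
    using x y z by (auto intro!: sgr_eqI[of _ n]
        simp: sgr_simps(1) sgr_mult_closed sgr_add_closed push_mult push_add distrib_left distrib_right)
qed

lemma sgr_a_inv: "f \<in> carrier (sgr n) \<Longrightarrow> \<ominus>\<^bsub>sgr n\<^esub> f = - f"
proof -
  assume f: "f \<in> carrier (sgr n)"
  interpret ring "sgr n" by (rule ring_sgr)
  show ?thesis using f sgr_uminus_closed by (intro minus_equality) (simp_all add: sgr_simps)
qed

definition psi :: "nat \<Rightarrow> (spin_elt \<Rightarrow>\<^sub>0 int) \<Rightarrow> salg" where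
  "psi n f = abs_salg (push (iota n) f)"

lemma abs_salg_eq_0: "abs_salg F = 0 \<longleftrightarrow> zeta * F = 0"
  unfolding zero_salg_def salg.abs_eq_iff by simp

lemma psi_add: "psi n (f + g) = psi n f + psi n g"
  by (simp add: psi_def push_add plus_salg.abs_eq)
lemma psi_diff: "psi n (f - g) = psi n f - psi n g"
  by (simp add: psi_def push_diff minus_salg.abs_eq)
lemma psi_0 [simp]: "psi n 0 = 0" by (simp add: psi_def zero_salg_def)
lemma psi_uminus: "psi n (- f) = - psi n f"
  using psi_diff[of n 0 f] by simp
lemma psi_sum: "psi n (sum f A) = (\<Sum>x\<in>A. psi n (f x))"
  by (induction A rule: infinite_finite_induct) (simp_all add: psi_add)
lemma psi_mult: "f \<in> carrier (sgr n) \<Longrightarrow> g \<in> carrier (sgr n) \<Longrightarrow> psi n (f \<otimes>\<^bsub>sgr n\<^esub> g) = psi n f * psi n g"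
  by (simp add: psi_def push_mult times_salg.abs_eq)
lemma psi_one: "psi n \<one>\<^bsub>sgr n\<^esub> = 1"
  by (simp add: psi_def push_one one_salg_def)
lemma psi_frag: "psi n (frag_of a) = el (iota n a)"
  by (simp add: psi_def push_single el.abs_eq)

definition psi_kernel :: "nat \<Rightarrow> (spin_elt \<Rightarrow>\<^sub>0 int) set" where
  "psi_kernel n = {f \<in> carrier (sgr n). psi n f = 0}"

lemma ideal_psi_kernel: "ideal (psi_kernel n) (sgr n)"
proof (rule idealI[OF ring_sgr])
  show "subgroup (psi_kernel n) (add_monoid (sgr n))"
  proof
    fix x assume x: "x \<in> psi_kernel n"
    then have "inv\<^bsub>add_monoid (sgr n)\<^esub> x = - x"
      using sgr_a_inv[of x n] by (simp add: a_inv_def psi_kernel_def)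
    then show "inv\<^bsub>add_monoid (sgr n)\<^esub> x \<in> psi_kernel n"
      using x sgr_uminus_closed by (simp add: psi_kernel_def psi_uminus)
  qed (auto simp: psi_kernel_def sgr_simps sgr_add_closed sgr_0_closed psi_add)
qed (auto simp: psi_kernel_def sgr_mult_closed psi_mult)

lemma lookup_single_zz_mult: "Poly_Mapping.lookup (Poly_Mapping.single zz 1 * F) a = Poly_Mapping.lookup F (zz + a)"
  for F :: "sp \<Rightarrow>\<^sub>0 int"
proof (induction F rule: single_one_induct)
  case (add F b)
  then show ?case by (simp add: distrib_left lookup_add mult_single lookup_single when_def zz_add_eq_iff)
next
  case (diff F b)
  then show ?case by (simp add: right_diff_distrib lookup_minus mult_single lookup_single when_def zz_add_eq_iff)
qed simp

lemma lookup_zeta_mult: "Poly_Mapping.lookup (zeta * F) a = Poly_Mapping.lookup F a - Poly_Mapping.lookup F (zz + a)"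
  by (simp add: zeta_def left_diff_distrib lookup_minus lookup_single_zz_mult)

lemma spin_ideal_gen_closed:
  "frag_of (spin_z n) + frag_of \<one>\<^bsub>spin_group n\<^esub> \<in> carrier (sgr n)"
  by (intro sgr_add_closed) (simp_all add: sgr_carrier spin_z_closed spin_one_closed)

lemma ideal_spin_ideal: "ideal (spin_ideal n) (sgr n)"
  unfolding spin_ideal_def
  by (intro ring.genideal_ideal[OF ring_sgr]) (simp add: spin_ideal_gen_closed)

lemma spin_ideal_gen_mem: "frag_of (spin_z n) + frag_of \<one>\<^bsub>spin_group n\<^esub> \<in> spin_ideal n"
  unfolding spin_ideal_def
  using ring.genideal_self[OF ring_sgr] spin_ideal_gen_closed by (metis empty_subsetI insert_subset)

text \<open>Vanishing under \<open>psi\<close> forces the coefficients at a and at a z to agree.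
  Subtracting their contribution c (a + a z), a multiple of the generator z + 1, removes two keys,
  which drives an induction on the number of keys.\<close>

lemma psi_kernel_subset: "f \<in> psi_kernel n \<Longrightarrow> f \<in> spin_ideal n"
proof (induction "card (Poly_Mapping.keys f)" arbitrary: f rule: less_induct)
  case less
  interpret I: ideal "spin_ideal n" "sgr n" by (rule ideal_spin_ideal)
  have fc: "f \<in> carrier (sgr n)" and f0: "psi n f = 0" using less.prems by (auto simp: psi_kernel_def)
  show ?case
  proof (cases "f = 0")
    case True
    then show ?thesis using additive_subgroup.zero_closed[OF ideal.axioms(1)[OF ideal_spin_ideal], of n]
      by (simp add: sgr_simps)
  next
    case False
    then obtain a where a: "a \<in> Poly_Mapping.keys f" by fastforce
    then have ac: "a \<in> carrier (spin_group n)" using fc by (auto simp: sgr_carrier)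
    define b where "b = a \<otimes>\<^bsub>spin_group n\<^esub> spin_z n"
    define c where "c = Poly_Mapping.lookup f a"
    have bc: "b \<in> carrier (spin_group n)" using ac by (simp add: b_def spin_mult_closed spin_z_closed)
    have ib: "iota n b = zz + iota n a" using ac by (simp add: b_def iota_mult spin_z_closed iota_spin_z zz_commute)
    have ne: "a \<noteq> b" using ib neq_zz_add by metis
    have "zeta * push (iota n) f = 0" using f0 by (simp add: psi_def abs_salg_eq_0)
    then have "Poly_Mapping.lookup (zeta * push (iota n) f) (iota n a) = 0" by simp
    then have "Poly_Mapping.lookup (push (iota n) f) (iota n a) = Poly_Mapping.lookup (push (iota n) f) (iota n b)"
      by (simp add: lookup_zeta_mult ib)
    then have fb: "Poly_Mapping.lookup f b = c"
      using lookup_push[OF iota_inj, of f n] fc ac bc by (simp add: sgr_carrier c_def)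
    define h where "h = Poly_Mapping.single a c + Poly_Mapping.single b c"
    have sc: "Poly_Mapping.single a c \<in> carrier (sgr n)" "Poly_Mapping.single b c \<in> carrier (sgr n)"
      using ac bc by (auto simp: sgr_carrier)
    have hc: "h \<in> carrier (sgr n)" unfolding h_def by (intro sgr_add_closed sc)
    let ?g = "frag_of (spin_z n) + frag_of \<one>\<^bsub>spin_group n\<^esub>"
    have "Poly_Mapping.single a c \<otimes>\<^bsub>sgr n\<^esub> ?g = h"
    proof (rule sgr_eqI[of _ n])
      show "push (iota n) (Poly_Mapping.single a c \<otimes>\<^bsub>sgr n\<^esub> ?g) = push (iota n) h"
        unfolding push_mult[OF sc(1) spin_ideal_gen_closed] h_def push_add push_single iota_one iota_spin_z ib
        by (simp add: distrib_left mult_single zz_commute add.commute)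
    qed (use sc hc spin_ideal_gen_closed sgr_mult_closed in auto)
    then have hI: "h \<in> spin_ideal n"
      using I.I_l_closed[OF spin_ideal_gen_mem sc(1)] by simp
    have hk: "psi n h = 0"
      by (simp add: psi_def h_def push_add push_single ib abs_salg_eq_0 zeta_def algebra_simps mult_single)
    have "f - h \<in> psi_kernel n"
      using fc hc f0 hk by (simp add: psi_kernel_def sgr_diff_closed psi_diff)
    moreover have "card (Poly_Mapping.keys (f - h)) < card (Poly_Mapping.keys f)"
    proof (rule psubset_card_mono)
      have "Poly_Mapping.lookup (f - h) x = (if x = a \<or> x = b then 0 else Poly_Mapping.lookup f x)" for x
        using ne fb by (simp add: h_def lookup_minus lookup_add lookup_single when_def c_def)
      then have "x \<in> Poly_Mapping.keys (f - h) \<longleftrightarrow> x \<in> Poly_Mapping.keys f - {a, b}" for x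
        unfolding in_keys_iff Diff_iff by simp
      then have "Poly_Mapping.keys (f - h) = Poly_Mapping.keys f - {a, b}" by blast
      then show "Poly_Mapping.keys (f - h) \<subset> Poly_Mapping.keys f" using a by blast
    qed simp
    ultimately have "f - h \<in> spin_ideal n" using less.hyps by blast
    then have "(f - h) \<oplus>\<^bsub>sgr n\<^esub> h \<in> spin_ideal n" using hI I.a_closed by blast
    then show ?thesis by (simp add: sgr_simps)
  qed
qed

lemma spin_ideal_eq: "spin_ideal n = psi_kernel n"
proof
  have "psi n (frag_of (spin_z n) + frag_of \<one>\<^bsub>spin_group n\<^esub>) = 0"
    by (simp add: psi_add psi_frag iota_spin_z)
  then have "frag_of (spin_z n) + frag_of \<one>\<^bsub>spin_group n\<^esub> \<in> psi_kernel n"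
    using spin_ideal_gen_closed by (simp add: psi_kernel_def)
  then show "spin_ideal n \<subseteq> psi_kernel n"
    unfolding spin_ideal_def by (intro ring.genideal_minimal[OF ring_sgr ideal_psi_kernel]) simp
  show "psi_kernel n \<subseteq> spin_ideal n" using psi_kernel_subset by blast
qed

lemma ring_spin_algebra: "ring (spin_algebra n)"
  unfolding spin_algebra_def by (rule ideal.quotient_is_ring[OF ideal_spin_ideal])

lemma to_spin_hom: "to_spin_algebra n \<in> ring_hom (sgr n) (spin_algebra n)"
  using ideal.rcos_ring_hom[OF ideal_spin_ideal, of n]
  unfolding spin_algebra_def to_spin_algebra_def[abs_def] .

lemma spin_algebra_carrier: "carrier (spin_algebra n) = to_spin_algebra n ` carrier (sgr n)"
  by (auto simp: spin_algebra_def FactRing_def A_RCOSETS_def' to_spin_algebra_def)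

lemma to_spin_eq_iff:
  assumes "f \<in> carrier (sgr n)" "g \<in> carrier (sgr n)"
  shows "to_spin_algebra n f = to_spin_algebra n g \<longleftrightarrow> psi n f = psi n g"
proof -
  have "f \<ominus>\<^bsub>sgr n\<^esub> g = f - g" using assms by (simp add: a_minus_def sgr_a_inv sgr_simps)
  then have "to_spin_algebra n f = to_spin_algebra n g \<longleftrightarrow> f - g \<in> spin_ideal n"
    using ring.quotient_eq_iff_same_a_r_cos[OF ring_sgr ideal_spin_ideal assms]
    by (simp add: to_spin_algebra_def)
  also have "\<dots> \<longleftrightarrow> psi n f = psi n g"
    using assms by (simp add: spin_ideal_eq psi_kernel_def sgr_diff_closed psi_diff)
  finally show ?thesis .
qed

definition Psi :: "nat \<Rightarrow> (spin_elt \<Rightarrow>\<^sub>0 int) set \<Rightarrow> salg" where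
  "Psi n X = psi n (SOME f. f \<in> carrier (sgr n) \<and> X = to_spin_algebra n f)"

lemma Psi_to_spin: "f \<in> carrier (sgr n) \<Longrightarrow> Psi n (to_spin_algebra n f) = psi n f"
proof -
  assume f: "f \<in> carrier (sgr n)"
  define g where "g = (SOME g. g \<in> carrier (sgr n) \<and> to_spin_algebra n f = to_spin_algebra n g)"
  have "g \<in> carrier (sgr n) \<and> to_spin_algebra n f = to_spin_algebra n g"
    unfolding g_def by (rule someI[of _ f]) (simp add: f)
  then have "psi n g = psi n f" using to_spin_eq_iff[OF f, of g] by simp
  then show ?thesis unfolding Psi_def g_def .
qed

lemma Psi_inj: "inj_on (Psi n) (carrier (spin_algebra n))"
proof (rule inj_onI)
  fix X Y assume X: "X \<in> carrier (spin_algebra n)" and Y: "Y \<in> carrier (spin_algebra n)" and e: "Psi n X = Psi n Y"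
  obtain f where f: "f \<in> carrier (sgr n)" "X = to_spin_algebra n f" using X spin_algebra_carrier by auto
  obtain g where g: "g \<in> carrier (sgr n)" "Y = to_spin_algebra n g" using Y spin_algebra_carrier by auto
  show "X = Y"
    using e unfolding f(2) g(2) Psi_to_spin[OF f(1)] Psi_to_spin[OF g(1)] to_spin_eq_iff[OF f(1) g(1)] .
qed

lemma Psi_hom:
  assumes "X \<in> carrier (spin_algebra n)" "Y \<in> carrier (spin_algebra n)"
  shows "Psi n (X \<otimes>\<^bsub>spin_algebra n\<^esub> Y) = Psi n X * Psi n Y"
    "Psi n (X \<oplus>\<^bsub>spin_algebra n\<^esub> Y) = Psi n X + Psi n Y"
proof -
  obtain f where f: "f \<in> carrier (sgr n)" "X = to_spin_algebra n f" using assms(1) spin_algebra_carrier by auto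
  obtain g where g: "g \<in> carrier (sgr n)" "Y = to_spin_algebra n g" using assms(2) spin_algebra_carrier by auto
  show "Psi n (X \<otimes>\<^bsub>spin_algebra n\<^esub> Y) = Psi n X * Psi n Y"
    using ring_hom_mult[OF to_spin_hom f(1) g(1), symmetric] f g
    by (simp add: Psi_to_spin sgr_mult_closed psi_mult)
  show "Psi n (X \<oplus>\<^bsub>spin_algebra n\<^esub> Y) = Psi n X + Psi n Y"
    using ring_hom_add[OF to_spin_hom f(1) g(1), symmetric] f g
    by (simp add: Psi_to_spin sgr_simps sgr_add_closed psi_add)
qed

lemma Psi_one: "Psi n \<one>\<^bsub>spin_algebra n\<^esub> = 1"
  using ring_hom_one[OF to_spin_hom, of n] Psi_to_spin[OF sgr_one_closed, of n] psi_one by simp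

lemma Psi_zero: "Psi n \<zero>\<^bsub>spin_algebra n\<^esub> = 0"
proof -
  interpret ring "spin_algebra n" by (rule ring_spin_algebra)
  show ?thesis using Psi_hom(2)[OF zero_closed zero_closed] by simp
qed

lemma Psi_finsum:
  assumes "finite A" "\<And>i. i \<in> A \<Longrightarrow> F i \<in> carrier (spin_algebra n)"
  shows "Psi n (\<Oplus>\<^bsub>spin_algebra n\<^esub>i\<in>A. F i) = (\<Sum>i\<in>A. Psi n (F i))"
proof -
  interpret ring "spin_algebra n" by (rule ring_spin_algebra)
  show ?thesis using assms
    by (induction A rule: finite_induct) (simp_all add: Psi_zero Psi_hom Pi_def finsum_closed)
qed

lemma Psi_list_prod:
  assumes "set xs \<subseteq> carrier (spin_algebra n)"
  shows "list_prod (spin_algebra n) xs \<in> carrier (spin_algebra n) \<and>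
    Psi n (list_prod (spin_algebra n) xs) = prod_list (map (Psi n) xs)"
proof -
  interpret ring "spin_algebra n" by (rule ring_spin_algebra)
  show ?thesis using assms by (induction xs) (auto simp: Psi_one Psi_hom)
qed

lemma Psi_add_pow:
  assumes "X \<in> carrier (spin_algebra n)"
  shows "Psi n ([(k::int)] \<cdot>\<^bsub>spin_algebra n\<^esub> X) = of_int k * Psi n X"
proof -
  interpret ring "spin_algebra n" by (rule ring_spin_algebra)
  have nat: "Psi n ([(m::nat)] \<cdot>\<^bsub>spin_algebra n\<^esub> X) = of_nat m * Psi n X" for m
    by (induction m) (simp_all add: add.nat_pow_Suc Psi_zero Psi_hom assms algebra_simps)
  have neg: "Psi n (\<ominus>\<^bsub>spin_algebra n\<^esub> Y) = - Psi n Y" if "Y \<in> carrier (spin_algebra n)" for Y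
    using Psi_hom(2)[of Y n "\<ominus>\<^bsub>spin_algebra n\<^esub> Y"] that by (simp add: r_neg Psi_zero eq_neg_iff_add_eq_0 add.commute)
  show ?thesis
  proof (cases "0 \<le> k")
    case True
    then have "[k] \<cdot>\<^bsub>spin_algebra n\<^esub> X = [nat k] \<cdot>\<^bsub>spin_algebra n\<^esub> X"
      unfolding add_pow_def int_pow_def2 by (intro if_not_P) simp
    then show ?thesis using nat[of "nat k"] True by simp
  next
    case False
    then have "[k] \<cdot>\<^bsub>spin_algebra n\<^esub> X = \<ominus>\<^bsub>spin_algebra n\<^esub> ([nat (- k)] \<cdot>\<^bsub>spin_algebra n\<^esub> X)"
      unfolding add_pow_def int_pow_def2 a_inv_def by (intro if_P) simp
    then show ?thesis using nat[of "nat (- k)"] neg[of "[nat (- k)] \<cdot>\<^bsub>spin_algebra n\<^esub> X"] False assms by simp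
  qed
qed

section \<open>Class sums, their coordinates and the odd Jucys--Murphy elements in the model\<close>

lemma D_class_Dn:
  assumes "\<alpha> \<in> EP"
  shows "D_class \<alpha> n \<subseteq> carrier (spin_group n)" "iota n ` D_class \<alpha> n = Dn \<alpha> n"
proof -
  have c: "list_prod (spin_group n) (map (spin_cycle n) cs) \<in> carrier (spin_group n) \<and>
      iota n (list_prod (spin_group n) (map (spin_cycle n) cs)) = csum cs"
    if cs: "cyc_of_type \<alpha> cs" "set (concat cs) \<subseteq> {1..n}" for cs
  proof -
    have sys: "cyc_sys cs" and o: "\<And>c. c \<in> set cs \<Longrightarrow> odd (length c)"
      using cyc_of_type(1,2)[OF assms cs(1)] by auto
    have s: "spin_cycle n c \<in> carrier (spin_group n) \<and> iota n (spin_cycle n c) = cyc c" if "c \<in> set cs" for c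
    proof -
      have "distinct c" "set c \<subseteq> {1..n}" "2 \<le> length c"
        using that sys cs(2) distinct_cyc by (auto simp: cyc_sys_def)
      then show ?thesis using spin_cycle[of c n] o[OF that] by (simp add: cyc_def)
    qed
    then have sub: "set (map (spin_cycle n) cs) \<subseteq> carrier (spin_group n)" by auto
    have "map (iota n) (map (spin_cycle n) cs) = map cyc cs" using s by simp
    then show ?thesis using iota_list_prod[OF sub] by (simp only: csum_def)
  qed
  have D: "D_class \<alpha> n = {list_prod (spin_group n) (map (spin_cycle n) cs) | cs.
      cyc_of_type \<alpha> cs \<and> set (concat cs) \<subseteq> {1..n}}"
    unfolding D_class_def cyc_of_type_def by (simp only: conj_assoc)
  show "D_class \<alpha> n \<subseteq> carrier (spin_group n)" unfolding D using c by blast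
  show "iota n ` D_class \<alpha> n = Dn \<alpha> n" unfolding D Dn_eq[OF assms] using c by (auto simp: image_iff) (metis c)
qed

lemma d_sum:
  assumes "\<alpha> \<in> EP"
  shows "d_sum \<alpha> n \<in> carrier (spin_algebra n)" "Psi n (d_sum \<alpha> n) = dn \<alpha> n"
proof -
  have c: "(\<Sum>g\<in>D_class \<alpha> n. frag_of g) \<in> carrier (sgr n)"
    unfolding sgr_carrier using D_class_Dn(1)[OF assms] by (intro keys_sum_subset) auto
  show "d_sum \<alpha> n \<in> carrier (spin_algebra n)"
    unfolding d_sum_def spin_algebra_carrier using c by blast
  have inj: "inj_on (iota n) (D_class \<alpha> n)"
    using iota_inj D_class_Dn(1)[OF assms] inj_on_subset by blast
  have "Psi n (d_sum \<alpha> n) = (\<Sum>g\<in>D_class \<alpha> n. el (iota n g))"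
    by (simp add: d_sum_def Psi_to_spin[OF c] psi_sum psi_frag)
  also have "\<dots> = dn \<alpha> n" unfolding dn_def D_class_Dn(2)[OF assms, symmetric] sum.reindex[OF inj] by simp
  finally show "Psi n (d_sum \<alpha> n) = dn \<alpha> n" .
qed

text \<open>Existence of the coordinates is \<open>even_center_expand\<close>, uniqueness is
  \<open>co_combination\<close>; both are carried back along the injective map
  \<open>Psi n\<close>.\<close>

lemma class_coeffs:
  assumes "v \<in> carrier (spin_algebra n)" "Psi n v \<in> even_center n"
  shows "class_coeffs n v = (\<lambda>\<nu>. if \<nu> \<in> EP_upto n then co (rep \<nu>) (Psi n v) else 0)"
  unfolding class_coeffs_def
proof (rule the_equality)
  interpret ring "spin_algebra n" by (rule ring_spin_algebra)
  have EP: "\<alpha> \<in> EP" if "\<alpha> \<in> EP_upto n" for \<alpha> using that by (simp add: EP_upto_def)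
  have c: "[k] \<cdot>\<^bsub>spin_algebra n\<^esub> d_sum \<nu> n \<in> carrier (spin_algebra n)" if "\<nu> \<in> EP_upto n" for \<nu> and k :: int
    using d_sum(1)[OF EP[OF that]] by simp
  have P: "Psi n (\<Oplus>\<^bsub>spin_algebra n\<^esub>\<nu>\<in>EP_upto n. [a \<nu>] \<cdot>\<^bsub>spin_algebra n\<^esub> d_sum \<nu> n)
      = (\<Sum>\<nu>\<in>EP_upto n. of_int (a \<nu>) * dn \<nu> n)" for a :: "nat multiset \<Rightarrow> int"
    using c EP by (simp add: Psi_finsum[OF finite_EP_upto] Psi_add_pow d_sum)
  have cl: "(\<Oplus>\<^bsub>spin_algebra n\<^esub>\<nu>\<in>EP_upto n. [a \<nu>] \<cdot>\<^bsub>spin_algebra n\<^esub> d_sum \<nu> n) \<in> carrier (spin_algebra n)"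
    for a :: "nat multiset \<Rightarrow> int"
    using c by (intro finsum_closed) auto
  let ?a = "\<lambda>\<nu>. if \<nu> \<in> EP_upto n then co (rep \<nu>) (Psi n v) else 0"
  show "(\<forall>\<nu>. \<nu> \<notin> EP_upto n \<longrightarrow> ?a \<nu> = 0) \<and>
      v = (\<Oplus>\<^bsub>spin_algebra n\<^esub>\<nu>\<in>EP_upto n. [?a \<nu>] \<cdot>\<^bsub>spin_algebra n\<^esub> d_sum \<nu> n)"
  proof (intro conjI allI impI)
    have "Psi n v = (\<Sum>\<nu>\<in>EP_upto n. of_int (?a \<nu>) * dn \<nu> n)"
      using even_center_expand[OF assms(2)] by simp
    then show "v = (\<Oplus>\<^bsub>spin_algebra n\<^esub>\<nu>\<in>EP_upto n. [?a \<nu>] \<cdot>\<^bsub>spin_algebra n\<^esub> d_sum \<nu> n)"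
      using inj_onD[OF Psi_inj _ assms(1) cl[of ?a]] P[of ?a] by simp
  qed simp
  fix a :: "nat multiset \<Rightarrow> int"
  assume a: "(\<forall>\<nu>. \<nu> \<notin> EP_upto n \<longrightarrow> a \<nu> = 0) \<and>
      v = (\<Oplus>\<^bsub>spin_algebra n\<^esub>\<nu>\<in>EP_upto n. [a \<nu>] \<cdot>\<^bsub>spin_algebra n\<^esub> d_sum \<nu> n)"
  then have "Psi n v = (\<Sum>\<nu>\<in>EP_upto n. of_int (a \<nu>) * dn \<nu> n)" using P by blast
  then have "co (rep \<nu>) (Psi n v) = a \<nu>" if "\<nu> \<in> EP_upto n" for \<nu>
    using co_combination[OF that EP_upto_rep[OF that]] by simp
  then show "a = ?a" using a by auto
qed

lemma struct_coeff_eq: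
  assumes "\<alpha> \<in> EP" "\<beta> \<in> EP" "\<nu> \<in> EP_upto n"
  shows "struct_coeff \<alpha> \<beta> \<nu> n = co (rep \<nu>) (dn \<alpha> n * dn \<beta> n)"
proof -
  interpret ring "spin_algebra n" by (rule ring_spin_algebra)
  have c: "d_sum \<alpha> n \<otimes>\<^bsub>spin_algebra n\<^esub> d_sum \<beta> n \<in> carrier (spin_algebra n)"
    using d_sum(1) assms by simp
  have P: "Psi n (d_sum \<alpha> n \<otimes>\<^bsub>spin_algebra n\<^esub> d_sum \<beta> n) = dn \<alpha> n * dn \<beta> n"
    using d_sum assms by (simp add: Psi_hom)
  have "dn \<alpha> n * dn \<beta> n \<in> even_center n"
    using assms dn_even_center even_center_mult by simp
  then show ?thesis unfolding struct_coeff_def using class_coeffs[OF c] P assms(3) by simp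
qed

definition MM :: "nat \<Rightarrow> salg" where
  "MM k = (\<Sum>i\<in>{1..<k}. el (tt i k))"

lemma JM:
  assumes "k \<le> n"
  shows "JM n k \<in> carrier (spin_algebra n)" "Psi n (JM n k) = MM k"
proof -
  have s: "spin_cycle n [i, k] \<in> carrier (spin_group n)" "iota n (spin_cycle n [i, k]) = tt i k"
    if "i \<in> {1..<k}" for i
    using spin_cycle[of "[i, k]" n] that assms by (auto simp: gcy_def)
  have c: "(\<Sum>i\<in>{1..<k}. frag_of (spin_cycle n [i, k])) \<in> carrier (sgr n)"
    unfolding sgr_carrier using s(1) by (intro keys_sum_subset) auto
  show "JM n k \<in> carrier (spin_algebra n)"
    unfolding JM_def spin_algebra_carrier using c by blast
  show "Psi n (JM n k) = MM k"
    unfolding JM_def Psi_to_spin[OF c] psi_sum psi_frag MM_def using s(2) by simp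
qed

lemma e_sym:
  "e_sym r n \<in> carrier (spin_algebra n)"
  "Psi n (e_sym r n) = (\<Sum>I\<in>{I. I \<subseteq> {1..n} \<and> card I = r}. prod_list (map (\<lambda>k. MM k * MM k) (sorted_list_of_set I)))"
proof -
  interpret ring "spin_algebra n" by (rule ring_spin_algebra)
  let ?F = "\<lambda>I. list_prod (spin_algebra n) (map (\<lambda>k. JM n k \<otimes>\<^bsub>spin_algebra n\<^esub> JM n k) (sorted_list_of_set I))"
  have s: "?F I \<in> carrier (spin_algebra n)"
    "Psi n (?F I) = prod_list (map (\<lambda>k. MM k * MM k) (sorted_list_of_set I))" if "I \<subseteq> {1..n}" for I
  proof -
    have "finite I" using that finite_subset by blast
    then have l: "set (sorted_list_of_set I) \<subseteq> {1..n}" using that by simp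
    have J: "JM n k \<in> carrier (spin_algebra n)" "Psi n (JM n k) = MM k" if "k \<in> set (sorted_list_of_set I)" for k
      using JM[of k n] l that by auto
    let ?xs = "map (\<lambda>k. JM n k \<otimes>\<^bsub>spin_algebra n\<^esub> JM n k) (sorted_list_of_set I)"
    have sub: "set ?xs \<subseteq> carrier (spin_algebra n)" using J(1) by auto
    have "map (Psi n) ?xs = map (\<lambda>k. MM k * MM k) (sorted_list_of_set I)"
      unfolding map_map o_def using J by (intro map_cong HOL.refl) (simp add: Psi_hom)
    then show "?F I \<in> carrier (spin_algebra n)"
      "Psi n (?F I) = prod_list (map (\<lambda>k. MM k * MM k) (sorted_list_of_set I))"
      using Psi_list_prod[OF sub] by (simp_all only:)
  qed
  have fin: "finite {I. I \<subseteq> {1..n} \<and> card I = r}" by simp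
  show "e_sym r n \<in> carrier (spin_algebra n)"
    unfolding e_sym_def using s(1) by (intro finsum_closed) auto
  have "Psi n (e_sym r n) = (\<Sum>I\<in>{I. I \<subseteq> {1..n} \<and> card I = r}. Psi n (?F I))"
    unfolding e_sym_def by (rule Psi_finsum[OF fin]) (use s(1) in blast)
  also have "\<dots> = (\<Sum>I\<in>{I. I \<subseteq> {1..n} \<and> card I = r}. prod_list (map (\<lambda>k. MM k * MM k) (sorted_list_of_set I)))"
    by (rule sum.cong[OF HOL.refl]) (use s(2) in blast)
  finally show "Psi n (e_sym r n) = \<dots>" .
qed

section \<open>Structure polynomials\<close>

definition wsum :: "(nat \<times> nat) list \<Rightarrow> sp" where
  "wsum L = sum_list (map (\<lambda>(i, j). tt i j) L)"

lemma wsum_simps [simp]: "wsum [] = 0" "wsum ((i, j) # L) = tt i j + wsum L" "wsum (L @ L') = wsum L + wsum L'"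
  by (simp_all add: wsum_def)

lemma label_wsum:
  assumes "\<And>i j. (i, j) \<in> set L \<Longrightarrow> f i = f j"
  shows "f (act (wsum L) x) = f x"
  using assms
proof (induction L arbitrary: x)
  case (Cons e L)
  obtain i j where e: "e = (i, j)" by (cases e)
  have "f i = f j" using Cons.prems e by simp
  then have "f (transpose i j y) = f y" for y by (simp add: transpose_def)
  then show ?case using Cons e by simp
qed simp

text \<open>A labelling of the points that is constant along the transpositions of \<open>L\<close>: each
  transposition merges at most two labels, so many labels remain.\<close>
lemma ex_label:
  "\<exists>f :: nat \<Rightarrow> nat. (\<forall>i j. (i, j) \<in> set L \<longrightarrow> f i = f j) \<and> N \<le> card (f ` {1..N}) + length L"
proof (induction L)
  case Nil
  show ?case by (rule exI[of _ id]) simp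
next
  case (Cons e L)
  obtain i j where e: "e = (i, j)" by (cases e)
  obtain f :: "nat \<Rightarrow> nat" where f: "\<And>i j. (i, j) \<in> set L \<Longrightarrow> f i = f j" "N \<le> card (f ` {1..N}) + length L"
    using Cons by blast
  define f' where "f' x = (if f x = f i then f j else f x)" for x
  have "f ` {1..N} \<subseteq> insert (f i) (f' ` {1..N})"
  proof
    fix y assume "y \<in> f ` {1..N}"
    then obtain x where x: "x \<in> {1..N}" "y = f x" by blast
    show "y \<in> insert (f i) (f' ` {1..N})"
    proof (cases "f x = f i")
      case False
      then have "y = f' x" using x by (simp add: f'_def)
      then show ?thesis using x by blast
    qed (use x in simp)
  qed
  then have "card (f ` {1..N}) \<le> card (insert (f i) (f' ` {1..N}))"
    by (intro card_mono) auto
  also have "\<dots> \<le> Suc (card (f' ` {1..N}))" by (rule card_insert_le_m1) simp_all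
  finally have "N \<le> card (f' ` {1..N}) + length (e # L)" using f(2) by simp
  moreover have "f' k = f' l" if "(k, l) \<in> set (e # L)" for k l
    using that f(1) e by (auto simp: f'_def)
  ultimately show ?case by blast
qed

lemma in_set_tl: "x \<in> set (tl c) \<Longrightarrow> x \<in> set c"
  by (cases c) auto

text \<open>A labelling that g preserves is constant on orbits, and g has N minus the sum of
  \<open>\<nu>\<close> orbits on {1..N}. If the number of labels reaches this bound, different
  orbits carry different labels, so a fixed point shares its label with no other point.\<close>

lemma label_DD:
  assumes "\<nu> \<in> EP" "g \<in> Dn \<nu> N" "\<And>x. f (act g x) = f x"
  shows "card (f ` {1..N}) + sum_mset \<nu> \<le> N"
    "N \<le> card (f ` {1..N}) + sum_mset \<nu> \<Longrightarrow> x \<in> {1..N} \<Longrightarrow> y \<in> {1..N} \<Longrightarrow> act g x = x \<Longrightarrow> f y = f x \<Longrightarrow> y = x"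
proof -
  obtain cs where cs: "cyc_of_type \<nu> cs" "set (concat cs) \<subseteq> {1..N}" "g = csum cs"
    using assms(2) Dn_eq[OF assms(1)] by auto
  have sys: "cyc_sys cs" and d: "distinct (concat cs)"
    using cyc_of_type(1)[OF assms(1) cs(1)] by (auto simp: cyc_sys_def)
  have ne: "c \<noteq> []" if "c \<in> set cs" for c using sys that by (fastforce simp: cyc_sys_def)
  have fc: "f x = f (hd c)" if c: "c \<in> set cs" "x \<in> set c" for c x
  proof -
    have h: "hd c \<in> set c" using ne[OF c(1)] by simp
    then obtain n where "x = (cycle_of_list c ^^ n) (hd c)"
      using range_cycle[OF distinct_cyc[OF d c(1)] h] c(2) by auto
    then have x: "x = (act g ^^ n) (hd c)"
      using act_gsum_funpow[OF d c(1) h] cs(3) by (simp add: act_csum)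
    have "f ((act g ^^ n) z) = f z" for z by (induction n) (simp_all add: assms(3))
    then show ?thesis using x by simp
  qed
  \<comment> \<open>A transversal of the orbits of g on {1..N}: the first entry of each cycle and
    all fixed points.\<close>
  define R where "R = {1..N} - set (concat (map tl cs))"
  have sub: "set (concat (map tl cs)) \<subseteq> set (concat cs)"
    by (auto dest: in_set_tl)
  have dt: "distinct (concat (map tl cs))" and lt: "length (concat (map tl cs)) = sum_mset \<nu>"
  proof -
    have "distinct (concat (map tl xs)) \<and> set (concat (map tl xs)) \<subseteq> set (concat xs)"
      if "distinct (concat xs)" for xs :: "nat list list"
      using that
    proof (induction xs)
      case (Cons a xs)
      then show ?case using distinct_tl[of a] in_set_tl[of _ a] by auto
    qed simp
    then show "distinct (concat (map tl cs))" using d by blast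
    have "map length (map tl cs) = parts_list \<nu>"
    proof -
      have "map length (map tl cs) = map (\<lambda>k. k - 1) (map length cs)" by simp
      also have "\<dots> = map (\<lambda>k. k - 1) (map Suc (parts_list \<nu>))" using cs(1) by (simp only: cyc_of_type_def)
      finally show ?thesis by (simp add: comp_def)
    qed
    then show "length (concat (map tl cs)) = sum_mset \<nu>" by (simp add: length_concat)
  qed
  have cR: "card R + sum_mset \<nu> = N"
  proof -
    have "card (set (concat (map tl cs))) = sum_mset \<nu>" using distinct_card[OF dt] lt by simp
    moreover have "card (set (concat (map tl cs))) \<le> N"
      using card_mono[of "{1..N}" "set (concat (map tl cs))"] sub cs(2) by fastforce
    ultimately show ?thesis unfolding R_def using sub cs(2)
      by (subst card_Diff_subset) auto
  qed
  have hR: "hd c \<in> R" if c: "c \<in> set cs" for c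
  proof -
    have h: "hd c \<in> set c" using ne[OF c] by simp
    have "hd c \<notin> set (tl c')" if c': "c' \<in> set cs" for c'
    proof (cases "c' = c")
      case True
      then show ?thesis using distinct_cyc[OF d c] ne[OF c] by (cases c) auto
    next
      case False
      then have "set c \<inter> set c' = {}" using d c c' by (metis distinct_concat_iff)
      then show ?thesis using h in_set_tl[of "hd c" c'] by blast
    qed
    moreover have "hd c \<in> {1..N}" using h c cs(2) by auto
    ultimately show ?thesis by (auto simp: R_def)
  qed
  \<comment> \<open>The alternative keeps track of fixed points: a point is its own representative,
    or else both it and its representative are moved. The second half of the lemma needs
    this.\<close>
  have rr: "\<exists>z\<in>R. f z = f x \<and> (z = x \<or> act g x \<noteq> x \<and> act g z \<noteq> z)" if x: "x \<in> {1..N}" for x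
  proof (cases "x \<in> R")
    case False
    then obtain c where c: "c \<in> set cs" "x \<in> set (tl c)" using x by (auto simp: R_def)
    then have xc: "x \<in> set c" using in_set_tl by metis
    have "x \<in> set (concat cs)" "hd c \<in> set (concat cs)" using c(1) xc hd_in_set[OF ne[OF c(1)]] by auto
    then have "act g x \<noteq> x" "act g (hd c) \<noteq> hd c"
      using cyc_of_type(6)[OF assms(1) cs(1)] cs(3) by blast+
    then show ?thesis using hR[OF c(1)] fc[OF c(1) xc] by metis
  qed blast
  have im: "f ` {1..N} = f ` R"
  proof
    show "f ` {1..N} \<subseteq> f ` R" using rr by (metis image_eqI image_subsetI)
  qed (auto simp: R_def)
  have fR: "finite R" by (simp add: R_def)
  show "card (f ` {1..N}) + sum_mset \<nu> \<le> N" unfolding im using card_image_le[OF fR, of f] cR by simp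
  assume "N \<le> card (f ` {1..N}) + sum_mset \<nu>"
  then have "card (f ` R) = card R" using card_image_le[OF fR, of f] cR im by simp
  then have inj: "inj_on f R" using eq_card_imp_inj_on[OF fR] by blast
  assume x: "x \<in> {1..N}" and y: "y \<in> {1..N}" and gx: "act g x = x" and fy: "f y = f x"
  obtain z where z: "z \<in> R" "f z = f x" "z = x \<or> act g x \<noteq> x" using rr[OF x] by blast
  obtain z' where z': "z' \<in> R" "f z' = f y" "z' = y \<or> act g y \<noteq> y \<and> act g z' \<noteq> z'" using rr[OF y] by blast
  have "z = z'" using inj_onD[OF inj _ z(1) z'(1)] z(2) z'(2) fy by simp
  then show "y = x" using z z' gx by auto
qed

text \<open>A word with too few letters would leave more labels than the product has orbits.\<close>

lemma word_rank:
  assumes "\<nu> \<in> EP" "g \<in> Dn \<nu> N" "act (wsum L) = act g"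
  shows "sum_mset \<nu> \<le> length L"
proof -
  obtain f :: "nat \<Rightarrow> nat" where f: "\<And>i j. (i, j) \<in> set L \<Longrightarrow> f i = f j" "N \<le> card (f ` {1..N}) + length L"
    using ex_label by blast
  have "f (act g x) = f x" for x using label_wsum[of L f] f(1) assms(3) by metis
  then show ?thesis using label_DD(1)[OF assms(1,2), of f] f(2) by simp
qed

text \<open>In a word of minimal length the labels separate the orbits of the product, so a fixed
  point has its label to itself. A prefix of the word preserves labels and therefore fixes it
  too.\<close>

lemma word_top_fix:
  assumes "\<nu> \<in> EP" "g \<in> Dn \<nu> N" "act (wsum (L @ L')) = act g" "length (L @ L') = sum_mset \<nu>"
    "wsum L \<in> Gn N" "act g x = x"
  shows "act (wsum L) x = x"
proof (cases "x \<in> {1..N}")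
  case True
  obtain f :: "nat \<Rightarrow> nat" where f: "\<And>i j. (i, j) \<in> set (L @ L') \<Longrightarrow> f i = f j"
      "N \<le> card (f ` {1..N}) + length (L @ L')"
    using ex_label by blast
  have g: "f (act g x) = f x" for x using label_wsum[of "L @ L'" f] f(1) assms(3) by metis
  have "f (act (wsum L) x) = f x" using label_wsum[of L f] f(1) by simp
  moreover have "act (wsum L) x \<in> {1..N}"
    using True assms(5) act_eq_iff[of "wsum L"] unfolding Gn_def by (metis (mono_tags, lifting) mem_Collect_eq)
  ultimately show ?thesis
    using label_DD(2)[where f = f, OF assms(1,2) g, of x "act (wsum L) x"] True assms(6) f(2) assms(4)
    by simp
next
  case False
  then show ?thesis using assms(5) by (simp add: Gn_def)
qed

lemma word_top_edge:
  assumes "\<nu> \<in> EP" "g \<in> Dn \<nu> N" "act (wsum L) = act g" "length L = sum_mset \<nu>"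
    "(i, j) \<in> set L" "i \<noteq> j" "i \<in> {1..N}" "j \<in> {1..N}"
  shows "act g i \<noteq> i" "act g j \<noteq> j"
proof -
  obtain f :: "nat \<Rightarrow> nat" where f: "\<And>i j. (i, j) \<in> set L \<Longrightarrow> f i = f j"
      "N \<le> card (f ` {1..N}) + length L"
    using ex_label by blast
  have g: "f (act g x) = f x" for x using label_wsum[of L f] f(1) assms(3) by metis
  have "N \<le> card (f ` {1..N}) + sum_mset \<nu>" using f(2) assms(4) by simp
  note l = label_DD(2)[where f = f, OF assms(1,2) g this]
  show "act g i \<noteq> i" using l[OF assms(7,8)] f(1)[OF assms(5)] assms(6) by metis
  show "act g j \<noteq> j" using l[OF assms(8,7)] f(1)[OF assms(5)] assms(6) by metis
qed

lemma gcy_wsum: "gcy c = wsum (map (Pair (hd c)) (rev (tl c)))"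
  by (simp add: gcy_def wsum_def comp_def)

lemma DD_wsum:
  assumes "\<alpha> \<in> EP" "a \<in> DD \<alpha>"
  shows "\<exists>L. act (wsum L) = act a \<and> length L = sum_mset \<alpha>"
proof -
  obtain cs where cs: "cyc_of_type \<alpha> cs" "a = csum cs" using assms(2) by (auto simp: DD_def)
  define L where "L = concat (map (\<lambda>c. map (Pair (hd c)) (rev (tl c))) cs)"
  have "wsum L = gsum cs" unfolding L_def by (induction cs) (simp_all add: gcy_wsum)
  then have "act (wsum L) = act a" using cs(2) by (simp only: act_csum)
  moreover have "length L = sum_mset \<alpha>"
  proof -
    have "length L = sum_list (map (\<lambda>k. k - 1) (map length cs))"
      by (simp add: L_def length_concat comp_def)
    also have "map length cs = map Suc (parts_list \<alpha>)" using cs(1) by (simp only: cyc_of_type_def)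
    finally show ?thesis by (simp add: comp_def)
  qed
  ultimately show ?thesis by blast
qed

lemma Gn_cong: "act a = act b \<Longrightarrow> a \<in> Gn n \<longleftrightarrow> b \<in> Gn n"
  by (simp add: Gn_def)

text \<open>Concatenating transposition words for a and b gives a word for g. Its length bounds the
  degree of g, and in the case of equality the word is minimal: the prefix a fixes each fixed point
  of g, and then so does b.\<close>

lemma DD_product:
  assumes "\<alpha> \<in> EP" "\<beta> \<in> EP" "\<nu> \<in> EP" "a \<in> Dn \<alpha> N" "b \<in> Dn \<beta> N" "g \<in> Dn \<nu> N" "act (a + b) = act g"
  shows "sum_mset \<nu> \<le> sum_mset \<alpha> + sum_mset \<beta>"
    "sum_mset \<nu> = sum_mset \<alpha> + sum_mset \<beta> \<Longrightarrow> act g x = x \<Longrightarrow> act a x = x \<and> act b x = x"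
proof -
  obtain La where La: "act (wsum La) = act a" "length La = sum_mset \<alpha>"
    using DD_wsum[OF assms(1)] assms(4) by (auto simp: Dn_def)
  obtain Lb where Lb: "act (wsum Lb) = act b" "length Lb = sum_mset \<beta>"
    using DD_wsum[OF assms(2)] assms(5) by (auto simp: Dn_def)
  have L: "act (wsum (La @ Lb)) = act g" using La Lb assms(7) by (simp only: wsum_simps act_add)
  show "sum_mset \<nu> \<le> sum_mset \<alpha> + sum_mset \<beta>"
    using word_rank[OF assms(3,6) L] La Lb by simp
  assume e: "sum_mset \<nu> = sum_mset \<alpha> + sum_mset \<beta>" and gx: "act g x = x"
  have "wsum La \<in> Gn N" using Gn_cong[OF La(1)] assms(4) by (simp add: Dn_def)
  then have ax: "act a x = x"
    using word_top_fix[OF assms(3,6) L _ _ gx] La Lb e by simp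
  have "act a (act b x) = x" using assms(7) gx by (metis act_add o_apply)
  then have "act a (act b x) = act a x" using ax by (simp only:)
  then have "act b x = x" by (simp only: act_eq_iff)
  then show "act a x = x \<and> act b x = x" using ax by simp
qed

section \<open>Dependence of products of class sums on n\<close>

definition moved :: "sp \<Rightarrow> nat set" where "moved a = {x. act a x \<noteq> x}"

lemma Dn_moved: "\<alpha> \<in> EP \<Longrightarrow> a \<in> Dn \<alpha> n \<longleftrightarrow> a \<in> DD \<alpha> \<and> moved a \<subseteq> {1..n}"
  by (auto simp: Dn_def Gn_def moved_def)

text \<open>Pairs are classified by the union of their supports, as in the Farahat--Higman argument,
  because this set is what a relabelling of the points moves.\<close>

definition pairs_on :: "nat multiset \<Rightarrow> nat multiset \<Rightarrow> nat set \<Rightarrow> (sp \<times> sp) set" where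
  "pairs_on \<alpha> \<beta> U = {(a, b). a \<in> DD \<alpha> \<and> b \<in> DD \<beta> \<and> moved a \<union> moved b = U}"

definition count_on :: "nat multiset \<Rightarrow> nat multiset \<Rightarrow> sp \<Rightarrow> nat set \<Rightarrow> int" where
  "count_on \<alpha> \<beta> g U = (\<Sum>(a, b)\<in>pairs_on \<alpha> \<beta> U. co g (el (a + b)))"

text \<open>A point of {1..s} moved by neither factor would be fixed by the product, although g
  moves it. Contributing supports thus contain {1..s}, and they are grouped by their remaining
  points V.\<close>

lemma co_product_group:
  assumes "\<alpha> \<in> EP" "\<beta> \<in> EP" "moved g = {1..s}" "s \<le> n"
  shows "co g (dn \<alpha> n * dn \<beta> n) = (\<Sum>V\<in>Pow {s<..n}. count_on \<alpha> \<beta> g ({1..s} \<union> V))"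
proof -
  let ?w = "\<lambda>(a, b). co g (el (a + b))"
  let ?P = "Dn \<alpha> n \<times> Dn \<beta> n"
  define S where "S = {(a, b) \<in> ?P. {1..s} \<subseteq> moved a \<union> moved b}"
  define U where "U = (\<lambda>(a, b). (moved a \<union> moved b) - {1..s})"
  have fin: "finite ?P" by (simp add: finite_Dn)
  have fS: "finite S" unfolding S_def by (rule finite_subset[OF _ fin]) auto
  have "co g (dn \<alpha> n * dn \<beta> n) = (\<Sum>a\<in>Dn \<alpha> n. \<Sum>b\<in>Dn \<beta> n. co g (el (a + b)))"
    by (simp add: dn_def sum_product co_sum el_add)
  also have "\<dots> = sum ?w ?P" by (simp add: sum.cartesian_product)
  also have "\<dots> = sum ?w S"
  proof (rule sum.mono_neutral_right[OF fin])
    show "\<forall>x\<in>?P - S. ?w x = 0"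
    proof
      fix x assume x: "x \<in> ?P - S"
      obtain a b where ab: "x = (a, b)" by (cases x)
      then have "\<not> {1..s} \<subseteq> moved a \<union> moved b" using x by (simp add: S_def)
      then obtain y where y: "y \<in> {1..s}" "act a y = y" "act b y = y"
        unfolding moved_def by blast
      have 1: "act g y \<noteq> y" using assms(3) y(1) unfolding moved_def by blast
      have "act (a + b) y = y" "act (zz + (a + b)) y = y" using y(2,3) by simp_all
      with 1 have "a + b \<noteq> g" "zz + (a + b) \<noteq> g" by metis+
      then show "?w x = 0" using ab by (simp add: co_el)
    qed
  qed (auto simp: S_def)
  also have "\<dots> = (\<Sum>V\<in>Pow {s<..n}. sum ?w {x \<in> S. U x = V})"
  proof (rule sum.group[symmetric, OF fS])
    show "U ` S \<subseteq> Pow {s<..n}"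
    proof
      fix V assume "V \<in> U ` S"
      then obtain a b where ab: "a \<in> Dn \<alpha> n" "b \<in> Dn \<beta> n" "V = (moved a \<union> moved b) - {1..s}"
        by (auto simp: S_def U_def)
      then have "moved a \<subseteq> {1..n}" "moved b \<subseteq> {1..n}"
        using Dn_moved[OF assms(1)] Dn_moved[OF assms(2)] by blast+
      then have "V \<subseteq> {1..n} - {1..s}" using ab(3) by blast
      also have "\<dots> \<subseteq> {s<..n}" by auto
      finally show "V \<in> Pow {s<..n}" by blast
    qed
  qed simp
  also have "\<dots> = (\<Sum>V\<in>Pow {s<..n}. count_on \<alpha> \<beta> g ({1..s} \<union> V))"
    unfolding count_on_def
  proof (intro sum.cong HOL.refl)
    fix V assume V: "V \<in> Pow {s<..n}"
    have sub: "{1..s} \<union> V \<subseteq> {1..n}" using V assms(4) by auto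
    have dis: "V \<inter> {1..s} = {}" using V by auto
    show "{x \<in> S. U x = V} = pairs_on \<alpha> \<beta> ({1..s} \<union> V)"
    proof (rule Set.set_eqI)
      fix x :: "sp \<times> sp"
      obtain a b where ab: "x = (a, b)" by (cases x)
      have 1: "{1..s} \<subseteq> moved a \<union> moved b \<and> (moved a \<union> moved b) - {1..s} = V \<longleftrightarrow>
          moved a \<union> moved b = {1..s} \<union> V" using dis by blast
      have "moved a \<subseteq> {1..n} \<and> moved b \<subseteq> {1..n}" if "moved a \<union> moved b = {1..s} \<union> V"
        using that sub by blast
      then show "x \<in> {x \<in> S. U x = V} \<longleftrightarrow> x \<in> pairs_on \<alpha> \<beta> ({1..s} \<union> V)"
        unfolding S_def U_def pairs_on_def ab mem_Collect_eq case_prod_conv mem_Times_iff fst_conv snd_conv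
          Dn_moved[OF assms(1)] Dn_moved[OF assms(2)]
        using 1 by blast
    qed
  qed
  finally show ?thesis .
qed

lemma moved_conj: "moved (c + a - c) = act c ` moved a"
proof (rule Set.set_eqI)
  fix x
  have cc: "act c (act (- c) y) = y" "act (- c) (act c y) = y" for y
    by (metis act_add act_0 o_apply id_apply right_minus, metis act_add act_0 o_apply id_apply left_minus)
  have "act (c + a - c) x = act c (act a (act (- c) x))"
    by (simp only: diff_conv_add_uminus act_add o_apply)
  then have "x \<in> moved (c + a - c) \<longleftrightarrow> act (- c) x \<in> moved a"
    unfolding moved_def using cc by (metis (mono_tags, lifting) mem_Collect_eq)
  also have "\<dots> \<longleftrightarrow> x \<in> act c ` moved a" using cc by (metis imageE imageI)
  finally show "x \<in> moved (c + a - c) \<longleftrightarrow> x \<in> act c ` moved a" .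
qed

lemma DD_conj_closed:
  assumes "\<alpha> \<in> EP" "a \<in> DD \<alpha>" "act c 0 = 0"
  shows "c + a - c \<in> DD \<alpha>"
proof -
  obtain cs where cs: "cyc_of_type \<alpha> cs" "0 \<notin> set (concat cs)" "a = csum cs"
    using assms(2) by (auto simp: DD_def)
  let ?ds = "map (map (act c)) cs"
  have "c + a = csum ?ds + c"
    using add_csum[of cs c] cyc_of_type(2)[OF assms(1) cs(1)] cs by (simp add: cyc_of_type_def)
  then have e: "c + a - c = csum ?ds" by (simp add: algebra_simps)
  have "distinct (map (act c) (concat cs))"
    using cs(1) by (simp add: cyc_of_type_def distinct_map inj_on_def)
  then have ct: "cyc_of_type \<alpha> ?ds"
    using cs(1) by (simp add: cyc_of_type_def comp_def map_concat[symmetric])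
  have "0 \<notin> set (concat ?ds)"
  proof
    assume "0 \<in> set (concat ?ds)"
    moreover have "set (concat ?ds) = act c ` set (concat cs)" by (metis map_concat list.set_map)
    ultimately obtain x where "x \<in> set (concat cs)" "act c x = 0" by (metis imageE)
    then show False using cs(2) assms(3) by (metis act_eq_iff)
  qed
  then show ?thesis unfolding e DD_def using ct by blast
qed

text \<open>Simultaneous conjugation by c is a bijection between the two sets of pairs. It preserves
  the coefficient at g because c commutes with g itself and not merely up to sign.\<close>

lemma count_on_conj:
  assumes "\<alpha> \<in> EP" "\<beta> \<in> EP" "act c 0 = 0" "c + g = g + c"
  shows "count_on \<alpha> \<beta> g (act c ` U) = count_on \<alpha> \<beta> g U"
proof -
  have cc: "act (- c) (act c y) = y" for y
    by (metis act_add act_0 o_apply id_apply left_minus)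
  have c0: "act (- c) 0 = 0" using cc[of 0] assms(3) by simp
  have bk: "- c + (c + a - c) - (- c) = a" "c + (- c + a - (- c)) - c = a" for a
    by (simp_all add: algebra_simps)
  have im: "act (- c) ` act c ` U = U" using cc by (auto simp: image_image)
  show ?thesis unfolding count_on_def
  proof (rule sum.reindex_bij_witness[of _ "\<lambda>(a, b). (c + a - c, c + b - c)" "\<lambda>(a, b). (- c + a - (- c), - c + b - (- c))"])
    fix x assume "x \<in> pairs_on \<alpha> \<beta> (act c ` U)"
    then obtain a b where x: "x = (a, b)" "a \<in> DD \<alpha>" "b \<in> DD \<beta>" "moved a \<union> moved b = act c ` U"
      by (auto simp: pairs_on_def)
    show "(case case x of (a, b) \<Rightarrow> (- c + a - (- c), - c + b - (- c)) of (a, b) \<Rightarrow> (c + a - c, c + b - c)) = x"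
      using x bk by simp
    show "(case x of (a, b) \<Rightarrow> (- c + a - (- c), - c + b - (- c))) \<in> pairs_on \<alpha> \<beta> U"
      using x DD_conj_closed[OF assms(1) x(2) c0] DD_conj_closed[OF assms(2) x(3) c0] im
      by (simp add: pairs_on_def moved_conj image_Un[symmetric] del: diff_minus_eq_add)
    have "co g (el (- c + (a + b) - (- c))) = co g (el (a + b))"
    proof -
      have "- c + g - (- c) = g" using assms(4) by (simp add: add.assoc flip: assms(4))
      then have "co g (el (- c) * el (a + b) * el (- (- c))) = co g (el (a + b))"
        using co_conj[of "- c" g "el (a + b)"] by simp
      then show ?thesis by (simp add: el_add[symmetric])
    qed
    moreover have "- c + (a + b) - (- c) = (- c + a - (- c)) + (- c + b - (- c))"
      by (simp add: add.assoc)
    ultimately show "(case case x of (a, b) \<Rightarrow> (- c + a - (- c), - c + b - (- c)) of (a, b) \<Rightarrow> co g (el (a + b))) =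
        (case x of (a, b) \<Rightarrow> co g (el (a + b)))"
      using x(1) by (simp only: case_prod_conv)
  next
    fix x assume "x \<in> pairs_on \<alpha> \<beta> U"
    then obtain a b where x: "x = (a, b)" "a \<in> DD \<alpha>" "b \<in> DD \<beta>" "moved a \<union> moved b = U"
      by (auto simp: pairs_on_def)
    show "(case case x of (a, b) \<Rightarrow> (c + a - c, c + b - c) of (a, b) \<Rightarrow> (- c + a - (- c), - c + b - (- c))) = x"
      using x bk by simp
    show "(case x of (a, b) \<Rightarrow> (c + a - c, c + b - c)) \<in> pairs_on \<alpha> \<beta> (act c ` U)"
      using x DD_conj_closed[OF assms(1) x(2) assms(3)] DD_conj_closed[OF assms(2) x(3) assms(3)]
      by (simp add: pairs_on_def moved_conj image_Un[symmetric])
  qed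
qed

lemma commute_rep:
  assumes "\<nu> \<in> EP" "\<And>x. x \<in> {1..sum_mset \<nu> + size \<nu>} \<Longrightarrow> act c x = x"
  shows "c + rep \<nu> = rep \<nu> + c"
proof -
  let ?cs = "blocks 0 (parts_list \<nu>)"
  have ct: "cyc_of_type \<nu> ?cs" by (simp add: cyc_of_type_def blocks)
  have s: "act c x = x" if "x \<in> set (concat ?cs)" for x
    using that assms(2) unfolding blocks(2) by auto
  have "map (map (act c)) ?cs = ?cs"
    by (intro map_idI) (use s in auto)
  then show ?thesis
    using add_csum[of ?cs c] cyc_of_type(2)[OF assms(1) ct] ct by (simp add: rep_def cyc_of_type_def)
qed

text \<open>A permutation taking V to V' and fixing {1..s} pointwise lifts to an element that
  commutes with \<open>rep \<nu>\<close>, all of whose cycles have odd length.\<close>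

lemma count_on_card:
  assumes "\<alpha> \<in> EP" "\<beta> \<in> EP" "\<nu> \<in> EP" "s = sum_mset \<nu> + size \<nu>" "V \<subseteq> {s<..n}" "V' \<subseteq> {s<..n}" "card V = card V'"
  shows "count_on \<alpha> \<beta> (rep \<nu>) ({1..s} \<union> V) = count_on \<alpha> \<beta> (rep \<nu>) ({1..s} \<union> V')"
proof -
  have fin: "finite V" "finite V'" using assms(5,6) finite_subset by blast+
  have sub: "set (sorted_list_of_set V) \<subseteq> {s<..n}" "set (sorted_list_of_set V') \<subseteq> {s<..n}"
    using fin assms(5,6) by simp_all
  have len: "length (sorted_list_of_set V) = length (sorted_list_of_set V')" using assms(7) by simp
  obtain p where p: "p permutes {s<..n}" "map p (sorted_list_of_set V) = sorted_list_of_set V'"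
    using ex_permutes_map[OF _ _ _ len sub] by auto
  obtain c where c: "act c = p" using ex_act[OF p(1)] by auto
  have "p ` V = V'" using p(2) fin by (metis list.set_map set_sorted_list_of_set)
  moreover have fx: "p x = x" if "x \<le> s" for x using p(1) that by (simp add: permutes_def)
  then have "p ` {1..s} = {1..s}" by (force simp: image_iff)
  ultimately have im: "act c ` ({1..s} \<union> V) = {1..s} \<union> V'" using c by (simp add: image_Un)
  have "c + rep \<nu> = rep \<nu> + c" using assms(4) fx c by (intro commute_rep[OF assms(3)]) auto
  then have "count_on \<alpha> \<beta> (rep \<nu>) (act c ` ({1..s} \<union> V)) = count_on \<alpha> \<beta> (rep \<nu>) ({1..s} \<union> V)"
    using c fx by (intro count_on_conj[OF assms(1,2)]) auto
  then show ?thesis using im by simp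
qed

lemma sum_Pow_card:
  fixes h :: "nat \<Rightarrow> int"
  assumes "finite X"
  shows "(\<Sum>V\<in>Pow X. h (card V)) = (\<Sum>k\<le>card X. of_nat (card X choose k) * h k)"
proof -
  have "(\<Sum>V\<in>Pow X. h (card V)) = (\<Sum>k\<le>card X. \<Sum>V | V \<in> Pow X \<and> card V = k. h (card V))"
    using assms by (intro sum.group[symmetric]) (auto intro: card_mono)
  also have "\<dots> = (\<Sum>k\<le>card X. of_nat (card X choose k) * h k)"
    by (intro sum.cong HOL.refl) (simp add: n_subsets[OF assms])
  finally show ?thesis .
qed

text \<open>The contribution of V depends only on its size k, and n - s choose k sets have that
  size, so n enters only through binomial coefficients.\<close>

lemma struct_coeff_binomial:
  assumes "\<alpha> \<in> EP" "\<beta> \<in> EP" "\<nu> \<in> EP"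
  defines "s \<equiv> sum_mset \<nu> + size \<nu>" and "K \<equiv> sum_mset \<alpha> + size \<alpha> + (sum_mset \<beta> + size \<beta>)"
  assumes "s \<le> n"
  shows "struct_coeff \<alpha> \<beta> \<nu> n = (\<Sum>k\<le>K. of_nat ((n - s) choose k) * count_on \<alpha> \<beta> (rep \<nu>) ({1..s} \<union> {s<..s + k}))"
proof -
  let ?h = "\<lambda>k. count_on \<alpha> \<beta> (rep \<nu>) ({1..s} \<union> {s<..s + k})"
  have m: "moved (rep \<nu>) = {1..s}" using rep(2)[OF assms(3)] by (simp add: moved_def s_def)
  have nu: "\<nu> \<in> EP_upto n" using assms(3,6) by (simp add: EP_upto_def s_def)
  \<comment> \<open>K is the total number of points that a pair can move, so larger unions of
    supports do not occur.\<close>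
  have h0: "?h k = 0" if "K < k" for k
  proof -
    have "pairs_on \<alpha> \<beta> ({1..s} \<union> {s<..s + k}) = {}"
    proof (rule ccontr)
      assume "pairs_on \<alpha> \<beta> ({1..s} \<union> {s<..s + k}) \<noteq> {}"
      then obtain a b where ab: "a \<in> DD \<alpha>" "b \<in> DD \<beta>" "moved a \<union> moved b = {1..s} \<union> {s<..s + k}"
        by (auto simp: pairs_on_def)
      have "card ({1..s} \<union> {s<..s + k}) = s + k" by (subst card_Un_disjoint) auto
      then have "s + k \<le> card (moved a) + card (moved b)"
        using card_Un_le[of "moved a" "moved b"] ab(3) by simp
      also have "\<dots> = K" using DD_card_moved[OF assms(1) ab(1)] DD_card_moved[OF assms(2) ab(2)]
        by (simp add: moved_def K_def)
      finally show False using that by simp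
    qed
    then show ?thesis by (simp add: count_on_def)
  qed
  have "struct_coeff \<alpha> \<beta> \<nu> n = (\<Sum>V\<in>Pow {s<..n}. count_on \<alpha> \<beta> (rep \<nu>) ({1..s} \<union> V))"
    using struct_coeff_eq[OF assms(1,2) nu] co_product_group[OF assms(1,2) m assms(6)] by simp
  also have "\<dots> = (\<Sum>V\<in>Pow {s<..n}. ?h (card V))"
  proof (intro sum.cong HOL.refl)
    fix V assume V: "V \<in> Pow {s<..n}"
    then have "card V \<le> n - s" using card_mono[of "{s<..n}" V] by simp
    then have "{s<..s + card V} \<subseteq> {s<..n}" using assms(6) by auto
    then show "count_on \<alpha> \<beta> (rep \<nu>) ({1..s} \<union> V) = ?h (card V)"
      using V by (intro count_on_card[OF assms(1-3)]) (auto simp: s_def)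
  qed
  also have "\<dots> = (\<Sum>k\<le>n - s. of_nat ((n - s) choose k) * ?h k)"
    using sum_Pow_card[of "{s<..n}" ?h] by simp
  also have "\<dots> = (\<Sum>k\<le>max K (n - s). of_nat ((n - s) choose k) * ?h k)"
    by (rule sum.mono_neutral_left) (auto simp: binomial_eq_0)
  also have "\<dots> = (\<Sum>k\<le>K. of_nat ((n - s) choose k) * ?h k)"
    by (rule sum.mono_neutral_right) (use h0 in auto)
  finally show ?thesis .
qed

lemma co_el_act: "co h (el a) \<noteq> 0 \<Longrightarrow> act a = act h"
proof -
  assume "co h (el a) \<noteq> 0"
  then have "h = a \<or> h = zz + a" by (auto simp: co_el split: if_splits)
  moreover have "act (zz + a) = act a" by simp
  ultimately show ?thesis by metis
qed

text \<open>In top degree both factors fix every fixed point of the product, so no pair has a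
  support reaching outside that of \<open>rep \<nu>\<close>. This leaves only V = {} and makes the
  coefficient independent of n.\<close>

lemma count_on_top:
  assumes "\<alpha> \<in> EP" "\<beta> \<in> EP" "\<nu> \<in> EP" "sum_mset \<nu> = sum_mset \<alpha> + sum_mset \<beta>"
    "V \<subseteq> {sum_mset \<nu> + size \<nu><..n}" "V \<noteq> {}"
  shows "count_on \<alpha> \<beta> (rep \<nu>) ({1..sum_mset \<nu> + size \<nu>} \<union> V) = 0"
  unfolding count_on_def
proof (rule sum.neutral, clarify)
  let ?s = "sum_mset \<nu> + size \<nu>"
  fix a b assume "(a, b) \<in> pairs_on \<alpha> \<beta> ({1..?s} \<union> V)"
  then have ab: "a \<in> DD \<alpha>" "b \<in> DD \<beta>" "moved a \<union> moved b = {1..?s} \<union> V" by (auto simp: pairs_on_def)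
  show "co (rep \<nu>) (el (a + b)) = 0"
  proof (rule ccontr)
    assume "co (rep \<nu>) (el (a + b)) \<noteq> 0"
    then have e: "act (a + b) = act (rep \<nu>)" by (rule co_el_act)
    obtain v where v: "v \<in> V" using assms(6) by blast
    let ?n = "max ?s n"
    have "{1..?s} \<union> V \<subseteq> {1..?n}" using assms(5) by auto
    then have "moved a \<subseteq> {1..?n}" "moved b \<subseteq> {1..?n}" using ab(3) by blast+
    then have "a \<in> Dn \<alpha> ?n" "b \<in> Dn \<beta> ?n"
      using Dn_moved[OF assms(1), of a ?n] Dn_moved[OF assms(2), of b ?n] ab(1,2) by blast+
    moreover have "rep \<nu> \<in> Dn \<nu> ?n" by (rule rep_Dn[OF assms(3)]) simp
    moreover have "v \<notin> {1..?s}" using v assms(5) by auto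
    then have "act (rep \<nu>) v = v" using rep(2)[OF assms(3)] by blast
    ultimately have "act a v = v \<and> act b v = v"
      using DD_product(2)[OF assms(1-3) _ _ _ e assms(4)] by blast
    moreover have "v \<in> moved a \<union> moved b" using v ab(3) by blast
    ultimately show False by (simp add: moved_def)
  qed
qed

lemma struct_coeff_top:
  assumes "\<alpha> \<in> EP" "\<beta> \<in> EP" "\<nu> \<in> EP" "sum_mset \<nu> = sum_mset \<alpha> + sum_mset \<beta>" "sum_mset \<nu> + size \<nu> \<le> n"
  shows "struct_coeff \<alpha> \<beta> \<nu> n = count_on \<alpha> \<beta> (rep \<nu>) {1..sum_mset \<nu> + size \<nu>}"
proof -
  let ?s = "sum_mset \<nu> + size \<nu>"
  have m: "moved (rep \<nu>) = {1..?s}" using rep(2)[OF assms(3)] by (simp add: moved_def)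
  have nu: "\<nu> \<in> EP_upto n" using assms(3,5) by (simp add: EP_upto_def)
  have "struct_coeff \<alpha> \<beta> \<nu> n = (\<Sum>V\<in>Pow {?s<..n}. count_on \<alpha> \<beta> (rep \<nu>) ({1..?s} \<union> V))"
    using struct_coeff_eq[OF assms(1,2) nu] co_product_group[OF assms(1,2) m assms(5)] by simp
  also have "\<dots> = (\<Sum>V\<in>{{}}. count_on \<alpha> \<beta> (rep \<nu>) ({1..?s} \<union> V))"
    by (rule sum.mono_neutral_right) (use count_on_top[OF assms(1-4)] in auto)
  finally show ?thesis by simp
qed

text \<open>The binomial coefficient x - s choose k as a polynomial in x.\<close>

definition binom_poly :: "nat \<Rightarrow> nat \<Rightarrow> rat poly" where
  "binom_poly s k = Polynomial.smult (1 / fact k) (\<Prod>i\<in>{0..<k}. [:- of_nat (s + i), 1:])"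

lemma poly_binom_poly: "poly (binom_poly s k) x = (x - of_nat s) gchoose k"
  by (simp add: binom_poly_def poly_prod gbinomial_prod_rev algebra_simps)

text \<open>For a negative upper index -m the value is, up to sign, the ordinary binomial
  coefficient m + k - 1 choose k.\<close>

lemma gbinomial_of_int_in_Ints: "(of_int z :: rat) gchoose k \<in> \<int>"
proof (cases "0 \<le> z")
  case True
  then have "(of_int z :: rat) gchoose k = of_nat (nat z choose k)"
    by (simp add: binomial_gbinomial)
  then show ?thesis by simp
next
  case False
  define m where "m = nat (- z) + k - 1"
  have "(of_int z :: rat) = - of_nat (nat (- z))" using False by simp
  then have "(of_int z :: rat) gchoose k = (- 1) ^ k * ((of_nat (nat (- z)) + of_nat k - 1) gchoose k)"
    by (simp only: gbinomial_minus)
  also have "(of_nat (nat (- z)) + of_nat k - 1 :: rat) = of_nat m" using False by (simp add: m_def of_nat_diff)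
  also have "(of_nat m :: rat) gchoose k = of_nat (m choose k)" by (simp add: binomial_gbinomial)
  finally show ?thesis by simp
qed

lemma binom_poly_int_valued: "binom_poly s k \<in> int_valued"
proof -
  have "poly (binom_poly s k) (of_int z) \<in> \<int>" for z
    using gbinomial_of_int_in_Ints[of "z - int s" k] by (simp add: poly_binom_poly)
  then show ?thesis by (simp add: int_valued_def)
qed

lemma int_valued_add: "p \<in> int_valued \<Longrightarrow> q \<in> int_valued \<Longrightarrow> p + q \<in> int_valued"
  by (simp add: int_valued_def)
lemma int_valued_0: "0 \<in> int_valued" by (simp add: int_valued_def)
lemma int_valued_of_int: "[:of_int k:] \<in> int_valued" by (simp add: int_valued_def)
lemma int_valued_smult: "p \<in> int_valued \<Longrightarrow> Polynomial.smult (of_int k) p \<in> int_valued"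
  by (simp add: int_valued_def)
lemma int_valued_sum: "(\<And>i. i \<in> A \<Longrightarrow> f i \<in> int_valued) \<Longrightarrow> sum f A \<in> int_valued"
  by (induction A rule: infinite_finite_induct) (auto intro: int_valued_add int_valued_0)

text \<open>The prescribed values at infinitely many integers determine a polynomial, which is the
  uniqueness required by the description in \<open>struct_poly\<close>.\<close>

lemma struct_poly_eqI:
  assumes "\<And>n. sum_mset \<nu> + size \<nu> \<le> n \<Longrightarrow> poly p (of_nat n) = of_int (struct_coeff \<alpha> \<beta> \<nu> n)"
  shows "struct_poly \<alpha> \<beta> \<nu> = p"
  unfolding struct_poly_def
proof (rule the_equality)
  let ?s = "sum_mset \<nu> + size \<nu>"
  fix q :: "rat poly"
  assume q: "\<forall>n\<ge>?s. poly q (of_nat n) = of_int (struct_coeff \<alpha> \<beta> \<nu> n)"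
  have "of_nat ` {?s..} \<subseteq> {x. poly (q - p) x = 0}" using q assms by auto
  moreover have "infinite (of_nat ` {?s..} :: rat set)"
    by (subst finite_image_iff) (auto simp: infinite_Ici inj_on_def)
  ultimately have "infinite {x. poly (q - p) x = 0}" using finite_subset by blast
  then show "q = p" using poly_roots_finite[of "q - p"] by auto
qed (use assms in blast)

lemma struct_poly_int_valued:
  assumes "\<alpha> \<in> EP" "\<beta> \<in> EP" "\<nu> \<in> EP"
  shows "struct_poly \<alpha> \<beta> \<nu> \<in> int_valued"
proof -
  define s where "s = sum_mset \<nu> + size \<nu>"
  define K where "K = sum_mset \<alpha> + size \<alpha> + (sum_mset \<beta> + size \<beta>)"
  define h where "h k = count_on \<alpha> \<beta> (rep \<nu>) ({1..s} \<union> {s<..s + k})" for k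
  have "struct_poly \<alpha> \<beta> \<nu> = (\<Sum>k\<le>K. Polynomial.smult (of_int (h k)) (binom_poly s k))"
  proof (rule struct_poly_eqI)
    fix n assume n: "sum_mset \<nu> + size \<nu> \<le> n"
    have "poly (binom_poly s k) (of_nat n) = of_nat ((n - s) choose k)" for k
      using n by (simp add: poly_binom_poly s_def binomial_gbinomial of_nat_diff)
    then show "poly (\<Sum>k\<le>K. Polynomial.smult (of_int (h k)) (binom_poly s k)) (of_nat n)
        = of_int (struct_coeff \<alpha> \<beta> \<nu> n)"
      using struct_coeff_binomial[OF assms n] by (simp add: poly_sum h_def s_def K_def mult.commute)
  qed
  then show ?thesis by (simp add: int_valued_sum int_valued_smult binom_poly_int_valued)
qed

lemma struct_poly_top:
  assumes "\<alpha> \<in> EP" "\<beta> \<in> EP" "\<nu> \<in> EP" "sum_mset \<nu> = sum_mset \<alpha> + sum_mset \<beta>" "sum_mset \<nu> + size \<nu> \<le> N"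
  shows "struct_poly \<alpha> \<beta> \<nu> = [:of_int (struct_coeff \<alpha> \<beta> \<nu> N):]"
  by (rule struct_poly_eqI) (simp add: struct_coeff_top[OF assms(1-4)] assms(5))

lemma co_dn_dn_above:
  assumes "\<alpha> \<in> EP" "\<beta> \<in> EP" "\<nu> \<in> EP_upto n" "sum_mset \<alpha> + sum_mset \<beta> < sum_mset \<nu>"
  shows "co (rep \<nu>) (dn \<alpha> n * dn \<beta> n) = 0"
proof -
  have nu: "\<nu> \<in> EP" using assms(3) by (simp add: EP_upto_def)
  have "co (rep \<nu>) (el (a + b)) = 0" if "a \<in> Dn \<alpha> n" "b \<in> Dn \<beta> n" for a b
  proof (rule ccontr)
    assume "co (rep \<nu>) (el (a + b)) \<noteq> 0"
    then have "act (a + b) = act (rep \<nu>)" by (rule co_el_act)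
    then show False
      using DD_product(1)[OF assms(1,2) nu that EP_upto_rep[OF assms(3)]] assms(4) by simp
  qed
  then show ?thesis by (simp add: dn_def sum_product co_sum flip: el_add)
qed

section \<open>Symmetric functions of the squared Jucys--Murphy elements\<close>

definition sg :: "sp \<Rightarrow> int" where "sg a = (if odd_sp a then - 1 else 1)"

lemma el_zs_add: "el (zs b + a) = of_int (if b then - 1 else 1) * el a"
  by (cases b) simp_all

lemma MM_conj:
  assumes "act a k = k" "act a ` {1..<k} = {1..<k}"
  shows "el a * MM k = of_int (sg a) * (MM k * el a)"
proof -
  have "el a * MM k = (\<Sum>i\<in>{1..<k}. of_int (sg a) * (el (tt (act a i) k) * el a))"
    unfolding MM_def sum_distrib_left
  proof (rule sum.cong[OF HOL.refl])
    fix i assume "i \<in> {1..<k}"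
    then have "a + tt i k = zs (odd_sp a) + (tt (act a i) k + a)"
      using add_tt[of i k a] assms(1) by (simp add: add.assoc)
    then have "el a * el (tt i k) = el (zs (odd_sp a) + (tt (act a i) k + a))" by (simp flip: el_add)
    then show "el a * el (tt i k) = of_int (sg a) * (el (tt (act a i) k) * el a)"
      unfolding el_zs_add sg_def by (simp add: el_add)
  qed
  also have "\<dots> = of_int (sg a) * ((\<Sum>i\<in>{1..<k}. el (tt (act a i) k)) * el a)"
    by (simp only: sum_distrib_left sum_distrib_right)
  also have "(\<Sum>i\<in>{1..<k}. el (tt (act a i) k)) = (\<Sum>i\<in>act a ` {1..<k}. el (tt i k))"
    by (subst sum.reindex) (auto simp: inj_on_def)
  also have "\<dots> = MM k" unfolding assms(2) MM_def ..
  finally show ?thesis .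
qed

lemma transpose_image_atLeastLessThan:
  assumes "i \<in> {1..<k} \<longleftrightarrow> j \<in> {1..<k}"
  shows "transpose i j ` {1..<k} = {1..<k}"
  using assms by (cases "i \<in> {1..<k}") (auto simp: transpose_def image_iff)

text \<open>Each term of \<open>MM j\<close> fixes k and permutes the points below k, so it passes
  through \<open>MM k\<close> with just the sign of an odd element.\<close>

lemma MM_anticommute:
  assumes "j < k"
  shows "MM j * MM k = - (MM k * MM j)"
proof -
  have "MM j * MM k = (\<Sum>i\<in>{1..<j}. el (tt i j) * MM k)" by (simp add: MM_def[of j] sum_distrib_right)
  also have "\<dots> = (\<Sum>i\<in>{1..<j}. - (MM k * el (tt i j)))"
  proof (rule sum.cong[OF HOL.refl])
    fix i assume i: "i \<in> {1..<j}"
    have "transpose i j ` {1..<k} = {1..<k}"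
      using i assms by (intro transpose_image_atLeastLessThan) auto
    then show "el (tt i j) * MM k = - (MM k * el (tt i j))"
      using MM_conj[of "tt i j" k] i assms by (simp add: sg_def)
  qed
  also have "\<dots> = - (MM k * MM j)" by (simp add: MM_def[of j] sum_distrib_left sum_negf)
  finally show ?thesis .
qed

definition yy :: "nat \<Rightarrow> salg" where "yy k = MM k * MM k"

lemma yy_commute: "yy j * yy k = yy k * yy j"
proof -
  have 1: "yy j * yy k = yy k * yy j" if "j < k" for j k
  proof -
    have a: "MM j * MM k = - (MM k * MM j)" using MM_anticommute that .
    have "yy j * MM k = MM k * yy j" unfolding yy_def
      by (metis a mult.assoc minus_mult_left minus_mult_right minus_minus)
    then show ?thesis unfolding yy_def by (metis mult.assoc)
  qed
  then show ?thesis by (metis linorder_neqE_nat)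
qed

text \<open>A spin analogue of the degenerate affine Hecke relation. Conjugation turns the terms of
  M_i into those of M_(i+1), except for the transposition itself; that missing term times itself
  gives the constant -1.\<close>

lemma tau_MM:
  assumes "1 \<le> i"
  shows "el (tt i (i + 1)) * MM i = - (MM (i + 1) * el (tt i (i + 1))) - 1"
proof -
  let ?t = "el (tt i (i + 1))"
  have "?t * MM i = (\<Sum>j\<in>{1..<i}. - (el (tt j (i + 1)) * ?t))"
    unfolding MM_def sum_distrib_left
  proof (rule sum.cong[OF HOL.refl])
    fix j assume "j \<in> {1..<i}"
    then have "tt i (i + 1) + tt j i = zz + (tt j (i + 1) + tt i (i + 1))"
      using add_tt[of j i "tt i (i + 1)"] by (simp add: add.assoc)
    then show "?t * el (tt j i) = - (el (tt j (i + 1)) * ?t)"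
      by (metis el_add el_zz_add)
  qed
  also have "\<dots> = - ((\<Sum>j\<in>{1..<i}. el (tt j (i + 1))) * ?t)"
    by (simp only: sum_negf sum_distrib_right)
  also have "(\<Sum>j\<in>{1..<i}. el (tt j (i + 1))) = MM (i + 1) - ?t"
  proof -
    have "{1..<i + 1} = insert i {1..<i}" using assms by auto
    then show ?thesis unfolding MM_def by simp
  qed
  also have "- ((MM (i + 1) - ?t) * ?t) = - (MM (i + 1) * ?t) + ?t * ?t"
    by (simp add: left_diff_distrib)
  also have "?t * ?t = - 1" using tt_tt[of i "i + 1"] by (simp flip: el_add)
  finally show ?thesis by simp
qed

context
  fixes t a b :: "'a :: ring_1"
  assumes ta: "t * a = - (b * t) - 1" and tt: "t * t = - 1" and ab: "a * b = - (b * a)"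
begin

lemma tau_b: "t * b = - (a * t) - 1"
proof -
  have "t * (t * a) * t = t * (- (b * t) - 1) * t" by (simp only: ta)
  then have "(t * t) * (a * t) = - (t * b * (t * t)) - t * t" by (simp add: algebra_simps)
  then have "- (a * t) = t * b + 1" by (simp add: tt)
  then show ?thesis by (simp add: algebra_simps)
qed

lemma tau_aa: "t * (a * a) = b * b * t + b - a"
proof -
  have "t * (a * a) = (- (b * t) - 1) * a" by (simp only: mult.assoc[symmetric] ta)
  also have "\<dots> = - (b * (t * a)) - a" by (simp add: algebra_simps)
  also have "\<dots> = b * b * t + b - a" unfolding ta by (simp add: algebra_simps)
  finally show ?thesis .
qed

lemma tau_bb: "t * (b * b) = a * a * t + a - b"
proof -
  have "t * (b * b) = (- (a * t) - 1) * b" by (simp only: mult.assoc[symmetric] tau_b)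
  also have "\<dots> = - (a * (t * b)) - b" by (simp add: algebra_simps)
  also have "\<dots> = a * a * t + a - b" unfolding tau_b by (simp add: algebra_simps)
  finally show ?thesis .
qed

text \<open>Neither square commutes with t, but the corrections b - a and a - b in
  \<open>tau_aa\<close> and \<open>tau_bb\<close> are opposite.\<close>

lemma tau_sum: "t * (a * a + b * b) = (a * a + b * b) * t"
  by (simp add: distrib_left distrib_right tau_aa tau_bb)

text \<open>Pushing t through both squares produces two corrections; they cancel because the square
  of b commutes with a.\<close>

lemma tau_prod: "t * ((a * a) * (b * b)) = ((a * a) * (b * b)) * t"
proof -
  have abb: "a * (b * b) = b * b * a"
    by (metis ab mult.assoc minus_mult_left minus_mult_right minus_minus)
  have aabb: "a * a * (b * b) = b * b * (a * a)" by (metis abb mult.assoc)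
  have "t * ((a * a) * (b * b)) = (b * b * t + b - a) * (b * b)"
    by (simp only: mult.assoc[symmetric] tau_aa[unfolded mult.assoc[symmetric]])
  also have "\<dots> = b * b * (t * (b * b)) + b * (b * b) - a * (b * b)"
    by (simp add: algebra_simps)
  also have "\<dots> = b * b * (a * a * t + a - b) + b * (b * b) - b * b * a"
    unfolding tau_bb abb by (rule HOL.refl)
  also have "\<dots> = b * b * (a * a) * t" by (simp add: algebra_simps)
  finally show ?thesis unfolding aabb .
qed

end

section \<open>Elementary symmetric elements lie in the even centre\<close>

fun El :: "nat \<Rightarrow> nat list \<Rightarrow> salg" where
  "El 0 ks = 1"
| "El (Suc r) [] = 0"
| "El (Suc r) (k # ks) = yy k * El r ks + El (Suc r) ks"

lemma El_commute_avoid: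
  assumes "\<And>k. k \<in> set ks \<Longrightarrow> t * yy k = yy k * t"
  shows "t * El r ks = El r ks * t"
  using assms
proof (induction r ks rule: El.induct)
  case (3 r k ks)
  have "t * yy k = yy k * t" "t * El r ks = El r ks * t" "t * El (Suc r) ks = El (Suc r) ks * t"
    using 3 by simp_all
  then show ?case by (simp add: distrib_left distrib_right) (metis mult.assoc)
qed simp_all

lemma tau_yy:
  assumes "1 \<le> i" "1 \<le> k" "k \<noteq> i" "k \<noteq> i + 1"
  shows "el (tt i (i + 1)) * yy k = yy k * el (tt i (i + 1))"
proof -
  have "transpose i (i + 1) ` {1..<k} = {1..<k}"
    using assms by (intro transpose_image_atLeastLessThan) auto
  then have "el (tt i (i + 1)) * MM k = - (MM k * el (tt i (i + 1)))"
    using MM_conj[of "tt i (i + 1)" k] assms by (simp add: sg_def)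
  then show ?thesis unfolding yy_def
    by (metis mult.assoc minus_mult_left minus_mult_right minus_minus)
qed

text \<open>Expanding in the two adjacent variables leaves only their sum, their product and
  elementary elements of the other variables, and t commutes with all of these.\<close>

lemma El_pair_commute:
  assumes "1 \<le> i" "\<And>k. k \<in> set ks \<Longrightarrow> 1 \<le> k \<and> k \<noteq> i \<and> k \<noteq> i + 1"
  shows "el (tt i (i + 1)) * El r (i # (i + 1) # ks) = El r (i # (i + 1) # ks) * el (tt i (i + 1))"
proof -
  let ?t = "el (tt i (i + 1))" and ?p = "yy i + yy (i + 1)" and ?q = "yy i * yy (i + 1)"
  have ab: "MM i * MM (i + 1) = - (MM (i + 1) * MM i)" by (rule MM_anticommute) simp
  have tt: "?t * ?t = - 1" using tt_tt[of i "i + 1"] by (simp flip: el_add)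
  have p: "?t * ?p = ?p * ?t" unfolding yy_def by (rule tau_sum[OF tau_MM[OF assms(1)] tt ab])
  have q: "?t * ?q = ?q * ?t" unfolding yy_def by (rule tau_prod[OF tau_MM[OF assms(1)] tt ab])
  have e: "?t * El r ks = El r ks * ?t" for r
    using assms by (intro El_commute_avoid tau_yy) auto
  have pe: "?t * (?p * El r ks) = ?p * El r ks * ?t" for r by (metis p e mult.assoc)
  have qe: "?t * (?q * El r ks) = ?q * El r ks * ?t" for r by (metis q e mult.assoc)
  consider "r = 0" | "r = 1" | r' where "r = Suc (Suc r')"
    by (metis One_nat_def not0_implies_Suc)
  then show ?thesis
  proof cases
    case 2
    have "El r (i # (i + 1) # ks) = ?p * El 0 ks + El 1 ks" using 2 by (simp add: add.assoc)
    then show ?thesis using pe[of 0] e[of 1] by (simp only: distrib_left distrib_right)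
  next
    case 3
    have "El r (i # (i + 1) # ks) = ?q * El r' ks + (?p * El (Suc r') ks + El r ks)"
      using 3 by (simp add: distrib_left distrib_right mult.assoc add.assoc)
    then show ?thesis using qe[of r'] pe[of "Suc r'"] e[of r] by (simp only: distrib_left distrib_right)
  qed simp
qed

definition esym :: "nat \<Rightarrow> nat \<Rightarrow> salg" where "esym r n = El r [1..<n + 1]"

lemma esym_tau_commute:
  assumes "1 \<le> i" "i < n"
  shows "el (tt i (i + 1)) * esym r n = esym r n * el (tt i (i + 1))"
proof -
  have main: "el (tt i (i + 1)) * El r (pre @ i # (i + 1) # ks) = El r (pre @ i # (i + 1) # ks) * el (tt i (i + 1))"
    if "\<And>k. k \<in> set (pre @ ks) \<Longrightarrow> 1 \<le> k \<and> k \<noteq> i \<and> k \<noteq> i + 1" for pre ks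
    using that
  proof (induction pre arbitrary: r)
    case Nil
    then show ?case using El_pair_commute[OF assms(1), of ks r] by simp
  next
    case (Cons k pre)
    have y: "el (tt i (i + 1)) * yy k = yy k * el (tt i (i + 1))"
      using Cons.prems by (intro tau_yy assms) auto
    show ?case
    proof (cases r)
      case (Suc r')
      let ?ks = "pre @ i # (i + 1) # ks" and ?t = "el (tt i (i + 1))"
      have "?t * El r' ?ks = El r' ?ks * ?t" "?t * El r ?ks = El r ?ks * ?t"
        using Cons.IH Cons.prems by simp_all
      then have "?t * (yy k * El r' ?ks) = yy k * El r' ?ks * ?t" "?t * El r ?ks = El r ?ks * ?t"
        using y by (metis mult.assoc)+
      then show ?thesis using Suc by (simp add: distrib_left distrib_right)
    qed simp
  qed
  have "[1..<n + 1] = [1..<i] @ i # (i + 1) # [i + 2..<n + 1]"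
  proof -
    have "[1..<n + 1] = [1..<i] @ [i..<n + 1]" using assms upt_add_eq_append[of 1 i "n + 1 - i"] by simp
    then show ?thesis using assms upt_conv_Cons[of i "n + 1"] upt_conv_Cons[of "i + 1" "n + 1"]
      by (simp del: upt_Suc)
  qed
  then show ?thesis
    unfolding esym_def by (simp only:, intro main) auto
qed

text \<open>Degree bookkeeping: W collects words in transpositions whose products account for the
  support of x. Only permutations are compared, so the lifts may differ by
  \<open>zz\<close>.\<close>

definition by_words :: "(nat \<times> nat) list set \<Rightarrow> salg \<Rightarrow> bool" where
  "by_words W x \<longleftrightarrow> (\<forall>g\<in>supp_salg x. \<exists>L\<in>W. act g = act (wsum L))"

lemma by_words_mult:
  assumes "by_words W x" "by_words W' y"
  shows "by_words {L @ L' | L L'. L \<in> W \<and> L' \<in> W'} (x * y)"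
  unfolding by_words_def
proof
  fix g assume "g \<in> supp_salg (x * y)"
  then obtain a b where ab: "g = a + b" "a \<in> supp_salg x" "b \<in> supp_salg y"
    using supp_salg_mult by blast
  then obtain L L' where L: "L \<in> W" "act a = act (wsum L)" "L' \<in> W'" "act b = act (wsum L')"
    using assms unfolding by_words_def by blast
  have "act g = act (wsum (L @ L'))" using L ab(1) by (simp only: wsum_simps act_add)
  then show "\<exists>L\<in>{L @ L' | L L'. L \<in> W \<and> L' \<in> W'}. act g = act (wsum L)" using L by blast
qed

lemma by_words_mono: "by_words W x \<Longrightarrow> W \<subseteq> W' \<Longrightarrow> by_words W' x"
  unfolding by_words_def by blast

lemma by_words_add: "by_words W x \<Longrightarrow> by_words W y \<Longrightarrow> by_words W (x + y)"
  unfolding by_words_def using supp_salg_add by blast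

lemma by_words_0: "by_words W 0" by (simp add: by_words_def)

lemma by_words_sum: "(\<And>i. i \<in> A \<Longrightarrow> by_words W (f i)) \<Longrightarrow> by_words W (sum f A)"
  by (induction A rule: infinite_finite_induct) (auto simp: by_words_0 by_words_add)

lemma by_words_of_int: "by_words W x \<Longrightarrow> by_words W (of_int k * x)"
  unfolding by_words_def using supp_salg_of_int by blast

lemma by_words_1: "by_words {[]} 1"
  by (simp add: by_words_def supp_salg_1)

definition edges :: "nat set \<Rightarrow> nat \<Rightarrow> (nat \<times> nat) list set" where
  "edges A m = {L. length L = m \<and> (\<forall>(i, k)\<in>set L. k \<in> A \<and> 1 \<le> i \<and> i < k)}"

lemma edges_append: "{L @ L' | L L'. L \<in> edges A m \<and> L' \<in> edges A m'} \<subseteq> edges A (m + m')"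
  by (auto simp: edges_def)

lemma by_words_edges_mult:
  "by_words (edges A m) x \<Longrightarrow> by_words (edges A m') y \<Longrightarrow> by_words (edges A (m + m')) (x * y)"
  using by_words_mono[OF by_words_mult edges_append] .

lemma by_words_MM: "by_words (edges {k} 1) (MM k)"
  unfolding MM_def
proof (rule by_words_sum)
  fix i assume "i \<in> {1..<k}"
  then have "[(i, k)] \<in> edges {k} 1" by (simp add: edges_def)
  moreover have "act g = act (wsum [(i, k)])" if "g \<in> supp_salg (el (tt i k))" for g
    using that by (auto simp: supp_salg_el)
  ultimately show "by_words (edges {k} 1) (el (tt i k))" unfolding by_words_def by blast
qed

lemma by_words_yy: "k \<in> A \<Longrightarrow> by_words (edges A 2) (yy k)"
proof -
  assume "k \<in> A"
  then have "edges {k} (1 + 1) \<subseteq> edges A 2" by (auto simp: edges_def)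
  then show ?thesis unfolding yy_def
    using by_words_mono[OF by_words_edges_mult[OF by_words_MM by_words_MM]] by blast
qed

lemma by_words_one: "by_words (edges A 0) 1"
  using by_words_mono[OF by_words_1] by (simp add: edges_def)

lemma edges_mono: "A \<subseteq> B \<Longrightarrow> edges A m \<subseteq> edges B m"
  by (auto simp: edges_def)

lemma by_words_El: "by_words (edges (set ks) (2 * r)) (El r ks)"
proof (induction r ks rule: El.induct)
  case (1 ks)
  then show ?case using by_words_one by simp
next
  case (2 r)
  then show ?case by (simp add: by_words_0)
next
  case (3 r k ks)
  have "by_words (edges (set (k # ks)) (2 * r)) (El r ks)"
    by (rule by_words_mono[OF 3(1)]) (auto intro!: edges_mono)
  then have "by_words (edges (set (k # ks)) (2 + 2 * r)) (yy k * El r ks)"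
    by (intro by_words_edges_mult by_words_yy) simp_all
  moreover have "by_words (edges (set (k # ks)) (2 * Suc r)) (El (Suc r) ks)"
    by (rule by_words_mono[OF 3(2)]) (auto intro!: edges_mono)
  ultimately show ?case by (simp add: by_words_add)
qed

lemma edges_Gn: "L \<in> edges {1..n} m \<Longrightarrow> wsum L \<in> Gn n \<and> (odd_sp (wsum L) \<longleftrightarrow> odd m)"
proof (induction L arbitrary: m)
  case (Cons e L)
  obtain i k where e: "e = (i, k)" by (cases e)
  have ik: "i \<in> {1..n}" "k \<in> {1..n}" "i \<noteq> k" using Cons.prems e by (auto simp: edges_def)
  have "L \<in> edges {1..n} (m - 1)" "0 < m" using Cons.prems by (auto simp: edges_def)
  then have "wsum L \<in> Gn n" "odd_sp (wsum L) \<longleftrightarrow> odd (m - 1)" using Cons.IH by blast+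
  moreover have "tt i k \<in> Gn n" using ik by (auto simp: Gn_def transpose_def)
  ultimately show ?case using e ik \<open>0 < m\<close> by (auto intro: Gn_add)
qed (simp add: edges_def)

lemma by_words_even:
  assumes "by_words (edges {1..n} (2 * r)) x" "g \<in> supp_salg x"
  shows "g \<in> Gn n \<and> \<not> odd_sp g"
proof -
  obtain L where L: "L \<in> edges {1..n} (2 * r)" "act g = act (wsum L)"
    using assms unfolding by_words_def by blast
  have "wsum L \<in> Gn n" "\<not> odd_sp (wsum L)" using edges_Gn[OF L(1)] by simp_all
  then show ?thesis using Gn_cong[OF L(2)] by (simp add: odd_sp_def L(2))
qed

text \<open>By \<open>ev_surj\<close> each element of \<open>Gn n\<close> is a word in the
  generators, and every letter evaluates to an adjacent transposition up to sign or to
  \<open>zz\<close>.\<close>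

lemma Gn_commute:
  assumes "\<And>i. 1 \<le> i \<Longrightarrow> i < n \<Longrightarrow> el (tt i (i + 1)) * x = x * el (tt i (i + 1))" "a \<in> Gn n"
  shows "el a * x = x * el a"
proof -
  obtain u where u: "spin_valid n u" "ev u = a" using ev_surj[OF assms(2)] by blast
  have "el (ev u) * x = x * el (ev u)" using u(1)
  proof (induction u)
    case (Cons y u)
    have v: "spin_valid n [y]" "spin_valid n u" using Cons.prems spin_valid_Cons by blast+
    obtain g b where y: "y = (g, b)" by (cases y)
    have "el (ev [y]) * x = x * el (ev [y])"
    proof (cases g)
      case Z
      then show ?thesis using y by simp
    next
      case (T i)
      then have i: "1 \<le> i" "i < n" using v y by (auto simp: spin_valid_def spin_gens_def)
      have "el (ev [y]) = el (tt i (i + 1)) \<or> el (ev [y]) = - el (tt i (i + 1))"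
      proof -
        have 1: "tt (i + 1) i = zz + tt i (i + 1)" by (rule tt_swap) simp
        have "- tt (i + 1) i = zz + tt (i + 1) i" by (rule uminus_tt) simp
        also have "\<dots> = tt i (i + 1)" unfolding 1 by (rule zz_zz_add)
        finally have 2: "- tt (i + 1) i = tt i (i + 1)" .
        show ?thesis
        proof (cases b)
          case True
          then have "ev [y] = zz + tt i (i + 1)" using y T 1 by (simp only: ev_simps sp_gen.simps if_True add_0_right)
          then show ?thesis by simp
        next
          case False
          then have "ev [y] = tt i (i + 1)" using y T 2 by (simp only: ev_simps sp_gen.simps if_False add_0_right)
          then show ?thesis by simp
        qed
      qed
      then show ?thesis using assms(1)[OF i] by (metis minus_mult_left minus_mult_right)
    qed
    moreover have "ev (y # u) = ev [y] + ev u" using ev_simps(2)[of "[y]" u] by simp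
    ultimately show ?case using Cons.IH v(2) by (metis el_add mult.assoc)
  qed simp
  then show ?thesis using u(2) by simp
qed

lemma by_words_esym: "by_words (edges {1..n} (2 * r)) (esym r n)"
proof -
  have "set [1..<n + 1] = {1..n}" by auto
  then show ?thesis unfolding esym_def using by_words_El[of "[1..<n + 1]" r] by (simp only:)
qed

lemma esym_even_center: "esym r n \<in> even_center n"
proof (rule even_centerI)
  show "g \<in> Gn n \<and> \<not> odd_sp g" if "g \<in> supp_salg (esym r n)" for g
    by (rule by_words_even[OF by_words_esym that])
  show "el a * esym r n = esym r n * el a" if "a \<in> Gn n" for a
    by (rule Gn_commute[OF esym_tau_commute that])
qed

lemma El_sum:
  "distinct ks \<Longrightarrow> El r ks = (\<Sum>I | I \<subseteq> set ks \<and> card I = r. prod_list (map (\<lambda>k. if k \<in> I then yy k else 1) ks))"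
proof (induction r ks rule: El.induct)
  case (1 ks)
  have "{I. I \<subseteq> set ks \<and> card I = 0} = {{}}"
    using finite_subset[of _ "set ks"] by (auto simp: card_eq_0_iff)
  moreover have "prod_list (map (\<lambda>k. 1 :: salg) ks) = 1" by (induction ks) simp_all
  ultimately show ?case by simp
next
  case (2 r)
  have "{I. I \<subseteq> set [] \<and> card I = Suc r} = ({} :: nat set set)" by auto
  then show ?case by (simp only: El.simps sum.empty)
next
  case (3 r k ks)
  let ?f = "\<lambda>I. prod_list (map (\<lambda>k. if k \<in> I then yy k else 1) (k # ks))"
  let ?g = "\<lambda>I. prod_list (map (\<lambda>k. if k \<in> I then yy k else 1) ks)"
  let ?A = "insert k ` {I. I \<subseteq> set ks \<and> card I = r}" and ?B = "{I. I \<subseteq> set ks \<and> card I = Suc r}"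
  have k: "k \<notin> set ks" and d: "distinct ks" using 3(3) by auto
  have AB: "{I. I \<subseteq> set (k # ks) \<and> card I = Suc r} = ?A \<union> ?B"
  proof (intro equalityI subsetI)
    fix I assume I: "I \<in> {I. I \<subseteq> set (k # ks) \<and> card I = Suc r}"
    then have fin: "finite I" using finite_subset[of I "set (k # ks)"] by simp
    show "I \<in> ?A \<union> ?B"
    proof (cases "k \<in> I")
      case True
      then have "I = insert k (I - {k})" "card (I - {k}) = r" "I - {k} \<subseteq> set ks" using I fin by auto
      then show ?thesis by blast
    qed (use I in auto)
  next
    fix I assume "I \<in> ?A \<union> ?B"
    then show "I \<in> {I. I \<subseteq> set (k # ks) \<and> card I = Suc r}"
      using k finite_subset[of _ "set ks"] by (auto simp: card_insert_if)
  qed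
  have "?A \<inter> ?B = {}" using k by auto
  then have "(\<Sum>I | I \<subseteq> set (k # ks) \<and> card I = Suc r. ?f I) = sum ?f ?A + sum ?f ?B"
    unfolding AB by (intro sum.union_disjoint) auto
  also have "sum ?f ?A = (\<Sum>I | I \<subseteq> set ks \<and> card I = r. ?f (insert k I))"
    by (rule sum.reindex_cong[of "insert k"]) (use k in \<open>auto simp: inj_on_def\<close>)
  also have "\<dots> = (\<Sum>I | I \<subseteq> set ks \<and> card I = r. yy k * ?g I)"
  proof (rule sum.cong[OF HOL.refl])
    fix I
    have "?g (insert k I) = ?g I"
      by (intro arg_cong[where f = prod_list] map_cong HOL.refl) (use k in auto)
    moreover have "?f (insert k I) = yy k * ?g (insert k I)" by simp
    ultimately show "?f (insert k I) = yy k * ?g I" by (simp only:)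
  qed
  also have "\<dots> = yy k * El r ks" using 3(1)[OF d] by (simp add: sum_distrib_left)
  also have "sum ?f ?B = sum ?g ?B"
  proof (rule sum.cong[OF HOL.refl])
    fix I assume "I \<in> ?B"
    then have "k \<notin> I" using k by blast
    then show "?f I = ?g I" by simp
  qed
  also have "\<dots> = El (Suc r) ks" using 3(2)[OF d] by simp
  finally show ?case by simp
qed

lemma Psi_e_sym: "Psi n (e_sym r n) = esym r n"
proof -
  have s: "set [1..<n + 1] = {1..n}" by auto
  have "prod_list (map (\<lambda>k. if k \<in> I then yy k else 1) ks) = prod_list (map yy (filter (\<lambda>k. k \<in> I) ks))" for I ks
    by (induction ks) simp_all
  moreover have "filter (\<lambda>k. k \<in> I) [1..<n + 1] = sorted_list_of_set I" if "I \<subseteq> {1..n}" for I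
  proof (rule sorted_distinct_set_unique)
    show "set (filter (\<lambda>k. k \<in> I) [1..<n + 1]) = set (sorted_list_of_set I)"
      using that finite_subset[OF that] s by auto
  qed (simp_all add: sorted_wrt_filter del: upt_Suc)
  ultimately have "esym r n = (\<Sum>I\<in>{I. I \<subseteq> {1..n} \<and> card I = r}. prod_list (map yy (sorted_list_of_set I)))"
    unfolding esym_def El_sum[OF distinct_upt] s by (intro sum.cong[OF HOL.refl]) simp
  then show ?thesis unfolding e_sym(2) yy_def by simp
qed

lemma class_coeffs_e_sym:
  "\<nu> \<in> EP_upto n \<Longrightarrow> class_coeffs n (e_sym r n) \<nu> = co (rep \<nu>) (esym r n)"
  using class_coeffs[OF e_sym(1)] esym_even_center by (simp add: Psi_e_sym)

lemma El_snoc: "El (Suc r) (ks @ [k]) = El r ks * yy k + El (Suc r) ks"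
proof (induction ks arbitrary: r)
  case Nil
  show ?case by (cases r) simp_all
next
  case (Cons j ks)
  show ?case
  proof (cases r)
    case 0
    then show ?thesis using Cons[of 0] by (simp add: algebra_simps)
  next
    case (Suc r')
    then show ?thesis using Cons[of r'] Cons[of r] by (simp add: algebra_simps)
  qed
qed

text \<open>Words that use the transpositions \<open>(i, n + 1)\<close> cannot multiply to \<open>rep \<nu>\<close> in top degree.\<close>
lemma co_esym_stable:
  assumes "\<nu> \<in> EP" "sum_mset \<nu> = 2 * r" "sum_mset \<nu> + size \<nu> \<le> n"
  shows "co (rep \<nu>) (esym r (Suc n)) = co (rep \<nu>) (esym r n)"
proof (cases r)
  case 0
  then show ?thesis by (simp add: esym_def)
next
  case (Suc r')
  let ?k = "n + 1"
  have e: "esym r (Suc n) = esym r' n * yy ?k + esym r n"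
    using El_snoc[of r' "[1..<n + 1]" ?k] Suc by (simp add: esym_def)
  have "co (rep \<nu>) (esym r' n * yy ?k) = 0"
  proof (rule ccontr)
    assume "co (rep \<nu>) (esym r' n * yy ?k) \<noteq> 0"
    then have g: "rep \<nu> \<in> supp_salg (esym r' n * yy ?k)" by (simp add: supp_salg_def)
    obtain L L' where L: "L \<in> edges {1..n} (2 * r')" "L' \<in> edges {?k} 2" "act (rep \<nu>) = act (wsum (L @ L'))"
      using by_words_mult[OF by_words_esym[of n r'] by_words_yy[of ?k "{?k}"]] g
      unfolding by_words_def by blast
    have len: "length (L @ L') = sum_mset \<nu>" using L Suc assms(2) by (simp add: edges_def)
    obtain i where i: "(i, ?k) \<in> set L'" "1 \<le> i" "i < ?k"
      using L(2) by (cases L') (auto simp: edges_def)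
    have "rep \<nu> \<in> Dn \<nu> ?k" using assms by (intro rep_Dn) simp_all
    then have "act (rep \<nu>) ?k \<noteq> ?k"
      using word_top_edge(2)[OF assms(1) _ HOL.sym[OF L(3)] len, of ?k i ?k] i by simp
    then have "?k \<in> {1..sum_mset \<nu> + size \<nu>}" using rep(2)[OF assms(1)] by blast
    then show False using assms(3) by simp
  qed
  then show ?thesis unfolding e by simp
qed

text \<open>Stability in n makes the description in \<open>A_coeff\<close> legitimate and lets any
  sufficiently large N compute it.\<close>

lemma A_coeff_eq:
  assumes "\<nu> \<in> EP" "sum_mset \<nu> = 2 * r" "sum_mset \<nu> + size \<nu> \<le> N"
  shows "A_coeff r \<nu> = co (rep \<nu>) (esym r N)"
proof -
  let ?s = "sum_mset \<nu> + size \<nu>"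
  have st: "co (rep \<nu>) (esym r n) = co (rep \<nu>) (esym r ?s)" if "?s \<le> n" for n
    using that
  proof (induction n rule: dec_induct)
    case (step n)
    then show ?case using co_esym_stable[OF assms(1,2)] by simp
  qed simp
  have c: "class_coeffs n (e_sym r n) \<nu> = co (rep \<nu>) (esym r N)" if "?s \<le> n" for n
    using class_coeffs_e_sym[of \<nu> n r] that assms(1) st[OF that] st[OF assms(3)] by (simp add: EP_upto_def)
  show ?thesis unfolding A_coeff_def
    by (rule the_equality) (use c in auto)
qed

section \<open>Symmetric polynomials in the squared elements, given by coefficient functions\<close>

definition ymono :: "(nat \<Rightarrow> nat) \<Rightarrow> nat list \<Rightarrow> salg" where
  "ymono a ks = prod_list (map (\<lambda>k. yy k ^ a k) ks)"

lemma mono_simps [simp]: "ymono a [] = 1" "ymono a (k # ks) = yy k ^ a k * ymono a ks"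
  by (simp_all add: ymono_def)

lemma power_yy_commute: "yy j ^ m * yy k ^ n = yy k ^ n * yy j ^ m"
proof -
  have "yy j ^ m * yy k = yy k * yy j ^ m" by (rule power_commuting_commutes[OF yy_commute])
  then show ?thesis by (rule power_commuting_commutes[OF HOL.sym, THEN HOL.sym])
qed

lemma mono_yy_commute: "ymono a ks * yy k ^ m = yy k ^ m * ymono a ks"
proof (induction ks)
  case (Cons j ks)
  have "ymono a (j # ks) * yy k ^ m = yy j ^ a j * (ymono a ks * yy k ^ m)" by (simp add: mult.assoc)
  also have "\<dots> = (yy j ^ a j * yy k ^ m) * ymono a ks" unfolding Cons by (simp only: mult.assoc)
  also have "\<dots> = yy k ^ m * ymono a (j # ks)" unfolding power_yy_commute[of j] by (simp add: mult.assoc)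
  finally show ?case .
qed simp

lemma mono_add: "ymono (\<lambda>k. a k + b k) ks = ymono a ks * ymono b ks"
proof (induction ks)
  case (Cons k ks)
  have "ymono a (k # ks) * ymono b (k # ks) = yy k ^ a k * (ymono a ks * yy k ^ b k) * ymono b ks"
    by (simp add: mult.assoc)
  also have "\<dots> = yy k ^ a k * yy k ^ b k * (ymono a ks * ymono b ks)"
    unfolding mono_yy_commute by (simp only: mult.assoc)
  finally show ?case using Cons by (simp add: power_add)
qed simp

definition Ex :: "nat \<Rightarrow> nat \<Rightarrow> (nat \<Rightarrow> nat) set" where
  "Ex N r = {a. (\<forall>k. k \<notin> {1..N} \<longrightarrow> a k = 0) \<and> (\<Sum>k\<in>{1..N}. a k) = r}"

lemma finite_Ex: "finite (Ex N r)"
proof (rule finite_subset)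
  show "Ex N r \<subseteq> {f. \<forall>k. (k \<in> {1..N} \<longrightarrow> f k \<in> {..r}) \<and> (k \<notin> {1..N} \<longrightarrow> f k = 0)}"
  proof
    fix a assume a: "a \<in> Ex N r"
    have "a k \<le> r" if "k \<in> {1..N}" for k
      using member_le_sum[of k "{1..N}" a] that a by (simp add: Ex_def)
    then show "a \<in> {f. \<forall>k. (k \<in> {1..N} \<longrightarrow> f k \<in> {..r}) \<and> (k \<notin> {1..N} \<longrightarrow> f k = 0)}"
      using a by (auto simp: Ex_def)
  qed
  show "finite {f :: nat \<Rightarrow> nat. \<forall>k. (k \<in> {1..N} \<longrightarrow> f k \<in> {..r}) \<and> (k \<notin> {1..N} \<longrightarrow> f k = 0)}"
    by (rule finite_set_of_finite_funs) simp_all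
qed

text \<open>A homogeneous polynomial is handled through its coefficient function u on exponent
  vectors. The elements \<open>yy k\<close> are not algebraically independent (\<open>yy 1\<close>
  is 0), so the element does not determine u, and symmetry is a property of u.\<close>

definition msum :: "nat \<Rightarrow> nat \<Rightarrow> ((nat \<Rightarrow> nat) \<Rightarrow> int) \<Rightarrow> salg" where
  "msum N r u = (\<Sum>a\<in>Ex N r. of_int (u a) * ymono a [1..<N + 1])"

definition symm :: "nat \<Rightarrow> ((nat \<Rightarrow> nat) \<Rightarrow> int) \<Rightarrow> bool" where
  "symm N u \<longleftrightarrow> (\<forall>p a. p permutes {1..N} \<longrightarrow> u (\<lambda>k. a (p k)) = u a)"

lemma symmD: "symm N u \<Longrightarrow> p permutes {1..N} \<Longrightarrow> u (\<lambda>k. a (p k)) = u a"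
  unfolding symm_def by blast

abbreviation spt :: "nat \<Rightarrow> (nat \<Rightarrow> nat) \<Rightarrow> nat set" where
  "spt N a \<equiv> {k \<in> {1..N}. a k \<noteq> 0}"

definition subs :: "nat \<Rightarrow> nat \<Rightarrow> nat set set" where
  "subs N j = {I. I \<subseteq> {1..N} \<and> card I = j}"

lemma finite_subs: "finite (subs N j)" by (simp add: subs_def)

definition ind :: "nat set \<Rightarrow> nat \<Rightarrow> nat" where "ind I k = (if k \<in> I then 1 else 0)"

lemma sum_ind: "I \<subseteq> {1..N} \<Longrightarrow> (\<Sum>k\<in>{1..N}. ind I k) = card I"
  by (simp add: ind_def sum.If_cases Int_absorb1)

lemma esym_mono: "esym j N = (\<Sum>I\<in>subs N j. ymono (ind I) [1..<N + 1])"
proof -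
  have s: "set [1..<N + 1] = {1..N}" by auto
  have "prod_list (map (\<lambda>k. if k \<in> I then yy k else 1) ks) = ymono (ind I) ks" for I ks
    by (induction ks) (auto simp: ind_def)
  then show ?thesis unfolding esym_def El_sum[OF distinct_upt] s subs_def by simp
qed

lemma permutes_spt:
  assumes "p permutes {1..N}"
  shows "p ` spt N (\<lambda>k. a (p k)) = spt N a"
proof (intro equalityI subsetI)
  fix k assume k: "k \<in> spt N a"
  then have "k \<in> p ` {1..N}" using permutes_image[OF assms] by simp
  then obtain l where "l \<in> {1..N}" "k = p l" by blast
  then show "k \<in> p ` spt N (\<lambda>k. a (p k))" using k by blast
qed (use assms in \<open>auto simp: permutes_in_image simp del: atLeastAtMost_iff\<close>)

lemma card_permutes_spt:
  assumes "p permutes {1..N}"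
  shows "card (spt N (\<lambda>k. a (p k))) = card (spt N a)"
  using permutes_spt[OF assms, of a] card_image[of p "spt N (\<lambda>k. a (p k))"] permutes_inj_on[OF assms] by metis

text \<open>A monomial in exactly j variables is divisible by the product of these variables. This
  is the coefficient function of a symmetric polynomial that collects the quotients: b arises from b
  + 1_S, where S is any set of j variables containing those of b.\<close>

definition shift :: "nat \<Rightarrow> nat \<Rightarrow> ((nat \<Rightarrow> nat) \<Rightarrow> int) \<Rightarrow> (nat \<Rightarrow> nat) \<Rightarrow> int" where
  "shift N j u b = (if card (spt N b) \<le> j
     then u (\<lambda>k. b k + ind (SOME S. S \<in> subs N j \<and> spt N b \<subseteq> S) k) else 0)"

text \<open>A permutation that fixes the support of b pointwise and maps S' onto S identifies the
  two exponent vectors. The lists are ordered so that matching them entry by entry yields such a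
  permutation.\<close>

lemma shift_welldef:
  assumes "symm N u" "S \<in> subs N j" "S' \<in> subs N j" "spt N b \<subseteq> S" "spt N b \<subseteq> S'"
  shows "u (\<lambda>k. b k + ind S k) = u (\<lambda>k. b k + ind S' k)"
proof -
  let ?B = "spt N b"
  have fin: "finite S" "finite S'" "finite ?B" using assms(2,3) finite_subset by (auto simp: subs_def)
  have sS: "S \<subseteq> {1..N}" "S' \<subseteq> {1..N}" "card S = card S'" using assms(2,3) by (auto simp: subs_def)
  let ?L = "sorted_list_of_set ?B @ sorted_list_of_set (S' - ?B)"
  let ?L' = "sorted_list_of_set ?B @ sorted_list_of_set (S - ?B)"
  have "card (S' - ?B) = card (S - ?B)" using assms(4,5) sS(3) fin by (simp add: card_Diff_subset)
  then have len: "length ?L = length ?L'" by simp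
  have "distinct ?L" "distinct ?L'" using fin by auto
  moreover have "set ?L \<subseteq> {1..N}" "set ?L' \<subseteq> {1..N}" using fin sS by auto
  ultimately obtain p where p: "p permutes {1..N}" "map p ?L = ?L'"
    using ex_permutes_map[of "{1..N}" ?L ?L'] len by blast
  have len2: "length (map p (sorted_list_of_set ?B)) = length (sorted_list_of_set ?B)" by simp
  have m: "map p (sorted_list_of_set ?B) = sorted_list_of_set ?B"
      "map p (sorted_list_of_set (S' - ?B)) = sorted_list_of_set (S - ?B)"
    using p(2) append_eq_append_conv[OF disjI1[OF len2]] unfolding map_append by blast+
  have pB: "p k = k" if "k \<in> ?B" for k
  proof -
    have "map p (sorted_list_of_set ?B) = map (\<lambda>k. k) (sorted_list_of_set ?B)"
      unfolding list.map_ident by (rule m(1))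
    then have "\<forall>k\<in>set (sorted_list_of_set ?B). p k = k" unfolding map_eq_conv .
    then show ?thesis using that fin(3) by simp
  qed
  have "p ` set (sorted_list_of_set (S' - ?B)) = set (sorted_list_of_set (S - ?B))"
    unfolding m(2)[symmetric] list.set_map ..
  then have "p ` (S' - ?B) = S - ?B" using fin by simp
  moreover have "p ` ?B = ?B" using pB by (auto simp: image_iff)
  ultimately have "p ` (?B \<union> (S' - ?B)) = ?B \<union> (S - ?B)" by (simp only: image_Un)
  moreover have "?B \<union> (S' - ?B) = S'" "?B \<union> (S - ?B) = S" using assms(4,5) by blast+
  ultimately have "p ` S' = S" by (simp only:)
  then have S: "p k \<in> S \<longleftrightarrow> k \<in> S'" for k
    using inj_image_mem_iff[OF permutes_inj[OF p(1)], of k S'] by simp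
  have b: "b (p k) = b k" for k
  proof (cases "k \<in> {1..N}")
    case True
    show ?thesis
    proof (cases "k \<in> ?B")
      case False
      have "p k \<in> {1..N}" using True permutes_in_image[OF p(1), of k] by blast
      moreover have "p k \<notin> ?B"
        using False \<open>p ` ?B = ?B\<close> inj_image_mem_iff[OF permutes_inj[OF p(1)], of k ?B] by simp
      ultimately have "b (p k) = 0" by blast
      moreover have "b k = 0" using False True by blast
      ultimately show ?thesis by simp
    qed (simp add: pB)
  qed (use p(1) in \<open>simp add: permutes_def\<close>)
  have "ind S (p k) = ind S' k" for k by (simp add: ind_def S)
  then show ?thesis using symmD[OF assms(1) p(1), of "\<lambda>k. b k + ind S k"] by (simp only: b)
qed

lemma ex_superset:
  assumes "card (spt N b) \<le> j" "j \<le> N"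
  shows "\<exists>S. S \<in> subs N j \<and> spt N b \<subseteq> S"
proof -
  have sub: "spt N b \<subseteq> {1..N}" by blast
  have "j \<le> card {1..N}" using assms(2) by simp
  from exists_subset_between[OF assms(1) this sub finite_atLeastAtMost]
  show ?thesis unfolding subs_def by blast
qed

lemma shift_eq:
  assumes "symm N u" "S \<in> subs N j" "spt N b \<subseteq> S"
  shows "shift N j u b = u (\<lambda>k. b k + ind S k)"
proof -
  have fin: "finite S" using assms(2) finite_subset by (auto simp: subs_def)
  have "card (spt N b) \<le> j" using card_mono[OF fin assms(3)] assms(2) by (simp add: subs_def)
  moreover have "(SOME S. S \<in> subs N j \<and> spt N b \<subseteq> S) \<in> subs N j \<and> spt N b \<subseteq> (SOME S. S \<in> subs N j \<and> spt N b \<subseteq> S)"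
    by (rule someI[of _ S]) (use assms in blast)
  ultimately show ?thesis unfolding shift_def
    using shift_welldef[OF assms(1) _ assms(2) _ assms(3)] by simp
qed

lemma permutes_subs:
  assumes "p permutes {1..N}"
  shows "p ` S \<in> subs N j \<longleftrightarrow> S \<in> subs N j"
proof -
  have "card (p ` S) = card S" by (rule card_image[OF inj_on_subset[OF permutes_inj[OF assms]]]) simp
  moreover have "p ` S \<subseteq> {1..N} \<longleftrightarrow> S \<subseteq> {1..N}" using permutes_in_image[OF assms] by blast
  ultimately show ?thesis by (simp add: subs_def)
qed

lemma symm_shift:
  assumes "symm N u" "j \<le> N"
  shows "symm N (shift N j u)"
  unfolding symm_def
proof (intro allI impI)
  fix p and a :: "nat \<Rightarrow> nat"
  assume p: "p permutes {1..N}"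
  let ?b = "\<lambda>k. a (p k)"
  show "shift N j u ?b = shift N j u a"
  proof (cases "card (spt N a) \<le> j")
    case False
    then show ?thesis using card_permutes_spt[OF p, of a] by (simp add: shift_def)
  next
    case True
    then have "card (spt N ?b) \<le> j" using card_permutes_spt[OF p, of a] by simp
    from ex_superset[OF this assms(2)] obtain S where S: "S \<in> subs N j" "spt N ?b \<subseteq> S" by blast
    have S': "p ` S \<in> subs N j" using S(1) permutes_subs[OF p, of S j] by blast
    have S'': "spt N a \<subseteq> p ` S"
      using image_mono[OF S(2), of p] permutes_spt[OF p, of a] by (simp only:)
    have "ind (p ` S) (p k) = ind S k" for k
      using inj_image_mem_iff[OF permutes_inj[OF p]] by (simp add: ind_def)
    then have "u (\<lambda>k. ?b k + ind S k) = u (\<lambda>k. a k + ind (p ` S) k)"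
      using symmD[OF assms(1) p, of "\<lambda>k. a k + ind (p ` S) k"] by (simp only:)
    then show ?thesis using shift_eq[OF assms(1) S] shift_eq[OF assms(1) S' S''] by simp
  qed
qed

text \<open>The coefficient function of e_j times w: the sum runs over the j variables that the
  factor e_j supplies to the monomial a.\<close>

definition conv :: "nat \<Rightarrow> nat \<Rightarrow> ((nat \<Rightarrow> nat) \<Rightarrow> int) \<Rightarrow> (nat \<Rightarrow> nat) \<Rightarrow> int" where
  "conv N j w a = (\<Sum>I\<in>{I \<in> subs N j. I \<subseteq> spt N a}. w (\<lambda>k. a k - ind I k))"

lemma symm_conv:
  assumes "symm N w"
  shows "symm N (conv N j w)"
  unfolding symm_def
proof (intro allI impI)
  fix p and a :: "nat \<Rightarrow> nat"
  assume p: "p permutes {1..N}"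
  let ?b = "\<lambda>k. a (p k)"
  have inj: "inj p" by (rule permutes_inj[OF p])
  have im: "{I \<in> subs N j. I \<subseteq> spt N a} = image p ` {I \<in> subs N j. I \<subseteq> spt N ?b}"
  proof (intro equalityI subsetI)
    fix I assume I: "I \<in> {I \<in> subs N j. I \<subseteq> spt N a}"
    have "I = p ` (p -` I)" using permutes_surj[OF p] by (simp add: surj_image_vimage_eq)
    moreover have "p -` I \<subseteq> spt N ?b"
      using I permutes_in_image[OF p] by blast
    ultimately have "I = p ` (p -` I)" "p -` I \<in> {I \<in> subs N j. I \<subseteq> spt N ?b}"
      using I permutes_subs[OF p, of "p -` I" j] by auto
    then show "I \<in> image p ` {I \<in> subs N j. I \<subseteq> spt N ?b}" by blast
  next
    fix I assume "I \<in> image p ` {I \<in> subs N j. I \<subseteq> spt N ?b}"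
    then obtain J where "I = p ` J" "J \<in> subs N j" "J \<subseteq> spt N ?b" by blast
    then show "I \<in> {I \<in> subs N j. I \<subseteq> spt N a}"
      using permutes_subs[OF p, of J j] permutes_spt[OF p, of a] by blast
  qed
  have "conv N j w a = (\<Sum>I\<in>{I \<in> subs N j. I \<subseteq> spt N ?b}. w (\<lambda>k. a k - ind (p ` I) k))"
    unfolding conv_def im by (subst sum.reindex) (auto simp: inj_on_def inj_image_eq_iff[OF inj])
  also have "\<dots> = conv N j w ?b" unfolding conv_def
  proof (rule sum.cong[OF HOL.refl])
    fix I
    have "ind (p ` I) (p k) = ind I k" for k
      using inj_image_mem_iff[OF inj] by (simp add: ind_def)
    then show "w (\<lambda>k. a k - ind (p ` I) k) = w (\<lambda>k. ?b k - ind I k)"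
      using symmD[OF assms p, of "\<lambda>k. a k - ind (p ` I) k"] by (simp only:)
  qed
  finally show "conv N j w ?b = conv N j w a" ..
qed

lemma esym_msum:
  assumes "j \<le> r"
  shows "esym j N * msum N (r - j) w = msum N r (conv N j w)"
proof -
  let ?m = "\<lambda>a. ymono a [1..<N + 1]"
  have "esym j N * msum N (r - j) w = (\<Sum>I\<in>subs N j. \<Sum>b\<in>Ex N (r - j). of_int (w b) * ?m (\<lambda>k. ind I k + b k))"
    unfolding esym_mono msum_def sum_product
    by (intro sum.cong HOL.refl) (metis mono_add mult.assoc of_int_commute)
  also have "\<dots> = (\<Sum>(I, b)\<in>subs N j \<times> Ex N (r - j). of_int (w b) * ?m (\<lambda>k. ind I k + b k))"
    by (rule sum.cartesian_product)
  also have "\<dots> = (\<Sum>(a, I)\<in>(SIGMA a:Ex N r. {I \<in> subs N j. I \<subseteq> spt N a}). of_int (w (\<lambda>k. a k - ind I k)) * ?m a)"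
  proof (rule sum.reindex_bij_witness[of _ "\<lambda>(a, I). (I, \<lambda>k. a k - ind I k)" "\<lambda>(I, b). (\<lambda>k. ind I k + b k, I)"])
    fix x assume "x \<in> subs N j \<times> Ex N (r - j)"
    then obtain I b where x: "x = (I, b)" "I \<in> subs N j" "b \<in> Ex N (r - j)" by blast
    have bk: "(\<lambda>k. ind I k + b k - ind I k) = b" by simp
    show "(case case x of (I, b) \<Rightarrow> (\<lambda>k. ind I k + b k, I) of (a, I) \<Rightarrow> (I, \<lambda>k. a k - ind I k)) = x"
      using x(1) bk by simp
    have sub: "I \<subseteq> {1..N}" "card I = j" using x(2) by (auto simp: subs_def)
    have "(\<lambda>k. ind I k + b k) \<in> Ex N r"
      using x(3) sub sum_ind[OF sub(1)] assms unfolding Ex_def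
      by (auto simp: sum.distrib ind_def simp del: atLeastAtMost_iff)
    moreover have "I \<subseteq> spt N (\<lambda>k. ind I k + b k)" using sub(1) by (auto simp: ind_def)
    ultimately show "(case x of (I, b) \<Rightarrow> (\<lambda>k. ind I k + b k, I)) \<in> (SIGMA a:Ex N r. {I \<in> subs N j. I \<subseteq> spt N a})"
      using x by simp
    show "(case case x of (I, b) \<Rightarrow> (\<lambda>k. ind I k + b k, I) of (a, I) \<Rightarrow> of_int (w (\<lambda>k. a k - ind I k)) * ?m a) =
        (case x of (I, b) \<Rightarrow> of_int (w b) * ?m (\<lambda>k. ind I k + b k))"
      using x(1) bk by simp
  next
    fix x assume "x \<in> (SIGMA a:Ex N r. {I \<in> subs N j. I \<subseteq> spt N a})"
    then obtain a I where x: "x = (a, I)" "a \<in> Ex N r" "I \<in> subs N j" "I \<subseteq> spt N a" by blast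
    have le: "ind I k \<le> a k" for k using x(4) by (auto simp: ind_def)
    then have bk: "(\<lambda>k. ind I k + (a k - ind I k)) = a" by simp
    show "(case case x of (a, I) \<Rightarrow> (I, \<lambda>k. a k - ind I k) of (I, b) \<Rightarrow> (\<lambda>k. ind I k + b k, I)) = x"
      using x(1) bk by simp
    have sub: "I \<subseteq> {1..N}" "card I = j" using x(3) by (auto simp: subs_def)
    have "(\<Sum>k\<in>{1..N}. a k - ind I k) = (\<Sum>k\<in>{1..N}. a k) - (\<Sum>k\<in>{1..N}. ind I k)"
      using le by (intro sum_subtractf_nat) auto
    then have "(\<lambda>k. a k - ind I k) \<in> Ex N (r - j)"
      using x(2) sub sum_ind[OF sub(1)] by (simp add: Ex_def)
    then show "(case x of (a, I) \<Rightarrow> (I, \<lambda>k. a k - ind I k)) \<in> subs N j \<times> Ex N (r - j)"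
      using x by simp
  qed
  also have "\<dots> = (\<Sum>a\<in>Ex N r. \<Sum>I\<in>{I \<in> subs N j. I \<subseteq> spt N a}. of_int (w (\<lambda>k. a k - ind I k)) * ?m a)"
    by (intro sum.Sigma[symmetric] finite_Ex ballI) (simp add: finite_subs)
  also have "\<dots> = msum N r (conv N j w)"
    unfolding msum_def conv_def by (simp add: sum_distrib_right)
  finally show ?thesis .
qed

lemma msum_add: "msum N r (\<lambda>a. u a + v a) = msum N r u + msum N r v"
  by (simp add: msum_def distrib_right sum.distrib)

text \<open>An exponent vector of degree r in at least r variables has all its nonzero entries equal
  to 1, and symmetry gives all these squarefree monomials the same coefficient.\<close>

lemma msum_elementary:
  assumes "symm N u" "r \<le> N" "\<And>a. a \<in> Ex N r \<Longrightarrow> card (spt N a) < r \<Longrightarrow> u a = 0"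
  shows "msum N r u = of_int (u (ind {1..r})) * esym r N"
proof -
  have r0: "{1..r} \<in> subs N r" using assms(2) by (simp add: subs_def)
  have c: "u (ind I) = u (ind {1..r})" if "I \<in> subs N r" for I
  proof -
    have "spt N (\<lambda>_. 0) = {}" by simp
    then show ?thesis using shift_welldef[OF assms(1) that r0, of "\<lambda>_. 0"] by simp
  qed
  have inj: "inj_on ind (subs N r)"
  proof (rule inj_onI)
    fix I J assume e: "ind I = ind J"
    have "k \<in> I \<longleftrightarrow> k \<in> J" for k
      using fun_cong[OF e, of k] by (simp add: ind_def split: if_splits)
    then show "I = J" by blast
  qed
  have sub: "ind ` subs N r \<subseteq> Ex N r"
    using sum_ind by (auto simp: Ex_def subs_def ind_def)
  have "msum N r u = (\<Sum>a\<in>ind ` subs N r. of_int (u a) * ymono a [1..<N + 1])"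
    unfolding msum_def
  proof (rule sum.mono_neutral_right[OF finite_Ex sub], rule ballI)
    fix a assume a: "a \<in> Ex N r - ind ` subs N r"
    have "card (spt N a) < r"
    proof (rule ccontr)
      assume "\<not> card (spt N a) < r"
      then have ge: "r \<le> card (spt N a)" by simp
      have "(\<Sum>k\<in>spt N a. a k) = (\<Sum>k\<in>{1..N}. a k)"
        by (rule sum.mono_neutral_left) auto
      then have sa: "(\<Sum>k\<in>spt N a. a k) = r" using a by (simp add: Ex_def)
      have one: "a k = 1" if k: "k \<in> spt N a" for k
      proof -
        have "(\<Sum>l\<in>spt N a - {k}. 1) \<le> (\<Sum>l\<in>spt N a - {k}. a l)" by (rule sum_mono) auto
        moreover have "(\<Sum>l\<in>spt N a. a l) = a k + (\<Sum>l\<in>spt N a - {k}. a l)"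
          using k by (intro sum.remove) auto
        moreover have "card (spt N a - {k}) = card (spt N a) - 1" using k by simp
        ultimately have "a k \<le> 1" using sa ge by simp
        then show ?thesis using k by auto
      qed
      have "(\<Sum>k\<in>spt N a. a k) = (\<Sum>k\<in>spt N a. 1)"
        by (rule sum.cong[OF HOL.refl]) (rule one)
      then have "card (spt N a) = r" using sa by (simp only: card_eq_sum)
      then have "spt N a \<in> subs N r" by (auto simp: subs_def)
      moreover have "a = ind (spt N a)"
      proof
        fix k
        show "a k = ind (spt N a) k" using one[of k] a by (auto simp: ind_def Ex_def)
      qed
      ultimately show False using a by blast
    qed
    then show "of_int (u a) * ymono a [1..<N + 1] = 0" using assms(3) a by simp
  qed
  also have "\<dots> = (\<Sum>I\<in>subs N r. of_int (u (ind I)) * ymono (ind I) [1..<N + 1])"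
    by (subst sum.reindex[OF inj]) simp
  also have "\<dots> = of_int (u (ind {1..r})) * esym r N"
    unfolding esym_mono sum_distrib_left by (rule sum.cong[OF HOL.refl]) (simp add: c)
  finally show ?thesis .
qed

text \<open>Every symmetric polynomial of degree \<open>r\<close> is an integer multiple of \<open>e\<^sub>r\<close> plus products
  \<open>e\<^sub>j w\<^sub>j\<close> with \<open>0 < j < r\<close>: subtracting \<open>e\<^sub>j\<close> times a suitable symmetric polynomial removes the
  monomials in exactly \<open>j\<close> variables without creating monomials in fewer variables.\<close>
lemma symm_decompose:
  assumes "symm N u" "r \<le> N" "1 \<le> j" "j \<le> r" "\<And>a. a \<in> Ex N r \<Longrightarrow> card (spt N a) < j \<Longrightarrow> u a = 0"
  shows "\<exists>c w. (\<forall>i. symm N (w i)) \<and>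
    msum N r u = of_int c * esym r N + (\<Sum>i\<in>{1..<r}. esym i N * msum N (r - i) (w i))"
  using assms
proof (induction "r - j" arbitrary: j u)
  case 0
  then have "j = r" by simp
  then have m: "msum N r u = of_int (u (ind {1..r})) * esym r N"
    using 0 by (intro msum_elementary) auto
  have "symm N (\<lambda>_. 0)" by (simp add: symm_def)
  moreover have "msum N i (\<lambda>_. 0) = 0" for i by (simp add: msum_def)
  ultimately show ?case using m by (intro exI[of _ "u (ind {1..r})"] exI[of _ "\<lambda>_ _. 0"]) simp
next
  case (Suc d)
  define v where "v = shift N j u"
  define u' where "u' a = u a + - conv N j v a" for a
  have jN: "j \<le> N" using Suc by simp
  have sv: "symm N v" unfolding v_def by (rule symm_shift[OF Suc(3) jN])
  have su: "symm N u'" using Suc(3) symm_conv[OF sv] by (simp add: u'_def symm_def)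
  have van: "u' a = 0" if a: "a \<in> Ex N r" "card (spt N a) < Suc j" for a
  proof (cases "card (spt N a) < j")
    case True
    have "\<not> (I \<in> subs N j \<and> I \<subseteq> spt N a)" for I
    proof
      assume I: "I \<in> subs N j \<and> I \<subseteq> spt N a"
      have "card I \<le> card (spt N a)" by (rule card_mono) (use I in simp_all)
      then show False using I True by (simp add: subs_def)
    qed
    then have "{I \<in> subs N j. I \<subseteq> spt N a} = {}" by blast
    then have "conv N j v a = 0" by (simp only: conv_def sum.empty)
    then show ?thesis using Suc(7)[OF a(1) True] by (simp add: u'_def)
  next
    case False
    then have c: "card (spt N a) = j" using a(2) by simp
    then have s: "spt N a \<in> subs N j" by (auto simp: subs_def)
    \<comment> \<open>With exactly j variables, the sum in \<open>conv\<close> has the single term I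
      = \<open>spt N a\<close>, and \<open>shift\<close> was made so that this term returns u
      a.\<close>
    have "I = spt N a" if "I \<in> subs N j" "I \<subseteq> spt N a" for I
      using that c by (intro card_subset_eq) (auto simp: subs_def)
    then have "{I \<in> subs N j. I \<subseteq> spt N a} = {spt N a}" using s by blast
    then have "conv N j v a = v (\<lambda>k. a k - ind (spt N a) k)" by (simp add: conv_def)
    also have "\<dots> = u (\<lambda>k. a k - ind (spt N a) k + ind (spt N a) k)"
      unfolding v_def by (rule shift_eq[OF Suc(3) s]) auto
    also have "(\<lambda>k. a k - ind (spt N a) k + ind (spt N a) k) = a"
      by (rule ext) (auto simp: ind_def)
    finally show ?thesis by (simp add: u'_def)
  qed
  have "j < r" using Suc(2) by simp
  have "d = r - Suc j" using Suc(2) by simp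
  moreover have "1 \<le> Suc j" "Suc j \<le> r" using Suc(2) by simp_all
  ultimately obtain c w where w: "\<forall>i. symm N (w i)"
      "msum N r u' = of_int c * esym r N + (\<Sum>i\<in>{1..<r}. esym i N * msum N (r - i) (w i))"
    using Suc(1)[OF _ su Suc(4) _ _ van] by blast
  \<comment> \<open>The multiplier v of e_j joins the one that the induction found for u'; since j <
    r, the index j occurs in the sum.\<close>
  define w' where "w' i = (if i = j then (\<lambda>a. w i a + v a) else w i)" for i
  have "\<forall>i. symm N (w' i)" using w(1) sv by (simp add: w'_def symm_def)
  moreover have "msum N r u = of_int c * esym r N + (\<Sum>i\<in>{1..<r}. esym i N * msum N (r - i) (w' i))"
  proof -
    have u: "u = (\<lambda>a. u' a + conv N j v a)" by (simp add: u'_def)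
    have "msum N r u = msum N r u' + msum N r (conv N j v)" by (subst u) (rule msum_add)
    also have "msum N r (conv N j v) = esym j N * msum N (r - j) v"
      using esym_msum[of j r N v] Suc(6) by simp
    also have "\<dots> = (\<Sum>i\<in>{1..<r}. if i = j then esym i N * msum N (r - i) v else 0)"
      using \<open>j < r\<close> Suc(5) by (simp add: sum.delta)
    finally have "msum N r u = of_int c * esym r N + (\<Sum>i\<in>{1..<r}. esym i N * msum N (r - i) (w i)
        + (if i = j then esym i N * msum N (r - i) v else 0))"
      unfolding w(2) by (simp add: sum.distrib add.assoc)
    also have "\<dots> = of_int c * esym r N + (\<Sum>i\<in>{1..<r}. esym i N * msum N (r - i) (w' i))"
      by (intro arg_cong2[where f = "(+)"] sum.cong HOL.refl) (simp add: w'_def msum_add distrib_left)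
    finally show ?thesis .
  qed
  ultimately show ?case by blast
qed

lemma msum_decompose:
  assumes "symm N u" "1 \<le> r" "r \<le> N"
  shows "\<exists>c w. (\<forall>i. symm N (w i)) \<and>
    msum N r u = of_int c * esym r N + (\<Sum>i\<in>{1..<r}. esym i N * msum N (r - i) (w i))"
proof (rule symm_decompose[OF assms(1,3), of 1])
  fix a assume a: "a \<in> Ex N r" "card (spt N a) < 1"
  then have "spt N a = {}" by simp
  then have "(\<Sum>k\<in>{1..N}. a k) = 0" by (intro sum.neutral) blast
  then show "u a = 0" using a(1) assms(2) by (simp add: Ex_def)
qed (use assms in auto)

text \<open>The decomposition reduces a symmetric element to elementary ones and to symmetric
  elements of lower degree, so centrality is inherited from \<open>esym\<close>.\<close>

lemma msum_even_center:
  assumes "symm N u" "r \<le> N"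
  shows "msum N r u \<in> even_center N"
  using assms
proof (induction r arbitrary: u rule: less_induct)
  case (less r)
  show ?case
  proof (cases "r = 0")
    case True
    have z: "a k = 0" if a: "a \<in> Ex N 0" for a k
    proof (cases "k \<in> {1..N}")
      case True
      then show ?thesis using a member_le_sum[of k "{1..N}" a] by (simp add: Ex_def)
    qed (use a in \<open>simp add: Ex_def\<close>)
    have "Ex N 0 = {\<lambda>_. 0}"
    proof
      show "Ex N 0 \<subseteq> {\<lambda>_. 0}" using z by blast
    qed (simp add: Ex_def)
    moreover have "ymono (\<lambda>_. 0) ks = 1" for ks by (induction ks) simp_all
    ultimately have "msum N r u = of_int (u (\<lambda>_. 0)) * 1" using True by (simp add: msum_def)
    then show ?thesis using even_center_of_int[OF even_center_1] by metis
  next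
    case False
    obtain c w where w: "\<And>i. symm N (w i)"
        "msum N r u = of_int c * esym r N + (\<Sum>i\<in>{1..<r}. esym i N * msum N (r - i) (w i))"
      using msum_decompose[OF less.prems(1) _ less.prems(2)] False by auto
    have "msum N (r - i) (w i) \<in> even_center N" if "i \<in> {1..<r}" for i
      using that less.prems(2) by (intro less.IH w(1)) auto
    then show ?thesis unfolding w(2)
      by (intro even_center_add even_center_of_int even_center_sum even_center_mult esym_even_center)
  qed
qed

lemma by_words_mono_prod:
  assumes "set ks \<subseteq> A"
  shows "by_words (edges A (2 * sum_list (map a ks))) (ymono a ks)"
  using assms
proof (induction ks)
  case Nil
  then show ?case using by_words_one by simp
next
  case (Cons k ks)
  have p: "by_words (edges A (2 * m)) (yy k ^ m)" for m
  proof (induction m)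
    case 0
    then show ?case using by_words_one by simp
  next
    case (Suc m)
    have "by_words (edges A (2 + 2 * m)) (yy k * yy k ^ m)"
      by (rule by_words_edges_mult[OF by_words_yy Suc]) (use Cons.prems in simp)
    then show ?case by simp
  qed
  have "by_words (edges A (2 * sum_list (map a ks))) (ymono a ks)" using Cons by simp
  from by_words_edges_mult[OF p[of "a k"] this] show ?case by (simp add: distrib_left)
qed

lemma by_words_msum: "by_words (edges {1..N} (2 * r)) (msum N r u)"
  unfolding msum_def
proof (intro by_words_sum by_words_of_int)
  fix a assume a: "a \<in> Ex N r"
  have "sum_list (map a [1..<N + 1]) = (\<Sum>k\<in>{1..N}. a k)"
    by (simp add: sum_list_distinct_conv_sum_set atLeastLessThanSuc_atLeastAtMost del: upt_Suc)
  then have "sum_list (map a [1..<N + 1]) = r" using a by (simp add: Ex_def)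
  then show "by_words (edges {1..N} (2 * r)) (ymono a [1..<N + 1])"
    using by_words_mono_prod[of "[1..<N + 1]" "{1..N}" a]
    by (simp add: atLeastLessThanSuc_atLeastAtMost del: upt_Suc)
qed

section \<open>Triangularity of the monomial symmetric functions\<close>

definition lists_below :: "nat \<Rightarrow> nat \<Rightarrow> nat list set" where
  "lists_below k m = {l. length l = m \<and> set l \<subseteq> {1..<k}}"

lemma finite_lists_below: "finite (lists_below k m)"
  using finite_lists_length_eq[of "{1..<k}" m] by (simp add: lists_below_def conj_commute)

definition starw :: "nat \<Rightarrow> nat list \<Rightarrow> sp" where
  "starw k l = sum_list (map (\<lambda>i. tt i k) l)"

lemma starw_simps [simp]: "starw k [] = 0" "starw k (i # l) = tt i k + starw k l"
  by (simp_all add: starw_def)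

lemma lists_below_Suc: "lists_below k (Suc m) = (\<lambda>(i, l). i # l) ` ({1..<k} \<times> lists_below k m)"
proof (intro equalityI subsetI)
  fix l assume l: "l \<in> lists_below k (Suc m)"
  then obtain i l' where "l = i # l'" by (cases l) (auto simp: lists_below_def)
  then show "l \<in> (\<lambda>(i, l). i # l) ` ({1..<k} \<times> lists_below k m)"
    using l by (intro image_eqI[of _ _ "(i, l')"]) (auto simp: lists_below_def)
qed (auto simp: lists_below_def)

lemma MM_power: "MM k ^ m = (\<Sum>l\<in>lists_below k m. el (starw k l))"
proof (induction m)
  case 0
  have "lists_below k 0 = {[]}" by (auto simp: lists_below_def)
  then show ?case by simp
next
  case (Suc m)
  have inj: "inj_on (\<lambda>(i, l). i # l) ({1..<k} \<times> lists_below k m)" by (auto simp: inj_on_def)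
  have "MM k ^ Suc m = (\<Sum>i\<in>{1..<k}. \<Sum>l\<in>lists_below k m. el (tt i k + starw k l))"
    by (simp add: Suc) (simp add: MM_def sum_product el_add)
  also have "\<dots> = (\<Sum>(i, l)\<in>{1..<k} \<times> lists_below k m. el (starw k (i # l)))"
    by (simp add: sum.cartesian_product)
  also have "\<dots> = (\<Sum>l\<in>lists_below k (Suc m). el (starw k l))"
    unfolding lists_below_Suc sum.reindex[OF inj] by (rule sum.cong) auto
  finally show ?case .
qed

lemma yy_power: "yy k ^ m = MM k ^ (2 * m)"
  by (simp add: yy_def power_mult power2_eq_square)

text \<open>Expanding every power of a Jucys--Murphy element turns a monomial into a sum over these
  families: each centre k receives a list of 2 * a k leaves below k.\<close>

definition fams :: "(nat \<Rightarrow> nat) \<Rightarrow> nat list \<Rightarrow> nat list list set" where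
  "fams a ks = {F. list_all2 (\<lambda>k l. l \<in> lists_below k (2 * a k)) ks F}"

definition Fsum :: "nat list \<Rightarrow> nat list list \<Rightarrow> sp" where
  "Fsum ks F = sum_list (map2 starw ks F)"

lemma Fsum_simps [simp]: "Fsum [] F = 0" "Fsum (k # ks) (l # F) = starw k l + Fsum ks F"
  by (simp_all add: Fsum_def)

lemma fams_Nil: "fams a [] = {[]}" by (auto simp: fams_def)

lemma fams_Cons: "fams a (k # ks) = (\<lambda>(l, F). l # F) ` (lists_below k (2 * a k) \<times> fams a ks)"
proof (intro equalityI subsetI)
  fix F assume F: "F \<in> fams a (k # ks)"
  then obtain l F' where "F = l # F'" by (cases F) (auto simp: fams_def)
  then show "F \<in> (\<lambda>(l, F). l # F) ` (lists_below k (2 * a k) \<times> fams a ks)"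
    using F by (intro image_eqI[of _ _ "(l, F')"]) (auto simp: fams_def)
qed (auto simp: fams_def)

lemma finite_fams: "finite (fams a ks)"
  by (induction ks) (simp_all add: fams_Nil fams_Cons finite_lists_below)

lemma mono_expand: "ymono a ks = (\<Sum>F\<in>fams a ks. el (Fsum ks F))"
proof (induction ks)
  case (Cons k ks)
  have inj: "inj_on (\<lambda>(l, F). l # F) (lists_below k (2 * a k) \<times> fams a ks)" by (auto simp: inj_on_def)
  have "ymono a (k # ks) = (\<Sum>l\<in>lists_below k (2 * a k). \<Sum>F\<in>fams a ks. el (starw k l + Fsum ks F))"
    unfolding mono_simps yy_power MM_power Cons sum_product by (simp only: el_add)
  also have "\<dots> = (\<Sum>(l, F)\<in>lists_below k (2 * a k) \<times> fams a ks. el (Fsum (k # ks) (l # F)))"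
    by (simp add: sum.cartesian_product)
  also have "\<dots> = (\<Sum>F\<in>fams a (k # ks). el (Fsum (k # ks) F))"
    unfolding fams_Cons sum.reindex[OF inj] by (rule sum.cong) auto
  finally show ?case .
qed (simp add: fams_Nil)

text \<open>The cycles read off from a family. Centres without leaves are dropped, since they would
  be cycles of length 1; the reversal matches the order in which \<open>gcy\<close> multiplies its
  star.\<close>

definition cyl :: "nat list \<Rightarrow> nat list list \<Rightarrow> nat list list" where
  "cyl ks F = map (\<lambda>(k, l). k # rev l) (filter (\<lambda>(k, l). l \<noteq> []) (zip ks F))"

lemma cyl_simps [simp]: "cyl [] F = []"
  "cyl (k # ks) (l # F) = (if l = [] then cyl ks F else (k # rev l) # cyl ks F)"
  by (simp_all add: cyl_def)

lemma act_starw: "act (starw k l) = act (gcy (k # rev l))"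
proof (induction l)
  case Nil
  then show ?case by (simp add: gcy_def)
next
  case (Cons i l)
  have "act (starw k (i # l)) = transpose i k \<circ> act (starw k l)" by (simp only: starw_simps act_add act_tt)
  also have "\<dots> = transpose k i \<circ> act (gcy (k # rev l))" unfolding Cons transpose_commute[of i k] ..
  also have "\<dots> = act (gcy (k # rev (i # l)))" by (simp only: gcy_def list.sel rev_rev_ident list.map sum_list.Cons act_add act_tt)
  finally show ?case .
qed

lemma fams_induct [consumes 1, case_names Nil Cons]:
  assumes "F \<in> fams a ks" "P [] []"
    and "\<And>k l ks F. F \<in> fams a ks \<Longrightarrow> length l = 2 * a k \<Longrightarrow> set l \<subseteq> {1..<k} \<Longrightarrow> P ks F \<Longrightarrow> P (k # ks) (l # F)"
  shows "P ks F"
proof -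
  have "list_all2 (\<lambda>k l. l \<in> lists_below k (2 * a k)) ks F" using assms(1) by (simp add: fams_def)
  then show ?thesis
    by (induction rule: list_all2_induct) (auto intro!: assms(2,3) simp: fams_def lists_below_def)
qed

lemma act_Fsum: "F \<in> fams a ks \<Longrightarrow> act (Fsum ks F) = act (gsum (cyl ks F))"
proof (induction rule: fams_induct)
  case (Cons k l ks F)
  show ?case
  proof (cases "l = []")
    case False
    have "act (Fsum (k # ks) (l # F)) = act (starw k l) \<circ> act (Fsum ks F)" by (simp only: Fsum_simps act_add)
    also have "\<dots> = act (gsum ((k # rev l) # cyl ks F))"
      unfolding act_starw Cons(4) by (simp only: gsum_simps act_add)
    finally show ?thesis using False by simp
  qed (use Cons in simp)
qed simp

lemma set_cyl: "F \<in> fams a ks \<Longrightarrow> set (concat (cyl ks F)) = {k \<in> set ks. a k \<noteq> 0} \<union> set (concat F)"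
proof (induction rule: fams_induct)
  case (Cons k l ks F)
  have "l = [] \<longleftrightarrow> a k = 0" using Cons(2) by auto
  then show ?case using Cons(4) by auto
qed simp

lemma length_concat_fams: "F \<in> fams a ks \<Longrightarrow> length (concat F) = 2 * sum_list (map a ks)"
  by (induction rule: fams_induct) simp_all

definition good :: "(nat \<Rightarrow> nat) \<Rightarrow> nat list \<Rightarrow> nat list list \<Rightarrow> bool" where
  "good a ks F \<longleftrightarrow> F \<in> fams a ks \<and> distinct ks \<and> distinct (concat F) \<and>
     {k \<in> set ks. a k \<noteq> 0} \<inter> set (concat F) = {}"

lemma good_cyl:
  assumes "good a ks F"
  shows "cyc_sys (cyl ks F)" "\<And>c. c \<in> set (cyl ks F) \<Longrightarrow> odd (length c)"
    "mset (map (\<lambda>c. length c - 1) (cyl ks F)) = image_mset (\<lambda>k. 2 * a k) (mset (filter (\<lambda>k. a k \<noteq> 0) ks))"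
proof -
  have F: "F \<in> fams a ks" using assms by (simp add: good_def)
  have d: "distinct ks" "distinct (concat F)" "{k \<in> set ks. a k \<noteq> 0} \<inter> set (concat F) = {}"
    using assms by (auto simp: good_def)
  from F d have "cyc_sys (cyl ks F)"
  proof (induction rule: fams_induct)
    case (Cons k l ks F)
    have ak: "l = [] \<longleftrightarrow> a k = 0" using Cons(2) by auto
    have IH: "cyc_sys (cyl ks F)" using Cons by auto
    show ?case
    proof (cases "l = []")
      case False
      have "k \<notin> set l" using Cons(3) by auto
      moreover have "set (k # rev l) \<inter> set (concat (cyl ks F)) = {}"
        unfolding set_cyl[OF Cons(1)] using Cons(5-7) ak False by auto
      moreover have "2 \<le> length (k # rev l)" using False by (cases l) auto
      ultimately show ?thesis using IH False Cons(6) by (simp add: cyc_sys_def)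
    qed (use IH in simp)
  qed (simp add: cyc_sys_def)
  then show "cyc_sys (cyl ks F)" .
  have "(\<forall>c\<in>set (cyl ks F). odd (length c)) \<and>
    mset (map (\<lambda>c. length c - 1) (cyl ks F)) = image_mset (\<lambda>k. 2 * a k) (mset (filter (\<lambda>k. a k \<noteq> 0) ks))"
    using F
  proof (induction rule: fams_induct)
    case (Cons k l ks F)
    have ak: "l = [] \<longleftrightarrow> a k = 0" using Cons(2) by auto
    then show ?case using Cons(2,4) by simp
  qed simp
  then show "\<And>c. c \<in> set (cyl ks F) \<Longrightarrow> odd (length c)"
    "mset (map (\<lambda>c. length c - 1) (cyl ks F)) = image_mset (\<lambda>k. 2 * a k) (mset (filter (\<lambda>k. a k \<noteq> 0) ks))"
    by blast+
qed

definition mtype :: "nat \<Rightarrow> (nat \<Rightarrow> nat) \<Rightarrow> nat multiset" where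
  "mtype N a = image_mset (\<lambda>k. 2 * a k) (mset_set (spt N a))"

lemma size_mtype: "size (mtype N a) = card (spt N a)" by (simp add: mtype_def)

lemma set_upt1: "set [1..<N + 1] = {1..N}" by auto

lemma mset_filter_upt: "mset (filter (\<lambda>k. a k \<noteq> 0) [1..<N + 1]) = mset_set (spt N a)"
proof -
  have "mset (filter (\<lambda>k. a k \<noteq> 0) [1..<N + 1]) = mset_set (set (filter (\<lambda>k. a k \<noteq> 0) [1..<N + 1]))"
    by (rule mset_set_set[symmetric]) (simp del: upt_Suc)
  also have "set (filter (\<lambda>k. a k \<noteq> 0) [1..<N + 1]) = spt N a" by auto
  finally show ?thesis .
qed

lemma ctype_good:
  assumes "good a [1..<N + 1] F"
  shows "ctype (act (Fsum [1..<N + 1] F)) = mtype N a"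
proof -
  have F: "F \<in> fams a [1..<N + 1]" using assms by (simp only: good_def)
  show ?thesis unfolding act_Fsum[OF F] ctype_gsum[OF good_cyl(1)[OF assms]] good_cyl(3)[OF assms] mset_filter_upt mtype_def ..
qed

lemma sum_list_Ex: "a \<in> Ex N r \<Longrightarrow> sum_list (map a [1..<N + 1]) = r"
proof -
  assume a: "a \<in> Ex N r"
  have "sum_list (map a [1..<N + 1]) = (\<Sum>k\<in>set [1..<N + 1]. a k)"
    by (rule sum_list_distinct_conv_sum_set) (rule distinct_upt)
  then show ?thesis unfolding set_upt1 using a by (simp add: Ex_def)
qed

text \<open>The product moves 2 * r + \<open>size \<nu>\<close> points, all of them active centres
  or leaves. There are at most 2 * r different leaves, so at least \<open>size \<nu>\<close> centres
  are active. Equality forces the leaves to be distinct and to avoid the centres.\<close>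

lemma top_count:
  assumes "\<nu> \<in> EP" "sum_mset \<nu> = 2 * r" "g \<in> Dn \<nu> N" "a \<in> Ex N r" "F \<in> fams a [1..<N + 1]"
    "act (Fsum [1..<N + 1] F) = act g"
  shows "size \<nu> \<le> card (spt N a)" "size \<nu> = card (spt N a) \<Longrightarrow> good a [1..<N + 1] F \<and> \<nu> = mtype N a"
proof -
  let ?ks = "[1..<N + 1]" and ?C = "spt N a" and ?L = "set (concat F)"
  have len: "length (concat F) = 2 * r" using length_concat_fams[OF assms(5)] sum_list_Ex[OF assms(4)] by simp
  have C: "{k \<in> set ?ks. a k \<noteq> 0} = ?C" unfolding set_upt1 ..
  have "{x. act g x \<noteq> x} \<subseteq> set (concat (cyl ?ks F))"
    using act_gsum_outside[of _ "cyl ?ks F"] unfolding assms(6)[symmetric] act_Fsum[OF assms(5)] by blast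
  then have sub: "{x. act g x \<noteq> x} \<subseteq> ?C \<union> ?L" unfolding set_cyl[OF assms(5)] C .
  have "2 * r + size \<nu> = card {x. act g x \<noteq> x}"
    using DD_card_moved[OF assms(1), of g] assms(2,3) by (simp add: Dn_def)
  also have "\<dots> \<le> card (?C \<union> ?L)" by (rule card_mono[OF _ sub]) simp
  finally have 1: "2 * r + size \<nu> \<le> card (?C \<union> ?L)" .
  have 2: "card (?C \<union> ?L) + card (?C \<inter> ?L) = card ?C + card ?L"
    by (rule card_Un_Int[symmetric]) simp_all
  have 3: "card ?L \<le> 2 * r" using card_length[of "concat F"] len by simp
  show "size \<nu> \<le> card ?C" using 1 2 3 by linarith
  assume e: "size \<nu> = card ?C"
  have "card ?L = length (concat F)" using 1 2 3 e len by linarith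
  then have "distinct (concat F)" by (rule card_distinct)
  moreover have "card (?C \<inter> ?L) = 0" using 1 2 3 e by linarith
  then have "?C \<inter> ?L = {}" by simp
  ultimately have g: "good a ?ks F"
    unfolding good_def C using assms(5) distinct_upt by blast
  moreover have "\<nu> = mtype N a"
    using ctype_good[OF g] DD_ctype[OF assms(1), of g] assms(3,6) by (simp add: Dn_def)
  ultimately show "good a ?ks F \<and> \<nu> = mtype N a" by blast
qed

lemma cyl_mem: "F \<in> fams a ks \<Longrightarrow> i < length ks \<Longrightarrow> F ! i \<noteq> [] \<Longrightarrow> (ks ! i) # rev (F ! i) \<in> set (cyl ks F)"
proof (induction arbitrary: i rule: fams_induct)
  case (Cons k l ks F)
  then show ?case by (cases i) auto
qed simp

lemma fams_nth: "F \<in> fams a ks \<Longrightarrow> length F = length ks \<and>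
    (\<forall>i<length ks. length (F ! i) = 2 * a (ks ! i) \<and> set (F ! i) \<subseteq> {1..<ks ! i})"
proof (induction rule: fams_induct)
  case (Cons k l ks F)
  then show ?case by (auto simp: nth_Cons split: nat.split)
qed simp

lemma mem_cyl: "c \<in> set (cyl ks F) \<Longrightarrow> F \<in> fams a ks \<Longrightarrow> \<exists>i<length ks. c = ks ! i # rev (F ! i)"
  unfolding cyl_def using fams_nth[of F a ks] by (auto simp: set_zip)

lemma Max_star: "set l \<subseteq> {1..<k} \<Longrightarrow> Max (set (k # rev l)) = k"
  by (rule Max_eqI) (auto dest!: subsetD)

text \<open>The centres are the maxima of the nontrivial orbits and the leaves are read off along them.\<close>
lemma good_unique:
  assumes "good a ks F" "good b ks G" "act (Fsum ks F) = act (Fsum ks G)"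
  shows "\<And>k. k \<in> set ks \<Longrightarrow> a k = b k" "F = G"
proof -
  have F: "F \<in> fams a ks" and G: "G \<in> fams b ks" using assms by (auto simp: good_def)
  have e: "act (gsum (cyl ks F)) = act (gsum (cyl ks G))"
    using assms(3) unfolding act_Fsum[OF F] act_Fsum[OF G] .
  have le: "b k = a k" if gF: "good a ks F" and gG: "good b ks G" and
      eq: "act (gsum (cyl ks F)) = act (gsum (cyl ks G))" and k: "k \<in> set ks" "a k \<noteq> 0" for a b F G k
  proof -
    have F: "F \<in> fams a ks" and G: "G \<in> fams b ks" and dk: "distinct ks" using gF gG by (auto simp: good_def)
    obtain i where i: "i < length ks" "ks ! i = k" using k(1) by (metis in_set_conv_nth)
    have l: "length (F ! i) = 2 * a k" "set (F ! i) \<subseteq> {1..<k}" using fams_nth[OF F] i by auto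
    then have "F ! i \<noteq> []" using k(2) by auto
    then have c: "k # rev (F ! i) \<in> set (cyl ks F)" using cyl_mem[OF F i(1)] i(2) by simp
    have "set ` set (cyl ks F) = set ` set (cyl ks G)"
      using orbs_gsum[OF good_cyl(1)[OF gF]] orbs_gsum[OF good_cyl(1)[OF gG]] eq by simp
    then obtain c' where c': "c' \<in> set (cyl ks G)" "set c' = set (k # rev (F ! i))"
      using c by (metis (no_types, lifting) image_iff)
    obtain i' where i': "i' < length ks" "c' = ks ! i' # rev (G ! i')" using mem_cyl[OF c'(1) G] by blast
    have l': "length (G ! i') = 2 * b (ks ! i')" "set (G ! i') \<subseteq> {1..<ks ! i'}" using fams_nth[OF G] i' by auto
    have "ks ! i' = k" using Max_star[OF l'(2)] Max_star[OF l(2)] c'(2) i'(2) by metis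
    moreover have "distinct c'" using good_cyl(1)[OF gG] c'(1) distinct_cyc by (metis cyc_sys_def)
    moreover have "distinct (k # rev (F ! i))" using good_cyl(1)[OF gF] c distinct_cyc by (metis cyc_sys_def)
    ultimately have "length c' = length (k # rev (F ! i))" using c'(2) by (metis distinct_card)
    then show ?thesis using i'(2) l l' \<open>ks ! i' = k\<close> by simp
  qed
  show ab: "a k = b k" if "k \<in> set ks" for k
    using le[OF assms(1,2) e that] le[OF assms(2,1) e[symmetric] that] by metis
  have pos: "(k # rev (F ! i)) ! n = (act (gsum (cyl ks F)) ^^ n) k"
    if g: "good a ks F" and i: "i < length ks" "k = ks ! i" "F ! i \<noteq> []" and n: "n \<le> length (F ! i)" for a F i k n
  proof -
    have F: "F \<in> fams a ks" using g by (auto simp: good_def)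
    have d: "distinct (concat (cyl ks F))" using good_cyl(1)[OF g] by (simp add: cyc_sys_def)
    have c: "k # rev (F ! i) \<in> set (cyl ks F)" using cyl_mem[OF F i(1,3)] i(2) by simp
    have "(act (gsum (cyl ks F)) ^^ n) k = (cycle_of_list (k # rev (F ! i)) ^^ n) ((k # rev (F ! i)) ! 0)"
      using act_gsum_funpow[OF d c, of k n] by simp
    also have "\<dots> = (k # rev (F ! i)) ! ((0 + n) mod length (k # rev (F ! i)))"
      by (rule cycle_of_list_nth[OF distinct_cyc[OF d c]]) simp
    finally show ?thesis using n by simp
  qed
  have lenF: "length F = length ks" "length G = length ks" using fams_nth[OF F] fams_nth[OF G] by auto
  show "F = G"
  proof (rule nth_equalityI)
    fix i assume "i < length F"
    then have i: "i < length ks" using lenF by simp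
    have len: "length (F ! i) = length (G ! i)" using fams_nth[OF F] fams_nth[OF G] i ab[of "ks ! i"] by simp
    show "F ! i = G ! i"
    proof (cases "F ! i = []")
      case False
      then have G': "G ! i \<noteq> []" using len by auto
      have "ks ! i # rev (F ! i) = ks ! i # rev (G ! i)"
      proof (rule nth_equalityI)
        fix n assume "n < length (ks ! i # rev (F ! i))"
        then have n: "n \<le> length (F ! i)" "n \<le> length (G ! i)" using len by auto
        show "(ks ! i # rev (F ! i)) ! n = (ks ! i # rev (G ! i)) ! n"
          using pos[OF assms(1) i HOL.refl False n(1)] pos[OF assms(2) i HOL.refl G' n(2)] e by simp
      qed (use len in simp)
      then show ?thesis by simp
    qed (use len in simp)
  qed (use lenF in simp)
qed

lemma good_append:
  assumes "good a ks F" "distinct (ks @ ks')" "\<And>k. k \<in> set ks' \<Longrightarrow> a k = 0"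
  shows "good a (ks @ ks') (F @ replicate (length ks') [])"
proof -
  have F: "list_all2 (\<lambda>k l. l \<in> lists_below k (2 * a k)) ks F" using assms(1) by (simp add: good_def fams_def)
  have "list_all2 (\<lambda>k l. l \<in> lists_below k (2 * a k)) ks' (replicate (length ks') [])"
    using assms(3) by (auto simp: list_all2_conv_all_nth lists_below_def)
  then have "list_all2 (\<lambda>k l. l \<in> lists_below k (2 * a k)) (ks @ ks') (F @ replicate (length ks') [])"
    using F list_all2_appendI by blast
  moreover have "concat (F @ replicate (length ks') []) = concat F" by simp
  moreover have "{k \<in> set (ks @ ks'). a k \<noteq> 0} = {k \<in> set ks. a k \<noteq> 0}" using assms(3) by auto
  ultimately show ?thesis using assms(1,2) unfolding good_def fams_def by simp
qed

lemma fams_cong: "(\<And>k. k \<in> set ks \<Longrightarrow> a k = b k) \<Longrightarrow> fams a ks = fams b ks"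
  by (induction ks) (simp_all add: fams_Nil fams_Cons)

text \<open>Each part p = 2 q takes the next p + 1 points: the last of them, Y, becomes a centre
  with exponent q, and the p points before it are its leaves. They carry exponent 0, hence empty
  lists of their own.\<close>

lemma ex_good:
  assumes "\<forall>p\<in>set ps. even p \<and> 0 < p"
  shows "\<exists>a F. (\<forall>k. k \<notin> {1..sum_list ps + length ps} \<longrightarrow> a k = 0) \<and>
     good a [1..<sum_list ps + length ps + 1] F \<and> set (concat F) \<subseteq> {1..sum_list ps + length ps} \<and>
     mtype (sum_list ps + length ps) a = mset ps \<and> 2 * (\<Sum>k\<in>{1..sum_list ps + length ps}. a k) = sum_list ps"
  using assms
proof (induction ps)
  case Nil
  show ?case by (rule exI[of _ "\<lambda>_. 0"], rule exI[of _ "[]"]) (simp add: good_def fams_Nil mtype_def)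
next
  case (Cons p ps)
  define X where "X = sum_list ps + length ps"
  obtain a F where aF: "\<And>k. k \<notin> {1..X} \<Longrightarrow> a k = 0" "good a [1..<X + 1] F" "set (concat F) \<subseteq> {1..X}"
      "mtype X a = mset ps" "2 * (\<Sum>k\<in>{1..X}. a k) = sum_list ps"
    using Cons unfolding X_def by auto
  obtain q where q: "p = 2 * q" "0 < q" using Cons.prems by auto
  define Y where "Y = X + p + 1"
  have Y: "sum_list (p # ps) + length (p # ps) = Y" by (simp add: Y_def X_def)
  define b where "b = a(Y := q)"
  have ba: "b k = a k" if "k \<noteq> Y" for k using that by (simp add: b_def)
  have aY: "a k = 0" if "X < k" for k using aF(1) that by simp
  let ?mid = "[X + 1..<X + p + 1]"
  let ?F0 = "F @ replicate (length ?mid) []"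
  have ks: "[1..<Y + 1] = ([1..<X + 1] @ ?mid) @ [Y]"
    unfolding Y_def using upt_add_eq_append[of 1 "X + 1" p] by simp
  have mid: "{1..X} \<inter> set ?mid = {}" "Y \<notin> {1..X}" "Y \<notin> set ?mid" "{1..X} \<subseteq> {1..Y}" "set ?mid \<subseteq> {1..Y}"
    by (auto simp: Y_def simp del: upt_Suc)
  have sFm: "set (concat (?F0 @ [?mid])) = set (concat F) \<union> set ?mid" by (simp del: upt_Suc)
  have "distinct ([1..<X + 1] @ ?mid)" by (auto simp del: upt_Suc)
  then have g0: "good a ([1..<X + 1] @ ?mid) ?F0"
    by (rule good_append[OF aF(2)]) (auto intro: aY)
  have s0: "set (concat ?F0) \<subseteq> {1..X}" using aF(3) by simp
  have g1: "good b [1..<Y + 1] (?F0 @ [?mid])"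
    unfolding good_def
  proof (intro conjI)
    have "fams a ([1..<X + 1] @ ?mid) = fams b ([1..<X + 1] @ ?mid)"
      by (rule fams_cong) (auto simp: b_def Y_def)
    then have f0: "list_all2 (\<lambda>k l. l \<in> lists_below k (2 * b k)) ([1..<X + 1] @ ?mid) ?F0"
      using g0 unfolding good_def fams_def by blast
    have f1: "?mid \<in> lists_below Y (2 * b Y)" by (auto simp: lists_below_def b_def q(1) Y_def)
    show "?F0 @ [?mid] \<in> fams b [1..<Y + 1]"
      unfolding ks fams_def mem_Collect_eq by (rule list_all2_appendI[OF f0]) (use f1 in \<open>simp del: upt_Suc\<close>)
    show "distinct (concat (?F0 @ [?mid]))"
    proof -
      have c: "concat (?F0 @ [?mid]) = concat F @ ?mid" by (simp del: upt_Suc)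
      have "distinct (concat F)" using aF(2) unfolding good_def by blast
      moreover have "set (concat F) \<inter> set ?mid = {}" using aF(3) mid(1) by blast
      ultimately show ?thesis unfolding c distinct_append using distinct_upt by blast
    qed
    have "{k \<in> set [1..<Y + 1]. b k \<noteq> 0} \<subseteq> insert Y {k \<in> set [1..<X + 1]. a k \<noteq> 0}"
    proof
      fix k assume k: "k \<in> {k \<in> set [1..<Y + 1]. b k \<noteq> 0}"
      show "k \<in> insert Y {k \<in> set [1..<X + 1]. a k \<noteq> 0}"
      proof (cases "k = Y")
        case False
        have "b k \<noteq> 0" using k by blast
        then have "a k \<noteq> 0" unfolding ba[OF False] .
        then have "k \<in> {1..X}" using aF(1)[of k] by argo
        then show ?thesis unfolding set_upt1 using \<open>a k \<noteq> 0\<close> by blast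
      qed simp
    qed
    moreover have "{k \<in> set [1..<X + 1]. a k \<noteq> 0} \<inter> set (concat F) = {}"
      using aF(2) by (simp only: good_def)
    moreover have "{k \<in> set [1..<X + 1]. a k \<noteq> 0} \<inter> set ?mid = {}" by (auto simp del: upt_Suc)
    moreover have "Y \<notin> set (concat F) \<union> set ?mid" using aF(3) mid(2,3) by blast
    moreover note sFm
    ultimately show "{k \<in> set [1..<Y + 1]. b k \<noteq> 0} \<inter> set (concat (?F0 @ [?mid])) = {}" by blast
  qed (rule distinct_upt)
  have g2: "set (concat (?F0 @ [?mid])) \<subseteq> {1..Y}" unfolding sFm using aF(3) mid(4,5) by blast
  have spt: "spt Y b = insert Y (spt X a)"
  proof (intro equalityI subsetI)
    fix k assume k: "k \<in> spt Y b"
    show "k \<in> insert Y (spt X a)"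
    proof (cases "k = Y")
      case False
      have "b k \<noteq> 0" using k by blast
      then have "a k \<noteq> 0" unfolding ba[OF False] .
      moreover from this have "k \<in> {1..X}" using aF(1)[of k] by argo
      ultimately show ?thesis by blast
    qed simp
  next
    fix k assume k: "k \<in> insert Y (spt X a)"
    show "k \<in> spt Y b"
    proof (cases "k = Y")
      case True
      then show ?thesis using q(2) by (simp add: b_def Y_def)
    next
      case False
      then show ?thesis using k ba mid(4) by auto
    qed
  qed
  have g3: "mtype Y b = mset (p # ps)"
  proof -
    have "Y \<notin> spt X a" by (simp add: Y_def)
    then have "mset_set (spt Y b) = add_mset Y (mset_set (spt X a))" unfolding spt by simp
    moreover have "image_mset (\<lambda>k. 2 * b k) (mset_set (spt X a)) = image_mset (\<lambda>k. 2 * a k) (mset_set (spt X a))"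
      by (rule image_mset_cong) (simp add: b_def Y_def)
    ultimately show ?thesis using aF(4) q(1) by (simp add: mtype_def b_def)
  qed
  have g4: "2 * (\<Sum>k\<in>{1..Y}. b k) = sum_list (p # ps)"
  proof -
    have "(\<Sum>k\<in>{1..Y}. b k) = (\<Sum>k\<in>spt Y b. b k)" by (rule sum.mono_neutral_right) auto
    also have "\<dots> = q + (\<Sum>k\<in>spt X a. b k)" unfolding spt by (subst sum.insert) (auto simp: Y_def b_def)
    also have "(\<Sum>k\<in>spt X a. b k) = (\<Sum>k\<in>spt X a. a k)" by (rule sum.cong) (auto simp: b_def Y_def)
    also have "\<dots> = (\<Sum>k\<in>{1..X}. a k)" by (rule sum.mono_neutral_left) auto
    finally show ?thesis using aF(5) q(1) by simp
  qed
  have g0b: "\<forall>k. k \<notin> {1..Y} \<longrightarrow> b k = 0" using aF(1) by (auto simp: b_def Y_def)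
  show ?case unfolding Y
    by (rule exI[of _ b], rule exI[of _ "?F0 @ [?mid]"]) (intro conjI g0b g1 g2 g3 g4)
qed

lemma ex_good_type:
  assumes "\<nu> \<in> EP" "sum_mset \<nu> = 2 * r" "sum_mset \<nu> + size \<nu> \<le> N"
  shows "\<exists>a F. a \<in> Ex N r \<and> good a [1..<N + 1] F \<and> mtype N a = \<nu>"
proof -
  let ?X = "sum_mset \<nu> + size \<nu>"
  have "\<forall>p\<in>set (parts_list \<nu>). even p \<and> 0 < p" using assms(1) by (auto simp: EP_def)
  from ex_good[OF this] obtain a F where aF: "\<And>k. k \<notin> {1..?X} \<Longrightarrow> a k = 0" "good a [1..<?X + 1] F"
      "mtype ?X a = \<nu>" "2 * (\<Sum>k\<in>{1..?X}. a k) = sum_mset \<nu>"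
    by auto
  have ks: "[1..<N + 1] = [1..<?X + 1] @ [?X + 1..<N + 1]"
    using upt_add_eq_append[of 1 "?X + 1" "N - ?X"] assms(3) by simp
  have z: "k \<in> {1..?X}" if "a k \<noteq> 0" for k using aF(1)[of k] that by argo
  have sub: "{1..?X} \<subseteq> {1..N}" using assms(3) by auto
  have "a k = 0" if "k \<in> set [?X + 1..<N + 1]" for k
    using that by (intro aF(1)) (simp del: upt_Suc)
  then have g: "good a [1..<N + 1] (F @ replicate (length [?X + 1..<N + 1]) [])"
    unfolding ks by (intro good_append[OF aF(2)]) (auto simp del: upt_Suc)
  have "spt N a = spt ?X a" using z sub by blast
  then have mt: "mtype N a = \<nu>" using aF(3) by (simp only: mtype_def)
  have Ex: "a \<in> Ex N r"
  proof -
    have "(\<Sum>k\<in>{1..N}. a k) = (\<Sum>k\<in>{1..?X}. a k)"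
      by (rule sum.mono_neutral_right[OF _ sub]) (use aF(1) in simp_all)
    then have "(\<Sum>k\<in>{1..N}. a k) = r" using aF(4) assms(2) by simp
    moreover have "a k = 0" if "k \<notin> {1..N}" for k using that z[of k] sub by blast
    ultimately show ?thesis by (simp add: Ex_def)
  qed
  show ?thesis
    by (rule exI[of _ a], rule exI[of _ "F @ replicate (length [?X + 1..<N + 1]) []"]) (intro conjI Ex g mt)
qed

text \<open>The coefficient function of a monomial symmetric polynomial, indexed by the doubled
  exponents because the variables are squares.\<close>

definition utype :: "nat \<Rightarrow> nat multiset \<Rightarrow> (nat \<Rightarrow> nat) \<Rightarrow> int" where
  "utype N \<nu> a = of_bool (mtype N a = \<nu>)"

lemma symm_utype: "symm N (utype N \<nu>)"
  unfolding symm_def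
proof (intro allI impI)
  fix p and a :: "nat \<Rightarrow> nat" assume p: "p permutes {1..N}"
  have "mset_set (spt N a) = image_mset p (mset_set (spt N (\<lambda>k. a (p k))))"
    using image_mset_mset_set[OF permutes_inj_on[OF p], of "spt N (\<lambda>k. a (p k))"]
    unfolding permutes_spt[OF p, of a] by (rule HOL.sym)
  then have "mtype N (\<lambda>k. a (p k)) = mtype N a" by (simp add: mtype_def multiset.map_comp comp_def)
  then show "utype N \<nu> (\<lambda>k. a (p k)) = utype N \<nu> a" by (simp only: utype_def)
qed

lemma co_msum_fams:
  "co g (msum N r u) = (\<Sum>a\<in>Ex N r. \<Sum>F\<in>fams a [1..<N + 1]. u a * co g (el (Fsum [1..<N + 1] F)))"
  unfolding msum_def co_sum co_of_int mono_expand sum_distrib_left ..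

text \<open>A monomial of type \<open>\<kappa>\<close> has \<open>size \<kappa>\<close> active
  centres, so \<open>top_count\<close> bounds the number of parts of \<open>\<nu>\<close>, and
  equality identifies the two types.\<close>

lemma co_msum_utype:
  assumes "\<nu> \<in> EP" "sum_mset \<nu> = 2 * r" "sum_mset \<nu> + size \<nu> \<le> N" "co (rep \<nu>) (msum N r (utype N \<kappa>)) \<noteq> 0"
  shows "size \<nu> < size \<kappa> \<or> \<nu> = \<kappa>"
proof -
  obtain a where a: "a \<in> Ex N r"
      "(\<Sum>F\<in>fams a [1..<N + 1]. utype N \<kappa> a * co (rep \<nu>) (el (Fsum [1..<N + 1] F))) \<noteq> 0"
    using assms(4) unfolding co_msum_fams by (meson sum.neutral)
  then obtain F where F: "F \<in> fams a [1..<N + 1]" "utype N \<kappa> a * co (rep \<nu>) (el (Fsum [1..<N + 1] F)) \<noteq> 0"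
    by (meson sum.neutral)
  have k: "mtype N a = \<kappa>" using F(2) by (auto simp: utype_def)
  have e: "act (Fsum [1..<N + 1] F) = act (rep \<nu>)" using F(2) co_el_act by simp
  note t = top_count[OF assms(1,2) rep_Dn[OF assms(1,3)] a(1) F(1) e]
  show ?thesis using t k size_mtype[of N a] by (cases "size \<nu> = card (spt N a)") auto
qed

text \<open>By \<open>good_unique\<close> exactly one term of the expansion lies over the
  permutation of a suitable h. This h belongs to the class of \<open>\<nu>\<close> only up to
  \<open>zz\<close>, whence the undetermined sign.\<close>

lemma co_msum_utype_diag:
  assumes "\<nu> \<in> EP" "sum_mset \<nu> = 2 * r" "sum_mset \<nu> + size \<nu> \<le> N"
  shows "co (rep \<nu>) (msum N r (utype N \<nu>)) = 1 \<or> co (rep \<nu>) (msum N r (utype N \<nu>)) = - 1"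
proof -
  let ?ks = "[1..<N + 1]"
  obtain a F where aF: "a \<in> Ex N r" "good a ?ks F" "mtype N a = \<nu>" using ex_good_type[OF assms] by blast
  have Fa: "F \<in> fams a ?ks" using aF(2) by (simp only: good_def)
  define h where "h = Fsum ?ks F"
  have ch: "ctype (act h) = \<nu>" unfolding h_def ctype_good[OF aF(2)] by (rule aF(3))
  have sub: "set (concat (cyl ?ks F)) \<subseteq> {1..N}"
  proof -
    have "x \<in> {1..N}" if x: "x \<in> set (concat F)" for x
    proof -
      obtain l where l: "l \<in> set F" "x \<in> set l" using x unfolding set_concat by blast
      obtain i where i: "i < length F" "F ! i = l" using l(1) by (metis in_set_conv_nth)
      have i': "i < length ?ks" using i(1) fams_nth[OF Fa] by metis
      have n: "?ks ! i \<in> {1..N}" using nth_mem[OF i'] unfolding set_upt1 .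
      have "set l \<subseteq> {1..<?ks ! i}" using fams_nth[OF Fa] i' i(2) by metis
      then have "x \<in> {1..<?ks ! i}" using l(2) by blast
      then show ?thesis using n unfolding atLeastLessThan_iff atLeastAtMost_iff by linarith
    qed
    then have "set (concat F) \<subseteq> {1..N}" by blast
    then show ?thesis unfolding set_cyl[OF Fa] set_upt1 by blast
  qed
  have hG: "h \<in> Gn N"
  proof -
    have "act h x = x" if "x \<notin> {1..N}" for x
      unfolding h_def act_Fsum[OF Fa] by (rule act_gsum_outside) (use that sub in blast)
    then show ?thesis unfolding Gn_def by blast
  qed
  obtain \<beta> where \<beta>: "\<beta> \<in> EP_upto N" "h \<in> Dn \<beta> N \<or> zz + h \<in> Dn \<beta> N"
    using odd_cycles_in_Dn[OF hG good_cyl(1)[OF aF(2)] act_Fsum[OF Fa, folded h_def, symmetric] good_cyl(2)[OF aF(2)]]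
    by blast
  have "\<beta> = \<nu>"
    using \<beta> ch DD_ctype[of \<beta> h] DD_ctype[of \<beta> "zz + h"] by (auto simp: Dn_def EP_upto_def)
  then obtain g where g: "g \<in> Dn \<nu> N" "g = h \<or> g = zz + h" using \<beta>(2) by blast
  have ag: "act g = act h" using g(2) by auto
  have one: "co h (msum N r (utype N \<nu>)) = 1"
  proof -
    \<comment> \<open>Every contributing family is good by the equality case of
      \<open>top_count\<close>, and a good family is determined by its permutation.\<close>
    have z: "utype N \<nu> b * co h (el (Fsum ?ks G)) = 0"
      if b: "b \<in> Ex N r" "G \<in> fams b ?ks" "(b, G) \<noteq> (a, F)" for b G
    proof (rule ccontr)
      assume nz: "utype N \<nu> b * co h (el (Fsum ?ks G)) \<noteq> 0"
      then have t: "mtype N b = \<nu>" by (auto simp: utype_def)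
      have e: "act (Fsum ?ks G) = act h" using nz co_el_act by simp
      have "good b ?ks G"
        using top_count(2)[OF assms(1,2) g(1) b(1,2)] e ag t size_mtype[of N b] by simp
      then have gu: "\<And>k. k \<in> set ?ks \<Longrightarrow> b k = a k" "G = F"
        using good_unique[OF _ aF(2)] e unfolding h_def by blast+
      have "b = a"
      proof
        fix k
        show "b k = a k"
        proof (cases "k \<in> {1..N}")
          case True
          then show ?thesis using gu(1) unfolding set_upt1 by blast
        qed (use b(1) aF(1) in \<open>simp add: Ex_def\<close>)
      qed
      then show False using gu(2) b(3) by simp
    qed
    have "co h (msum N r (utype N \<nu>)) = (\<Sum>b\<in>Ex N r. if b = a then 1 else 0)"
      unfolding co_msum_fams
    proof (rule sum.cong[OF HOL.refl])
      fix b assume b: "b \<in> Ex N r"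
      show "(\<Sum>G\<in>fams b ?ks. utype N \<nu> b * co h (el (Fsum ?ks G))) = (if b = a then 1 else 0)"
      proof (cases "b = a")
        case True
        have "(\<Sum>G\<in>fams b ?ks. utype N \<nu> b * co h (el (Fsum ?ks G))) = (\<Sum>G\<in>fams a ?ks. if G = F then 1 else 0)"
          unfolding True
        proof (rule sum.cong[OF HOL.refl])
          fix G assume G: "G \<in> fams a ?ks"
          show "utype N \<nu> a * co h (el (Fsum ?ks G)) = (if G = F then 1 else 0)"
          proof (cases "G = F")
            case True
            then show ?thesis using aF(3) h_def by (simp add: utype_def co_el del: upt_Suc)
          next
            case False
            then show ?thesis using z[OF aF(1) G] by simp
          qed
        qed
        then show ?thesis using True Fa by (simp add: sum.delta[OF finite_fams] del: upt_Suc)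
      next
        case False
        then show ?thesis using z[OF b] by (simp add: sum.neutral del: upt_Suc)
      qed
    qed
    then show ?thesis using aF(1) by (simp add: sum.delta[OF finite_Ex])
  qed
  have rN: "r \<le> N" using assms(2,3) by simp
  have "co (rep \<nu>) (msum N r (utype N \<nu>)) = co g (msum N r (utype N \<nu>))"
    by (rule even_center_co_eq[OF msum_even_center[OF symm_utype rN] assms(1) rep_Dn[OF assms(1,3)] g(1)])
  then show ?thesis using g(2) one by (auto simp: co_zz_add)
qed

section \<open>The spin FH-algebra\<close>

lemma EP_sum_size: "\<nu> \<in> EP \<Longrightarrow> size \<nu> \<le> sum_mset \<nu> \<and> even (sum_mset \<nu>)"
  unfolding EP_def by (induction \<nu>) fastforce+

text \<open>The number of parts is at most the sum, so at index 2 * m all classes of degree m are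
  present.\<close>

lemma EP_of_upto: "\<nu> \<in> EP_of m \<Longrightarrow> \<nu> \<in> EP_upto (2 * m)"
  using EP_sum_size[of \<nu>] by (simp add: EP_of_def EP_upto_def)

lemma finite_EP_of: "finite (EP_of m)"
  by (rule finite_subset[OF _ finite_EP_upto[of "2 * m"]]) (use EP_of_upto in blast)

lemma finite_EP_le: "finite {\<nu>. \<nu> \<in> EP \<and> sum_mset \<nu> \<le> m}"
proof (rule finite_subset)
  show "{\<nu>. \<nu> \<in> EP \<and> sum_mset \<nu> \<le> m} \<subseteq> (\<Union>k\<in>{..m}. EP_of k)" by (auto simp: EP_of_def)
qed (use finite_EP_of in blast)

section \<open>Integer combinations of coefficient vectors in one degree\<close>

definition proper_pairs :: "nat \<Rightarrow> (nat multiset \<times> nat multiset) set" where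
  "proper_pairs m = {(\<alpha>, \<beta>). \<alpha> \<in> EP \<and> \<beta> \<in> EP \<and> sum_mset \<alpha> + sum_mset \<beta> = m \<and>
     sum_mset \<alpha> > 0 \<and> sum_mset \<beta> > 0}"

lemma finite_proper_pairs: "finite (proper_pairs m)"
  by (rule finite_subset[OF _ finite_cartesian_product[OF finite_EP_le[of m] finite_EP_le[of m]]])
    (auto simp: proper_pairs_def)

text \<open>F agrees in degree m with a vector in the integer lattice spanned by the class
  coefficients of e_(m/2) and of proper products of class sums, all taken at one index N. Values of
  F in other degrees are left free.\<close>

definition lat :: "nat \<Rightarrow> nat \<Rightarrow> (nat multiset \<Rightarrow> int) \<Rightarrow> bool" where
  "lat m N F \<longleftrightarrow> (\<exists>c d. \<forall>\<nu>\<in>EP_of m. F \<nu> = c * co (rep \<nu>) (esym (m div 2) N) +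
     (\<Sum>p\<in>proper_pairs m. d p * co (rep \<nu>) (dn (fst p) N * dn (snd p) N)))"

lemma lat_cong: "lat m N F \<Longrightarrow> (\<And>\<nu>. \<nu> \<in> EP_of m \<Longrightarrow> G \<nu> = F \<nu>) \<Longrightarrow> lat m N G"
  by (simp add: lat_def)

lemma lat_0: "lat m N (\<lambda>\<nu>. 0)"
  unfolding lat_def by (rule exI[of _ 0], rule exI[of _ "\<lambda>_. 0"]) simp

lemma lat_esym: "lat m N (\<lambda>\<nu>. co (rep \<nu>) (esym (m div 2) N))"
  unfolding lat_def by (rule exI[of _ 1], rule exI[of _ "\<lambda>_. 0"]) simp

lemma lat_pair:
  assumes "(\<alpha>, \<beta>) \<in> proper_pairs m"
  shows "lat m N (\<lambda>\<nu>. co (rep \<nu>) (dn \<alpha> N * dn \<beta> N))"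
proof -
  have "(\<Sum>p\<in>proper_pairs m. of_bool (p = (\<alpha>, \<beta>)) * co (rep \<nu>) (dn (fst p) N * dn (snd p) N)) =
      co (rep \<nu>) (dn \<alpha> N * dn \<beta> N)" for \<nu>
  proof -
    have "(\<Sum>p\<in>proper_pairs m. of_bool (p = (\<alpha>, \<beta>)) * co (rep \<nu>) (dn (fst p) N * dn (snd p) N)) =
        (\<Sum>p\<in>proper_pairs m. if p = (\<alpha>, \<beta>) then co (rep \<nu>) (dn \<alpha> N * dn \<beta> N) else 0)"
      by (rule sum.cong) simp_all
    then show ?thesis using assms by (simp add: sum.delta[OF finite_proper_pairs])
  qed
  then show ?thesis
    unfolding lat_def by (intro exI[of _ 0] exI[of _ "\<lambda>p. of_bool (p = (\<alpha>, \<beta>))"]) simp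
qed

lemma lat_add:
  assumes "lat m N F" "lat m N G"
  shows "lat m N (\<lambda>\<nu>. F \<nu> + G \<nu>)"
proof -
  obtain c d where F: "\<forall>\<nu>\<in>EP_of m. F \<nu> = c * co (rep \<nu>) (esym (m div 2) N) +
     (\<Sum>p\<in>proper_pairs m. d p * co (rep \<nu>) (dn (fst p) N * dn (snd p) N))"
    using assms(1) unfolding lat_def by (elim exE)
  obtain c' d' where G: "\<forall>\<nu>\<in>EP_of m. G \<nu> = c' * co (rep \<nu>) (esym (m div 2) N) +
     (\<Sum>p\<in>proper_pairs m. d' p * co (rep \<nu>) (dn (fst p) N * dn (snd p) N))"
    using assms(2) unfolding lat_def by (elim exE)
  show ?thesis unfolding lat_def
    by (rule exI[of _ "c + c'"], rule exI[of _ "\<lambda>p. d p + d' p"])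
      (simp add: F G distrib_right sum.distrib)
qed

lemma lat_scale:
  assumes "lat m N F"
  shows "lat m N (\<lambda>\<nu>. k * F \<nu>)"
proof -
  obtain c d where F: "\<forall>\<nu>\<in>EP_of m. F \<nu> = c * co (rep \<nu>) (esym (m div 2) N) +
     (\<Sum>p\<in>proper_pairs m. d p * co (rep \<nu>) (dn (fst p) N * dn (snd p) N))"
    using assms(1) unfolding lat_def by (elim exE)
  show ?thesis unfolding lat_def
    by (rule exI[of _ "k * c"], rule exI[of _ "\<lambda>p. k * d p"])
      (simp add: F distrib_left sum_distrib_left mult.assoc)
qed

lemma lat_sum: "(\<And>i. i \<in> A \<Longrightarrow> lat m N (F i)) \<Longrightarrow> lat m N (\<lambda>\<nu>. \<Sum>i\<in>A. F i \<nu>)"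
proof (induction A rule: infinite_finite_induct)
  case (insert x A)
  then have "lat m N (\<lambda>\<nu>. F x \<nu> + (\<Sum>i\<in>A. F i \<nu>))" by (intro lat_add) simp_all
  then show ?case using insert(1,2) by simp
qed (simp_all add: lat_0)

lemma co_scaled_mult: "co h (of_int a * x * (of_int b * y)) = a * b * co h (x * y)" for x y :: salg
proof -
  have "of_int a * x * (of_int b * y) = of_int a * (x * of_int b) * y" by (simp only: mult.assoc)
  also have "x * of_int b = of_int b * x" by (rule mult_of_int_commute[symmetric])
  finally have "of_int a * x * (of_int b * y) = of_int (a * b) * (x * y)"
    by (simp only: mult.assoc of_int_mult)
  then show ?thesis by (simp only: co_of_int)
qed

text \<open>Expanding both factors in class sums, pairs of total degree below m contribute nothing
  in degree m. The degree bounds on x and y leave only pairs of degrees exactly i and j, and these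
  are proper.\<close>

lemma lat_product:
  assumes x: "x \<in> even_center N" and y: "y \<in> even_center N"
    and dx: "\<And>\<alpha>. \<alpha> \<in> EP_upto N \<Longrightarrow> co (rep \<alpha>) x \<noteq> 0 \<Longrightarrow> sum_mset \<alpha> \<le> i"
    and dy: "\<And>\<beta>. \<beta> \<in> EP_upto N \<Longrightarrow> co (rep \<beta>) y \<noteq> 0 \<Longrightarrow> sum_mset \<beta> \<le> j"
    and ij: "0 < i" "0 < j" "i + j = m" "2 * m \<le> N"
  shows "lat m N (\<lambda>\<nu>. co (rep \<nu>) (x * y))"
proof -
  have up: "\<nu> \<in> EP_upto N" if "\<nu> \<in> EP_of m" for \<nu>
    using EP_of_upto[OF that] ij(4) by (simp add: EP_upto_def)
  let ?a = "\<lambda>\<alpha>. co (rep \<alpha>) x" and ?b = "\<lambda>\<beta>. co (rep \<beta>) y"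
  have "x * y = (\<Sum>\<alpha>\<in>EP_upto N. of_int (?a \<alpha>) * dn \<alpha> N) * (\<Sum>\<beta>\<in>EP_upto N. of_int (?b \<beta>) * dn \<beta> N)"
    by (rule arg_cong2[where f = "(*)", OF even_center_expand[OF x] even_center_expand[OF y]])
  also have "\<dots> = (\<Sum>\<alpha>\<in>EP_upto N. \<Sum>\<beta>\<in>EP_upto N. of_int (?a \<alpha>) * dn \<alpha> N * (of_int (?b \<beta>) * dn \<beta> N))"
    by (rule sum_product)
  finally have xy: "co (rep \<nu>) (x * y) =
      (\<Sum>\<alpha>\<in>EP_upto N. \<Sum>\<beta>\<in>EP_upto N. ?a \<alpha> * ?b \<beta> * co (rep \<nu>) (dn \<alpha> N * dn \<beta> N))" for \<nu>
    by (simp only: co_sum co_scaled_mult)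
  have "lat m N (\<lambda>\<nu>. \<Sum>\<alpha>\<in>EP_upto N. \<Sum>\<beta>\<in>EP_upto N. ?a \<alpha> * ?b \<beta> * co (rep \<nu>) (dn \<alpha> N * dn \<beta> N))"
  proof (intro lat_sum)
    fix \<alpha> \<beta> assume ab: "\<alpha> \<in> EP_upto N" "\<beta> \<in> EP_upto N"
    then have EP: "\<alpha> \<in> EP" "\<beta> \<in> EP" by (simp_all add: EP_upto_def)
    show "lat m N (\<lambda>\<nu>. ?a \<alpha> * ?b \<beta> * co (rep \<nu>) (dn \<alpha> N * dn \<beta> N))"
    proof (cases "?a \<alpha> = 0 \<or> ?b \<beta> = 0")
      case True
      then show ?thesis using lat_0 by auto
    next
      case False
      then have le: "sum_mset \<alpha> \<le> i" "sum_mset \<beta> \<le> j" using dx[OF ab(1)] dy[OF ab(2)] by blast+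
      show ?thesis
      proof (cases "sum_mset \<alpha> + sum_mset \<beta> < m")
        case True
        have "co (rep \<nu>) (dn \<alpha> N * dn \<beta> N) = 0" if "\<nu> \<in> EP_of m" for \<nu>
          using co_dn_dn_above[OF EP up[OF that]] True that by (simp add: EP_of_def)
        then show ?thesis by (intro lat_cong[OF lat_0]) simp
      next
        case False
        then have "(\<alpha>, \<beta>) \<in> proper_pairs m" using le ij EP by (simp add: proper_pairs_def)
        then show ?thesis by (rule lat_scale[OF lat_pair])
      qed
    qed
  qed
  then show ?thesis by (rule lat_cong) (rule xy)
qed

lemma by_words_degree:
  assumes "by_words (edges A k) x" "\<alpha> \<in> EP_upto N" "co (rep \<alpha>) x \<noteq> 0"
  shows "sum_mset \<alpha> \<le> k"
proof -
  have EP: "\<alpha> \<in> EP" "sum_mset \<alpha> + size \<alpha> \<le> N" using assms(2) by (simp_all add: EP_upto_def)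
  have "rep \<alpha> \<in> supp_salg x" using assms(3) unfolding supp_salg_def mem_Collect_eq .
  then obtain L where L: "L \<in> edges A k" "act (rep \<alpha>) = act (wsum L)"
    using assms(1) unfolding by_words_def by blast
  show ?thesis
    using word_rank[OF EP(1) rep_Dn[OF EP] HOL.sym[OF L(2)]] L(1) by (simp add: edges_def)
qed

lemma lat_msum:
  assumes "symm N u" "1 \<le> r" "4 * r \<le> N"
  shows "lat (2 * r) N (\<lambda>\<nu>. co (rep \<nu>) (msum N r u))"
proof -
  have rN: "r \<le> N" using assms(3) by simp
  obtain c w where w: "\<And>i. symm N (w i)"
      "msum N r u = of_int c * esym r N + (\<Sum>i\<in>{1..<r}. esym i N * msum N (r - i) (w i))"
    using msum_decompose[OF assms(1,2) rN] by metis
  have "lat (2 * r) N (\<lambda>\<nu>. co (rep \<nu>) (esym i N * msum N (r - i) (w i)))" if i: "i \<in> {1..<r}" for i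
  proof (rule lat_product[OF esym_even_center msum_even_center[OF w(1)]])
    show "sum_mset \<alpha> \<le> 2 * i" if "\<alpha> \<in> EP_upto N" "co (rep \<alpha>) (esym i N) \<noteq> 0" for \<alpha>
      by (rule by_words_degree[OF by_words_esym that])
    show "sum_mset \<alpha> \<le> 2 * (r - i)" if "\<alpha> \<in> EP_upto N" "co (rep \<alpha>) (msum N (r - i) (w i)) \<noteq> 0" for \<alpha>
      by (rule by_words_degree[OF by_words_msum that])
  qed (use i assms(3) in auto)
  then have "lat (2 * r) N (\<lambda>\<nu>. c * co (rep \<nu>) (esym (2 * r div 2) N) +
      (\<Sum>i\<in>{1..<r}. co (rep \<nu>) (esym i N * msum N (r - i) (w i))))"
    by (intro lat_add lat_scale[OF lat_esym] lat_sum)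
  then show ?thesis by (rule lat_cong) (simp add: w(2) co_sum)
qed

text \<open>The monomial symmetric function attached to \<open>\<xi>\<close> is unitriangular with respect to the number of parts.\<close>
lemma lat_delta:
  assumes "1 \<le> r" "4 * r \<le> N" "\<xi> \<in> EP_of (2 * r)"
  shows "lat (2 * r) N (\<lambda>\<nu>. of_bool (\<nu> = \<xi>))"
  using assms(3)
proof (induction "size \<xi>" arbitrary: \<xi> rule: less_induct)
  case less
  define G where "G \<nu> = co (rep \<nu>) (msum N r (utype N \<xi>))" for \<nu>
  define S where "S = {\<kappa> \<in> EP_of (2 * r). size \<kappa> < size \<xi>}"
  have fS: "finite S" unfolding S_def using finite_EP_of by simp
  have EP: "\<nu> \<in> EP" "sum_mset \<nu> = 2 * r" "sum_mset \<nu> + size \<nu> \<le> N" if "\<nu> \<in> EP_of (2 * r)" for \<nu>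
    using EP_of_upto[OF that] that assms(2) by (simp_all add: EP_of_def EP_upto_def)
  \<comment> \<open>The diagonal entry is 1 or -1, so multiplication by it normalises the entry to 1
    without knowing which sign occurs.\<close>
  have diag: "G \<xi> * G \<xi> = 1" using co_msum_utype_diag[OF EP[OF less.prems]] by (auto simp: G_def)
  have "lat (2 * r) N G" unfolding G_def by (rule lat_msum[OF symm_utype assms(1,2)])
  moreover have "lat (2 * r) N (\<lambda>\<nu>. \<Sum>\<kappa>\<in>S. (- (G \<xi> * G \<kappa>)) * of_bool (\<nu> = \<kappa>))"
    using less.hyps by (intro lat_sum lat_scale) (simp add: S_def)
  ultimately have "lat (2 * r) N (\<lambda>\<nu>. G \<xi> * G \<nu> + (\<Sum>\<kappa>\<in>S. (- (G \<xi> * G \<kappa>)) * of_bool (\<nu> = \<kappa>)))"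
    by (intro lat_add lat_scale)
  then show ?case
  proof (rule lat_cong)
    fix \<nu> assume nu: "\<nu> \<in> EP_of (2 * r)"
    have "(\<Sum>\<kappa>\<in>S. (- (G \<xi> * G \<kappa>)) * of_bool (\<nu> = \<kappa>)) = (\<Sum>\<kappa>\<in>S. if \<nu> = \<kappa> then - (G \<xi> * G \<nu>) else 0)"
      by (rule sum.cong) auto
    also have "\<dots> = (if \<nu> \<in> S then - (G \<xi> * G \<nu>) else 0)" by (simp add: sum.delta'[OF fS])
    finally have s: "(\<Sum>\<kappa>\<in>S. (- (G \<xi> * G \<kappa>)) * of_bool (\<nu> = \<kappa>)) = \<dots>" .
    have "G \<nu> = 0 \<or> size \<nu> < size \<xi> \<or> \<nu> = \<xi>"
      using co_msum_utype[OF EP[OF nu], of \<xi>] unfolding G_def by blast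
    then show "of_bool (\<nu> = \<xi>) = G \<xi> * G \<nu> + (\<Sum>\<kappa>\<in>S. (- (G \<xi> * G \<kappa>)) * of_bool (\<nu> = \<kappa>))"
      unfolding s using nu diag by (auto simp: S_def)
  qed
qed

section \<open>From coefficient vectors to the algebra\<close>

lemma lookup_fh_scale [simp]: "Poly_Mapping.lookup (fh_scale c v) \<alpha> = c * Poly_Mapping.lookup v \<alpha>"
  by (simp add: fh_scale_def Poly_Mapping.map.rep_eq when_def)

lemma lookup_sum_basis:
  assumes "finite A"
  shows "Poly_Mapping.lookup (\<Sum>\<nu>\<in>A. fh_scale (f \<nu>) (d_basis \<nu>)) \<alpha> = (if \<alpha> \<in> A then f \<alpha> else 0)"
proof -
  have "Poly_Mapping.lookup (\<Sum>\<nu>\<in>A. fh_scale (f \<nu>) (d_basis \<nu>)) \<alpha> = (\<Sum>\<nu>\<in>A. if \<nu> = \<alpha> then f \<nu> else 0)"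
    by (simp add: lookup_sum lookup_single when_def if_distrib cong: if_cong)
  then show ?thesis by (simp add: sum.delta[OF assms])
qed

text \<open>An integer identity at the single index 4 * r lifts to the algebra, because the
  coefficients of \<open>e_star\<close> and the top-degree structure polynomials do not depend on
  n.\<close>

lemma d_basis_combination:
  assumes "1 \<le> r" "\<xi> \<in> EP_of (2 * r)"
  shows "\<exists>c d. d_basis \<xi> = fh_scale (of_int c) (e_star r) +
     (\<Sum>p\<in>proper_pairs (2 * r). fh_scale (of_int (d p)) (d_mult_top (fst p) (snd p)))"
proof -
  let ?N = "4 * r"
  obtain c d where cd: "\<And>\<nu>. \<nu> \<in> EP_of (2 * r) \<Longrightarrow> of_bool (\<nu> = \<xi>) = c * co (rep \<nu>) (esym r ?N) +
      (\<Sum>p\<in>proper_pairs (2 * r). d p * co (rep \<nu>) (dn (fst p) ?N * dn (snd p) ?N))"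
    using lat_delta[OF assms(1) order.refl assms(2)] unfolding lat_def by auto
  have e: "Poly_Mapping.lookup (e_star r) \<nu> = (if \<nu> \<in> EP_of (2 * r) then of_int (A_coeff r \<nu>) else 0)" for \<nu>
    unfolding e_star_def by (rule lookup_sum_basis[OF finite_EP_of])
  have t: "Poly_Mapping.lookup (d_mult_top (fst p) (snd p)) \<nu> =
      (if \<nu> \<in> EP_of (2 * r) then of_int (co (rep \<nu>) (dn (fst p) ?N * dn (snd p) ?N)) else 0)"
    if p: "p \<in> proper_pairs (2 * r)" for p \<nu>
  proof -
    have EP: "fst p \<in> EP" "snd p \<in> EP" "sum_mset (fst p) + sum_mset (snd p) = 2 * r"
      using p by (auto simp: proper_pairs_def)
    have "d_mult_top (fst p) (snd p) =
        (\<Sum>\<nu>\<in>EP_of (2 * r). fh_scale (struct_poly (fst p) (snd p) \<nu>) (d_basis \<nu>))"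
      unfolding d_mult_top_def EP_of_def EP(3) ..
    then have "Poly_Mapping.lookup (d_mult_top (fst p) (snd p)) \<nu> =
        (if \<nu> \<in> EP_of (2 * r) then struct_poly (fst p) (snd p) \<nu> else 0)"
      by (simp only: lookup_sum_basis[OF finite_EP_of])
    moreover have "struct_poly (fst p) (snd p) \<nu> = of_int (co (rep \<nu>) (dn (fst p) ?N * dn (snd p) ?N))"
      if nu: "\<nu> \<in> EP_of (2 * r)"
    proof -
      have u: "\<nu> \<in> EP_upto ?N" using EP_of_upto[OF nu] by simp
      then have n: "\<nu> \<in> EP" "sum_mset \<nu> + size \<nu> \<le> ?N" by (simp_all add: EP_upto_def)
      have s: "sum_mset \<nu> = sum_mset (fst p) + sum_mset (snd p)" using nu EP(3) by (simp add: EP_of_def)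
      show ?thesis
        unfolding struct_poly_top[OF EP(1,2) n(1) s n(2)] struct_coeff_eq[OF EP(1,2) u] of_int_poly ..
    qed
    ultimately show ?thesis by (cases "\<nu> \<in> EP_of (2 * r)") simp_all
  qed
  have "d_basis \<xi> = fh_scale (of_int c) (e_star r) +
     (\<Sum>p\<in>proper_pairs (2 * r). fh_scale (of_int (d p)) (d_mult_top (fst p) (snd p)))"
  proof (rule poly_mapping_eqI)
    fix \<nu>
    have r: "Poly_Mapping.lookup (fh_scale (of_int c) (e_star r) +
         (\<Sum>p\<in>proper_pairs (2 * r). fh_scale (of_int (d p)) (d_mult_top (fst p) (snd p)))) \<nu> =
        of_int c * Poly_Mapping.lookup (e_star r) \<nu> +
         (\<Sum>p\<in>proper_pairs (2 * r). of_int (d p) * Poly_Mapping.lookup (d_mult_top (fst p) (snd p)) \<nu>)"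
      by (simp add: lookup_add lookup_sum)
    show "Poly_Mapping.lookup (d_basis \<xi>) \<nu> = Poly_Mapping.lookup (fh_scale (of_int c) (e_star r) +
         (\<Sum>p\<in>proper_pairs (2 * r). fh_scale (of_int (d p)) (d_mult_top (fst p) (snd p)))) \<nu>"
      unfolding r
    proof (cases "\<nu> \<in> EP_of (2 * r)")
      case True
      then have n: "\<nu> \<in> EP" "sum_mset \<nu> = 2 * r" "sum_mset \<nu> + size \<nu> \<le> ?N"
        using EP_of_upto[OF True] by (simp_all add: EP_of_def EP_upto_def)
      have "Poly_Mapping.lookup (d_basis \<xi>) \<nu> = (of_int (of_bool (\<nu> = \<xi>)) :: rat poly)"
        by (simp add: lookup_single when_def)
      also have "\<dots> = of_int c * of_int (co (rep \<nu>) (esym r ?N)) +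
         (\<Sum>p\<in>proper_pairs (2 * r). of_int (d p) * of_int (co (rep \<nu>) (dn (fst p) ?N * dn (snd p) ?N)))"
        unfolding cd[OF True] by simp
      also have "\<dots> = of_int c * Poly_Mapping.lookup (e_star r) \<nu> +
         (\<Sum>p\<in>proper_pairs (2 * r). of_int (d p) * Poly_Mapping.lookup (d_mult_top (fst p) (snd p)) \<nu>)"
        using True by (intro arg_cong2[where f = "(+)"] sum.cong) (simp_all add: e t A_coeff_eq[OF n])
      finally show "Poly_Mapping.lookup (d_basis \<xi>) \<nu> = of_int c * Poly_Mapping.lookup (e_star r) \<nu> +
         (\<Sum>p\<in>proper_pairs (2 * r). of_int (d p) * Poly_Mapping.lookup (d_mult_top (fst p) (snd p)) \<nu>)" .
    next
      case False
      then have "\<nu> \<noteq> \<xi>" using assms(2) by blast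
      then show "Poly_Mapping.lookup (d_basis \<xi>) \<nu> = of_int c * Poly_Mapping.lookup (e_star r) \<nu> +
         (\<Sum>p\<in>proper_pairs (2 * r). of_int (d p) * Poly_Mapping.lookup (d_mult_top (fst p) (snd p)) \<nu>)"
        using False by (simp add: e t lookup_single when_def)
    qed
  qed
  then show ?thesis by blast
qed

section \<open>Coefficient rings and submodules\<close>

lemma int_valued_of_int_poly: "of_int k \<in> int_valued"
  by (simp add: of_int_poly int_valued_of_int)

lemma int_valued_mult: "p \<in> int_valued \<Longrightarrow> q \<in> int_valued \<Longrightarrow> p * q \<in> int_valued"
  by (simp add: int_valued_def)

lemma int_valued_halfI: "p \<in> int_valued \<Longrightarrow> p \<in> int_valued_half"
  unfolding int_valued_half_def by (intro CollectI exI[of _ "0::nat"] exI[of _ p]) simp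

lemma int_valued_half_mult:
  assumes "p \<in> int_valued_half" "q \<in> int_valued_half"
  shows "p * q \<in> int_valued_half"
proof -
  obtain k p' l q' where "p = Polynomial.smult (1 / 2 ^ k) p'" "q = Polynomial.smult (1 / 2 ^ l) q'"
      "p' \<in> int_valued" "q' \<in> int_valued"
    using assms unfolding int_valued_half_def by blast
  then have "p * q = Polynomial.smult (1 / 2 ^ (k + l)) (p' * q')" "p' * q' \<in> int_valued"
    by (simp_all add: int_valued_mult power_add mult.commute)
  then show ?thesis unfolding int_valued_half_def by blast
qed

lemma int_valued_half_add:
  assumes "p \<in> int_valued_half" "q \<in> int_valued_half"
  shows "p + q \<in> int_valued_half"
proof -
  obtain k p' l q' where pq: "p = Polynomial.smult (1 / 2 ^ k) p'" "q = Polynomial.smult (1 / 2 ^ l) q'"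
      "p' \<in> int_valued" "q' \<in> int_valued"
    using assms unfolding int_valued_half_def by blast
  have "p + q = Polynomial.smult (1 / 2 ^ (k + l))
      (Polynomial.smult (of_int (2 ^ l)) p' + Polynomial.smult (of_int (2 ^ k)) q')"
    by (simp add: pq smult_add_right power_add)
  moreover have "Polynomial.smult (of_int (2 ^ l)) p' + Polynomial.smult (of_int (2 ^ k)) q' \<in> int_valued"
    by (intro int_valued_add int_valued_smult pq)
  ultimately show ?thesis unfolding int_valued_half_def by blast
qed

text \<open>The common properties of \<open>int_valued\<close> and \<open>int_valued_half\<close>,
  so that module arguments are carried out once for both. Containing \<open>int_valued\<close>
  supplies the integers and the structure polynomials.\<close>

definition coeff_ring :: "rat poly set \<Rightarrow> bool" where
  "coeff_ring B \<longleftrightarrow> int_valued \<subseteq> B \<and> (\<forall>p\<in>B. \<forall>q\<in>B. p + q \<in> B \<and> p * q \<in> B)"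

lemma coeff_ring_int_valued: "coeff_ring int_valued"
  by (simp add: coeff_ring_def int_valued_add int_valued_mult)

lemma coeff_ring_int_valued_half: "coeff_ring int_valued_half"
  using int_valued_halfI by (auto simp: coeff_ring_def int_valued_half_add int_valued_half_mult)

definition fh_sub :: "rat poly set \<Rightarrow> fh_elt set \<Rightarrow> bool" where
  "fh_sub B M \<longleftrightarrow> M \<subseteq> carrier (fh_algebra B) \<and> 0 \<in> M \<and> (\<forall>x\<in>M. \<forall>y\<in>M. x + y \<in> M) \<and>
     (\<forall>c\<in>B. \<forall>x\<in>M. fh_scale c x \<in> M)"

lemma fh_carrier: "v \<in> carrier (fh_algebra B) \<longleftrightarrow>
    Poly_Mapping.keys v \<subseteq> EP \<and> (\<forall>\<alpha>. Poly_Mapping.lookup v \<alpha> \<in> B)"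
  by (simp add: fh_algebra_def)

lemma fh_subgroup:
  assumes "coeff_ring B" "fh_sub B M"
  shows "subgroup M (add_monoid (fh_algebra B))"
proof
  show "M \<subseteq> carrier (add_monoid (fh_algebra B))" using assms(2) by (simp add: fh_sub_def)
  show "x \<otimes>\<^bsub>add_monoid (fh_algebra B)\<^esub> y \<in> M" if "x \<in> M" "y \<in> M" for x y
    using assms(2) that by (simp add: fh_sub_def fh_algebra_def)
  show "\<one>\<^bsub>add_monoid (fh_algebra B)\<^esub> \<in> M" using assms(2) by (simp add: fh_sub_def fh_algebra_def)
  fix x assume x: "x \<in> M"
  \<comment> \<open>Negation is scaling by -1, so closure under scalars provides the additive
    inverses.\<close>
  have "of_int (- 1) \<in> B" using assms(1) int_valued_of_int_poly unfolding coeff_ring_def by blast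
  moreover have "fh_scale (of_int (- 1)) x = - x" by (rule poly_mapping_eqI) simp
  ultimately have m: "- x \<in> M" using assms(2) x unfolding fh_sub_def by metis
  have "inv\<^bsub>add_monoid (fh_algebra B)\<^esub> x = - x"
    unfolding m_inv_def
  proof (rule the_equality)
    show "- x \<in> carrier (add_monoid (fh_algebra B)) \<and>
        x \<otimes>\<^bsub>add_monoid (fh_algebra B)\<^esub> - x = \<one>\<^bsub>add_monoid (fh_algebra B)\<^esub> \<and>
        - x \<otimes>\<^bsub>add_monoid (fh_algebra B)\<^esub> x = \<one>\<^bsub>add_monoid (fh_algebra B)\<^esub>"
    proof (intro conjI)
      show "- x \<in> carrier (add_monoid (fh_algebra B))" using m assms(2) unfolding fh_sub_def by auto
    qed (simp_all add: fh_algebra_def)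
    show "y = - x" if "y \<in> carrier (add_monoid (fh_algebra B)) \<and>
        x \<otimes>\<^bsub>add_monoid (fh_algebra B)\<^esub> y = \<one>\<^bsub>add_monoid (fh_algebra B)\<^esub> \<and>
        y \<otimes>\<^bsub>add_monoid (fh_algebra B)\<^esub> x = \<one>\<^bsub>add_monoid (fh_algebra B)\<^esub>" for y
      using that by (simp add: fh_algebra_def eq_neg_iff_add_eq_0)
  qed
  then show "inv\<^bsub>add_monoid (fh_algebra B)\<^esub> x \<in> M" using m by simp
qed

lemma submodule_iff:
  assumes "coeff_ring B"
  shows "submodule M (poly_ring_on B) (fh_algebra B) \<longleftrightarrow> fh_sub B M"
proof
  assume "submodule M (poly_ring_on B) (fh_algebra B)"
  then interpret submodule M "poly_ring_on B" "fh_algebra B" .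
  show "fh_sub B M"
    using subset m_closed one_closed smult_closed
    by (simp add: fh_sub_def fh_algebra_def poly_ring_on_def)
next
  assume M: "fh_sub B M"
  show "submodule M (poly_ring_on B) (fh_algebra B)"
  proof (intro submodule.intro fh_subgroup[OF assms M] submodule_axioms.intro)
    show "c \<odot>\<^bsub>fh_algebra B\<^esub> x \<in> M" if "c \<in> carrier (poly_ring_on B)" "x \<in> M" for c x
      using M that by (simp add: fh_sub_def fh_algebra_def poly_ring_on_def)
  qed
qed

lemma fh_sub_add: "fh_sub B M \<Longrightarrow> x \<in> M \<Longrightarrow> y \<in> M \<Longrightarrow> x + y \<in> M"
  and fh_sub_scale: "fh_sub B M \<Longrightarrow> c \<in> B \<Longrightarrow> x \<in> M \<Longrightarrow> fh_scale c x \<in> M"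
  and fh_sub_0: "fh_sub B M \<Longrightarrow> 0 \<in> M"
  by (simp_all add: fh_sub_def)

lemma fh_sub_sum: "fh_sub B M \<Longrightarrow> (\<And>i. i \<in> A \<Longrightarrow> f i \<in> M) \<Longrightarrow> sum f A \<in> M"
  by (induction A rule: infinite_finite_induct) (auto intro: fh_sub_add fh_sub_0)

lemma fh_sub_carrier:
  assumes "coeff_ring B"
  shows "fh_sub B (carrier (fh_algebra B))"
proof -
  have z: "0 \<in> B" using assms int_valued_0 unfolding coeff_ring_def by blast
  have "x + y \<in> carrier (fh_algebra B)" if "x \<in> carrier (fh_algebra B)" "y \<in> carrier (fh_algebra B)" for x y
    using that assms Poly_Mapping.keys_add[of x y] by (auto simp: fh_carrier lookup_add coeff_ring_def)
  moreover have "fh_scale c x \<in> carrier (fh_algebra B)" if "c \<in> B" "x \<in> carrier (fh_algebra B)" for c x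
  proof -
    have "Poly_Mapping.keys (fh_scale c x) \<subseteq> Poly_Mapping.keys x" by (auto simp: in_keys_iff)
    then show ?thesis using that assms by (auto simp: fh_carrier coeff_ring_def)
  qed
  ultimately show ?thesis using z by (simp add: fh_sub_def) (simp add: fh_carrier)
qed

lemma d_basis_carrier:
  assumes "coeff_ring B" "\<alpha> \<in> EP"
  shows "d_basis \<alpha> \<in> carrier (fh_algebra B)"
proof -
  have "0 \<in> B" "1 \<in> B"
    using assms(1) int_valued_of_int_poly[of 0] int_valued_of_int_poly[of 1] unfolding coeff_ring_def by auto
  then show ?thesis using assms(2) by (simp add: fh_carrier lookup_single when_def)
qed

lemma struct_poly_coeff_ring:
  "coeff_ring B \<Longrightarrow> \<alpha> \<in> EP \<Longrightarrow> \<beta> \<in> EP \<Longrightarrow> \<nu> \<in> EP \<Longrightarrow> struct_poly \<alpha> \<beta> \<nu> \<in> B"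
  using struct_poly_int_valued unfolding coeff_ring_def by blast

lemma of_int_coeff_ring: "coeff_ring B \<Longrightarrow> of_int k \<in> B"
  using int_valued_of_int_poly unfolding coeff_ring_def by blast

lemma struct_sum_mem:
  assumes "coeff_ring B" "fh_sub B M" "\<alpha> \<in> EP" "\<beta> \<in> EP" "A \<subseteq> EP" "\<And>\<nu>. \<nu> \<in> A \<Longrightarrow> d_basis \<nu> \<in> M"
  shows "(\<Sum>\<nu>\<in>A. fh_scale (struct_poly \<alpha> \<beta> \<nu>) (d_basis \<nu>)) \<in> M"
  using assms by (intro fh_sub_sum[OF assms(2)] fh_sub_scale[OF assms(2)] struct_poly_coeff_ring) auto

lemma d_mult_carrier:
  assumes "coeff_ring B" "\<alpha> \<in> EP" "\<beta> \<in> EP"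
  shows "d_mult \<alpha> \<beta> \<in> carrier (fh_algebra B)"
  unfolding d_mult_def
  by (rule struct_sum_mem[OF assms(1) fh_sub_carrier[OF assms(1)] assms(2,3)])
    (auto intro: d_basis_carrier[OF assms(1)])

lemma e_star_mem:
  assumes "coeff_ring B" "fh_sub B M" "\<And>\<nu>. \<nu> \<in> EP_of (2 * r) \<Longrightarrow> d_basis \<nu> \<in> M"
  shows "e_star r \<in> M"
  unfolding e_star_def
  by (intro fh_sub_sum[OF assms(2)] fh_sub_scale[OF assms(2)] of_int_coeff_ring[OF assms(1)] assms(3))

lemma fh_subring_carrier:
  assumes "coeff_ring B"
  shows "subring (carrier (fh_algebra B)) (fh_algebra B)"
proof (intro subring.intro fh_subgroup[OF assms fh_sub_carrier[OF assms]])
  show "submonoid (carrier (fh_algebra B)) (fh_algebra B)"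
  proof
    fix x y assume xy: "x \<in> carrier (fh_algebra B)" "y \<in> carrier (fh_algebra B)"
    have "(\<Sum>\<alpha>\<in>Poly_Mapping.keys x. \<Sum>\<beta>\<in>Poly_Mapping.keys y.
        fh_scale (Poly_Mapping.lookup x \<alpha> * Poly_Mapping.lookup y \<beta>) (d_mult \<alpha> \<beta>)) \<in> carrier (fh_algebra B)"
      using xy assms
      by (intro fh_sub_sum[OF fh_sub_carrier[OF assms]] fh_sub_scale[OF fh_sub_carrier[OF assms]]
          d_mult_carrier[OF assms]) (auto simp: fh_carrier coeff_ring_def)
    then show "x \<otimes>\<^bsub>fh_algebra B\<^esub> y \<in> carrier (fh_algebra B)" by (simp add: fh_algebra_def)
  next
    have "{#} \<in> EP" by (simp add: EP_def)
    from d_basis_carrier[OF assms this] show "\<one>\<^bsub>fh_algebra B\<^esub> \<in> carrier (fh_algebra B)"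
      by (simp add: fh_algebra_def)
  qed simp
qed

lemma d_basis_mult: "d_basis \<alpha> \<otimes>\<^bsub>fh_algebra B\<^esub> d_basis \<beta> = d_mult \<alpha> \<beta>"
proof -
  have "fh_scale 1 v = v" for v by (rule poly_mapping_eqI) simp
  then show ?thesis by (simp add: fh_algebra_def)
qed

lemma d_mult_split: "d_mult \<alpha> \<beta> = d_mult_top \<alpha> \<beta> +
    (\<Sum>\<nu> | \<nu> \<in> EP \<and> sum_mset \<nu> < sum_mset \<alpha> + sum_mset \<beta>. fh_scale (struct_poly \<alpha> \<beta> \<nu>) (d_basis \<nu>))"
proof -
  let ?s = "sum_mset \<alpha> + sum_mset \<beta>"
  have "{\<nu>. \<nu> \<in> EP \<and> sum_mset \<nu> \<le> ?s} = {\<nu>. \<nu> \<in> EP \<and> sum_mset \<nu> = ?s} \<union> {\<nu>. \<nu> \<in> EP \<and> sum_mset \<nu> < ?s}"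
    by auto
  moreover have "finite {\<nu>. \<nu> \<in> EP \<and> sum_mset \<nu> = ?s}" "finite {\<nu>. \<nu> \<in> EP \<and> sum_mset \<nu> < ?s}"
    by (rule finite_subset[OF _ finite_EP_le[of ?s]]; auto)+
  ultimately show ?thesis
    unfolding d_mult_def d_mult_top_def by (subst sum.union_disjoint[symmetric]) auto
qed

lemma d_basis_mem_degree:
  assumes "fh_sub int_valued_half M" "1 \<le> r" "e_star r \<in> M"
    "\<And>\<alpha> \<beta>. (\<alpha>, \<beta>) \<in> proper_pairs (2 * r) \<Longrightarrow> d_mult_top \<alpha> \<beta> \<in> M" "\<xi> \<in> EP_of (2 * r)"
  shows "d_basis \<xi> \<in> M"
proof -
  obtain c d where cd: "d_basis \<xi> = fh_scale (of_int c) (e_star r) +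
     (\<Sum>p\<in>proper_pairs (2 * r). fh_scale (of_int (d p)) (d_mult_top (fst p) (snd p)))"
    using d_basis_combination[OF assms(2,5)] by blast
  show ?thesis unfolding cd
    using assms(3,4)
    by (intro fh_sub_add[OF assms(1)] fh_sub_sum[OF assms(1)] fh_sub_scale[OF assms(1)]
        of_int_coeff_ring[OF coeff_ring_int_valued_half]) auto
qed

text \<open>In the induction on the degree, the full product of two smaller basis elements lies in
  M. Its part below the top degree does so by induction, hence the top-degree part does as well, and
  \<open>d_basis_mem_degree\<close> applies.\<close>

lemma d_basis_mem_subalgebra:
  assumes "subring M (fh_algebra int_valued_half)" "fh_sub int_valued_half M"
    "\<And>r. 1 \<le> r \<Longrightarrow> e_star r \<in> M" "\<xi> \<in> EP"
  shows "d_basis \<xi> \<in> M"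
  using assms(4)
proof (induction "sum_mset \<xi>" arbitrary: \<xi> rule: less_induct)
  case less
  note mult = subring.axioms(2)[OF assms(1)]
  show ?case
  proof (cases "sum_mset \<xi> = 0")
    case True
    then have "size \<xi> = 0" using EP_sum_size[OF less.prems] by linarith
    then have "\<xi> = {#}" by simp
    then show ?thesis using submonoid.one_closed[OF mult] by (simp add: fh_algebra_def)
  next
    case False
    obtain r where r: "sum_mset \<xi> = 2 * r" using EP_sum_size[OF less.prems] by blast
    have r1: "1 \<le> r" using r False by simp
    show ?thesis
    proof (rule d_basis_mem_degree[OF assms(2) r1 assms(3)[OF r1]])
      show "\<xi> \<in> EP_of (2 * r)" using less.prems r by (simp add: EP_of_def)
      fix \<alpha> \<beta> assume ab: "(\<alpha>, \<beta>) \<in> proper_pairs (2 * r)"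
      then have EP: "\<alpha> \<in> EP" "\<beta> \<in> EP" "sum_mset \<alpha> + sum_mset \<beta> = sum_mset \<xi>"
          "sum_mset \<alpha> < sum_mset \<xi>" "sum_mset \<beta> < sum_mset \<xi>"
        using r by (auto simp: proper_pairs_def)
      have "d_mult \<alpha> \<beta> \<in> M"
        using submonoid.m_closed[OF mult less.hyps[OF EP(4,1)] less.hyps[OF EP(5,2)]] by (simp only: d_basis_mult)
      define low where "low = (\<Sum>\<nu> | \<nu> \<in> EP \<and> sum_mset \<nu> < sum_mset \<alpha> + sum_mset \<beta>.
          fh_scale (struct_poly \<alpha> \<beta> \<nu>) (d_basis \<nu>))"
      have "low \<in> M"
        unfolding low_def using less.hyps EP(3)
        by (intro struct_sum_mem[OF coeff_ring_int_valued_half assms(2) EP(1,2)]) auto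
      then have "d_mult \<alpha> \<beta> + fh_scale (of_int (- 1)) low \<in> M"
        using \<open>d_mult \<alpha> \<beta> \<in> M\<close>
        by (intro fh_sub_add[OF assms(2)] fh_sub_scale[OF assms(2)] of_int_coeff_ring[OF coeff_ring_int_valued_half])
      moreover have "d_mult \<alpha> \<beta> + fh_scale (of_int (- 1)) low = d_mult_top \<alpha> \<beta>"
        unfolding d_mult_split[of \<alpha> \<beta>] low_def[symmetric] by (rule poly_mapping_eqI) (simp add: lookup_add)
      ultimately show "d_mult_top \<alpha> \<beta> \<in> M" by simp
    qed
  qed
qed

section \<open>The two generation statements\<close>

lemma fh_span_eq: "coeff_ring B \<Longrightarrow> fh_span B S = \<Inter> {M. fh_sub B M \<and> S \<subseteq> M}"
  by (simp add: fh_span_def hull_def submodule_iff)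

lemma d_mult_top_eq: "d_mult_top \<alpha> \<beta> =
    (\<Sum>\<nu>\<in>EP_of (sum_mset \<alpha> + sum_mset \<beta>). fh_scale (struct_poly \<alpha> \<beta> \<nu>) (d_basis \<nu>))"
  unfolding d_mult_top_def EP_of_def ..

lemma H_deg_eq: "H_deg m = fh_span int_valued ((\<lambda>(\<alpha>, \<beta>). d_mult_top \<alpha> \<beta>) ` proper_pairs m)"
  unfolding H_deg_def by (rule arg_cong[where f = "fh_span int_valued"]) (force simp: proper_pairs_def)

text \<open>\<open>H_deg\<close> is a span over the smaller ring. Intersecting M with the integral
  form gives a submodule over that ring, which contains the generators because the structure
  polynomials are integer-valued.\<close>

lemma H_deg_subset:
  assumes "fh_sub int_valued_half M" "d_basis ` EP_of m \<subseteq> M"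
  shows "H_deg m \<subseteq> M"
proof -
  let ?C = "carrier (fh_algebra int_valued)"
  let ?M = "M \<inter> ?C"
  note C = fh_sub_carrier[OF coeff_ring_int_valued]
  have sub: "fh_sub int_valued ?M"
    using assms(1) C int_valued_halfI unfolding fh_sub_def by blast
  have "d_mult_top \<alpha> \<beta> \<in> ?M" if "(\<alpha>, \<beta>) \<in> proper_pairs m" for \<alpha> \<beta>
  proof -
    have EP: "\<alpha> \<in> EP" "\<beta> \<in> EP" "sum_mset \<alpha> + sum_mset \<beta> = m" using that by (simp_all add: proper_pairs_def)
    have "d_basis \<nu> \<in> ?M" if nu: "\<nu> \<in> EP_of m" for \<nu>
    proof
      show "d_basis \<nu> \<in> M" using assms(2) nu by blast
      show "d_basis \<nu> \<in> ?C" using nu by (intro d_basis_carrier[OF coeff_ring_int_valued]) (simp add: EP_of_def)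
    qed
    then show ?thesis
      unfolding d_mult_top_eq EP(3)
      by (intro struct_sum_mem[OF coeff_ring_int_valued sub EP(1,2)]) (auto simp: EP_of_def)
  qed
  then have "(\<lambda>(\<alpha>, \<beta>). d_mult_top \<alpha> \<beta>) ` proper_pairs m \<subseteq> ?M" by auto
  then have "H_deg m \<subseteq> ?M"
    unfolding H_deg_eq fh_span_eq[OF coeff_ring_int_valued] using sub by (intro Inter_lower) simp
  then show ?thesis by blast
qed

lemma d_mult_top_H_deg: "(\<alpha>, \<beta>) \<in> proper_pairs m \<Longrightarrow> d_mult_top \<alpha> \<beta> \<in> H_deg m"
  unfolding H_deg_eq fh_span_eq[OF coeff_ring_int_valued] by force

theorem theorem5p5:
  shows "(\<forall>m r. m = 2 * r \<and> m > 0 \<longrightarrow>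
            fh_span int_valued_half (insert (e_star r) (H_deg m)) = K_deg int_valued_half m) \<and>
         fh_alg_gen int_valued_half {e_star r | r. r \<ge> 1} = carrier (fh_algebra int_valued_half)"
proof (intro conjI allI impI)
  fix m r :: nat assume "m = 2 * r \<and> m > 0"
  then have m: "m = 2 * r" "1 \<le> r" by simp_all
  \<comment> \<open>A span is an intersection of submodules, so it suffices that the same submodules
    contain either generating set.\<close>
  have "fh_sub int_valued_half M \<and> insert (e_star r) (H_deg m) \<subseteq> M \<longleftrightarrow>
      fh_sub int_valued_half M \<and> d_basis ` EP_of m \<subseteq> M" for M
  proof (intro conj_cong HOL.refl iffI)
    assume M: "fh_sub int_valued_half M" and "insert (e_star r) (H_deg m) \<subseteq> M"
    then have "e_star r \<in> M" "\<And>\<alpha> \<beta>. (\<alpha>, \<beta>) \<in> proper_pairs (2 * r) \<Longrightarrow> d_mult_top \<alpha> \<beta> \<in> M"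
      using d_mult_top_H_deg m(1) by blast+
    then show "d_basis ` EP_of m \<subseteq> M" using d_basis_mem_degree[OF M m(2)] m(1) by blast
  next
    assume M: "fh_sub int_valued_half M" and b: "d_basis ` EP_of m \<subseteq> M"
    have "e_star r \<in> M"
      by (rule e_star_mem[OF coeff_ring_int_valued_half M]) (use b m(1) in blast)
    then show "insert (e_star r) (H_deg m) \<subseteq> M" using H_deg_subset[OF M b] by blast
  qed
  then show "fh_span int_valued_half (insert (e_star r) (H_deg m)) = K_deg int_valued_half m"
    unfolding K_deg_def fh_span_eq[OF coeff_ring_int_valued_half] by simp
next
  note B = coeff_ring_int_valued_half
  let ?C = "carrier (fh_algebra int_valued_half)"
  show "fh_alg_gen int_valued_half {e_star r | r. r \<ge> 1} = ?C"
    unfolding fh_alg_gen_def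
  proof (rule hull_unique)
    have "e_star r \<in> ?C" for r
      by (rule e_star_mem[OF B fh_sub_carrier[OF B]], rule d_basis_carrier[OF B]) (simp add: EP_of_def)
    then show "{e_star r | r. r \<ge> 1} \<subseteq> ?C" by blast
    show "subring ?C (fh_algebra int_valued_half) \<and>
        submodule ?C (poly_ring_on int_valued_half) (fh_algebra int_valued_half)"
      using fh_subring_carrier[OF B] fh_sub_carrier[OF B] submodule_iff[OF B] by blast
    fix M assume e: "{e_star r | r. r \<ge> 1} \<subseteq> M" and
      "subring M (fh_algebra int_valued_half) \<and> submodule M (poly_ring_on int_valued_half) (fh_algebra int_valued_half)"
    then have M: "subring M (fh_algebra int_valued_half)" "fh_sub int_valued_half M"
      using submodule_iff[OF B] by blast+
    show "?C \<subseteq> M"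
    proof
      fix v assume v: "v \<in> ?C"
      have "v = (\<Sum>\<alpha>\<in>Poly_Mapping.keys v. fh_scale (Poly_Mapping.lookup v \<alpha>) (d_basis \<alpha>))"
        by (rule poly_mapping_eqI) (simp add: lookup_sum_basis in_keys_iff)
      also have "\<dots> \<in> M"
      proof (intro fh_sub_sum[OF M(2)] fh_sub_scale[OF M(2)] d_basis_mem_subalgebra[OF M])
        show "e_star r \<in> M" if "1 \<le> r" for r using e that by blast
      qed (use v in \<open>auto simp: fh_carrier\<close>)
      finally show "v \<in> M" .
    qed
  qed
qed

end
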